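(* Let $k>\ell\ge 0$ be integers and $\mathcal F$ a family of $k$-graphs. Then $\gamma_\ell(\mathcal F)$ is the maximum of $\delta_\ell(W)$ over all $\mathcal F$-free $k$-hypergraphons $W$. Moreover, a $k$-hypergraphon $W$ belongs to $\mathcal W_\ell(\mathcal F)$ if and only if $W$ is $\mathcal F$-free and $\delta_\ell(W)=\gamma_\ell(\mathcal F)$.
   Context: A $k$-graph $G$ is a pair $(V(G),E(G))$ with $E(G)$ a set of $k$-subsets of the finite set $V(G)$; $\deg_L(G)$ is the number of edges containing $L$. The minimum $\ell$-degree is $\delta_\ell(G):=\min\{\deg_L(G): L\subseteq V(G),|L|=\ell\}$. $G$ is $\mathcal F$-free if it contains no member of $\mathcal F$ as a subgraph. $\mathrm{co\text{-}ex}_\ell(n,\mathcal F)$ is the maximum $m$ such that some $\mathcal F$-free $k$-graph $G$ on $n$ vertices has $\deg_L(G)\ge m$ for every $\ell$-subset $L$ of $V(G)$, and $\gamma_\ell(\mathcal F):=\lim_{n\to\infty}\mathrm{co\text{-}ex}_\ell(n,\mathcal F)/\binom{n-\ell}{k-\ell}$ (this limit is known to exist). For a finite set $A$, $\binom{A}{\le m}$ is the family of nonempty subsets of $A$ of size at most $m$; $r(A)$ denotes all nonempty subsets and $r_<(A)$ all nonempty proper subsets of $A$; $r[m]:=r([m])$, $r_<[m]:=r_<([m])$. For a vector $\mathbf x=(x_B)_B$, $\mathbf x_{\mathcal A}$ is its restriction to indices in $\mathcal A$. A $k$-hypergraphon is a measurable $W:[0,1]^{r_<[k]}\to[0,1]$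 invariant under the natural action of permutations of $[k]$ on the coordinates. For a $k$-graph $F$, $t(F,W):=\int_{[0,1]^{\binom{V(F)}{\le k-1}}}\prod_{A\in E(F)}W(\mathbf x_{r_<(A)})\,d\mathbf x$; $W$ is $\mathcal F$-free if $t(F,W)=0$ for all $F\in\mathcal F$. For a $k$-graph $G$, $t(F,G)$ is the probability that a uniformly random map $V(F)\to V(G)$ sends every edge of $F$ to an edge of $G$; $(G_n)$ converges to $W$ if $t(F,G_n)\to t(F,W)$ for every $k$-graph $F$. For $\mathbf x\in[0,1]^{r[\ell]}$, $\deg_W(\mathbf x):=\int_{[0,1]^{r_<[k]\setminus r[\ell]}}W(\mathbf x_{r_<[k]})\,d\mathbf x_{r_<[k]\setminus r[\ell]}$ (set to $0$ where undefined), and $\delta_\ell(W)$ is the essential infimum of $\deg_W(\mathbf x)$ over $\mathbf x\in[0,1]^{r[\ell]}$. $\mathcal W_\ell(\mathcal F)$ is the set of $k$-hypergraphons $W$ for which there is a sequence $(G_n)$ of $\mathcal F$-free $k$-graphs converging to $W$ with $|V(G_n)|\to\infty$ and $\delta_\ell(G_n)=(\gamma_\ell(\mathcal F)+o(1))\binom{|V(G_n)|-\ell}{k-\ell}$. *)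

theory Defs
  imports "HOL-Probability.Probability" "HOL-Combinatorics.Permutations"
begin

type_synonym hgraph = "nat set \<times> nat set set"

definition verts :: "hgraph \<Rightarrow> nat set" where "verts G = fst G"
definition edges :: "hgraph \<Rightarrow> nat set set" where "edges G = snd G"

definition kgraph :: "nat \<Rightarrow> hgraph \<Rightarrow> bool" where
  "kgraph k G \<longleftrightarrow> finite (verts G) \<and> (\<forall>e\<in>edges G. e \<subseteq> verts G \<and> card e = k)"

definition deg :: "hgraph \<Rightarrow> nat set \<Rightarrow> nat" where
  "deg G L = card {e \<in> edges G. L \<subseteq> e}"

definition min_deg :: "nat \<Rightarrow> hgraph \<Rightarrow> nat" where
  "min_deg l G = Min {deg G L | L. L \<subseteq> verts G \<and> card L = l}"

definition contains_copy :: "hgraph \<Rightarrow> hgraph \<Rightarrow> bool" where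
  "contains_copy G F \<longleftrightarrow> (\<exists>f. inj_on f (verts F) \<and> f ` verts F \<subseteq> verts G \<and>
                                 (\<forall>e\<in>edges F. f ` e \<in> edges G))"

definition Ffree :: "hgraph set \<Rightarrow> hgraph \<Rightarrow> bool" where
  "Ffree Fam G \<longleftrightarrow> (\<forall>F\<in>Fam. \<not> contains_copy G F)"

definition coex :: "nat \<Rightarrow> nat \<Rightarrow> nat \<Rightarrow> hgraph set \<Rightarrow> nat" where
  "coex k l n Fam = Max {m. \<exists>G. kgraph k G \<and> card (verts G) = n \<and> Ffree Fam G \<and>
                              (\<forall>L. L \<subseteq> verts G \<and> card L = l \<longrightarrow> m \<le> deg G L)}"

definition gamma :: "nat \<Rightarrow> nat \<Rightarrow> hgraph set \<Rightarrow> real" where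
  "gamma k l Fam = lim (\<lambda>n. real (coex k l n Fam) / real ((n - l) choose (k - l)))"

definition t_graph :: "hgraph \<Rightarrow> hgraph \<Rightarrow> real" where
  "t_graph F G = real (card {f \<in> verts F \<rightarrow>\<^sub>E verts G. \<forall>e\<in>edges F. f ` e \<in> edges G})
                 / real (card (verts G)) ^ card (verts F)"

definition unit_interval :: "real measure" where
  "unit_interval = restrict_space lborel {0..1}"

definition cube :: "nat set set \<Rightarrow> (nat set \<Rightarrow> real) measure" where
  "cube I = PiM I (\<lambda>_. unit_interval)"

definition binom_le :: "nat set \<Rightarrow> nat \<Rightarrow> nat set set" where
  "binom_le A m = {B. B \<subseteq> A \<and> B \<noteq> {} \<and> card B \<le> m}"
definition rall :: "nat set \<Rightarrow> nat set set" where
  "rall A = {B. B \<subseteq> A \<and> B \<noteq> {}}"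
definition rprop :: "nat set \<Rightarrow> nat set set" where
  "rprop A = {B. B \<subseteq> A \<and> B \<noteq> {} \<and> B \<noteq> A}"

definition hypergraphon :: "nat \<Rightarrow> ((nat set \<Rightarrow> real) \<Rightarrow> real) \<Rightarrow> bool" where
  "hypergraphon k W \<longleftrightarrow>
     W \<in> borel_measurable (cube (rprop {1..k})) \<and>
     (\<forall>x\<in>space (cube (rprop {1..k})). 0 \<le> W x \<and> W x \<le> 1) \<and>
     (\<forall>\<sigma> x. \<sigma> permutes {1..k} \<and> x \<in> space (cube (rprop {1..k})) \<longrightarrow>
         W (\<lambda>B\<in>rprop {1..k}. x (\<sigma> ` B)) = W x)"

text \<open>t(F,W): each edge A is identified with [k] via its increasing enumeration
  (any bijection gives the same value by symmetry of W).\<close>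
definition t_hom :: "nat \<Rightarrow> hgraph \<Rightarrow> ((nat set \<Rightarrow> real) \<Rightarrow> real) \<Rightarrow> real" where
  "t_hom k F W = (\<integral>x. (\<Prod>A\<in>edges F.
        W (\<lambda>B\<in>rprop {1..k}. x ((\<lambda>i. sorted_list_of_set A ! (i - 1)) ` B)))
      \<partial>cube (binom_le (verts F) (k - 1)))"

definition W_free :: "nat \<Rightarrow> hgraph set \<Rightarrow> ((nat set \<Rightarrow> real) \<Rightarrow> real) \<Rightarrow> bool" where
  "W_free k Fam W \<longleftrightarrow> (\<forall>F\<in>Fam. t_hom k F W = 0)"

definition converges_to :: "nat \<Rightarrow> (nat \<Rightarrow> hgraph) \<Rightarrow> ((nat set \<Rightarrow> real) \<Rightarrow> real) \<Rightarrow> bool" where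
  "converges_to k G W \<longleftrightarrow> (\<forall>F. kgraph k F \<longrightarrow> (\<lambda>n. t_graph F (G n)) \<longlonglongrightarrow> t_hom k F W)"

definition deg_W :: "nat \<Rightarrow> nat \<Rightarrow> ((nat set \<Rightarrow> real) \<Rightarrow> real) \<Rightarrow> (nat set \<Rightarrow> real) \<Rightarrow> real" where
  "deg_W k l W x = (\<integral>y. W (merge (rall {1..l}) (rprop {1..k} - rall {1..l}) (x, y))
                      \<partial>cube (rprop {1..k} - rall {1..l}))"

definition delta_W :: "nat \<Rightarrow> nat \<Rightarrow> ((nat set \<Rightarrow> real) \<Rightarrow> real) \<Rightarrow> real" where
  "delta_W k l W = Sup {c. AE x in cube (rall {1..l}). c \<le> deg_W k l W x}"

definition Wset :: "nat \<Rightarrow> nat \<Rightarrow> hgraph set \<Rightarrow> ((nat set \<Rightarrow> real) \<Rightarrow> real) set" where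
  "Wset k l Fam = {W. hypergraphon k W \<and>
     (\<exists>G. (\<forall>n. kgraph k (G n) \<and> Ffree Fam (G n)) \<and> converges_to k G W \<and>
          filterlim (\<lambda>n. card (verts (G n))) at_top sequentially \<and>
          (\<lambda>n. real (min_deg l (G n)) / real ((card (verts (G n)) - l) choose (k - l)))
             \<longlonglongrightarrow> gamma k l Fam)}"

end

theory Submission
  imports Defs "HOL-Library.Nat_Bijection"
begin

text \<open>
  If \<open>F\<close>-free graphs \<open>G n\<close> converge to \<open>W\<close>, then \<open>W\<close> is \<open>F\<close>-free, as non-injective maps are negligible,
  and counting stars of \<open>m\<close> non-edges through a common \<open>l\<close>-set bounds the moments
  \<open>\<integral>(1 - deg)^m\<close> by \<open>(1 - a)^m\<close>, where \<open>a\<close> is the limiting minimum degree density; letting \<open>m\<close>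
  grow gives \<open>a \<le> delta W\<close>.  Conversely, a graph sampled from an \<open>F\<close>-free \<open>W\<close> is almost surely
  \<open>F\<close>-free, its densities concentrate by Chebyshev's inequality, and its degrees concentrate
  exponentially, so that a union bound over all \<open>l\<close>-sets applies.

  Every sequence of graphs has a convergent subsequence: a weak limit of the laws of the sampled
  induced subgraphs is an exchangeable array, which an Aldous-Hoover argument represents by a kernel;
  the kernel is made symmetric by sorting the vertices according to a part of their randomness.  Hence
  every subsequential limit of the codegree densities is the minimum degree of an \<open>F\<close>-free
  hypergraphon and dominates that of all others, so all these limits coincide.
\<close>

subsection \<open>Product measures\<close>

text \<open>Convergence controls only the integrals t(F,W), which are polynomial in W, whereas delta
  is an essential infimum. Star moments are polynomial in W, and their growth rate in m sees the
  essential infimum of the degree. In the other direction there are about n^l degree conditions, so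
  for l \<ge> 1 a bound of order 1/n per l-set would not survive the union bound.

  For compactness an array of bits is stored as one real number in the Cantor set: tightness on the
  line then gives subsequences, digits are read by continuous functions, and conditional laws have
  real quantile functions. The vertices are split into infinitely many active and infinitely many
  auxiliary ones, and the auxiliary ones carry the randomness of the active ones. The kernel
  obtained has two defects. It depends on a coordinate indexed by the empty set, which hypergraphons
  lack; since densities of disjoint graphs multiply, almost every value of it gives the same
  densities, and one can be fixed. It also depends on the order of the vertices, because conditional
  laws are chosen along increasing enumerations.\<close>

lemma measurable_PiM_reindex:
  "f \<in> J \<rightarrow> I \<Longrightarrow> (\<lambda>x. \<lambda>j\<in>J. x (f j)) \<in> measurable (PiM I (\<lambda>_. M)) (PiM J (\<lambda>_. M))"
  by (auto intro!: measurable_restrict measurable_component_singleton)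

lemma distr_PiM_reindex_const:
  assumes "prob_space M" "inj_on f J" "f \<in> J \<rightarrow> I"
  shows "distr (PiM I (\<lambda>_. M)) (PiM J (\<lambda>_. M)) (\<lambda>x. \<lambda>j\<in>J. x (f j)) = PiM J (\<lambda>_. M)"
  using distr_PiM_reindex[of I "\<lambda>_. M" f J] assms by simp

lemma integral_PiM_reindex:
  fixes g :: "_ \<Rightarrow> real"
  assumes "prob_space M" "inj_on f J" "f \<in> J \<rightarrow> I" "g \<in> borel_measurable (PiM J (\<lambda>_. M))"
  shows "(\<integral>x. g (\<lambda>j\<in>J. x (f j)) \<partial>PiM I (\<lambda>_. M)) = (\<integral>x. g x \<partial>PiM J (\<lambda>_. M))"
  by (subst (1) distr_PiM_reindex_const[OF assms(1-3), symmetric], subst integral_distr)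
     (use assms measurable_PiM_reindex in auto)

lemma AE_PiM_reindex:
  assumes "prob_space M" "inj_on f J" "f \<in> J \<rightarrow> I" "AE x in PiM J (\<lambda>_. M). P x"
  shows "AE x in PiM I (\<lambda>_. M). P (\<lambda>j\<in>J. x (f j))"
proof -
  have "AE x in distr (PiM I (\<lambda>_. M)) (PiM J (\<lambda>_. M)) (\<lambda>x. \<lambda>j\<in>J. x (f j)). P x"
    using assms(4) by (subst distr_PiM_reindex_const[OF assms(1-3)])
  then show ?thesis
    by (rule AE_distrD[OF measurable_PiM_reindex[OF assms(3)]])
qed

lemma integral_PiM_restrict:
  fixes g :: "_ \<Rightarrow> real"
  assumes "prob_space M" "J \<subseteq> I" "g \<in> borel_measurable (PiM J (\<lambda>_. M))"
  shows "(\<integral>x. g (restrict x J) \<partial>PiM I (\<lambda>_. M)) = (\<integral>x. g x \<partial>PiM J (\<lambda>_. M))"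
proof -
  have "(\<lambda>j. j) \<in> J \<rightarrow> I" using assms(2) by blast
  from integral_PiM_reindex[OF assms(1) inj_on_id2 this assms(3)] show ?thesis .
qed

lemma (in prob_space) integrable_unit:
  fixes f :: "'a \<Rightarrow> real"
  assumes "f \<in> borel_measurable M" "\<And>x. x \<in> space M \<Longrightarrow> 0 \<le> f x \<and> f x \<le> 1"
  shows "integrable M f"
  by (rule integrable_const_bound[where B=1]) (use assms in \<open>auto intro!: AE_I2\<close>)

lemma (in prob_space) integral_unit:
  fixes f :: "'a \<Rightarrow> real"
  assumes "f \<in> borel_measurable M" "\<And>x. x \<in> space M \<Longrightarrow> 0 \<le> f x \<and> f x \<le> 1"
  shows "0 \<le> integral\<^sup>L M f \<and> integral\<^sup>L M f \<le> 1"
proof -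
  have "integral\<^sup>L M f \<le> (\<integral>x. 1 \<partial>M)"
    by (rule integral_mono[OF integrable_unit[OF assms]]) (use assms(2) in simp_all)
  moreover have "0 \<le> integral\<^sup>L M f"
    by (rule Bochner_Integration.integral_nonneg) (use assms(2) in simp)
  ultimately show ?thesis by (simp add: prob_space)
qed

lemma prod_unit:
  fixes f :: "'a \<Rightarrow> real"
  assumes "\<And>i. i \<in> K \<Longrightarrow> 0 \<le> f i \<and> f i \<le> 1"
  shows "0 \<le> (\<Prod>i\<in>K. f i) \<and> (\<Prod>i\<in>K. f i) \<le> 1"
  using assms by (auto intro!: prod_nonneg prod_le_1)

lemma mult_unit:
  fixes a b :: real
  shows "0 \<le> a \<and> a \<le> 1 \<Longrightarrow> 0 \<le> b \<and> b \<le> 1 \<Longrightarrow> 0 \<le> a * b \<and> a * b \<le> 1"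
  by (simp add: mult_le_one)

lemma measurable_restrict_PiM:
  "J \<subseteq> I \<Longrightarrow> (\<lambda>x. restrict x J) \<in> measurable (PiM I (\<lambda>_. M)) (PiM J (\<lambda>_. M))"
  by (rule measurable_restrict_subset)

lemma merge_space_PiM:
  "x \<in> space (PiM I (\<lambda>_. M)) \<Longrightarrow> y \<in> space (PiM J (\<lambda>_. M)) \<Longrightarrow> merge I J (x, y) \<in> space (PiM (I \<union> J) (\<lambda>_. M))"
  by (auto simp: space_PiM merge_def PiE_iff extensional_def)

lemma integral_merge_measurable:
  fixes g :: "_ \<Rightarrow> real"
  assumes "prob_space M" and [measurable]: "g \<in> borel_measurable (PiM (I \<union> J) (\<lambda>_. M))"
  shows "(\<lambda>x. \<integral>y. g (merge I J (x, y)) \<partial>PiM J (\<lambda>_. M)) \<in> borel_measurable (PiM I (\<lambda>_. M))"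
proof -
  interpret J: prob_space "PiM J (\<lambda>_. M)" by (rule prob_space_PiM) (rule assms)
  have "(\<lambda>(x, y). g (merge I J (x, y))) \<in> borel_measurable (PiM I (\<lambda>_. M) \<Otimes>\<^sub>M PiM J (\<lambda>_. M))"
    unfolding split_beta by simp
  then show ?thesis by (rule J.borel_measurable_lebesgue_integral)
qed

text \<open>Conditional independence of the groups of coordinates \<open>J i\<close> given the coordinates \<open>J0\<close>.\<close>

lemma integral_prod_fibres_aux:
  fixes M :: "'b measure" and g :: "'k \<Rightarrow> ('i \<Rightarrow> 'b) \<Rightarrow> real" and J :: "'k \<Rightarrow> 'i set"
  assumes M: "prob_space M" and K: "finite K" and J0: "finite J0"
    and J: "\<And>i. i \<in> K \<Longrightarrow> finite (J i) \<and> J0 \<inter> J i = {}" "disjoint_family_on J K"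
    and g: "\<And>i. i \<in> K \<Longrightarrow> g i \<in> borel_measurable (PiM (J0 \<union> J i) (\<lambda>_. M))"
      "\<And>i x. i \<in> K \<Longrightarrow> x \<in> space (PiM (J0 \<union> J i) (\<lambda>_. M)) \<Longrightarrow> 0 \<le> g i x \<and> g i x \<le> 1"
    and h: "h \<in> borel_measurable (PiM J0 (\<lambda>_. M))"
      "\<And>x. x \<in> space (PiM J0 (\<lambda>_. M)) \<Longrightarrow> 0 \<le> h x \<and> h x \<le> 1"
  shows "(\<integral>x. h (restrict x J0) * (\<Prod>i\<in>K. g i (restrict x (J0 \<union> J i))) \<partial>PiM (J0 \<union> (\<Union>i\<in>K. J i)) (\<lambda>_. M))
    = (\<integral>x. h x * (\<Prod>i\<in>K. \<integral>y. g i (merge J0 (J i) (x, y)) \<partial>PiM (J i) (\<lambda>_. M)) \<partial>PiM J0 (\<lambda>_. M))"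
  using K J g h
proof (induction K arbitrary: h rule: finite_induct)
  case empty
  then show ?case by (intro Bochner_Integration.integral_cong) (simp_all add: space_PiM)
next
  case (insert k K)
  interpret M: prob_space M by fact
  interpret product_prob_space "\<lambda>_. M" UNIV ..
  let ?P = "\<lambda>I. PiM I (\<lambda>_. M)"
  let ?U = "J0 \<union> (\<Union>i\<in>K. J i)"
  have pP: "prob_space (?P I)" for I by (rule prob_space_PiM) (rule M)
  note [measurable] = measurable_restrict_PiM
  have gm[measurable]: "\<And>i. i \<in> insert k K \<Longrightarrow> g i \<in> borel_measurable (?P (J0 \<union> J i))" by (fact insert.prems)
  note gb = insert.prems(4)
  have [measurable]: "h \<in> borel_measurable (?P J0)" by fact
  note hb = insert.prems(6)
  have finU: "finite ?U" "finite (J k)" using insert J0 by auto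
  have disj: "?U \<inter> J k = {}" using insert.prems(1)[of k] insert.prems(2) insert.hyps
    by (auto simp: disjoint_family_on_def)
  have U: "J0 \<union> (\<Union>i\<in>insert k K. J i) = ?U \<union> J k" by auto
  define G where "G x = (\<integral>y. g k (merge J0 (J k) (x, y)) \<partial>?P (J k))" for x
  have Gm[measurable]: "G \<in> borel_measurable (?P J0)"
    unfolding G_def by (rule integral_merge_measurable[OF M]) simp
  have gkm: "(\<lambda>y. g k (merge J0 (J k) (x, y))) \<in> borel_measurable (?P (J k))" if "x \<in> space (?P J0)" for x
    using that by simp
  have Gb: "0 \<le> G x \<and> G x \<le> 1" if "x \<in> space (?P J0)" for x
    unfolding G_def
    by (rule prob_space.integral_unit[OF pP gkm[OF that]], rule gb[OF insertI1 merge_space_PiM[OF that]])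
  let ?f = "\<lambda>x. h (restrict x J0) * (\<Prod>i\<in>insert k K. g i (restrict x (J0 \<union> J i)))"
  have fm: "?f \<in> borel_measurable (?P (?U \<union> J k))"
  proof (intro borel_measurable_times borel_measurable_prod)
    show "(\<lambda>x. h (restrict x J0)) \<in> borel_measurable (?P (?U \<union> J k))" 
      by (rule measurable_compose[OF measurable_restrict_PiM]) auto
    show "(\<lambda>x. g i (restrict x (J0 \<union> J i))) \<in> borel_measurable (?P (?U \<union> J k))" if "i \<in> insert k K" for i
      by (rule measurable_compose[OF measurable_restrict_PiM gm]) (use that in auto)
  qed
  have sp: "restrict x I' \<in> space (?P I')" if "x \<in> space (?P I)" "I' \<subseteq> I" for x I I'
    using that by (auto simp: space_PiM PiE_iff)
  have fb: "0 \<le> ?f x \<and> ?f x \<le> 1" if "x \<in> space (?P (?U \<union> J k))" for x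
    by (intro mult_unit prod_unit hb gb sp[OF that]) blast+
  have "(\<integral>x. ?f x \<partial>?P (?U \<union> J k)) = (\<integral>x. \<integral>y. ?f (merge ?U (J k) (x, y)) \<partial>?P (J k) \<partial>?P ?U)"
    by (rule product_integral_fold[OF disj finU prob_space.integrable_unit[OF pP fm fb]])
  also have "\<dots> = (\<integral>x. (h (restrict x J0) * G (restrict x J0)) * (\<Prod>i\<in>K. g i (restrict x (J0 \<union> J i))) \<partial>?P ?U)"
  proof (rule Bochner_Integration.integral_cong[OF refl])
    fix x assume x: "x \<in> space (?P ?U)"
    have "?f (merge ?U (J k) (x, y)) = (h (restrict x J0) * (\<Prod>i\<in>K. g i (restrict x (J0 \<union> J i)))) *
        g k (merge J0 (J k) (restrict x J0, y))" if "y \<in> space (?P (J k))" for y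
    proof -
      have "restrict (merge ?U (J k) (x, y)) J0 = restrict x J0"
        by (auto simp: merge_def fun_eq_iff)
      moreover have "restrict (merge ?U (J k) (x, y)) (J0 \<union> J i) = restrict x (J0 \<union> J i)" if "i \<in> K" for i
        using that by (auto simp: merge_def fun_eq_iff)
      moreover have "restrict (merge ?U (J k) (x, y)) (J0 \<union> J k) = merge J0 (J k) (restrict x J0, y)"
        using disj by (auto simp: merge_def fun_eq_iff restrict_def)
      ultimately show ?thesis using insert.hyps by simp
    qed
    then have "(\<integral>y. ?f (merge ?U (J k) (x, y)) \<partial>?P (J k)) = 
       (\<integral>y. (h (restrict x J0) * (\<Prod>i\<in>K. g i (restrict x (J0 \<union> J i)))) * g k (merge J0 (J k) (restrict x J0, y)) \<partial>?P (J k))"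
      by (rule Bochner_Integration.integral_cong[OF refl])
    then show "(\<integral>y. ?f (merge ?U (J k) (x, y)) \<partial>?P (J k)) =
       (h (restrict x J0) * G (restrict x J0)) * (\<Prod>i\<in>K. g i (restrict x (J0 \<union> J i)))"
      by (simp add: G_def)
  qed
  \<comment> \<open>The group just integrated leaves a function \<open>G\<close> of the common
    coordinates; the weight \<open>h\<close> is carried through the induction in order to absorb
    it.\<close>
  also have "\<dots> = (\<integral>x. (h x * G x) * (\<Prod>i\<in>K. \<integral>y. g i (merge J0 (J i) (x, y)) \<partial>?P (J i)) \<partial>?P J0)"
  proof (rule insert.IH[of "\<lambda>x. h x * G x"])
    show "disjoint_family_on J K" using insert.prems(2) by (auto simp: disjoint_family_on_def)
    show "0 \<le> h x * G x \<and> h x * G x \<le> 1" if "x \<in> space (?P J0)" for x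
      by (intro mult_unit hb Gb that)
    show "0 \<le> g i x \<and> g i x \<le> 1" if "i \<in> K" "x \<in> space (?P (J0 \<union> J i))" for i x
      using gb[of i x] that by blast
  qed (use insert.prems(1) in simp_all)
  also have "\<dots> = (\<integral>x. h x * (\<Prod>i\<in>insert k K. \<integral>y. g i (merge J0 (J i) (x, y)) \<partial>?P (J i)) \<partial>?P J0)"
    using insert.hyps by (simp add: G_def mult.assoc)
  finally show ?case unfolding U .
qed

text \<open>The auxiliary lemma with weight 1, inside a possibly larger index set \<open>I\<close>:
  coordinates that belong to no group integrate out.\<close>

lemma integral_prod_fibres:
  fixes M :: "'b measure" and g :: "'k \<Rightarrow> ('i \<Rightarrow> 'b) \<Rightarrow> real" and J :: "'k \<Rightarrow> 'i set"
  assumes M: "prob_space M" and K: "finite K" and I: "finite I" and J0: "J0 \<subseteq> I"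
    and J: "\<And>i. i \<in> K \<Longrightarrow> J i \<subseteq> I \<and> J0 \<inter> J i = {}" "disjoint_family_on J K"
    and g: "\<And>i. i \<in> K \<Longrightarrow> g i \<in> borel_measurable (PiM (J0 \<union> J i) (\<lambda>_. M))"
      "\<And>i x. i \<in> K \<Longrightarrow> x \<in> space (PiM (J0 \<union> J i) (\<lambda>_. M)) \<Longrightarrow> 0 \<le> g i x \<and> g i x \<le> 1"
  shows "(\<integral>x. (\<Prod>i\<in>K. g i (restrict x (J0 \<union> J i))) \<partial>PiM I (\<lambda>_. M))
    = (\<integral>x. (\<Prod>i\<in>K. \<integral>y. g i (merge J0 (J i) (x, y)) \<partial>PiM (J i) (\<lambda>_. M)) \<partial>PiM J0 (\<lambda>_. M))"
proof -
  let ?U = "J0 \<union> (\<Union>i\<in>K. J i)"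
  let ?g = "\<lambda>x. \<Prod>i\<in>K. g i (restrict x (J0 \<union> J i))"
  have fin: "finite J0" "\<And>i. i \<in> K \<Longrightarrow> finite (J i)" using I J0 J(1) by (auto intro: finite_subset)
  have "?g \<in> borel_measurable (PiM ?U (\<lambda>_. M))"
    by (intro borel_measurable_prod measurable_compose[OF measurable_restrict_PiM g(1)]) auto
  then have "(\<integral>x. ?g (restrict x ?U) \<partial>PiM I (\<lambda>_. M)) = (\<integral>x. ?g x \<partial>PiM ?U (\<lambda>_. M))"
    by (rule integral_PiM_restrict[OF M, rotated]) (use J0 J in auto)
  moreover have "?g (restrict x ?U) = ?g x" for x
    by (auto intro!: prod.cong arg_cong[of _ _ "g _"] simp: restrict_def fun_eq_iff)
  moreover have "(\<integral>x. ?g x \<partial>PiM ?U (\<lambda>_. M)) = 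
     (\<integral>x. (\<Prod>i\<in>K. \<integral>y. g i (merge J0 (J i) (x, y)) \<partial>PiM (J i) (\<lambda>_. M)) \<partial>PiM J0 (\<lambda>_. M))"
    using integral_prod_fibres_aux[OF M K fin(1), of J g "\<lambda>_. 1"] J fin g by simp
  ultimately show ?thesis by simp
qed

text \<open>Fibres over an empty common group: functions of disjoint groups of coordinates are
  independent, and the outer integral is over a one-point space.\<close>

lemma integral_prod_disjoint:
  fixes M :: "'b measure" and g :: "'k \<Rightarrow> ('i \<Rightarrow> 'b) \<Rightarrow> real" and J :: "'k \<Rightarrow> 'i set"
  assumes M: "prob_space M" and K: "finite K" and I: "finite I"
    and J: "\<And>i. i \<in> K \<Longrightarrow> J i \<subseteq> I" "disjoint_family_on J K"
    and g: "\<And>i. i \<in> K \<Longrightarrow> g i \<in> borel_measurable (PiM (J i) (\<lambda>_. M))"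
      "\<And>i x. i \<in> K \<Longrightarrow> x \<in> space (PiM (J i) (\<lambda>_. M)) \<Longrightarrow> 0 \<le> g i x \<and> g i x \<le> 1"
  shows "(\<integral>x. (\<Prod>i\<in>K. g i (restrict x (J i))) \<partial>PiM I (\<lambda>_. M)) = (\<Prod>i\<in>K. \<integral>y. g i y \<partial>PiM (J i) (\<lambda>_. M))"
proof -
  interpret E: prob_space "PiM {} (\<lambda>_::'i. M)" by (rule prob_space_PiM) (rule M)
  have "(\<integral>y. g i (merge {} (J i) (x, y)) \<partial>PiM (J i) (\<lambda>_. M)) = (\<integral>y. g i y \<partial>PiM (J i) (\<lambda>_. M))" for i x
    by (intro Bochner_Integration.integral_cong refl arg_cong[of _ _ "g i"])
      (auto simp: merge_def space_PiM PiE_iff extensional_def fun_eq_iff)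
  moreover have "(\<integral>x. (\<Prod>i\<in>K. g i (restrict x ({} \<union> J i))) \<partial>PiM I (\<lambda>_. M))
    = (\<integral>x. (\<Prod>i\<in>K. \<integral>y. g i (merge {} (J i) (x, y)) \<partial>PiM (J i) (\<lambda>_. M)) \<partial>PiM {} (\<lambda>_. M))"
    by (rule integral_prod_fibres[OF M K I]) (use J g in simp_all)
  ultimately show ?thesis by (simp only: Un_empty_left) (simp add: E.prob_space)
qed

subsection \<open>Homomorphism densities of hypergraphons\<close>

lemma prob_space_unit_interval: "prob_space unit_interval"
  unfolding unit_interval_def by (intro prob_spaceI) (simp add: emeasure_restrict_space space_restrict_space)

lemma space_unit_interval [simp]: "space unit_interval = {0..1}"
  by (simp add: unit_interval_def space_restrict_space)

lemma prob_space_cube: "prob_space (cube I)"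
  unfolding cube_def by (rule prob_space_PiM) (rule prob_space_unit_interval)

lemma space_cube: "space (cube I) = (\<Pi>\<^sub>E i\<in>I. {0..1})"
  by (simp add: cube_def space_PiM)

lemma sets_unit_interval [measurable_cong]: "sets unit_interval = sets (restrict_space borel {0..1})"
  unfolding unit_interval_def by (intro sets_restrict_space_cong) simp

lemma borel_measurable_unit_interval_id: "(\<lambda>x. x) \<in> borel_measurable unit_interval"
  by (simp add: measurable_cong_sets[OF sets_unit_interval refl] measurable_restrict_space1)

lemma borel_measurable_cube_component: "B \<in> I \<Longrightarrow> (\<lambda>x. x B) \<in> borel_measurable (cube I)"
  unfolding cube_def
  using measurable_compose[OF measurable_component_singleton[of B I "\<lambda>_. unit_interval"] borel_measurable_unit_interval_id] .

text \<open>The identification of an edge with [k] that \<open>t_hom\<close> uses. Positions are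
  counted from 1, hence the shift of the list index.\<close>

definition enum :: "'a::linorder set \<Rightarrow> nat \<Rightarrow> 'a" where
  "enum A i = sorted_list_of_set A ! (i - 1)"

lemma enum_mono: "finite A \<Longrightarrow> 1 \<le> i \<Longrightarrow> i < j \<Longrightarrow> j \<le> card A \<Longrightarrow> enum A i < enum A j"
  unfolding enum_def
  using sorted_wrt_nth_less[OF strict_sorted_list_of_set[of A], of "i - 1" "j - 1"] by simp

lemma enum_bij:
  assumes "finite A" shows "bij_betw (enum A) {1..card A} A"
proof -
  have "inj_on (enum A) {1..card A}"
  proof (rule linorder_inj_onI)
    fix i j assume "i < j" "i \<in> {1..card A}" "j \<in> {1..card A}"
    then show "enum A i \<noteq> enum A j" using enum_mono[OF assms, of i j] by simp
  qed auto
  moreover have "enum A ` {1..card A} \<subseteq> A"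
  proof
    fix a assume "a \<in> enum A ` {1..card A}"
    then obtain i where "1 \<le> i" "i \<le> card A" "a = enum A i" by auto
    then have "a \<in> set (sorted_list_of_set A)"
      unfolding enum_def using assms by (metis Suc_pred' add.right_neutral in_set_conv_nth length_sorted_list_of_set
          less_eq_Suc_le One_nat_def plus_1_eq_Suc)
    then show "a \<in> A" using assms by simp
  qed
  ultimately show ?thesis
    using assms by (metis bij_betw_imageI card_image card_atLeastAtMost card_subset_eq diff_Suc_1)
qed

text \<open>A strictly sorted list is determined by its set. Identities between enumerations are
  obtained below by exhibiting an increasing parametrisation.\<close>

lemma enum_unique:
  assumes "finite A" "\<And>i j. 1 \<le> i \<Longrightarrow> i < j \<Longrightarrow> j \<le> card A \<Longrightarrow> f i < f j" "f ` {1..card A} = A"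
    and i: "i \<in> {1..card A}"
  shows "enum A i = f i"
proof -
  let ?l = "map f [1..<Suc (card A)]"
  have "sorted_wrt (<) ?l"
    unfolding sorted_wrt_map sorted_wrt_iff_nth_less using assms(2) by (auto simp del: upt_Suc)
  moreover have "set ?l = A" using assms(3) by (simp add: atLeastLessThanSuc_atLeastAtMost del: upt_Suc)
  ultimately have "sorted_list_of_set A = ?l"
    by (metis assms(1) strict_sorted_equal strict_sorted_list_of_set set_sorted_list_of_set)
  then show ?thesis unfolding enum_def using i by (simp add: nth_append del: upt_Suc) (auto simp del: upt_Suc)
qed

lemma enum_atLeastAtMost: "i \<in> {1..k} \<Longrightarrow> enum {1..k} i = (i :: nat)"
  by (rule enum_unique) auto

lemma enum_image_mono:
  assumes "finite A" "\<And>a b. a \<in> A \<Longrightarrow> b \<in> A \<Longrightarrow> a < b \<Longrightarrow> f a < f b" "i \<in> {1..card A}"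
  shows "enum (f ` A) i = f (enum A i)"
proof -
  have inj: "inj_on f A" using assms(2) by (intro linorder_inj_onI) fastforce+
  then have c: "card (f ` A) = card A" by (rule card_image)
  have e: "enum A j \<in> A" if "j \<in> {1..card A}" for j
    using bij_betwE[OF enum_bij[OF assms(1)]] that by blast
  show ?thesis
  proof (rule enum_unique[where f="\<lambda>i. f (enum A i)"])
    show "(\<lambda>i. f (enum A i)) ` {1..card (f ` A)} = f ` A"
      using bij_betw_imp_surj_on[OF enum_bij[OF assms(1)]] unfolding c by (metis image_image)
    show "f (enum A a) < f (enum A b)" if "1 \<le> a" "a < b" "b \<le> card (f ` A)" for a b
      by (rule assms(2)[OF e e enum_mono[OF assms(1) that(1,2)]]) (use that c in auto)
  qed (use assms c in auto)
qed

text \<open>A face inherits the order of its edge, so enumerations compose. This is what makes the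
  recursive coding of an array depend on order types only.\<close>

lemma enum_enum_image:
  assumes "finite A" "B \<subseteq> {1..card A}" "i \<in> {1..card B}"
  shows "enum (enum A ` B) i = enum A (enum B i)"
proof (rule enum_image_mono)
  show "finite B" using assms(2) finite_subset by blast
  show "enum A a < enum A b" if "a \<in> B" "b \<in> B" "a < b" for a b
    using enum_mono[OF assms(1), of a b] that assms(2) by (auto simp: subset_iff)
qed (use assms in auto)

lemma enum_eq_imp_image: "finite A \<Longrightarrow> card A = k \<Longrightarrow> enum A ` {1..k} = A"
  using bij_betw_imp_surj_on[OF enum_bij[of A]] by simp

text \<open>The coordinates of the proper faces of the edge \<beta>([k]), in the form a kernel
  expects. A general \<beta> in place of the increasing enumeration lets the order of the vertices
  vary.\<close>

definition pull :: "nat \<Rightarrow> (nat \<Rightarrow> nat) \<Rightarrow> (nat set \<Rightarrow> real) \<Rightarrow> nat set \<Rightarrow> real" where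
  "pull k \<beta> x = (\<lambda>B\<in>rprop {1..k}. x (\<beta> ` B))"

lemma finite_rprop [simp]: "finite A \<Longrightarrow> finite (rprop A)"
  by (rule finite_subset[of _ "Pow A"]) (auto simp: rprop_def)
lemma finite_rall [simp]: "finite A \<Longrightarrow> finite (rall A)"
  by (rule finite_subset[of _ "Pow A"]) (auto simp: rall_def)
lemma finite_binom_le [simp]: "finite A \<Longrightarrow> finite (binom_le A m)"
  by (rule finite_subset[of _ "Pow A"]) (auto simp: binom_le_def)

lemma image_rprop:
  assumes "bij_betw \<beta> {1..k} A" "B \<in> rprop {1..k}" shows "\<beta> ` B \<in> rprop A"
proof -
  have "B \<subset> {1..k}" "B \<noteq> {}" using assms(2) by (auto simp: rprop_def)
  then have "\<beta> ` B \<subset> \<beta> ` {1..k}"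
    using image_strict_mono[of \<beta> "{1..k}" B] assms(1) by (simp add: bij_betw_def)
  then show ?thesis using assms(1) \<open>B \<noteq> {}\<close> by (auto simp: bij_betw_def rprop_def)
qed

lemma rprop_subset_binom_le:
  assumes "finite V" "A \<subseteq> V" "card A = k" shows "rprop A \<subseteq> binom_le V (k - 1)"
proof
  fix B assume B: "B \<in> rprop A"
  then have "B \<subset> A" by (auto simp: rprop_def)
  then have "card B < card A" using assms by (meson finite_subset psubset_card_mono)
  then show "B \<in> binom_le V (k - 1)" using assms B by (auto simp: binom_le_def rprop_def)
qed

lemma measurable_pull:
  assumes "\<And>B. B \<in> rprop {1..k} \<Longrightarrow> \<beta> ` B \<in> I"
  shows "pull k \<beta> \<in> measurable (cube I) (cube (rprop {1..k}))"
  unfolding pull_def cube_def by (rule measurable_PiM_reindex) (use assms in auto)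

lemma pull_space:
  assumes "\<And>B. B \<in> rprop {1..k} \<Longrightarrow> \<beta> ` B \<in> I" "x \<in> space (cube I)"
  shows "pull k \<beta> x \<in> space (cube (rprop {1..k}))"
  using measurable_space[OF measurable_pull[OF assms(1)] assms(2)] by blast

lemma pull_cong:
  assumes "\<And>B. B \<in> rprop {1..k} \<Longrightarrow> x (\<beta> ` B) = y (\<beta>' ` B)"
  shows "pull k \<beta> x = pull k \<beta>' y"
  unfolding pull_def by (rule restrict_ext) (use assms in auto)

text \<open>A hypergraphon without the symmetry condition: the kernel obtained from an exchangeable
  array depends on the order of the vertices until it is symmetrised.\<close>

definition unit_kernel :: "nat \<Rightarrow> ((nat set \<Rightarrow> real) \<Rightarrow> real) \<Rightarrow> bool" where
  "unit_kernel k W \<longleftrightarrow> W \<in> borel_measurable (cube (rprop {1..k})) \<and>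
     (\<forall>x\<in>space (cube (rprop {1..k})). 0 \<le> W x \<and> W x \<le> 1)"

lemma hypergraphon_unit_kernel: "hypergraphon k W \<Longrightarrow> unit_kernel k W"
  unfolding hypergraphon_def unit_kernel_def by blast

text \<open>Two enumerations of the same edge differ by a permutation of [k], under which a
  hypergraphon is invariant.\<close>

lemma hypergraphon_pull_eq:
  assumes W: "hypergraphon k W" and \<beta>: "bij_betw \<beta> {1..k} A" and \<beta>': "bij_betw \<beta>' {1..k} A"
    and x: "x \<in> space (cube I)" and I: "rprop A \<subseteq> I"
  shows "W (pull k \<beta> x) = W (pull k \<beta>' x)"
proof -
  define \<sigma> where "\<sigma> i = (if i \<in> {1..k} then inv_into {1..k} \<beta> (\<beta>' i) else i)" for i
  have "bij_betw (\<lambda>i. inv_into {1..k} \<beta> (\<beta>' i)) {1..k} {1..k}"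
    using bij_betw_trans[OF \<beta>' bij_betw_inv_into[OF \<beta>]] by (simp add: comp_def)
  then have "bij_betw \<sigma> {1..k} {1..k}" by (rule bij_betw_cong[THEN iffD1, rotated]) (simp add: \<sigma>_def)
  then have \<sigma>: "\<sigma> permutes {1..k}" by (rule bij_imp_permutes) (simp only: \<sigma>_def if_False)
  have b\<sigma>: "\<beta> (\<sigma> i) = \<beta>' i" if "i \<in> {1..k}" for i
  proof -
    have "\<beta>' i \<in> \<beta> ` {1..k}" using that \<beta> \<beta>' by (metis bij_betw_imp_surj_on imageI)
    then show ?thesis using that by (simp only: \<sigma>_def if_True f_inv_into_f)
  qed
  have "pull k \<beta>' x = (\<lambda>B\<in>rprop {1..k}. pull k \<beta> x (\<sigma> ` B))"
    unfolding pull_def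
  proof (rule restrict_ext)
    fix B assume B: "B \<in> rprop {1..k}"
    have "\<sigma> ` B \<in> rprop {1..k}" using image_rprop[OF permutes_imp_bij[OF \<sigma>] B] .
    moreover have "\<beta> ` \<sigma> ` B = \<beta>' ` B" unfolding image_image
      by (rule image_cong[OF refl b\<sigma>]) (use B in \<open>auto simp: rprop_def\<close>)
    ultimately show "x (\<beta>' ` B) = (\<lambda>B\<in>rprop {1..k}. x (\<beta> ` B)) (\<sigma> ` B)" by simp
  qed
  moreover have "pull k \<beta> x \<in> space (cube (rprop {1..k}))"
    by (rule pull_space[OF _ x]) (use image_rprop[OF \<beta>] I in blast)
  ultimately show ?thesis using W \<sigma> unfolding hypergraphon_def by metis
qed

lemma t_hom_pull:
  "t_hom k F W = (\<integral>x. (\<Prod>A\<in>edges F. W (pull k (enum A) x)) \<partial>cube (binom_le (verts F) (k - 1)))"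
  by (simp add: t_hom_def pull_def enum_def)

lemma unit_kernel_pull:
  assumes "unit_kernel k W" "bij_betw \<beta> {1..k} A" "rprop A \<subseteq> I"
  shows "(\<lambda>x. W (pull k \<beta> x)) \<in> borel_measurable (cube I)"
    and "x \<in> space (cube I) \<Longrightarrow> 0 \<le> W (pull k \<beta> x) \<and> W (pull k \<beta> x) \<le> 1"
proof -
  have I: "\<beta> ` B \<in> I" if "B \<in> rprop {1..k}" for B using image_rprop[OF assms(2) that] assms(3) by blast
  show "(\<lambda>x. W (pull k \<beta> x)) \<in> borel_measurable (cube I)"
    by (rule measurable_compose[OF measurable_pull[OF I]]) (use assms(1) in \<open>simp_all add: unit_kernel_def\<close>)
  show "x \<in> space (cube I) \<Longrightarrow> 0 \<le> W (pull k \<beta> x) \<and> W (pull k \<beta> x) \<le> 1"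
    using assms(1) pull_space[OF I] unfolding unit_kernel_def by blast
qed

lemma kgraph_edgeD:
  assumes "kgraph k F" "A \<in> edges F"
  shows "finite (verts F)" "A \<subseteq> verts F" "finite A" "card A = k" "bij_betw (enum A) {1..k} A"
    "rprop A \<subseteq> binom_le (verts F) (k - 1)"
proof -
  show *: "finite (verts F)" "A \<subseteq> verts F" "card A = k" using assms by (auto simp: kgraph_def)
  then show "finite A" by (blast intro: finite_subset)
  with * show "bij_betw (enum A) {1..k} A" using enum_bij[of A] by simp
  show "rprop A \<subseteq> binom_le (verts F) (k - 1)" by (rule rprop_subset_binom_le[OF *])
qed

lemma kgraph_finite_edges: "kgraph k F \<Longrightarrow> finite (edges F)"
  by (rule finite_subset[of _ "Pow (verts F)"]) (auto simp: kgraph_def)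

lemma t_hom_integrand:
  assumes "unit_kernel k W" "kgraph k F"
  shows "(\<lambda>x. \<Prod>A\<in>edges F. W (pull k (enum A) x)) \<in> borel_measurable (cube (binom_le (verts F) (k - 1)))"
    "x \<in> space (cube (binom_le (verts F) (k - 1))) \<Longrightarrow>
      0 \<le> (\<Prod>A\<in>edges F. W (pull k (enum A) x)) \<and> (\<Prod>A\<in>edges F. W (pull k (enum A) x)) \<le> 1"
proof -
  note * = unit_kernel_pull[OF assms(1) kgraph_edgeD(5)[OF assms(2)] kgraph_edgeD(6)[OF assms(2)]]
  show "(\<lambda>x. \<Prod>A\<in>edges F. W (pull k (enum A) x)) \<in> borel_measurable (cube (binom_le (verts F) (k - 1)))"
    by (rule borel_measurable_prod) (rule *(1))
  show "x \<in> space (cube (binom_le (verts F) (k - 1))) \<Longrightarrow>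
      0 \<le> (\<Prod>A\<in>edges F. W (pull k (enum A) x)) \<and> (\<Prod>A\<in>edges F. W (pull k (enum A) x)) \<le> 1"
    by (rule prod_unit) (rule *(2))
qed

lemma t_hom_unit: "unit_kernel k W \<Longrightarrow> kgraph k F \<Longrightarrow> 0 \<le> t_hom k F W \<and> t_hom k F W \<le> 1"
  unfolding t_hom_pull by (intro prob_space.integral_unit prob_space_cube t_hom_integrand)

definition relabel :: "(nat \<Rightarrow> nat) \<Rightarrow> hgraph \<Rightarrow> hgraph" where
  "relabel f F = (f ` verts F, (`) f ` edges F)"

lemma relabel_simps [simp]: "verts (relabel f F) = f ` verts F" "edges (relabel f F) = (`) f ` edges F"
  by (simp_all add: relabel_def verts_def edges_def)

lemma kgraph_relabel:
  assumes "kgraph k F" "inj_on f (verts F)" shows "kgraph k (relabel f F)"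
  using assms unfolding kgraph_def by (auto simp: card_image inj_on_subset)

lemma inj_on_image_edges: "kgraph k F \<Longrightarrow> inj_on f (verts F) \<Longrightarrow> inj_on ((`) f) (edges F)"
  by (rule inj_on_subset[OF inj_on_image_Pow]) (auto simp: kgraph_def)

text \<open>Renaming coordinates along \<open>f\<close> preserves the product measure. The edges
  keep the transported enumeration \<open>f \<circ> enum A\<close>, which may fail to be increasing,
  so the identity is available for kernels without symmetry.\<close>

lemma t_hom_relabel_pull:
  assumes W: "unit_kernel k W" and F: "kgraph k F" and f: "inj_on f (verts F)"
  shows "(\<integral>x. (\<Prod>A\<in>edges F. W (pull k (f \<circ> enum A) x)) \<partial>cube (binom_le (f ` verts F) (k - 1))) = t_hom k F W"
proof -
  let ?I = "binom_le (verts F) (k - 1)" and ?I' = "binom_le (f ` verts F) (k - 1)"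
  let ?g = "\<lambda>x. \<Prod>A\<in>edges F. W (pull k (enum A) x)"
  have 1: "inj_on ((`) f) ?I" by (rule inj_on_subset[OF inj_on_image_Pow[OF f]]) (auto simp: binom_le_def)
  have 2: "(`) f \<in> ?I \<rightarrow> ?I'"
  proof
    fix B assume "B \<in> ?I"
    then show "f ` B \<in> ?I'" using card_image[OF inj_on_subset[OF f, of B]] by (auto simp: binom_le_def)
  qed
  have "t_hom k F W = (\<integral>x. ?g (\<lambda>B\<in>?I. x (f ` B)) \<partial>cube ?I')"
    unfolding t_hom_pull cube_def
    by (rule integral_PiM_reindex[OF prob_space_unit_interval 1 2, symmetric])
       (use t_hom_integrand(1)[OF W F] in \<open>simp add: cube_def\<close>)
  also have "\<dots> = (\<integral>x. (\<Prod>A\<in>edges F. W (pull k (f \<circ> enum A) x)) \<partial>cube ?I')"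
  proof -
    have "pull k (enum A) (\<lambda>B\<in>?I. x (f ` B)) = pull k (f \<circ> enum A) x" if A: "A \<in> edges F" for A x
    proof (rule pull_cong)
      fix B assume "B \<in> rprop {1..k}"
      then have "enum A ` B \<in> ?I" using image_rprop[OF kgraph_edgeD(5)[OF F A]] kgraph_edgeD(6)[OF F A] by blast
      then show "(\<lambda>B\<in>?I. x (f ` B)) (enum A ` B) = x ((f \<circ> enum A) ` B)" by (simp add: image_comp)
    qed
    then have "?g (\<lambda>B\<in>?I. x (f ` B)) = (\<Prod>A\<in>edges F. W (pull k (f \<circ> enum A) x))" for x
      by (intro prod.cong[OF refl]) (simp only:)
    then show ?thesis by (simp only:)
  qed
  finally show ?thesis by simp
qed

text \<open>Relabelling can change a density only through the order in which an edge is enumerated.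
  The hypothesis \<open>eq\<close> isolates this point; it is supplied either by symmetry of
  \<open>W\<close> or by monotonicity of \<open>f\<close>.\<close>

lemma t_hom_relabel:
  assumes W: "unit_kernel k W" and F: "kgraph k F" and f: "inj_on f (verts F)"
    and eq: "\<And>A x. A \<in> edges F \<Longrightarrow> x \<in> space (cube (binom_le (f ` verts F) (k - 1))) \<Longrightarrow>
      W (pull k (enum (f ` A)) x) = W (pull k (f \<circ> enum A) x)"
  shows "t_hom k (relabel f F) W = t_hom k F W"
proof -
  have "t_hom k (relabel f F) W = (\<integral>x. (\<Prod>A\<in>edges F. W (pull k (f \<circ> enum A) x)) \<partial>cube (binom_le (f ` verts F) (k - 1)))"
    unfolding t_hom_pull relabel_simps prod.reindex[OF inj_on_image_edges[OF F f]] comp_def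
    by (rule Bochner_Integration.integral_cong[OF refl], rule prod.cong[OF refl], rule eq[unfolded comp_def])
  with t_hom_relabel_pull[OF W F f] show ?thesis by simp
qed

lemma hypergraphon_t_hom_relabel:
  assumes W: "hypergraphon k W" and F: "kgraph k F" and f: "inj_on f (verts F)"
  shows "t_hom k (relabel f F) W = t_hom k F W"
proof (rule t_hom_relabel[OF hypergraphon_unit_kernel[OF W] F f])
  fix A x assume A: "A \<in> edges F" and x: "x \<in> space (cube (binom_le (f ` verts F) (k - 1)))"
  have fA: "f ` A \<in> edges (relabel f F)" using A by simp
  note * = kgraph_edgeD[OF kgraph_relabel[OF F f] fA] kgraph_edgeD[OF F A]
  show "W (pull k (enum (f ` A)) x) = W (pull k (f \<circ> enum A) x)"
  proof (rule hypergraphon_pull_eq[OF W *(5) _ x])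
    show "bij_betw (f \<circ> enum A) {1..k} (f ` A)"
      by (rule bij_betw_trans[OF *(11)]) (use f *(8) in \<open>auto simp: bij_betw_def inj_on_subset\<close>)
  qed (use *(6) in simp)
qed

lemma t_hom_relabel_mono:
  assumes W: "unit_kernel k W" and F: "kgraph k F" and f: "strict_mono f"
  shows "t_hom k (relabel f F) W = t_hom k F W"
proof (rule t_hom_relabel[OF W F inj_on_subset[OF strict_mono_imp_inj_on[OF f]]])
  fix A x assume "A \<in> edges F"
  note * = kgraph_edgeD[OF F this]
  have "enum (f ` A) ` B = (f \<circ> enum A) ` B" if "B \<in> rprop {1..k}" for B
  proof -
    have "enum (f ` A) i = f (enum A i)" if "i \<in> {1..k}" for i
      by (rule enum_image_mono) (use * that f in \<open>auto simp: strict_mono_def\<close>)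
    then show ?thesis using that unfolding comp_def by (intro image_cong[OF refl]) (auto simp: rprop_def)
  qed
  then show "W (pull k (enum (f ` A)) x) = W (pull k (f \<circ> enum A) x)"
    by (intro arg_cong[of _ _ W] pull_cong) simp
qed auto

definition disj_union :: "hgraph \<Rightarrow> hgraph \<Rightarrow> hgraph" where
  "disj_union F F' = (verts F \<union> verts F', edges F \<union> edges F')"

lemma disj_union_simps [simp]:
  "verts (disj_union F F') = verts F \<union> verts F'" "edges (disj_union F F') = edges F \<union> edges F'"
  by (simp_all add: disj_union_def verts_def edges_def)

lemma kgraph_disj_union: "kgraph k F \<Longrightarrow> kgraph k F' \<Longrightarrow> kgraph k (disj_union F F')"
  by (auto simp: kgraph_def)

lemma edges_disjoint:
  assumes "kgraph k F" "kgraph k F'" "verts F \<inter> verts F' = {}" "0 < k"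
  shows "edges F \<inter> edges F' = {}"
proof -
  have False if "A \<in> edges F" "A \<in> edges F'" for A
  proof -
    have "A = {}" using kgraph_edgeD(2)[OF assms(1) that(1)] kgraph_edgeD(2)[OF assms(2) that(2)] assms(3) by blast
    then show False using kgraph_edgeD(4)[OF assms(1) that(1)] assms(4) by simp
  qed
  then show ?thesis by blast
qed

text \<open>Graphs on disjoint vertex sets use disjoint coordinates, because \<open>binom_le\<close>
  omits the empty set. The condition on \<open>k\<close> rules out a common empty edge.\<close>

lemma t_hom_disj_union:
  assumes W: "unit_kernel k W" and F: "kgraph k F" "kgraph k F'" and d: "verts F \<inter> verts F' = {}" and k: "0 < k"
  shows "t_hom k (disj_union F F') W = t_hom k F W * t_hom k F' W"
proof -
  let ?F = "\<lambda>b. if b then F else F'"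
  let ?J = "\<lambda>b. binom_le (verts (?F b)) (k - 1)"
  let ?g = "\<lambda>b x. \<Prod>A\<in>edges (?F b). W (pull k (enum A) x)"
  have kF: "kgraph k (?F b)" for b using F by simp
  have "(\<integral>x. (\<Prod>b\<in>UNIV. ?g b (restrict x (?J b))) \<partial>PiM (binom_le (verts (disj_union F F')) (k - 1)) (\<lambda>_. unit_interval))
    = (\<Prod>b\<in>UNIV. \<integral>y. ?g b y \<partial>PiM (?J b) (\<lambda>_. unit_interval))"
  proof (rule integral_prod_disjoint[OF prob_space_unit_interval])
    show "finite (binom_le (verts (disj_union F F')) (k - 1))" using F by (auto simp: kgraph_def)
    have "binom_le (verts F) (k - 1) \<inter> binom_le (verts F') (k - 1) = {}" using d by (auto simp: binom_le_def)
    then show "disjoint_family_on ?J UNIV" by (auto simp: disjoint_family_on_def)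
    show "?J b \<subseteq> binom_le (verts (disj_union F F')) (k - 1)" for b by (auto simp: binom_le_def)
    show "?g b \<in> borel_measurable (PiM (?J b) (\<lambda>_. unit_interval))" for b
      by (rule t_hom_integrand(1)[OF W kF[of b], unfolded cube_def])
    show "0 \<le> ?g b x \<and> ?g b x \<le> 1" if "x \<in> space (PiM (?J b) (\<lambda>_. unit_interval))" for b x
      using t_hom_integrand(2)[OF W kF[of b], of x] that by (simp only: cube_def)
  qed simp
  moreover have "?g b (restrict x (?J b)) = ?g b x" for b x
  proof (rule prod.cong[OF refl], rule arg_cong[of _ _ W], rule pull_cong)
    fix A B assume A: "A \<in> edges (?F b)" and "B \<in> rprop {1..k}"
    then have "enum A ` B \<in> ?J b" using image_rprop[OF kgraph_edgeD(5)[OF kF A]] kgraph_edgeD(6)[OF kF A] by blast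
    then show "restrict x (?J b) (enum A ` B) = x (enum A ` B)" by simp
  qed
  moreover have "(\<Prod>b\<in>UNIV. ?g b x) = (\<Prod>A\<in>edges F \<union> edges F'. W (pull k (enum A) x))" for x
    by (subst prod.union_disjoint[OF kgraph_finite_edges[OF F(1)] kgraph_finite_edges[OF F(2)] edges_disjoint[OF F d k]])
       (simp add: UNIV_bool mult.commute)
  ultimately have "(\<integral>x. (\<Prod>A\<in>edges F \<union> edges F'. W (pull k (enum A) x)) \<partial>PiM (binom_le (verts (disj_union F F')) (k - 1)) (\<lambda>_. unit_interval))
    = (\<Prod>b\<in>UNIV. \<integral>y. ?g b y \<partial>PiM (?J b) (\<lambda>_. unit_interval))"
    by (simp only:)
  then show ?thesis by (simp add: t_hom_pull cube_def UNIV_bool mult.commute)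
qed

subsection \<open>Homomorphism densities of graphs\<close>

text \<open>Turns the count of maps in \<open>t_graph\<close> into a product integral, so that the
  same fibre lemmas serve graphs and hypergraphons.\<close>

lemma PiM_uniform:
  assumes I: "finite I" and V: "finite V" "V \<noteq> {}"
  shows "PiM I (\<lambda>_. uniform_count_measure V) = uniform_count_measure (I \<rightarrow>\<^sub>E V)"
proof -
  interpret prob_space "uniform_count_measure V" using V by (rule prob_space_uniform_count_measure)
  interpret product_prob_space "\<lambda>_. uniform_count_measure V" UNIV ..
  have fin: "finite (I \<rightarrow>\<^sub>E V)" using I V by (simp add: finite_PiE)
  have single: "{f} \<in> sets (PiM I (\<lambda>_. uniform_count_measure V))" if "f \<in> I \<rightarrow>\<^sub>E V" for f
  proof -
    have "(\<Pi>\<^sub>E i\<in>I. {f i}) = {f}" using that by (intro PiE_singleton) (simp add: PiE_iff)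
    moreover have "(\<Pi>\<^sub>E i\<in>I. {f i}) \<in> sets (PiM I (\<lambda>_. uniform_count_measure V))"
      by (rule sets_PiM_I_finite[OF I]) (use that in \<open>auto simp: sets_uniform_count_measure\<close>)
    ultimately show ?thesis by simp
  qed
  have sets: "sets (uniform_count_measure (I \<rightarrow>\<^sub>E V)) = sets (PiM I (\<lambda>_. uniform_count_measure V))"
  proof (rule antisym)
    show "sets (PiM I (\<lambda>_. uniform_count_measure V)) \<subseteq> sets (uniform_count_measure (I \<rightarrow>\<^sub>E V))"
      using sets.sets_into_space[of _ "PiM I (\<lambda>_. uniform_count_measure V)"]
      by (auto simp: sets_uniform_count_measure space_PiM space_uniform_count_measure)
    show "sets (uniform_count_measure (I \<rightarrow>\<^sub>E V)) \<subseteq> sets (PiM I (\<lambda>_. uniform_count_measure V))"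
    proof
      fix S assume "S \<in> sets (uniform_count_measure (I \<rightarrow>\<^sub>E V))"
      then have S: "S \<subseteq> I \<rightarrow>\<^sub>E V" by (simp add: sets_uniform_count_measure)
      then have "(\<Union>f\<in>S. {f}) \<in> sets (PiM I (\<lambda>_. uniform_count_measure V))"
        by (intro sets.finite_UN finite_subset[OF S fin] single) blast
      then show "S \<in> sets (PiM I (\<lambda>_. uniform_count_measure V))" by simp
    qed
  qed
  show ?thesis
  proof (rule PiM_eqI[OF I sets, symmetric])
    fix A assume A: "\<And>i. i \<in> I \<Longrightarrow> A i \<in> sets (uniform_count_measure V)"
    then have AV: "A i \<subseteq> V" if "i \<in> I" for i using that by (simp add: sets_uniform_count_measure)
    then have sub: "Pi\<^sub>E I A \<subseteq> I \<rightarrow>\<^sub>E V" by (intro PiE_mono) blast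
    have "(\<Prod>i\<in>I. emeasure (uniform_count_measure V) (A i)) = (\<Prod>i\<in>I. ennreal (card (A i) / card V))"
      by (intro prod.cong[OF refl] emeasure_uniform_count_measure V AV)
    also have "\<dots> = ennreal (\<Prod>i\<in>I. card (A i) / card V)" by (rule prod_ennreal) simp
    also have "(\<Prod>i\<in>I. card (A i) / card V) = card (Pi\<^sub>E I A) / card (I \<rightarrow>\<^sub>E V)"
      by (simp add: prod_dividef card_PiE[OF I])
    also have "ennreal \<dots> = emeasure (uniform_count_measure (I \<rightarrow>\<^sub>E V)) (Pi\<^sub>E I A)"
      by (rule emeasure_uniform_count_measure[OF fin sub, symmetric])
    finally show "emeasure (uniform_count_measure (I \<rightarrow>\<^sub>E V)) (Pi\<^sub>E I A) = 
        (\<Prod>i\<in>I. emeasure (uniform_count_measure V) (A i))" by simp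
  qed
qed

lemma borel_measurable_PiM_uniform:
  assumes "finite I" "finite V" "V \<noteq> {}"
  shows "f \<in> borel_measurable (PiM I (\<lambda>_. uniform_count_measure V))"
  unfolding PiM_uniform[OF assms] by (simp add: measurable_def space_uniform_count_measure sets_uniform_count_measure)

definition hom_ind :: "hgraph \<Rightarrow> hgraph \<Rightarrow> (nat \<Rightarrow> nat) \<Rightarrow> real" where
  "hom_ind F G \<phi> = (\<Prod>e\<in>edges F. of_bool (\<phi> ` e \<in> edges G))"

lemma hom_ind_eq: "finite (edges F) \<Longrightarrow> hom_ind F G \<phi> = of_bool (\<forall>e\<in>edges F. \<phi> ` e \<in> edges G)"
  by (cases "\<forall>e\<in>edges F. \<phi> ` e \<in> edges G") (auto simp: hom_ind_def intro!: prod.neutral prod_zero)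

lemma hom_ind_unit: "0 \<le> hom_ind F G \<phi> \<and> hom_ind F G \<phi> \<le> 1"
  unfolding hom_ind_def by (rule prod_unit) simp

lemma t_graph_integral:
  assumes F: "kgraph k F" and G: "finite (verts G)" "verts G \<noteq> {}"
  shows "t_graph F G = (\<integral>\<phi>. hom_ind F G \<phi> \<partial>PiM (verts F) (\<lambda>_. uniform_count_measure (verts G)))"
proof -
  have vF: "finite (verts F)" using F by (simp add: kgraph_def)
  have fin: "finite (verts F \<rightarrow>\<^sub>E verts G)" using vF G by (simp add: finite_PiE)
  have "(\<integral>\<phi>. hom_ind F G \<phi> \<partial>PiM (verts F) (\<lambda>_. uniform_count_measure (verts G))) =
     (\<Sum>\<phi>\<in>verts F \<rightarrow>\<^sub>E verts G. hom_ind F G \<phi>) / card (verts F \<rightarrow>\<^sub>E verts G)"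
    unfolding PiM_uniform[OF vF G] by (rule integral_uniform_count_measure[OF fin])
  also have "(\<Sum>\<phi>\<in>verts F \<rightarrow>\<^sub>E verts G. hom_ind F G \<phi>) =
      real (card {f \<in> verts F \<rightarrow>\<^sub>E verts G. \<forall>e\<in>edges F. f ` e \<in> edges G})"
    unfolding hom_ind_eq[OF kgraph_finite_edges[OF F]] using fin by (simp add: of_bool_def sum.If_cases Int_def)
  also have "real (card (verts F \<rightarrow>\<^sub>E verts G)) = real (card (verts G)) ^ card (verts F)"
    by (simp add: card_PiE vF)
  finally show ?thesis by (simp add: t_graph_def)
qed

lemma hom_ind_cong:
  assumes "kgraph k F" "\<And>v. v \<in> verts F \<Longrightarrow> \<phi> v = \<psi> v" shows "hom_ind F G \<phi> = hom_ind F G \<psi>"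
proof -
  have "\<phi> ` e = \<psi> ` e" if "e \<in> edges F" for e
    by (rule image_cong[OF refl]) (use kgraph_edgeD(2)[OF assms(1) that] assms(2) in blast)
  then show ?thesis unfolding hom_ind_def by (intro prod.cong[OF refl]) simp
qed

lemma t_graph_integral_superset:
  assumes F: "kgraph k F" and G: "finite (verts G)" "verts G \<noteq> {}" and I: "verts F \<subseteq> I"
  shows "t_graph F G = (\<integral>\<phi>. hom_ind F G \<phi> \<partial>PiM I (\<lambda>_. uniform_count_measure (verts G)))"
proof -
  have vF: "finite (verts F)" using F by (simp add: kgraph_def)
  have "(\<integral>\<phi>. hom_ind F G (restrict \<phi> (verts F)) \<partial>PiM I (\<lambda>_. uniform_count_measure (verts G))) = t_graph F G"
    unfolding t_graph_integral[OF F G]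
    by (rule integral_PiM_restrict[OF prob_space_uniform_count_measure[OF G] I borel_measurable_PiM_uniform[OF vF G]])
  moreover have "hom_ind F G (restrict \<phi> (verts F)) = hom_ind F G \<phi>" for \<phi>
    by (rule hom_ind_cong[OF F]) simp
  ultimately show ?thesis by simp
qed

lemma t_graph_relabel:
  assumes F: "kgraph k F" and f: "inj_on f (verts F)" and G: "finite (verts G)" "verts G \<noteq> {}"
  shows "t_graph (relabel f F) G = t_graph F G"
proof -
  have vF: "finite (verts F)" using F by (simp add: kgraph_def)
  have "t_graph F G = (\<integral>\<phi>. hom_ind F G (\<lambda>v\<in>verts F. \<phi> (f v)) \<partial>PiM (f ` verts F) (\<lambda>_. uniform_count_measure (verts G)))"
    unfolding t_graph_integral[OF F G]
    by (rule integral_PiM_reindex[symmetric, OF prob_space_uniform_count_measure[OF G] f _ borel_measurable_PiM_uniform[OF vF G]]) simp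
  also have "\<dots> = (\<integral>\<phi>. hom_ind (relabel f F) G \<phi> \<partial>PiM (f ` verts F) (\<lambda>_. uniform_count_measure (verts G)))"
  proof (rule Bochner_Integration.integral_cong[OF refl])
    fix \<phi>
    have "hom_ind F G (\<lambda>v\<in>verts F. \<phi> (f v)) = hom_ind F G (\<lambda>v. \<phi> (f v))"
      by (rule hom_ind_cong[OF F]) simp
    also have "\<dots> = hom_ind (relabel f F) G \<phi>"
      by (simp add: hom_ind_def prod.reindex[OF inj_on_image_edges[OF F f]] image_image)
    finally show "hom_ind F G (\<lambda>v\<in>verts F. \<phi> (f v)) = hom_ind (relabel f F) G \<phi>" .
  qed
  also have "\<dots> = t_graph (relabel f F) G"
    using t_graph_integral[OF kgraph_relabel[OF F f] G] by simp
  finally show ?thesis by simp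
qed

lemma t_graph_disj_union:
  assumes F: "kgraph k F" "kgraph k F'" and d: "verts F \<inter> verts F' = {}" and k: "0 < k"
    and G: "finite (verts G)" "verts G \<noteq> {}"
  shows "t_graph (disj_union F F') G = t_graph F G * t_graph F' G"
proof -
  let ?F = "\<lambda>b. if b then F else F'"
  let ?U = "\<lambda>_. uniform_count_measure (verts G)"
  have kF: "kgraph k (?F b)" for b using F by simp
  have fin: "finite (verts (?F b))" for b using kF[of b] by (simp add: kgraph_def)
  have "(\<integral>\<phi>. (\<Prod>b\<in>UNIV. hom_ind (?F b) G (restrict \<phi> (verts (?F b)))) \<partial>PiM (verts F \<union> verts F') ?U)
    = (\<Prod>b\<in>UNIV. \<integral>\<phi>. hom_ind (?F b) G \<phi> \<partial>PiM (verts (?F b)) ?U)"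
  proof (rule integral_prod_disjoint[OF prob_space_uniform_count_measure[OF G]])
    show "finite (verts F \<union> verts F')" using F by (simp add: kgraph_def)
    show "disjoint_family_on (\<lambda>b. verts (?F b)) UNIV" using d by (auto simp: disjoint_family_on_def)
    show "verts (?F b) \<subseteq> verts F \<union> verts F'" for b by simp
    show "hom_ind (?F b) G \<in> borel_measurable (PiM (verts (?F b)) ?U)" for b
      by (rule borel_measurable_PiM_uniform[OF fin G])
  qed (simp_all only: finite_class.finite_UNIV hom_ind_unit)
  moreover have "hom_ind (?F b) G (restrict \<phi> (verts (?F b))) = hom_ind (?F b) G \<phi>" for b \<phi>
    by (rule hom_ind_cong[OF kF]) simp
  moreover have "(\<Prod>b\<in>UNIV. hom_ind (?F b) G \<phi>) = hom_ind (disj_union F F') G \<phi>" for \<phi>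
    unfolding hom_ind_def disj_union_simps 
    by (subst prod.union_disjoint[OF kgraph_finite_edges[OF F(1)] kgraph_finite_edges[OF F(2)] edges_disjoint[OF F d k]])
       (simp add: UNIV_bool mult.commute)
  ultimately have "(\<integral>\<phi>. hom_ind (disj_union F F') G \<phi> \<partial>PiM (verts F \<union> verts F') ?U)
    = (\<Prod>b\<in>UNIV. \<integral>\<phi>. hom_ind (?F b) G \<phi> \<partial>PiM (verts (?F b)) ?U)" by (simp only:)
  then show ?thesis
    using t_graph_integral[OF kgraph_disj_union[OF F] G]
    by (simp add: t_graph_integral[OF F(1) G] t_graph_integral[OF F(2) G] UNIV_bool)
qed

text \<open>Union bound over the ordered pairs of distinct indices, each of which collides with
  probability 1 / |V|.\<close>

lemma noninj_uniform:
  assumes I: "finite I" and V: "finite V" "V \<noteq> {}"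
  shows "(\<integral>\<phi>. of_bool (\<not> inj_on \<phi> I) \<partial>PiM I (\<lambda>_. uniform_count_measure V)) \<le> (real (card I))\<^sup>2 / card V"
proof -
  let ?P = "PiM I (\<lambda>_. uniform_count_measure V)"
  let ?D = "{(a, b) \<in> I \<times> I. a \<noteq> b}"
  interpret U: prob_space "uniform_count_measure V" using V by (rule prob_space_uniform_count_measure)
  interpret product_prob_space "\<lambda>_. uniform_count_measure V" UNIV ..
  have pP: "prob_space (PiM J (\<lambda>_. uniform_count_measure V))" for J by (intro prob_space_PiM U.prob_space_axioms)
  have fD: "finite ?D" by (rule finite_subset[of _ "I \<times> I"]) (use I in auto)
  note m = borel_measurable_PiM_uniform[OF _ V]
  have pair: "(\<integral>\<phi>. of_bool (\<phi> a = \<phi> b) \<partial>?P) = 1 / real (card V)" if ab: "a \<in> I" "b \<in> I" "a \<noteq> b" for a b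
  proof -
    have "(\<integral>\<phi>. (of_bool (\<phi> a = \<phi> b) :: real) \<partial>?P) = (\<integral>\<phi>. of_bool (restrict \<phi> {b, a} a = restrict \<phi> {b, a} b) \<partial>?P)" by simp
    also have "\<dots> = (\<integral>\<phi>. of_bool (\<phi> a = \<phi> b) \<partial>PiM {b, a} (\<lambda>_. uniform_count_measure V))"
      by (rule integral_PiM_restrict[OF U.prob_space_axioms _ m, where g = "\<lambda>\<phi>. of_bool (\<phi> a = \<phi> b)"]) (use ab in auto)
    also have "\<dots> = (\<integral>x. \<integral>y. of_bool ((x(b := y)) a = (x(b := y)) b) \<partial>uniform_count_measure V \<partial>PiM {a} (\<lambda>_. uniform_count_measure V))"
      by (rule product_integral_insert[OF _ _ prob_space.integrable_unit[OF pP m], where f = "\<lambda>\<phi>. of_bool (\<phi> a = \<phi> b)"]) (use ab in auto)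
    also have "\<dots> = (\<integral>x. 1 / real (card V) \<partial>PiM {a} (\<lambda>_. uniform_count_measure V))"
    proof (rule Bochner_Integration.integral_cong[OF refl])
      fix x assume "x \<in> space (PiM {a} (\<lambda>_. uniform_count_measure V))"
      then have "x a \<in> V" by (auto simp: space_PiM space_uniform_count_measure)
      then show "(\<integral>y. of_bool ((x(b := y)) a = (x(b := y)) b) \<partial>uniform_count_measure V) = 1 / real (card V)"
        using ab V by (simp add: integral_uniform_count_measure of_bool_def)
    qed
    finally show ?thesis by (simp add: prob_space.prob_space[OF pP])
  qed
  have int: "integrable ?P (\<lambda>\<phi>. of_bool (Q \<phi>) :: real)" for Q
    by (rule prob_space.integrable_unit[OF pP m[OF I]]) simp
  have "(\<integral>\<phi>. (of_bool (\<not> inj_on \<phi> I) :: real) \<partial>?P) \<le> (\<integral>\<phi>. (\<Sum>(a, b)\<in>?D. of_bool (\<phi> a = \<phi> b)) \<partial>?P)"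
  proof (rule integral_mono[OF int])
    show "integrable ?P (\<lambda>\<phi>. \<Sum>(a, b)\<in>?D. of_bool (\<phi> a = \<phi> b) :: real)"
      unfolding split_beta by (rule Bochner_Integration.integrable_sum[OF int])
    fix \<phi> :: "'a \<Rightarrow> 'b"
    show "of_bool (\<not> inj_on \<phi> I) \<le> (\<Sum>(a, b)\<in>?D. of_bool (\<phi> a = \<phi> b) :: real)"
    proof (cases "inj_on \<phi> I")
      case True then show ?thesis by (auto intro!: sum_nonneg)
    next
      case False
      then obtain a b where "(a, b) \<in> ?D" "\<phi> a = \<phi> b" by (auto simp: inj_on_def)
      then have "1 \<le> (\<Sum>(a, b)\<in>?D. of_bool (\<phi> a = \<phi> b) :: real)"
        using member_le_sum[of "(a, b)" ?D "\<lambda>(a, b). of_bool (\<phi> a = \<phi> b) :: real"] fD by auto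
      then show ?thesis using False by simp
    qed
  qed
  also have "\<dots> = (\<Sum>(a, b)\<in>?D. (\<integral>\<phi>. of_bool (\<phi> a = \<phi> b) \<partial>?P))"
    unfolding split_beta by (rule Bochner_Integration.integral_sum[OF int])
  also have "\<dots> = (\<Sum>(a, b)\<in>?D. 1 / real (card V))"
    by (rule sum.cong[OF refl]) (auto simp: pair)
  also have "\<dots> = card ?D * (1 / real (card V))" by simp
  also have "\<dots> \<le> (card I * card I) * (1 / real (card V))"
  proof (rule mult_right_mono)
    have "card ?D \<le> card (I \<times> I)" by (rule card_mono) (use I in auto)
    then show "real (card ?D) \<le> card I * card I" unfolding card_cartesian_product of_nat_mult[symmetric] of_nat_le_iff .
  qed simp
  finally show ?thesis by (simp add: power2_eq_square)
qed

text \<open>An injective homomorphism from \<open>F\<close> would be a copy of \<open>F\<close>, so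
  only non-injective maps contribute to the density.\<close>

lemma t_graph_Ffree_le:
  assumes F: "kgraph k F" "F \<in> Fam" and G: "finite (verts G)" "verts G \<noteq> {}" "Ffree Fam G"
  shows "t_graph F G \<le> (real (card (verts F)))\<^sup>2 / card (verts G)"
proof -
  let ?P = "PiM (verts F) (\<lambda>_. uniform_count_measure (verts G))"
  have vF: "finite (verts F)" using F by (simp add: kgraph_def)
  have pP: "prob_space ?P" by (intro prob_space_PiM prob_space_uniform_count_measure G)
  note m = borel_measurable_PiM_uniform[OF vF G(1,2)]
  have "t_graph F G \<le> (\<integral>\<phi>. of_bool (\<not> inj_on \<phi> (verts F)) \<partial>?P)"
    unfolding t_graph_integral[OF F(1) G(1,2)]
  proof (rule integral_mono)
    show "integrable ?P (hom_ind F G)" by (rule prob_space.integrable_unit[OF pP m hom_ind_unit])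
    show "integrable ?P (\<lambda>\<phi>. of_bool (\<not> inj_on \<phi> (verts F)) :: real)"
      by (rule prob_space.integrable_unit[OF pP m]) simp
    fix \<phi> assume "\<phi> \<in> space ?P"
    then have "\<phi> ` verts F \<subseteq> verts G" by (auto simp: space_PiM space_uniform_count_measure)
    then have "\<not> inj_on \<phi> (verts F) \<or> \<not> (\<forall>e\<in>edges F. \<phi> ` e \<in> edges G)"
      using G(3) F(2) unfolding Ffree_def contains_copy_def by blast
    then show "hom_ind F G \<phi> \<le> of_bool (\<not> inj_on \<phi> (verts F))"
      unfolding hom_ind_eq[OF kgraph_finite_edges[OF F(1)]] by auto
  qed
  also have "\<dots> \<le> (real (card (verts F)))\<^sup>2 / card (verts G)" by (rule noninj_uniform[OF vF G(1,2)])
  finally show ?thesis .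
qed

lemma W_free_limit:
  assumes Fam: "\<forall>F\<in>Fam. kgraph k F" and conv: "converges_to k G W"
    and G: "\<And>n. kgraph k (G n) \<and> Ffree Fam (G n)" and card: "filterlim (\<lambda>n. card (verts (G n))) at_top sequentially"
  shows "W_free k Fam W"
  unfolding W_free_def
proof
  fix F assume F: "F \<in> Fam"
  then have kF: "kgraph k F" using Fam by blast
  have lim: "(\<lambda>n. t_graph F (G n)) \<longlonglongrightarrow> t_hom k F W" using conv kF unfolding converges_to_def by blast
  have l0: "(\<lambda>n. (real (card (verts F)))\<^sup>2 / real (card (verts (G n)))) \<longlonglongrightarrow> 0"
    by (rule tendsto_divide_0[OF tendsto_const filterlim_at_top_imp_at_infinity])
       (rule filterlim_compose[OF filterlim_real_sequentially card])
  have "\<forall>\<^sub>F n in sequentially. 0 < card (verts (G n))"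
    using card[unfolded filterlim_at_top, rule_format, of 1] by (simp add: Suc_le_eq)
  then have up: "\<forall>\<^sub>F n in sequentially. t_graph F (G n) \<le> (real (card (verts F)))\<^sup>2 / real (card (verts (G n)))"
  proof (rule eventually_mono)
    fix n assume "0 < card (verts (G n))"
    then show "t_graph F (G n) \<le> (real (card (verts F)))\<^sup>2 / real (card (verts (G n)))"
      by (intro t_graph_Ffree_le[OF kF F]) (use G[of n] in \<open>auto simp: card_gt_0_iff\<close>)
  qed
  have lo: "\<forall>\<^sub>F n in sequentially. 0 \<le> t_graph F (G n)" unfolding t_graph_def by (rule always_eventually) simp
  have "(\<lambda>n. t_graph F (G n)) \<longlonglongrightarrow> 0" by (rule tendsto_sandwich[OF lo up tendsto_const l0])
  with lim show "t_hom k F W = 0" by (rule LIMSEQ_unique)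
qed

subsection \<open>Degrees in the limit\<close>

lemma (in prob_space) integral_one_minus:
  fixes f :: "'a \<Rightarrow> real"
  assumes "integrable M f" shows "(\<integral>x. 1 - f x \<partial>M) = 1 - integral\<^sup>L M f"
  using Bochner_Integration.integral_diff[OF integrable_const assms, of 1] by (simp add: prob_space)

text \<open>Inclusion-exclusion over the edges that are present: convergence is stated for edges,
  while the stars below count non-edges.\<close>

lemma prod_one_minus_expand:
  fixes f :: "'a \<Rightarrow> real"
  assumes "finite E" shows "(\<Prod>e\<in>E. 1 - f e) = (\<Sum>X\<in>Pow E. (-1) ^ card X * (\<Prod>e\<in>X. f e))"
proof -
  have "(\<Prod>e\<in>E. 1 - f e) = (\<Prod>e\<in>E. - f e + 1)" by simp
  also have "\<dots> = (\<Sum>X\<in>Pow E. (\<Prod>e\<in>X. - f e) * (\<Prod>e\<in>E-X. 1))" by (rule prod_add[OF assms])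
  also have "\<dots> = (\<Sum>X\<in>Pow E. (-1) ^ card X * (\<Prod>e\<in>X. f e))" by (simp add: prod_uminus)
  finally show ?thesis .
qed

lemma kgraph_subgraph: "kgraph k F \<Longrightarrow> X \<subseteq> edges F \<Longrightarrow> kgraph k (verts F, X)"
  by (auto simp: kgraph_def verts_def edges_def)

lemma hgraph_simps [simp]: "verts (V, E) = V" "edges (V, E) = E"
  by (simp_all add: verts_def edges_def)

lemma integral_none_graph:
  assumes F: "kgraph k F" and G: "finite (verts G)" "verts G \<noteq> {}"
  shows "(\<integral>\<phi>. (\<Prod>e\<in>edges F. 1 - of_bool (\<phi> ` e \<in> edges G)) \<partial>PiM (verts F) (\<lambda>_. uniform_count_measure (verts G)))
    = (\<Sum>X\<in>Pow (edges F). (-1) ^ card X * t_graph (verts F, X) G)"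
proof -
  let ?P = "PiM (verts F) (\<lambda>_. uniform_count_measure (verts G))"
  have vF: "finite (verts F)" using F by (simp add: kgraph_def)
  have pP: "prob_space ?P" by (intro prob_space_PiM prob_space_uniform_count_measure G)
  have int: "integrable ?P (hom_ind H G)" for H
    by (rule prob_space.integrable_unit[OF pP borel_measurable_PiM_uniform[OF vF G] hom_ind_unit])
  have "(\<Prod>e\<in>edges F. 1 - of_bool (\<phi> ` e \<in> edges G)) = (\<Sum>X\<in>Pow (edges F). (-1) ^ card X * hom_ind (verts F, X) G \<phi>)" for \<phi>
    unfolding prod_one_minus_expand[OF kgraph_finite_edges[OF F]] by (simp add: hom_ind_def)
  then have "(\<integral>\<phi>. (\<Prod>e\<in>edges F. 1 - of_bool (\<phi> ` e \<in> edges G)) \<partial>?P) =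
     (\<integral>\<phi>. (\<Sum>X\<in>Pow (edges F). (-1) ^ card X * hom_ind (verts F, X) G \<phi>) \<partial>?P)" by (simp only:)
  also have "\<dots> = (\<Sum>X\<in>Pow (edges F). (\<integral>\<phi>. (-1) ^ card X * hom_ind (verts F, X) G \<phi> \<partial>?P))"
    by (rule Bochner_Integration.integral_sum) (intro integrable_mult_right int)
  also have "\<dots> = (\<Sum>X\<in>Pow (edges F). (-1) ^ card X * t_graph (verts F, X) G)"
  proof (rule sum.cong[OF refl])
    fix X assume "X \<in> Pow (edges F)"
    then have "kgraph k (verts F, X)" using kgraph_subgraph[OF F] by blast
    from t_graph_integral[OF this G] show "(\<integral>\<phi>. (-1) ^ card X * hom_ind (verts F, X) G \<phi> \<partial>?P) = (-1) ^ card X * t_graph (verts F, X) G"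
      by simp
  qed
  finally show ?thesis .
qed

lemma integral_none_W:
  assumes W: "unit_kernel k W" and F: "kgraph k F"
  shows "(\<integral>x. (\<Prod>A\<in>edges F. 1 - W (pull k (enum A) x)) \<partial>cube (binom_le (verts F) (k - 1)))
    = (\<Sum>X\<in>Pow (edges F). (-1) ^ card X * t_hom k (verts F, X) W)"
proof -
  let ?P = "cube (binom_le (verts F) (k - 1))"
  let ?h = "\<lambda>X x. \<Prod>A\<in>X. W (pull k (enum A) x)"
  have int: "integrable ?P (?h X)" if "X \<in> Pow (edges F)" for X
  proof -
    have "kgraph k (verts F, X)" using kgraph_subgraph[OF F] that by blast
    note t_hom_integrand[OF W this, unfolded hgraph_simps]
    then show ?thesis by (rule prob_space.integrable_unit[OF prob_space_cube])
  qed
  have "(\<integral>x. (\<Prod>A\<in>edges F. 1 - W (pull k (enum A) x)) \<partial>?P) =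
     (\<integral>x. (\<Sum>X\<in>Pow (edges F). (-1) ^ card X * ?h X x) \<partial>?P)"
    unfolding prod_one_minus_expand[OF kgraph_finite_edges[OF F]] by (rule refl)
  also have "\<dots> = (\<Sum>X\<in>Pow (edges F). (\<integral>x. (-1) ^ card X * ?h X x \<partial>?P))"
    by (rule Bochner_Integration.integral_sum) (intro integrable_mult_right int)
  also have "\<dots> = (\<Sum>X\<in>Pow (edges F). (-1) ^ card X * t_hom k (verts F, X) W)"
    by (simp add: t_hom_pull)
  finally show ?thesis .
qed

text \<open>Both sides are the same alternating sum over the spanning subgraphs of \<open>F\<close>,
  and each summand converges.\<close>

lemma converges_to_none:
  assumes conv: "converges_to k G W" and W: "unit_kernel k W" and F: "kgraph k F"
    and G: "\<And>n. finite (verts (G n))" and card: "filterlim (\<lambda>n. card (verts (G n))) at_top sequentially"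
  shows "(\<lambda>n. \<integral>\<phi>. (\<Prod>e\<in>edges F. 1 - of_bool (\<phi> ` e \<in> edges (G n))) \<partial>PiM (verts F) (\<lambda>_. uniform_count_measure (verts (G n))))
    \<longlonglongrightarrow> (\<integral>x. (\<Prod>A\<in>edges F. 1 - W (pull k (enum A) x)) \<partial>cube (binom_le (verts F) (k - 1)))"
  unfolding integral_none_W[OF W F]
proof (rule Lim_transform_eventually)
  show "(\<lambda>n. \<Sum>X\<in>Pow (edges F). (-1) ^ card X * t_graph (verts F, X) (G n)) \<longlonglongrightarrow>
     (\<Sum>X\<in>Pow (edges F). (-1) ^ card X * t_hom k (verts F, X) W)"
  proof (intro tendsto_sum tendsto_mult_left)
    fix X assume "X \<in> Pow (edges F)"
    then have "kgraph k (verts F, X)" using kgraph_subgraph[OF F] by blast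
    then show "(\<lambda>n. t_graph (verts F, X) (G n)) \<longlonglongrightarrow> t_hom k (verts F, X) W" using conv unfolding converges_to_def by blast
  qed
  have "\<forall>\<^sub>F n in sequentially. 1 \<le> card (verts (G n))" using card[unfolded filterlim_at_top, rule_format, of 1] .
  then show "\<forall>\<^sub>F n in sequentially. (\<Sum>X\<in>Pow (edges F). (-1) ^ card X * t_graph (verts F, X) (G n)) = 
     (\<integral>\<phi>. (\<Prod>e\<in>edges F. 1 - of_bool (\<phi> ` e \<in> edges (G n))) \<partial>PiM (verts F) (\<lambda>_. uniform_count_measure (verts (G n))))"
  proof (rule eventually_mono)
    fix n assume "1 \<le> card (verts (G n))"
    then have "verts (G n) \<noteq> {}" by auto
    from integral_none_graph[OF F G this] show "(\<Sum>X\<in>Pow (edges F). (-1) ^ card X * t_graph (verts F, X) (G n)) = 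
     (\<integral>\<phi>. (\<Prod>e\<in>edges F. 1 - of_bool (\<phi> ` e \<in> edges (G n))) \<partial>PiM (verts F) (\<lambda>_. uniform_count_measure (verts (G n))))" ..
  qed
qed

lemma rall_subset_rprop: "l < k \<Longrightarrow> rall {1..l} \<subseteq> rprop {1..k}"
  by (auto simp: rall_def rprop_def)

lemma deg_W_measurable:
  assumes "unit_kernel k W" "l < k" shows "deg_W k l W \<in> borel_measurable (cube (rall {1..l}))"
proof -
  have *: "rall {1..l} \<union> (rprop {1..k} - rall {1..l}) = rprop {1..k}" using rall_subset_rprop[OF assms(2)] by blast
  show ?thesis unfolding deg_W_def cube_def
    by (rule integral_merge_measurable[OF prob_space_unit_interval])
       (use assms(1) in \<open>simp only: * unit_kernel_def cube_def\<close>)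
qed

lemma deg_W_inner:
  assumes "unit_kernel k W" "l < k" "x \<in> space (cube (rall {1..l}))"
  defines "f \<equiv> \<lambda>y. W (merge (rall {1..l}) (rprop {1..k} - rall {1..l}) (x, y))"
  shows "f \<in> borel_measurable (cube (rprop {1..k} - rall {1..l}))"
    and "y \<in> space (cube (rprop {1..k} - rall {1..l})) \<Longrightarrow> 0 \<le> f y \<and> f y \<le> 1"
proof -
  let ?L = "rall {1..l}" and ?R = "rprop {1..k} - rall {1..l}"
  have *: "?L \<union> ?R = rprop {1..k}" using rall_subset_rprop[OF assms(2)] by blast
  have m: "(\<lambda>y. merge ?L ?R (x, y)) \<in> measurable (cube ?R) (cube (?L \<union> ?R))"
    using measurable_compose[OF measurable_Pair1'[OF assms(3)] measurable_merge[of ?L ?R "\<lambda>_. unit_interval", folded cube_def]] .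
  show "f \<in> borel_measurable (cube ?R)" unfolding f_def
    by (rule measurable_compose[OF m]) (use assms(1) in \<open>simp only: * unit_kernel_def\<close>)
  show "0 \<le> f y \<and> f y \<le> 1" if "y \<in> space (cube ?R)"
    using measurable_space[OF m that] assms(1) unfolding f_def * unit_kernel_def by blast
qed

lemma deg_W_unit:
  assumes "unit_kernel k W" "l < k" "x \<in> space (cube (rall {1..l}))"
  shows "0 \<le> deg_W k l W x \<and> deg_W k l W x \<le> 1"
  unfolding deg_W_def by (rule prob_space.integral_unit[OF prob_space_cube deg_W_inner[OF assms]])

text \<open>By symmetry of \<open>W\<close> the vertices of \<open>L\<close> may be enumerated
  before those of \<open>B\<close>. The fibre integral over a k-set extending \<open>L\<close> then
  becomes the one defining \<open>deg_W\<close>, wherever \<open>L\<close> lies inside the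
  k-set.\<close>

lemma deg_W_fibre:
  assumes W: "hypergraphon k W" and lk: "l < k"
    and L: "finite L" "card L = l" and B: "finite B" "card B = k - l" "L \<inter> B = {}"
    and x: "x \<in> space (cube (rall L))"
  defines "K \<equiv> L \<union> B"
  shows "(\<integral>y. W (pull k (enum K) (merge (rall L) (rprop K - rall L) (x, y))) \<partial>cube (rprop K - rall L))
     = deg_W k l W (\<lambda>S\<in>rall {1..l}. x (enum L ` S))"
proof -
  let ?L = "rall {1..l}" and ?R = "rprop {1..k} - rall {1..l}"
  let ?x = "\<lambda>S\<in>?L. x (enum L ` S)"
  define \<beta> where "\<beta> i = (if i \<le> l then enum L i else enum B (i - l))" for i
  have K: "finite K" "card K = k" using L B lk unfolding K_def by (simp_all add: card_Un_disjoint)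
  have BL: "bij_betw \<beta> {1..l} L"
    using enum_bij[OF L(1)] unfolding L(2) by (rule bij_betw_cong[THEN iffD1, rotated]) (simp add: \<beta>_def)
  have "bij_betw (\<lambda>i. i - l) {l+1..k} {1..k-l}"
    by (rule bij_betwI[of _ _ _ "\<lambda>i. i + l"]) auto
  from bij_betw_trans[OF this enum_bij[OF B(1), unfolded B(2)]]
  have "bij_betw \<beta> {l+1..k} B" by (rule bij_betw_cong[THEN iffD1, rotated]) (simp add: \<beta>_def)
  moreover have "{1..l} \<union> {l+1..k} = {1..k}" using lk by auto
  ultimately have \<beta>K: "bij_betw \<beta> {1..k} K"
    using bij_betw_combine[OF BL _ B(3)] unfolding K_def by metis
  have Lk: "{1..l} \<subset> {1..k}" using lk by auto
  have rL: "rall L \<subseteq> rprop K"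
  proof
    fix S assume S: "S \<in> rall L"
    have "B \<noteq> {}" using B lk by auto
    then show "S \<in> rprop K" using S B(3) unfolding K_def rall_def rprop_def by blast
  qed
  have UK: "rall L \<union> (rprop K - rall L) = rprop K" using rL by blast
  have in1: "\<beta> ` S \<in> rall L" "\<beta> ` S = enum L ` S" if "S \<in> ?L" for S
  proof -
    have S: "S \<subseteq> {1..l}" "S \<noteq> {}" using that by (auto simp: rall_def)
    show "\<beta> ` S \<in> rall L" using S BL by (auto simp: rall_def bij_betw_def)
    show "\<beta> ` S = enum L ` S" by (rule image_cong[OF refl]) (use S in \<open>auto simp: \<beta>_def\<close>)
  qed
  have in2: "\<beta> ` S \<in> rprop K - rall L" if "S \<in> ?R" for S
  proof -
    have S: "S \<subseteq> {1..k}" "S \<in> rprop {1..k}" "\<not> S \<subseteq> {1..l}" using that by (auto simp: rall_def rprop_def)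
    have "\<not> \<beta> ` S \<subseteq> \<beta> ` {1..l}" using inj_on_image_subset_iff[of \<beta> "{1..k}" S "{1..l}"] S Lk \<beta>K
      by (auto simp: bij_betw_def)
    then have "\<beta> ` S \<notin> rall L" using BL by (auto simp: rall_def bij_betw_def)
    then show ?thesis using image_rprop[OF \<beta>K S(2)] by blast
  qed
  have inj: "inj_on ((`) \<beta>) ?R"
    by (rule inj_on_subset[OF inj_on_image_Pow[of \<beta> "{1..k}"]]) (use \<beta>K in \<open>auto simp: bij_betw_def rprop_def\<close>)
  have x': "?x \<in> space (cube ?L)"
    using x in1 unfolding space_cube by (intro restrict_PiE_iff[THEN iffD2]) (auto simp: PiE_iff)
  have "(\<integral>y. W (pull k (enum K) (merge (rall L) (rprop K - rall L) (x, y))) \<partial>cube (rprop K - rall L)) =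
     (\<integral>y. W (merge ?L ?R (?x, \<lambda>S\<in>?R. y (\<beta> ` S))) \<partial>cube (rprop K - rall L))"
  proof (rule Bochner_Integration.integral_cong[OF refl])
    fix y assume y: "y \<in> space (cube (rprop K - rall L))"
    let ?z = "merge (rall L) (rprop K - rall L) (x, y)"
    have z: "?z \<in> space (cube (rprop K))" using merge_space_PiM[OF x[unfolded cube_def] y[unfolded cube_def]] 
      unfolding UK cube_def .
    have "W (pull k (enum K) ?z) = W (pull k \<beta> ?z)"
      by (rule hypergraphon_pull_eq[OF W _ \<beta>K z subset_refl]) (use enum_bij[OF K(1)] K(2) in simp)
    also have "pull k \<beta> ?z = merge ?L ?R (?x, \<lambda>S\<in>?R. y (\<beta> ` S))"
    proof
      fix S
      consider "S \<in> ?L" | "S \<in> ?R" | "S \<notin> rprop {1..k}" by blast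
      then show "pull k \<beta> ?z S = merge ?L ?R (?x, \<lambda>S\<in>?R. y (\<beta> ` S)) S"
      proof cases
        case 1 then show ?thesis using rall_subset_rprop[OF lk] in1[OF 1] by (auto simp: pull_def merge_def)
      next
        case 2 then show ?thesis using in2[OF 2] by (auto simp: pull_def merge_def)
      next
        case 3 then show ?thesis using rall_subset_rprop[OF lk] by (auto simp: pull_def merge_def)
      qed
    qed
    finally show "W (pull k (enum K) ?z) = W (merge ?L ?R (?x, \<lambda>S\<in>?R. y (\<beta> ` S)))" .
  qed
  also have "\<dots> = deg_W k l W ?x"
    unfolding deg_W_def cube_def
    by (rule integral_PiM_reindex[OF prob_space_unit_interval inj _
         deg_W_inner(1)[OF hypergraphon_unit_kernel[OF W] lk x', unfolded cube_def]]) (use in2 in blast)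
  finally show ?thesis .
qed


section \<open>Stars: edges through a common l-set, otherwise disjoint\<close>

definition blk :: "nat \<Rightarrow> nat \<Rightarrow> nat \<Rightarrow> nat set" where
  "blk l r i = {l + i * r <.. l + Suc i * r}"

definition star :: "nat \<Rightarrow> nat \<Rightarrow> nat \<Rightarrow> hgraph" where
  "star l r m = ({1..l + m * r}, (\<lambda>i. {1..l} \<union> blk l r i) ` {..<m})"

lemma blk_simps: "finite (blk l r i)" "card (blk l r i) = r" "{1..l} \<inter> blk l r i = {}"
  by (auto simp: blk_def)

lemma blk_disjoint: "disjoint_family_on (blk l r) S"
  unfolding disjoint_family_on_def
proof (intro ballI impI)
  have *: "blk l r i \<inter> blk l r j = {}" if "i < j" for i j
  proof -
    have "Suc i * r \<le> j * r" using that by (intro mult_right_mono) simp_all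
    then show ?thesis by (auto simp: blk_def)
  qed
  show "blk l r i \<inter> blk l r j = {}" if "i \<noteq> j" for i j
    using *[of i j] *[of j i] that by (cases "i < j") auto
qed

lemma blk_subset: "i < m \<Longrightarrow> {1..l} \<union> blk l r i \<subseteq> {1..l + m * r}"
proof -
  assume "i < m"
  then have "Suc i * r \<le> m * r" by (intro mult_right_mono) simp_all
  then show ?thesis by (auto simp: blk_def)
qed

lemma kgraph_star: "l < k \<Longrightarrow> kgraph k (star l (k - l) m)"
  using blk_subset[of _ m l "k - l"] blk_simps[of l "k - l"]
  by (auto simp: kgraph_def star_def card_Un_disjoint)

lemma inj_on_star:
  assumes "0 < r" shows "inj_on (\<lambda>i. {1..l} \<union> blk l r i) S"
proof (rule inj_onI)
  fix i j assume "{1..l} \<union> blk l r i = {1..l} \<union> blk l r j"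
  then have "blk l r i = blk l r j" using blk_simps(3)[of l r i] blk_simps(3)[of l r j] by blast
  moreover have "blk l r i \<noteq> {}" using assms blk_simps(2)[of l r i] by (metis card.empty less_numeral_extra(3))
  moreover have "blk l r i \<inter> blk l r j = {}" if "i \<noteq> j"
    using blk_disjoint[of l r UNIV] that by (simp add: disjoint_family_on_def)
  ultimately show "i = j" by auto
qed

text \<open>The edges of a star share exactly the coordinates of the subsets of the centre. Given
  these they are independent, and each is absent with conditional probability 1 - deg.\<close>

lemma star_moment_W:
  assumes W: "hypergraphon k W" and lk: "l < k"
  shows "(\<integral>x. (\<Prod>A\<in>edges (star l (k - l) m). 1 - W (pull k (enum A) x)) \<partial>cube (binom_le (verts (star l (k - l) m)) (k - 1)))
    = (\<integral>x. (1 - deg_W k l W x) ^ m \<partial>cube (rall {1..l}))"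
proof -
  let ?E = "\<lambda>i. {1..l} \<union> blk l (k - l) i" and ?L = "rall {1..l}" and ?I = "binom_le (verts (star l (k - l) m)) (k - 1)"
  let ?J = "\<lambda>i. rprop (?E i) - ?L"
  let ?g = "\<lambda>i x. 1 - W (pull k (enum (?E i)) x)"
  note uW = hypergraphon_unit_kernel[OF W]
  have edge: "?E i \<in> edges (star l (k - l) m)" if "i < m" for i using that by (auto simp: star_def)
  note e = kgraph_edgeD[OF kgraph_star[OF lk] edge]
  have rL: "?L \<subseteq> rprop (?E i)" for i
  proof
    fix S assume S: "S \<in> ?L"
    have "blk l (k - l) i \<noteq> {}" using blk_simps(2)[of l "k - l" i] lk by (metis card.empty zero_less_diff less_numeral_extra(3))
    then show "S \<in> rprop (?E i)" using S blk_simps(3)[of l "k - l" i] unfolding rall_def rprop_def by blast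
  qed
  have UJ: "?L \<union> ?J i = rprop (?E i)" for i using rL[of i] by blast
  have g_eq: "?g i (restrict x (?L \<union> ?J i)) = ?g i x" if "i < m" for i x
  proof -
    have "pull k (enum (?E i)) (restrict x (rprop (?E i))) = pull k (enum (?E i)) x"
      by (rule pull_cong) (use image_rprop[OF e(5)[OF that]] in simp)
    then show ?thesis unfolding UJ by simp
  qed
  have "(\<integral>x. (\<Prod>A\<in>edges (star l (k - l) m). 1 - W (pull k (enum A) x)) \<partial>cube ?I) =
     (\<integral>x. (\<Prod>i<m. ?g i x) \<partial>cube ?I)"
    unfolding star_def hgraph_simps by (subst prod.reindex[OF inj_on_star]) (use lk in simp_all)
  also have "\<dots> = (\<integral>x. (\<Prod>i<m. ?g i (restrict x (?L \<union> ?J i))) \<partial>cube ?I)"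
    by (rule Bochner_Integration.integral_cong[OF refl], rule prod.cong[OF refl]) (simp only: lessThan_iff g_eq)
  also have "\<dots> = (\<integral>x. (\<Prod>i<m. \<integral>y. ?g i (merge ?L (?J i) (x, y)) \<partial>PiM (?J i) (\<lambda>_. unit_interval)) \<partial>PiM ?L (\<lambda>_. unit_interval))"
    unfolding cube_def
  proof (rule integral_prod_fibres[OF prob_space_unit_interval])
    show "finite ?I" using kgraph_star[OF lk, of m] by (simp add: kgraph_def)
    show "?L \<subseteq> ?I"
    proof
      fix S assume S: "S \<in> ?L"
      then have "card S \<le> card {1..l}" by (intro card_mono) (auto simp: rall_def)
      then show "S \<in> ?I" using S lk unfolding rall_def binom_le_def star_def hgraph_simps by fastforce
    qed
    show "?J i \<subseteq> ?I \<and> ?L \<inter> ?J i = {}" if "i \<in> {..<m}" for i using e(6)[of i] that by blast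
    show "disjoint_family_on ?J {..<m}" unfolding disjoint_family_on_def
    proof (intro ballI impI)
      fix i j :: nat assume "i \<noteq> j"
      show "?J i \<inter> ?J j = {}"
      proof (rule ccontr)
        assume "?J i \<inter> ?J j \<noteq> {}"
        then obtain S where "S \<in> ?J i" "S \<in> ?J j" by blast
        then have "S \<subseteq> ?E i \<inter> ?E j" "S \<noteq> {}" "S \<notin> ?L" by (auto simp: rprop_def)
        moreover have "?E i \<inter> ?E j \<subseteq> {1..l}" using blk_disjoint[of l "k - l" UNIV] \<open>i \<noteq> j\<close> unfolding disjoint_family_on_def by blast
        ultimately show False unfolding rall_def by blast
      qed
    qed
    show "?g i \<in> borel_measurable (PiM (?L \<union> ?J i) (\<lambda>_. unit_interval))" if "i \<in> {..<m}" for i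
      using unit_kernel_pull(1)[OF uW e(5), of i "?L \<union> ?J i"] that UJ unfolding cube_def by simp
    show "0 \<le> ?g i x \<and> ?g i x \<le> 1" if "i \<in> {..<m}" "x \<in> space (PiM (?L \<union> ?J i) (\<lambda>_. unit_interval))" for i x
      using unit_kernel_pull(2)[OF uW e(5), of i "?L \<union> ?J i" x] that UJ unfolding cube_def by simp
  qed simp
  also have "\<dots> = (\<integral>x. (1 - deg_W k l W x) ^ m \<partial>PiM ?L (\<lambda>_. unit_interval))"
  proof (rule Bochner_Integration.integral_cong[OF refl])
    fix x assume "x \<in> space (PiM ?L (\<lambda>_. unit_interval))"
    then have x: "x \<in> space (cube ?L)" unfolding cube_def .
    \<comment> \<open>The centre is already [l], so the reindexing that occurs in
      \<open>deg_W_fibre\<close> is the identity here.\<close>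
    have ex: "(\<lambda>S\<in>?L. x (enum {1..l} ` S)) = x"
    proof
      fix S
      have "enum {1..l} ` S = S" if "S \<subseteq> {1..l}"
      proof -
        have "enum {1..l} ` S = (\<lambda>i. i) ` S" by (rule image_cong[OF refl enum_atLeastAtMost]) (use that in blast)
        then show ?thesis by simp
      qed
      then show "(\<lambda>S\<in>?L. x (enum {1..l} ` S)) S = x S"
        using x by (cases "S \<in> ?L") (auto simp: rall_def space_cube PiE_iff extensional_def)
    qed
    have "(\<integral>y. ?g i (merge ?L (?J i) (x, y)) \<partial>PiM (?J i) (\<lambda>_. unit_interval)) = 1 - deg_W k l W x" if "i < m" for i
    proof -
      have x': "merge ?L (?J i) (x, y) \<in> space (cube (rprop (?E i)))" if "y \<in> space (cube (?J i))" for y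
        using merge_space_PiM[OF x[unfolded cube_def] that[unfolded cube_def]] unfolding UJ cube_def .
      have "(\<lambda>y. merge ?L (?J i) (x, y)) \<in> measurable (cube (?J i)) (cube (rprop (?E i)))"
        using measurable_compose[OF measurable_Pair1'[OF x] measurable_merge[of ?L "?J i" "\<lambda>_. unit_interval", folded cube_def]]
        unfolding UJ .
      from measurable_compose[OF this unit_kernel_pull(1)[OF uW e(5)[OF that] subset_refl]]
      have int: "integrable (cube (?J i)) (\<lambda>y. W (pull k (enum (?E i)) (merge ?L (?J i) (x, y))))"
        by (rule prob_space.integrable_unit[OF prob_space_cube])
           (rule unit_kernel_pull(2)[OF uW e(5)[OF that] subset_refl x'])
      have "(\<integral>y. W (pull k (enum (?E i)) (merge ?L (?J i) (x, y))) \<partial>cube (?J i)) = deg_W k l W x"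
        using deg_W_fibre[OF W lk _ _ blk_simps x] unfolding ex by simp
      then show ?thesis
        using prob_space.integral_one_minus[OF prob_space_cube int] unfolding cube_def[symmetric] by simp
    qed
    then show "(\<Prod>i<m. \<integral>y. ?g i (merge ?L (?J i) (x, y)) \<partial>PiM (?J i) (\<lambda>_. unit_interval)) = (1 - deg_W k l W x) ^ m"
      by simp
  qed
  finally show ?thesis unfolding cube_def .
qed

text \<open>Each edge through \<open>S\<close> is completed by (k - l)! bijections from
  \<open>B\<close> onto its remaining vertices, and such a map determines its edge.\<close>

lemma card_extensions_ge:
  assumes V: "finite V" and E: "\<And>e. e \<in> E \<Longrightarrow> e \<subseteq> V \<and> card e = k" and S: "card S = l" "finite S"
    and B: "finite B" "card B = k - l" 
  shows "fact (k - l) * card {e \<in> E. S \<subseteq> e} \<le> card {\<psi> \<in> B \<rightarrow>\<^sub>E V. S \<union> \<psi> ` B \<in> E}"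
proof -
  let ?D = "{e \<in> E. S \<subseteq> e}"
  let ?T = "{\<psi> \<in> B \<rightarrow>\<^sub>E V. S \<union> \<psi> ` B \<in> E}"
  have fE: "finite e" if "e \<in> E" for e using E[OF that] V finite_subset by blast
  have fD: "finite ?D" by (rule finite_subset[of _ "Pow V"]) (use E V in auto)
  have cD: "card (e - S) = k - l" if "e \<in> ?D" for e
    using card_Diff_subset[OF S(2), of e] that E S by auto
  have "\<exists>f. bij_betw f B (e - S)" if "e \<in> ?D" for e
    using finite_same_card_bij[OF B(1), of "e - S"] cD[OF that] fE that B(2) by auto
  then obtain \<psi> where \<psi>: "\<And>e. e \<in> ?D \<Longrightarrow> bij_betw (\<psi> e) B (e - S)" by metis
  let ?h = "\<lambda>(e, p). restrict (p \<circ> \<psi> e) B"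
  have img: "?h (e, p) ` B = e - S" if "e \<in> ?D" "p permutes (e - S)" for e p
  proof -
    have "?h (e, p) ` B = p ` \<psi> e ` B" by (auto simp: image_image)
    also have "\<dots> = e - S" using \<psi>[OF that(1)] permutes_image[OF that(2)] by (simp add: bij_betw_def)
    finally show ?thesis .
  qed
  have "inj_on ?h (Sigma ?D (\<lambda>e. {p. p permutes (e - S)}))"
  proof (rule inj_onI, safe)
    fix e p e' p' assume *: "e \<in> E" "S \<subseteq> e" "p permutes (e - S)" "e' \<in> E" "S \<subseteq> e'" "p' permutes (e' - S)"
      and eq: "restrict (p \<circ> \<psi> e) B = restrict (p' \<circ> \<psi> e') B"
    have "e - S = e' - S" using img[of e p] img[of e' p'] * eq by simp
    then have ee: "e = e'" using *(2,5) by blast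
    then show "x \<in> e'" if "x \<in> e" for x using that by simp
    show "x \<in> e" if "x \<in> e'" for x using ee that by simp
    show "p = p'"
    proof
      fix x
      show "p x = p' x"
      proof (cases "x \<in> e - S")
        case True
        then have "x \<in> \<psi> e ` B" using \<psi>[of e] * by (simp add: bij_betw_def)
        then obtain b where "b \<in> B" "x = \<psi> e b" by blast
        then show ?thesis using fun_cong[OF eq, of b] ee by simp
      next
        case False
        then show ?thesis using *(3,6) ee by (simp add: permutes_def)
      qed
    qed
  qed
  moreover have "?h ` (Sigma ?D (\<lambda>e. {p. p permutes (e - S)})) \<subseteq> ?T"
  proof
    fix f assume "f \<in> ?h ` (Sigma ?D (\<lambda>e. {p. p permutes (e - S)}))"
    then obtain e p where *: "e \<in> E" "S \<subseteq> e" "p permutes (e - S)" and f: "f = restrict (p \<circ> \<psi> e) B" by auto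
    have i: "restrict (p \<circ> \<psi> e) B ` B = e - S" using img[of e p] * by simp
    have "(p \<circ> \<psi> e) b \<in> V" if "b \<in> B" for b
    proof -
      have "restrict (p \<circ> \<psi> e) B b \<in> e - S" using i that by blast
      then show ?thesis using E[OF *(1)] that by auto
    qed
    then have "restrict (p \<circ> \<psi> e) B \<in> B \<rightarrow>\<^sub>E V" unfolding restrict_PiE_iff by blast
    moreover have "S \<union> restrict (p \<circ> \<psi> e) B ` B \<in> E" unfolding i using * by (simp add: Un_absorb1)
    ultimately show "f \<in> ?T" unfolding f by blast
  qed
  moreover have "finite ?T" using finite_PiE[OF B(1), of "\<lambda>_. V"] V by simp
  ultimately have "card (Sigma ?D (\<lambda>e. {p. p permutes (e - S)})) \<le> card ?T"
    by (rule card_inj_on_le)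
  moreover have "card (Sigma ?D (\<lambda>e. {p. p permutes (e - S)})) = (\<Sum>e\<in>?D. card {p. p permutes (e - S)})"
    by (rule card_SigmaI[OF fD]) (use fE in \<open>auto intro!: finite_permutations finite_Diff\<close>)
  moreover have "(\<Sum>e\<in>?D. card {p. p permutes (e - S)}) = (\<Sum>e\<in>?D. fact (k - l))"
    by (rule sum.cong[OF refl], rule card_permutations) (use cD fE in auto)
  ultimately show ?thesis by (simp add: mult.commute)
qed

lemma min_deg_le:
  assumes "finite (verts G)" "S \<subseteq> verts G" "card S = l" shows "min_deg l G \<le> deg G S"
proof -
  have "{deg G L |L. L \<subseteq> verts G \<and> card L = l} \<subseteq> deg G ` Pow (verts G)" by auto
  then have "finite {deg G L |L. L \<subseteq> verts G \<and> card L = l}" using assms(1) by (meson finite_Pow_iff finite_imageI finite_subset)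
  then show ?thesis unfolding min_deg_def by (rule Min_le) (use assms in auto)
qed

text \<open>If the centre is mapped injectively, its image has at least the minimum degree, so each
  block yields a non-edge with conditional probability at most 1 - q. The other maps of the centre
  have probability at most l^2 / n and contribute at most 1 each.\<close>

lemma star_moment_graph:
  assumes G: "kgraph k G" "verts G \<noteq> {}" and lk: "l < k"
  defines "n \<equiv> card (verts G)"
  defines "q \<equiv> fact (k - l) * real (min_deg l G) / real n ^ (k - l)"
  assumes q1: "q \<le> 1"
  shows "(\<integral>\<phi>. (\<Prod>e\<in>edges (star l (k - l) m). 1 - of_bool (\<phi> ` e \<in> edges G)) \<partial>PiM (verts (star l (k - l) m)) (\<lambda>_. uniform_count_measure (verts G)))
    \<le> (1 - q) ^ m + (real l)\<^sup>2 / n"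
proof -
  have fV: "finite (verts G)" using G by (simp add: kgraph_def)
  let ?E = "\<lambda>i. {1..l} \<union> blk l (k - l) i" and ?I = "verts (star l (k - l) m)"
  let ?U = "uniform_count_measure (verts G)"
  let ?g = "\<lambda>i \<phi>. 1 - of_bool (\<phi> ` ?E i \<in> edges G) :: real"
  have pU: "prob_space ?U" by (rule prob_space_uniform_count_measure[OF fV G(2)])
  have pP: "prob_space (PiM J (\<lambda>_. ?U))" for J :: "nat set" by (intro prob_space_PiM pU)
  note m = borel_measurable_PiM_uniform[OF _ fV G(2)]
  have b: "0 \<le> ?g i \<phi> \<and> ?g i \<phi> \<le> 1" for i \<phi> by simp
  let ?q = "\<lambda>i x. \<integral>y. ?g i (merge {1..l} (blk l (k - l) i) (x, y)) \<partial>PiM (blk l (k - l) i) (\<lambda>_. ?U)"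
  have qb: "0 \<le> ?q i x \<and> ?q i x \<le> 1" for i x
    by (rule prob_space.integral_unit[OF pP m[OF blk_simps(1)] b])
  have "(\<integral>\<phi>. (\<Prod>e\<in>edges (star l (k - l) m). 1 - of_bool (\<phi> ` e \<in> edges G)) \<partial>PiM ?I (\<lambda>_. ?U)) = 
     (\<integral>\<phi>. (\<Prod>i<m. ?g i \<phi>) \<partial>PiM ?I (\<lambda>_. ?U))"
    unfolding star_def hgraph_simps by (subst prod.reindex[OF inj_on_star]) (use lk in simp_all)
  also have "\<dots> = (\<integral>\<phi>. (\<Prod>i<m. ?g i (restrict \<phi> (?E i))) \<partial>PiM ?I (\<lambda>_. ?U))"
    by (simp only: image_restrict_eq)
  also have "\<dots> = (\<integral>x. (\<Prod>i<m. ?q i x) \<partial>PiM {1..l} (\<lambda>_. ?U))"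
  proof (rule integral_prod_fibres[OF pU])
    show "finite ?I" "{1..l} \<subseteq> ?I" by (auto simp: star_def)
    show "blk l (k - l) i \<subseteq> ?I \<and> {1..l} \<inter> blk l (k - l) i = {}" if "i \<in> {..<m}" for i
      using blk_subset[of i m l "k - l"] blk_simps(3)[of l "k - l" i] that by (auto simp: star_def)
    show "?g i \<in> borel_measurable (PiM (?E i) (\<lambda>_. ?U))" for i by (rule m) (simp add: blk_simps)
  qed (simp_all only: b blk_disjoint finite_lessThan)
  also have "\<dots> \<le> (\<integral>x. (1 - q) ^ m + of_bool (\<not> inj_on x {1..l}) \<partial>PiM {1..l} (\<lambda>_. ?U))"
  proof (rule integral_mono)
    show "integrable (PiM {1..l} (\<lambda>_. ?U)) (\<lambda>x. \<Prod>i<m. ?q i x)"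
      by (rule prob_space.integrable_unit[OF pP m]) (simp, rule prod_unit, rule qb)
    show "integrable (PiM {1..l} (\<lambda>_. ?U)) (\<lambda>x. (1 - q) ^ m + of_bool (\<not> inj_on x {1..l}))"
      by (intro Bochner_Integration.integrable_add prob_space.integrable_unit[OF pP m] finite_measure.integrable_const
          prob_space.finite_measure pP) auto
    fix x assume "x \<in> space (PiM {1..l} (\<lambda>_. ?U))"
    then have xV: "x ` {1..l} \<subseteq> verts G" by (auto simp: space_PiM space_uniform_count_measure)
    show "(\<Prod>i<m. ?q i x) \<le> (1 - q) ^ m + of_bool (\<not> inj_on x {1..l})"
    proof (cases "inj_on x {1..l}")
      case False
      have "(\<Prod>i<m. ?q i x) \<le> 1" using prod_unit[of "{..<m}" "\<lambda>i. ?q i x"] qb by blast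
      then show ?thesis using False q1 by (simp add: add_increasing)
    next
      case True
      let ?S = "x ` {1..l}"
      have cS: "card ?S = l" using card_image[OF True] by simp
      have "?q i x \<le> 1 - q" for i
      proof -
        let ?B = "blk l (k - l) i"
        have fin: "finite (?B \<rightarrow>\<^sub>E verts G)" using fV by (simp add: finite_PiE blk_simps)
        have im: "merge {1..l} ?B (x, y) ` ?E i = ?S \<union> y ` ?B" for y
        proof -
          have "merge {1..l} ?B (x, y) ` {1..l} = ?S" by (rule image_cong) (auto simp: merge_def)
          moreover have "merge {1..l} ?B (x, y) ` ?B = y ` ?B"
            by (rule image_cong[OF refl]) (use blk_simps(3)[of l "k - l" i] in \<open>auto simp: merge_def\<close>)
          ultimately show ?thesis by (simp only: image_Un)
        qed
        have "?q i x = 1 - (\<integral>y. of_bool (?S \<union> y ` ?B \<in> edges G) \<partial>PiM ?B (\<lambda>_. ?U))"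
          unfolding im
          by (rule prob_space.integral_one_minus[OF pP prob_space.integrable_unit[OF pP m[OF blk_simps(1)]]]) simp
        also have "(\<integral>y. of_bool (?S \<union> y ` ?B \<in> edges G) \<partial>PiM ?B (\<lambda>_. ?U)) = 
           (\<Sum>y\<in>?B \<rightarrow>\<^sub>E verts G. of_bool (?S \<union> y ` ?B \<in> edges G)) / real (card (?B \<rightarrow>\<^sub>E verts G))"
          unfolding PiM_uniform[OF blk_simps(1) fV G(2)] by (rule integral_uniform_count_measure[OF fin])
        also have "(\<Sum>y\<in>?B \<rightarrow>\<^sub>E verts G. of_bool (?S \<union> y ` ?B \<in> edges G)) = real (card {y \<in> ?B \<rightarrow>\<^sub>E verts G. ?S \<union> y ` ?B \<in> edges G})"
          using fin by (simp add: of_bool_def sum.If_cases Int_def)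
        also have "card (?B \<rightarrow>\<^sub>E verts G) = n ^ (k - l)" by (simp add: card_PiE blk_simps n_def)
        finally have qe: "?q i x = 1 - real (card {y \<in> ?B \<rightarrow>\<^sub>E verts G. ?S \<union> y ` ?B \<in> edges G}) / real (n ^ (k - l))" .
        have "fact (k - l) * min_deg l G \<le> fact (k - l) * deg G ?S"
          by (intro mult_left_mono min_deg_le[OF fV xV cS]) simp
        also have "\<dots> \<le> card {y \<in> ?B \<rightarrow>\<^sub>E verts G. ?S \<union> y ` ?B \<in> edges G}"
          unfolding deg_def by (rule card_extensions_ge[OF fV _ cS _ blk_simps(1,2)]) (use G(1) in \<open>auto simp: kgraph_def\<close>)
        finally have "real (fact (k - l) * min_deg l G) \<le> real (card {y \<in> ?B \<rightarrow>\<^sub>E verts G. ?S \<union> y ` ?B \<in> edges G})"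
          by (simp only: of_nat_le_iff)
        then have "q \<le> real (card {y \<in> ?B \<rightarrow>\<^sub>E verts G. ?S \<union> y ` ?B \<in> edges G}) / real (n ^ (k - l))"
          unfolding q_def by (simp add: divide_right_mono)
        then show ?thesis using qe by linarith
      qed
      then have "(\<Prod>i<m. ?q i x) \<le> (\<Prod>i<m. 1 - q)" by (intro prod_mono conjI) (use qb in blast)+
      then show ?thesis using True by simp
    qed
  qed
  also have "\<dots> = (1 - q) ^ m + (\<integral>x. of_bool (\<not> inj_on x {1..l}) \<partial>PiM {1..l} (\<lambda>_. ?U))"
    by (subst Bochner_Integration.integral_add)
       (auto intro!: prob_space.integrable_unit[OF pP m] finite_measure.integrable_const prob_space.finite_measure pP
         simp: prob_space.prob_space[OF pP])
  also have "\<dots> \<le> (1 - q) ^ m + (real l)\<^sup>2 / n"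
    using noninj_uniform[of "{1..l}", OF _ fV G(2)] by (simp add: n_def)
  finally show ?thesis .
qed

text \<open>Changes the normalisation: the star bound counts extending maps relative to N^(k-l), the
  degree density counts extending sets relative to a binomial coefficient.\<close>

lemma falling_ratio_tendsto: "(\<lambda>N. fact r * real ((N - l) choose r) / real N ^ r) \<longlonglongrightarrow> 1"
proof (rule Lim_transform_eventually)
  have "(\<lambda>N. (real N - c) / real N) \<longlonglongrightarrow> 1" for c
  proof (rule Lim_transform_eventually)
    show "(\<lambda>N. 1 - c / real N) \<longlonglongrightarrow> 1"
      using tendsto_diff[OF tendsto_const lim_const_over_n, of 1 c] by simp
    show "\<forall>\<^sub>F N in sequentially. 1 - c / real N = (real N - c) / real N"
      using eventually_gt_at_top[of 0] by (rule eventually_mono) (simp add: diff_divide_distrib)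
  qed
  then have "(\<lambda>N. \<Prod>i<r. (real N - real (l + i)) / real N) \<longlonglongrightarrow> (\<Prod>i<r. 1)" by (intro tendsto_prod)
  then show "(\<lambda>N. \<Prod>i<r. (real N - real (l + i)) / real N) \<longlonglongrightarrow> 1" by simp
  show "\<forall>\<^sub>F N in sequentially. (\<Prod>i<r. (real N - real (l + i)) / real N) = fact r * real ((N - l) choose r) / real N ^ r"
    using eventually_ge_at_top[of l]
  proof (rule eventually_mono)
    fix N assume N: "l \<le> N"
    have "real ((N - l) choose r) = real (N - l) gchoose r" by (rule binomial_gbinomial)
    also have "\<dots> = (\<Prod>i=0..<r. real (N - l) - real i) / fact r" by (rule gbinomial_prod_rev)
    also have "(\<Prod>i=0..<r. real (N - l) - real i) = (\<Prod>i<r. real N - real (l + i))"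
      unfolding atLeast0LessThan using N by (intro prod.cong) (auto simp: of_nat_diff)
    finally show "(\<Prod>i<r. (real N - real (l + i)) / real N) = fact r * real ((N - l) choose r) / real N ^ r"
      by (simp add: prod_dividef)
  qed
qed

text \<open>If D < c < a on a set of measure p, then p (1 - c)^m \<le> (1 - a)^m for every m, which
  forces p = 0.\<close>

lemma AE_ge_of_moments:
  assumes M: "prob_space M" and D: "D \<in> borel_measurable M" "\<And>x. x \<in> space M \<Longrightarrow> 0 \<le> D x \<and> D x \<le> 1"
    and a: "a \<le> (1::real)" and mom: "\<And>m::nat. (\<integral>x. (1 - D x) ^ m \<partial>M) \<le> (1 - a) ^ m"
  shows "AE x in M. a \<le> D x"
proof -
  interpret prob_space M by fact
  have *: "AE x in M. c \<le> D x" if c: "c < a" for c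
  proof -
    let ?A = "{x \<in> space M. D x < c}"
    have A: "?A \<in> sets M" using D(1) by measurable
    have le: "prob ?A * (1 - c) ^ m \<le> (1 - a) ^ m" for m
    proof -
      have "prob ?A * (1 - c) ^ m = (\<integral>x. indicator ?A x * (1 - c) ^ m \<partial>M)" using A by simp
      also have "\<dots> \<le> (\<integral>x. (1 - D x) ^ m \<partial>M)"
      proof (rule integral_mono)
        have "integrable M (indicator ?A :: 'a \<Rightarrow> real)" by (rule integrable_unit) (use A in auto)
        then show "integrable M (\<lambda>x. indicator ?A x * (1 - c) ^ m)" by (rule integrable_mult_left)
        show "integrable M (\<lambda>x. (1 - D x) ^ m)"
          by (rule integrable_unit) (use D in \<open>auto intro!: power_le_one\<close>)
        show "indicator ?A x * (1 - c) ^ m \<le> (1 - D x) ^ m" if "x \<in> space M" for x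
          using D(2)[OF that] c a by (cases "x \<in> ?A") (auto intro!: power_mono)
      qed
      also have "\<dots> \<le> (1 - a) ^ m" by (rule mom)
      finally show ?thesis .
    qed
    have "prob ?A \<le> ((1 - a) / (1 - c)) ^ m" for m
      using le[of m] c a by (simp add: power_divide pos_le_divide_eq)
    moreover have "(\<lambda>m. ((1 - a) / (1 - c)) ^ m) \<longlonglongrightarrow> 0"
      by (rule LIMSEQ_realpow_zero) (use c a in \<open>auto simp: divide_simps\<close>)
    ultimately have "prob ?A \<le> 0" by (intro LIMSEQ_le_const) auto
    then have "prob ?A = 0" by (simp add: measure_le_0_iff)
    then show ?thesis using A by (subst AE_iff_measurable[where N = ?A]) (auto simp: emeasure_eq_measure not_le)
  qed
  have "AE x in M. \<forall>j::nat. a - 1 / Suc j \<le> D x" unfolding AE_all_countable by (intro allI *) simp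
  then show ?thesis
  proof (rule AE_mp, intro AE_I2 impI)
    fix x assume h: "\<forall>j::nat. a - 1 / Suc j \<le> D x"
    have "(\<lambda>j. a - 1 / Suc j) \<longlonglongrightarrow> a - 0" by (intro tendsto_diff tendsto_const LIMSEQ_Suc[OF lim_1_over_n])
    then show "a \<le> D x" using h by (intro LIMSEQ_le_const2[of _ "a - 0" "D x", simplified]) auto
  qed
qed

text \<open>A real supremum needs a bound: an admissible level is at most 1, because
  \<open>deg_W\<close> is and the cube is a probability space.\<close>

lemma delta_W_ge:
  assumes "unit_kernel k W" "l < k" "AE x in cube (rall {1..l}). a \<le> deg_W k l W x"
  shows "a \<le> delta_W k l W"
  unfolding delta_W_def
proof (rule cSup_upper)
  show "bdd_above {c. AE x in cube (rall {1..l}). c \<le> deg_W k l W x}"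
  proof (rule bdd_aboveI)
    fix c assume "c \<in> {c. AE x in cube (rall {1..l}). c \<le> deg_W k l W x}"
    then have "AE x in cube (rall {1..l}). c \<le> deg_W k l W x" by simp
    then have "AE x in cube (rall {1..l}). c \<le> 1"
    proof (rule AE_mp, intro AE_I2 impI)
      fix x assume "x \<in> space (cube (rall {1..l}))" "c \<le> deg_W k l W x"
      then show "c \<le> 1" using deg_W_unit[OF assms(1,2)] order_trans by blast
    qed
    then show "c \<le> 1" by (simp add: prob_space.AE_const[OF prob_space_cube])
  qed
qed (use assms in simp)

text \<open>The supremum is itself an essential lower bound, since countably many admissible levels
  approach it.\<close>

lemma AE_delta_W_le:
  assumes "unit_kernel k W" "l < k"
  shows "AE x in cube (rall {1..l}). delta_W k l W \<le> deg_W k l W x"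
proof -
  let ?S = "{c. AE x in cube (rall {1..l}). c \<le> deg_W k l W x}"
  have "(0::real) \<in> ?S" using deg_W_unit[OF assms] by (auto intro!: AE_I2)
  then have ne: "?S \<noteq> {}" by blast
  have ex: "\<exists>c\<in>?S. delta_W k l W - 1 / Suc j < c" for j :: nat
    unfolding delta_W_def by (rule less_cSupD[OF ne]) simp
  have "AE x in cube (rall {1..l}). delta_W k l W - 1 / Suc j \<le> deg_W k l W x" for j :: nat
  proof -
    obtain c where "c \<in> ?S" "delta_W k l W - 1 / Suc j < c" using ex by blast
    then show ?thesis by (auto elim!: eventually_mono)
  qed
  then have "AE x in cube (rall {1..l}). \<forall>j::nat. delta_W k l W - 1 / Suc j \<le> deg_W k l W x"
    unfolding AE_all_countable by blast
  then show ?thesis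
  proof (rule AE_mp, intro AE_I2 impI)
    fix x assume h: "\<forall>j::nat. delta_W k l W - 1 / Suc j \<le> deg_W k l W x"
    have "(\<lambda>j. delta_W k l W - 1 / Suc j) \<longlonglongrightarrow> delta_W k l W - 0" by (intro tendsto_diff tendsto_const LIMSEQ_Suc[OF lim_1_over_n])
    then show "delta_W k l W \<le> deg_W k l W x" using h by (intro LIMSEQ_le_const2[of _ "delta_W k l W - 0" "deg_W k l W x", simplified]) auto
  qed
qed

lemma delta_W_limit_ge:
  assumes W: "hypergraphon k W" and lk: "l < k" and conv: "converges_to k G W"
    and G: "\<And>n. kgraph k (G n)" and card: "filterlim (\<lambda>n. card (verts (G n))) at_top sequentially"
    and deg: "(\<lambda>n. real (min_deg l (G n)) / real ((card (verts (G n)) - l) choose (k - l))) \<longlonglongrightarrow> a" and a1: "a \<le> 1"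
  shows "a \<le> delta_W k l W"
proof -
  note uW = hypergraphon_unit_kernel[OF W]
  define N where "N n = card (verts (G n))" for n
  define q where "q n = fact (k - l) * real (min_deg l (G n)) / real (N n) ^ (k - l)" for n
  have fin: "finite (verts (G n))" for n using G[of n] by (simp add: kgraph_def)
  have big: "\<forall>\<^sub>F n in sequentially. k \<le> N n" using card[unfolded filterlim_at_top] unfolding N_def by blast
  have lim: "(\<lambda>n. real (min_deg l (G n)) / real ((N n - l) choose (k - l)) * (fact (k - l) * real ((N n - l) choose (k - l)) / real (N n) ^ (k - l))) \<longlonglongrightarrow> a"
    using tendsto_mult[OF deg[folded N_def] filterlim_compose[OF falling_ratio_tendsto card[folded N_def]]]
    unfolding mult_1_right .
  have qa: "q \<longlonglongrightarrow> a"
  proof (rule Lim_transform_eventually[OF lim])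
    show "\<forall>\<^sub>F n in sequentially. real (min_deg l (G n)) / real ((N n - l) choose (k - l)) * (fact (k - l) * real ((N n - l) choose (k - l)) / real (N n) ^ (k - l)) = q n"
      using big
    proof (rule eventually_mono)
      fix n assume "k \<le> N n"
      then have "(N n - l) choose (k - l) \<noteq> 0" using lk by (simp add: binomial_eq_0_iff)
      then show "real (min_deg l (G n)) / real ((N n - l) choose (k - l)) * (fact (k - l) * real ((N n - l) choose (k - l)) / real (N n) ^ (k - l)) = q n"
        unfolding q_def by (simp add: field_simps)
    qed
  qed
  have mom: "(\<integral>x. (1 - deg_W k l W x) ^ m \<partial>cube (rall {1..l})) \<le> (1 - a) ^ m" for m
  proof -
    let ?F = "star l (k - l) m"
    let ?I = "\<lambda>n. \<integral>\<phi>. (\<Prod>e\<in>edges ?F. 1 - of_bool (\<phi> ` e \<in> edges (G n))) \<partial>PiM (verts ?F) (\<lambda>_. uniform_count_measure (verts (G n))) :: real"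
    have l1: "?I \<longlonglongrightarrow> (\<integral>x. (1 - deg_W k l W x) ^ m \<partial>cube (rall {1..l}))"
      using converges_to_none[OF conv uW kgraph_star[OF lk] fin card, of m] unfolding star_moment_W[OF W lk] .
    have l2: "(\<lambda>n. (1 - min (q n) 1) ^ m + (real l)\<^sup>2 / real (N n)) \<longlonglongrightarrow> (1 - min a 1) ^ m + 0"
      by (intro tendsto_intros qa tendsto_divide_0[OF tendsto_const filterlim_at_top_imp_at_infinity])
         (use filterlim_compose[OF filterlim_real_sequentially card] in \<open>simp add: N_def\<close>)
    have ev: "\<forall>\<^sub>F n in sequentially. ?I n \<le> (1 - min (q n) 1) ^ m + (real l)\<^sup>2 / real (N n)"
      using big
    proof (rule eventually_mono)
      fix n assume n: "k \<le> N n"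
      then have ne: "verts (G n) \<noteq> {}" using lk by (auto simp: N_def)
      show "?I n \<le> (1 - min (q n) 1) ^ m + (real l)\<^sup>2 / real (N n)"
      proof (cases "q n \<le> 1")
        case True
        then show ?thesis using star_moment_graph[OF G ne lk, of m] unfolding q_def N_def by simp
      next
        case False
        \<comment> \<open>The extensions of one l-set are maps from a (k-l)-set to the vertices, so
          there are at most N^(k-l) of them.\<close>
        have "q n \<le> 1"
        proof -
          have "l \<le> card (verts (G n))" using n lk by (simp add: N_def)
          then obtain S where S: "S \<subseteq> verts (G n)" "card S = l" by (meson obtain_subset_with_card_n)
          have fS: "finite S" using S fin finite_subset by blast
          have "fact (k - l) * min_deg l (G n) \<le> fact (k - l) * deg (G n) S"
            by (intro mult_left_mono min_deg_le[OF fin S]) simp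
          also have "\<dots> \<le> card {\<psi> \<in> {1..k - l} \<rightarrow>\<^sub>E verts (G n). S \<union> \<psi> ` {1..k - l} \<in> edges (G n)}"
            unfolding deg_def by (rule card_extensions_ge[OF fin _ S(2) fS]) (use G[of n] in \<open>auto simp: kgraph_def\<close>)
          also have "\<dots> \<le> card ({1..k - l} \<rightarrow>\<^sub>E verts (G n))" by (rule card_mono) (use fin in \<open>auto simp: finite_PiE\<close>)
          also have "\<dots> = N n ^ (k - l)" by (simp add: card_PiE N_def)
          finally have "real (fact (k - l) * min_deg l (G n)) \<le> real (N n ^ (k - l))" by (simp only: of_nat_le_iff)
          then show ?thesis unfolding q_def using n lk by (simp add: divide_simps)
        qed
        with False show ?thesis by simp
      qed
    qed
    from tendsto_le[OF sequentially_bot l2 l1 ev] show ?thesis using a1 by simp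
  qed
  show ?thesis
    by (rule delta_W_ge[OF uW lk AE_ge_of_moments[OF prob_space_cube deg_W_measurable[OF uW lk] deg_W_unit[OF uW lk] a1 mom]])
qed

subsection \<open>Bit sequences\<close>

text \<open>The ternary embedding of bit sequences. The gaps of the Cantor set are what allows the
  digits to be read by continuous functions.\<close>

definition cantor :: "(nat \<Rightarrow> bool) \<Rightarrow> real" where
  "cantor b = (\<Sum>n. 2 * of_bool (b n) / 3 ^ Suc n)"

text \<open>It is 0 up to 1/3 and 1 from 2/3 on, hence the first digit on the Cantor set; it is
  continuous on the whole line, as weak convergence requires.\<close>

definition cut :: "real \<Rightarrow> real" where "cut z = max 0 (min 1 (3 * z - 1))"

text \<open>On the Cantor set this removes the first digit.\<close>

definition cshift :: "real \<Rightarrow> real" where "cshift z = 3 * z - 2 * cut z"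

definition digit :: "nat \<Rightarrow> real \<Rightarrow> real" where "digit n z = cut ((cshift ^^ n) z)"

lemma sums_two_thirds: "(\<lambda>n. 2 / 3 ^ Suc n :: real) sums 1"
  using sums_mult[OF geometric_sums[of "1/3 :: real"], of "2/3"] by (simp add: power_divide)

lemma summable_cantor: "summable (\<lambda>n. 2 * of_bool (b n) / 3 ^ Suc n :: real)"
  by (rule summable_comparison_test'[OF sums_summable[OF sums_two_thirds], of 0]) (auto simp: of_bool_def)

lemma cantor_bounds: "0 \<le> cantor b" "cantor b \<le> 1"
proof -
  show "0 \<le> cantor b" unfolding cantor_def by (rule suminf_nonneg[OF summable_cantor]) simp
  have "cantor b \<le> (\<Sum>n. 2 / 3 ^ Suc n)"
    unfolding cantor_def by (rule suminf_le[OF _ summable_cantor sums_summable[OF sums_two_thirds]]) (auto simp: of_bool_def)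
  then show "cantor b \<le> 1" using sums_unique[OF sums_two_thirds] by simp
qed

lemma cantor_Suc: "cantor b = 2 / 3 * of_bool (b 0) + cantor (\<lambda>n. b (Suc n)) / 3"
proof -
  have "(\<Sum>n. 2 * of_bool (b (Suc n)) / 3 ^ Suc (Suc n)) = (cantor b - 2 * of_bool (b 0) / 3 ^ Suc 0 :: real)"
    unfolding cantor_def by (rule suminf_split_head[OF summable_cantor])
  moreover have "(\<Sum>n. 2 * of_bool (b (Suc n)) / 3 ^ Suc (Suc n)) = cantor (\<lambda>n. b (Suc n)) / 3"
    unfolding cantor_def suminf_divide[OF summable_cantor, symmetric] by (simp add: field_simps)
  ultimately show ?thesis by simp
qed

lemma cut_cantor: "cut (cantor b) = of_bool (b 0)"
  using cantor_Suc[of b] cantor_bounds[of "\<lambda>n. b (Suc n)"] by (cases "b 0") (auto simp: cut_def)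

lemma cshift_cantor: "cshift (cantor b) = cantor (\<lambda>n. b (Suc n))"
  unfolding cshift_def cut_cantor using cantor_Suc[of b] by simp

lemma digit_cantor: "digit n (cantor b) = of_bool (b n)"
proof -
  have "(cshift ^^ n) (cantor b) = cantor (\<lambda>m. b (m + n))"
    by (induction n) (simp_all add: cshift_cantor)
  then show ?thesis by (simp add: digit_def cut_cantor)
qed

lemma digit_unit: "0 \<le> digit n z \<and> digit n z \<le> 1"
  by (simp add: digit_def cut_def)

lemma continuous_digit: "continuous_on UNIV (digit n)"
proof -
  have c: "continuous_on A cut" for A unfolding cut_def by (intro continuous_intros)
  have s: "continuous_on A cshift" for A unfolding cshift_def by (intro continuous_intros c)
  have "continuous_on UNIV (cshift ^^ n)"
  proof (induction n)
    case (Suc n)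
    show ?case unfolding funpow.simps(2) by (rule continuous_on_compose[OF Suc s])
  qed (simp add: continuous_on_id)
  then have "continuous_on UNIV (\<lambda>z. cut ((cshift ^^ n) z))" using continuous_on_compose[OF _ c] by (simp add: comp_def)
  then show ?thesis unfolding digit_def .
qed

text \<open>A left inverse of \<open>cantor\<close> that is total and measurable on the reals. On
  the Cantor set \<open>digit\<close> is 0 or 1, and the threshold separates the two values.\<close>

definition bits :: "real \<Rightarrow> nat \<Rightarrow> bool" where "bits z n \<longleftrightarrow> 1/2 < digit n z"

lemma bits_cantor [simp]: "bits (cantor b) = b"
  by (rule ext) (simp add: bits_def digit_cantor)

definition bit_space :: "(nat \<Rightarrow> bool) measure" where
  "bit_space = PiM UNIV (\<lambda>_. count_space UNIV)"

lemma space_bit_space [simp]: "space bit_space = UNIV"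
  by (simp add: bit_space_def space_PiM)

lemma measurable_bit [measurable]: "(\<lambda>b. b i) \<in> measurable bit_space (count_space UNIV)"
  unfolding bit_space_def by (rule measurable_component_singleton) simp

lemma measurable_bit_spaceI:
  assumes "\<And>i. (\<lambda>x. f x i) \<in> measurable M (count_space UNIV)" shows "f \<in> measurable M bit_space"
  unfolding bit_space_def by (rule measurable_PiM_single') (use assms in auto)

lemma cantor_measurable [measurable]: "cantor \<in> borel_measurable bit_space"
  unfolding cantor_def by measurable

lemma digit_measurable [measurable]: "digit n \<in> borel_measurable borel"
  by (rule borel_measurable_continuous_onI[OF continuous_digit])

lemma bits_measurable [measurable]: "bits \<in> measurable borel bit_space"
  unfolding bits_def by (rule measurable_bit_spaceI) measurable

lemma cylinder_sets: "finite J \<Longrightarrow> {b. \<forall>i\<in>J. b i} \<in> sets bit_space"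
proof -
  assume J: "finite J"
  have "{b \<in> space bit_space. \<forall>i\<in>J. b i} \<in> sets bit_space"
    by (rule sets.sets_Collect_finite_All[OF _ J]) (use measurable_bit in \<open>simp add: pred_def\<close>)
  then show ?thesis by simp
qed

text \<open>Events that ask finitely many bits to be set are stable under intersection, and they
  generate the opposite events too. For arrays of edges their probabilities are the subgraph
  densities.\<close>

lemma measure_eq_cylinders:
  assumes M: "sets M = sets bit_space" and N: "sets N = sets bit_space" and fin: "emeasure M UNIV \<noteq> \<infinity>"
    and eq: "\<And>J. finite J \<Longrightarrow> emeasure M {b. \<forall>i\<in>J. b i} = emeasure N {b. \<forall>i\<in>J. b i}"
  shows "M = N"
proof -
  let ?E = "{{b :: nat \<Rightarrow> bool. \<forall>i\<in>J. b i} | J. finite J}"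
  have sub: "sigma_sets UNIV ?E \<subseteq> sets bit_space"
    using sets.sigma_sets_subset[of ?E bit_space] cylinder_sets by auto
  moreover have "sets bit_space \<subseteq> sigma_sets UNIV ?E"
  proof -
    interpret E: sigma_algebra UNIV "sigma_sets UNIV ?E" by (rule sigma_algebra_sigma_sets) auto
    have "{f \<in> UNIV. f i \<in> A} \<in> sigma_sets UNIV ?E" for i and A :: "bool set"
    proof -
      have 1: "{f. f i} \<in> sigma_sets UNIV ?E" by (rule sigma_sets.Basic) (auto intro!: exI[of _ "{i}"])
      have 2: "{f. \<not> f i} \<in> sigma_sets UNIV ?E" using E.compl_sets[OF 1] by (simp add: Compl_eq_Diff_UNIV[symmetric] Collect_neg_eq)
      have "{f \<in> UNIV. f i \<in> A} = (if True \<in> A then {f. f i} else {}) \<union> (if False \<in> A then {f. \<not> f i} else {})"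
        by (auto split: if_splits) (metis (full_types))+
      then show ?thesis using E.Un[of "if True \<in> A then {f. f i} else {}" "if False \<in> A then {f. \<not> f i} else {}"] 1 2 by simp
    qed
    moreover have "UNIV \<rightarrow>\<^sub>E space (count_space UNIV) = (UNIV :: (nat \<Rightarrow> bool) set)" by auto
    ultimately show ?thesis unfolding bit_space_def sets_PiM_single by (simp only:) (intro sigma_sets_mono, blast)
  qed
  ultimately have gen: "sets bit_space = sigma_sets UNIV ?E" by blast
  show ?thesis
  proof (rule measure_eqI_generator_eq[of ?E UNIV M N "\<lambda>_. UNIV"])
    show "Int_stable ?E"
    proof (rule Int_stableI)
      fix a b assume "a \<in> ?E" "b \<in> ?E"
      then obtain J J' where "finite J" "finite J'" "a = {b. \<forall>i\<in>J. b i}" "b = {b. \<forall>i\<in>J'. b i}" by auto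
      then show "a \<inter> b \<in> ?E" by (intro CollectI exI[of _ "J \<union> J'"]) auto
    qed
    show "range (\<lambda>_::nat. UNIV) \<subseteq> ?E" by (auto intro!: exI[of _ "{}"])
  qed (use M N gen eq fin in auto)
qed

lemma measure_eq_rectangles:
  assumes M: "sets M = sets (A \<Otimes>\<^sub>M B)" and N: "sets N = sets (A \<Otimes>\<^sub>M B)" and fin: "emeasure M (space M) \<noteq> \<infinity>"
    and eq: "\<And>a b. a \<in> sets A \<Longrightarrow> b \<in> sets B \<Longrightarrow> emeasure M (a \<times> b) = emeasure N (a \<times> b)"
  shows "M = N"
proof (rule measure_eqI_generator_eq[OF Int_stable_pair_measure_generator[of A B], where \<Omega> = "space A \<times> space B" and A = "\<lambda>_. space A \<times> space B"])
  show "{a \<times> b |a b. a \<in> sets A \<and> b \<in> sets B} \<subseteq> Pow (space A \<times> space B)"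
    by (rule pair_measure_closed)
  have "space M = space A \<times> space B" using sets_eq_imp_space_eq[OF M] by (simp add: space_pair_measure)
  then show "emeasure M (space A \<times> space B) \<noteq> \<infinity>" using fin by simp
qed (use M N eq in \<open>auto simp: sets_pair_measure\<close>)

text \<open>The inequality of integrals is tested on the set where g < f; finiteness of the integral
  of g permits the subtraction.\<close>

lemma AE_le_of_integrals:
  assumes [measurable]: "f \<in> borel_measurable M" "g \<in> borel_measurable M"
    and le: "\<And>A. A \<in> sets M \<Longrightarrow> (\<integral>\<^sup>+x. f x * indicator A x \<partial>M) \<le> (\<integral>\<^sup>+x. g x * indicator A x \<partial>M)"
    and fin: "(\<integral>\<^sup>+x. g x \<partial>M) < \<infinity>"
  shows "AE x in M. f x \<le> g x"
proof -
  let ?A = "{x \<in> space M. g x < f x}"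
  have A[measurable]: "?A \<in> sets M" by measurable
  have "(\<integral>\<^sup>+x. g x * indicator ?A x \<partial>M) \<le> (\<integral>\<^sup>+x. g x \<partial>M)"
    by (intro nn_integral_mono) (auto split: split_indicator)
  from order_le_less_trans[OF this fin] have f2: "(\<integral>\<^sup>+x. g x * indicator ?A x \<partial>M) \<noteq> \<infinity>" by simp
  have "(\<integral>\<^sup>+x. f x * indicator ?A x - g x * indicator ?A x \<partial>M) = 
     (\<integral>\<^sup>+x. f x * indicator ?A x \<partial>M) - (\<integral>\<^sup>+x. g x * indicator ?A x \<partial>M)"
    by (rule nn_integral_diff) (use f2 in \<open>auto split: split_indicator\<close>)
  also have "\<dots> = 0"
  proof -
    have "(\<integral>\<^sup>+x. f x * indicator ?A x \<partial>M) < \<top>" using order_le_less_trans[OF le[OF A]] f2 by (simp add: less_top)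
    then show ?thesis using le[OF A] by (simp add: diff_eq_0_iff_ennreal)
  qed
  finally have "AE x in M. f x * indicator ?A x - g x * indicator ?A x = 0"
    by (subst (asm) nn_integral_0_iff_AE) auto
  then show ?thesis
    by (rule AE_mp, intro AE_I2 impI)
       (auto split: split_indicator_asm simp: diff_eq_0_iff_ennreal not_less)
qed

text \<open>The threshold is an extended non-negative real because it will be a supremum of
  Radon-Nikodym derivatives.\<close>

lemma emeasure_unit_interval_less:
  "emeasure unit_interval {u \<in> {0..1}. ennreal u < c} = min 1 c"
proof (cases c)
  case (real r)
  then have r: "0 \<le> r" by simp
  have a: "{u \<in> {0..1}. ennreal u < c} = (if r \<le> 1 then {0..<r} else {0..1})"
    using r unfolding real(2) by (auto simp: ennreal_less_iff)
  have b: "emeasure unit_interval B = emeasure lborel B" if "B \<subseteq> {0..1}" for B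
    unfolding unit_interval_def by (rule emeasure_restrict_space) (use that in auto)
  have "emeasure unit_interval {u \<in> {0..1}. ennreal u < c} = (if r \<le> 1 then ennreal r else 1)"
  proof (cases "r \<le> 1")
    case True
    then have "{0..<r} \<subseteq> {0..1}" by auto
    then show ?thesis unfolding a using b[of "{0..<r}"] True r by simp
  next
    case False
    then show ?thesis unfolding a using b[of "{0..1}"] by simp
  qed
  also have "\<dots> = min 1 c" unfolding real(2) using r by (auto simp: min_def ennreal_le_1 ennreal_ge_1)
  finally show ?thesis .
next
  case top
  have "{u \<in> {0..1}. ennreal u < c} = space unit_interval" using top by auto
  then show ?thesis using top prob_space.emeasure_space_1[OF prob_space_unit_interval] by simp
qed

subsection \<open>Conditional quantiles\<close>

text \<open>Fixing the first side of a rectangle gives a measure on the second factor, to which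
  one-variable uniqueness theorems apply.\<close>

lemma emeasure_slice:
  assumes P[measurable_cong]: "sets P = sets (A \<Otimes>\<^sub>M B)" and a: "a \<in> sets A" and b[measurable]: "b \<in> sets B"
  shows "emeasure (distr (density P (indicator (a \<times> space B))) B snd) b = emeasure P (a \<times> b)"
proof -
  have AU[measurable]: "a \<times> space B \<in> sets (A \<Otimes>\<^sub>M B)" using a by (intro pair_measureI) simp_all
  have s: "snd -` b \<inter> space P \<in> sets P" using measurable_sets[of snd P B b] measurable_cong_sets[OF P refl] by auto
  have "emeasure (distr (density P (indicator (a \<times> space B))) B snd) b = emeasure (density P (indicator (a \<times> space B))) (snd -` b \<inter> space P)"
    by (subst emeasure_distr) (simp_all add: measurable_cong_sets[OF P refl])
  also have "\<dots> = (\<integral>\<^sup>+z. indicator (a \<times> space B) z * indicator (snd -` b \<inter> space P) z \<partial>P)"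
    by (rule emeasure_density[OF _ s]) measurable
  also have "\<dots> = (\<integral>\<^sup>+z. indicator (a \<times> b) z \<partial>P)"
    by (rule nn_integral_cong) (use sets.sets_into_space[OF b] in \<open>auto split: split_indicator\<close>)
  also have "\<dots> = emeasure P (a \<times> b)"
    by (rule nn_integral_indicator) (use a b P in simp)
  finally show ?thesis .
qed

lemma measure_eq_rectangle_cylinders:
  assumes M: "sets M = sets (A \<Otimes>\<^sub>M bit_space)" and N: "sets N = sets (A \<Otimes>\<^sub>M bit_space)" and fin: "emeasure M (space M) \<noteq> \<infinity>"
    and eq: "\<And>a J. a \<in> sets A \<Longrightarrow> finite J \<Longrightarrow> emeasure M (a \<times> {b. \<forall>i\<in>J. b i}) = emeasure N (a \<times> {b. \<forall>i\<in>J. b i})"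
  shows "M = N"
proof (rule measure_eq_rectangles[OF M N fin])
  fix a b assume a: "a \<in> sets A" and b: "b \<in> sets bit_space"
  let ?m = "\<lambda>P. distr (density P (indicator (a \<times> space bit_space))) bit_space snd"
  have "?m M = ?m N"
  proof (rule measure_eq_cylinders)
    have "emeasure (?m M) UNIV = emeasure M (a \<times> UNIV)" using emeasure_slice[OF M a sets.top[of bit_space]] by simp
    also have "\<dots> \<le> emeasure M (space M)" by (rule emeasure_space)
    finally show "emeasure (?m M) UNIV \<noteq> \<infinity>" using fin by (auto simp: top_unique)
    show "emeasure (?m M) {b. \<forall>i\<in>J. b i} = emeasure (?m N) {b. \<forall>i\<in>J. b i}" if "finite J" for J
      unfolding emeasure_slice[OF M a cylinder_sets[OF that]] emeasure_slice[OF N a cylinder_sets[OF that]] by (rule eq[OF a that])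
  qed simp_all
  then show "emeasure M (a \<times> b) = emeasure N (a \<times> b)"
    using emeasure_slice[OF M a b] emeasure_slice[OF N a b] by simp
qed

text \<open>A conditional quantile transform: \<open>f y\<close> pushes the uniform distribution forward to the
  conditional law of \<open>R\<close> given \<open>Y = y\<close>.  The function \<open>F q\<close> is the conditional probability of
  \<open>R > q\<close>.\<close>

lemma conditional_quantile:
  fixes R :: "'a \<Rightarrow> real"
  assumes M: "prob_space M" and Y[measurable]: "Y \<in> measurable M S" and R[measurable]: "R \<in> borel_measurable M"
    and R01: "\<And>x. 0 \<le> R x \<and> R x \<le> 1"
  shows "\<exists>f. f \<in> borel_measurable (S \<Otimes>\<^sub>M unit_interval) \<and>
    distr M (S \<Otimes>\<^sub>M borel) (\<lambda>x. (Y x, R x)) =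
    distr (M \<Otimes>\<^sub>M unit_interval) (S \<Otimes>\<^sub>M borel) (\<lambda>(x, u). (Y x, f (Y x, u)))"
proof -
  interpret M: prob_space M by fact
  interpret U: prob_space unit_interval by (rule prob_space_unit_interval)
  interpret MU: pair_prob_space M unit_interval ..
  define N where "N = distr M S Y"
  interpret N: prob_space N unfolding N_def by (rule M.prob_space_distr[OF Y])
  have sN[measurable_cong]: "sets N = sets S" by (simp add: N_def)
  \<comment> \<open>The law of \<open>Y\<close> restricted to the event R > q; its density with
    respect to the law of \<open>Y\<close> is the conditional probability of that event.\<close>
  define \<nu> where "\<nu> q = distr (density M (indicator {x \<in> space M. real_of_rat q < R x})) S Y" for q
  have \<nu>: "emeasure (\<nu> q) A = emeasure M {x \<in> space M. Y x \<in> A \<and> real_of_rat q < R x}" if A[measurable]: "A \<in> sets S" for q A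
  proof -
    have "emeasure (\<nu> q) A = emeasure (density M (indicator {x \<in> space M. real_of_rat q < R x})) (Y -` A \<inter> space M)"
      unfolding \<nu>_def by (subst emeasure_distr) simp_all
    also have "\<dots> = (\<integral>\<^sup>+x. indicator {x \<in> space M. real_of_rat q < R x} x * indicator (Y -` A \<inter> space M) x \<partial>M)"
      by (rule emeasure_density) measurable
    also have "\<dots> = (\<integral>\<^sup>+x. indicator {x \<in> space M. Y x \<in> A \<and> real_of_rat q < R x} x \<partial>M)"
      by (intro nn_integral_cong) (auto split: split_indicator)
    also have "\<dots> = emeasure M {x \<in> space M. Y x \<in> A \<and> real_of_rat q < R x}"
      by (rule nn_integral_indicator) measurable
    finally show ?thesis .
  qed
  have NA: "emeasure N A = emeasure M {x \<in> space M. Y x \<in> A}" if A: "A \<in> sets S" for A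
    unfolding N_def using A by (subst emeasure_distr) (auto intro!: arg_cong[of _ _ "emeasure M"])
  define F where "F q = RN_deriv N (\<nu> q)" for q
  have Fm[measurable]: "F q \<in> borel_measurable S" for q
    unfolding F_def using borel_measurable_RN_deriv[of N "\<nu> q"] measurable_cong_sets[OF sN refl] by blast
  have ac: "absolutely_continuous N (\<nu> q)" for q
    unfolding absolutely_continuous_def null_sets_def
  proof safe
    fix A assume A: "A \<in> sets N" "emeasure N A = 0"
    then have A': "A \<in> sets S" by (simp add: sN)
    show "A \<in> sets (\<nu> q)" using A' by (simp add: \<nu>_def)
    have "emeasure (\<nu> q) A \<le> emeasure N A"
      unfolding \<nu>[OF A'] NA[OF A'] by (rule emeasure_mono) (use A' in \<open>auto, measurable\<close>)
    then show "emeasure (\<nu> q) A = 0" using A by simp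
  qed
  have dens: "density N (F q) = \<nu> q" for q
    unfolding F_def by (rule N.density_RN_deriv[OF ac]) (simp add: \<nu>_def sN)
  have FA: "(\<integral>\<^sup>+y. F q y * indicator A y \<partial>N) = emeasure M {x \<in> space M. Y x \<in> A \<and> real_of_rat q < R x}" if A: "A \<in> sets S" for q A
    using emeasure_density[of "F q" N A] A \<nu>[OF A, of q] unfolding dens by (simp add: sN measurable_cong_sets[OF sN refl])
  have FA': "(\<integral>\<^sup>+x. F q (Y x) * indicator A (Y x) \<partial>M) = emeasure M {x \<in> space M. Y x \<in> A \<and> real_of_rat q < R x}" if A[measurable]: "A \<in> sets S" for q A
    unfolding FA[OF A, symmetric] N_def by (subst nn_integral_distr) measurable
  have AE1: "AE y in N. F q y \<le> 1" for q
  proof (rule AE_le_of_integrals)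
    show "(\<integral>\<^sup>+x. F q x * indicator A x \<partial>N) \<le> (\<integral>\<^sup>+x. 1 * indicator A x \<partial>N)" if A: "A \<in> sets N" for A
    proof -
      have A': "A \<in> sets S" using A by (simp add: sN)
      have "(\<integral>\<^sup>+x. 1 * indicator A x \<partial>N) = emeasure N A" using A by simp
      then show ?thesis unfolding FA[OF A'] using NA[OF A'] A' by (auto intro!: emeasure_mono)
    qed
  qed (simp_all add: N.emeasure_space_1)
  have AE2: "AE y in N. F q y \<le> F p y" if "p \<le> q" for p q
  proof (rule AE_le_of_integrals)
    show "(\<integral>\<^sup>+x. F q x * indicator A x \<partial>N) \<le> (\<integral>\<^sup>+x. F p x * indicator A x \<partial>N)" if A: "A \<in> sets N" for A
    proof -
      have A'[measurable]: "A \<in> sets S" using A by (simp add: sN)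
      have pq: "real_of_rat p \<le> real_of_rat q" using \<open>p \<le> q\<close> by (simp add: of_rat_less_eq)
      show ?thesis unfolding FA[OF A'] by (rule emeasure_mono) (use pq in \<open>auto, measurable\<close>)
    qed
    have "(\<integral>\<^sup>+x. F p x \<partial>N) \<le> (\<integral>\<^sup>+x. 1 \<partial>N)" by (rule nn_integral_mono_AE[OF AE1])
    also have "\<dots> < \<infinity>" by (simp add: N.emeasure_space_1)
    finally show "(\<integral>\<^sup>+x. F p x \<partial>N) < \<infinity>" .
  qed (simp_all)
  have "AE y in N. \<forall>q. F q y \<le> 1" unfolding AE_all_countable by (intro allI AE1)
  \<comment> \<open>As q is rational, only countably many null sets occur, and \<open>F\<close> is
    monotone in q for almost every y.\<close>
  moreover have "AE y in N. \<forall>p q. p \<le> q \<longrightarrow> F q y \<le> F p y"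
    unfolding AE_all_countable by (intro allI AE_impI AE2)
  ultimately have "AE y in N. (\<forall>q. F q y \<le> 1) \<and> (\<forall>p q. p \<le> q \<longrightarrow> F q y \<le> F p y)" by (rule AE_conjI)
  then have AEM: "AE x in M. (\<forall>q. F q (Y x) \<le> 1) \<and> (\<forall>p q. p \<le> q \<longrightarrow> F q (Y x) \<le> F p (Y x))"
    unfolding N_def by (rule AE_distrD[OF Y])
  \<comment> \<open>The generalised inverse of q \<mapsto> F q y. Taking rational q keeps
    \<open>f\<close> measurable, and the inserted 0 makes the set non-empty.\<close>
  define f where "f = (\<lambda>(y, u :: real). Sup (insert 0 {real_of_rat q | q. 0 \<le> q \<and> q \<le> 1 \<and> ennreal u < F q y}))"
  have f_less: "s < f (y, u) \<longleftrightarrow> s < 0 \<or> (\<exists>q. 0 \<le> q \<and> q \<le> 1 \<and> s < real_of_rat q \<and> ennreal u < F q y)" for s y u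
  proof -
    have "bdd_above (insert 0 {real_of_rat q | q. 0 \<le> q \<and> q \<le> 1 \<and> ennreal u < F q y})"
      by (rule bdd_aboveI[of _ 1]) auto
    then show ?thesis unfolding f_def prod.case by (subst less_cSup_iff) auto
  qed
  have fm: "f \<in> borel_measurable (S \<Otimes>\<^sub>M unit_interval)"
  proof (subst borel_measurable_iff_greater, intro allI)
    fix s
    have [measurable]: "(\<lambda>w. snd w) \<in> borel_measurable (S \<Otimes>\<^sub>M unit_interval)"
      by (rule measurable_compose[OF measurable_snd borel_measurable_unit_interval_id])
    have "{w \<in> space (S \<Otimes>\<^sub>M unit_interval). s < f w} = 
      {w \<in> space (S \<Otimes>\<^sub>M unit_interval). s < 0 \<or> (\<exists>q. 0 \<le> q \<and> q \<le> 1 \<and> s < real_of_rat q \<and> ennreal (snd w) < F q (fst w))}"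
      using f_less by auto
    also have "\<dots> \<in> sets (S \<Otimes>\<^sub>M unit_interval)" by measurable
    finally show "{w \<in> space (S \<Otimes>\<^sub>M unit_interval). s < f w} \<in> sets (S \<Otimes>\<^sub>M unit_interval)" .
  qed
  note [measurable] = fm
  have f_law: "emeasure unit_interval {u \<in> {0..1}. s < f (y, u)} = 
     (if s < 0 then 1 else min 1 (SUP q\<in>{q. 0 \<le> q \<and> q \<le> 1 \<and> s < real_of_rat q}. F q y))" for s y
  proof (cases "s < 0")
    case True
    then have "{u \<in> {0..1}. s < f (y, u)} = space unit_interval" using f_less by auto
    then show ?thesis using True U.emeasure_space_1 by simp
  next
    case False
    then have "{u \<in> {0..1}. s < f (y, u)} = {u \<in> {0..1}. ennreal u < (SUP q\<in>{q. 0 \<le> q \<and> q \<le> 1 \<and> s < real_of_rat q}. F q y)}"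
      unfolding f_less less_SUP_iff by auto
    then show ?thesis using False emeasure_unit_interval_less by simp
  qed
  let ?L = "distr M (S \<Otimes>\<^sub>M borel) (\<lambda>x. (Y x, R x))"
  let ?R = "distr (M \<Otimes>\<^sub>M unit_interval) (S \<Otimes>\<^sub>M borel) (\<lambda>(x, u). (Y x, f (Y x, u)))"
  have Rm: "(\<lambda>(x, u). (Y x, f (Y x, u))) \<in> measurable (M \<Otimes>\<^sub>M unit_interval) (S \<Otimes>\<^sub>M borel)" by measurable
  have L: "emeasure ?L (A \<times> B) = emeasure M {x \<in> space M. Y x \<in> A \<and> R x \<in> B}" if [measurable]: "A \<in> sets S" "B \<in> sets borel" for A B
    by (subst emeasure_distr) (auto intro!: arg_cong[of _ _ "emeasure M"])
  have Rr: "emeasure ?R (A \<times> B) = (\<integral>\<^sup>+x. indicator A (Y x) * emeasure unit_interval {u \<in> {0..1}. f (Y x, u) \<in> B} \<partial>M)"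
    if [measurable]: "A \<in> sets S" "B \<in> sets borel" for A B
  proof -
    have "emeasure ?R (A \<times> B) = (\<integral>\<^sup>+z. indicator (A \<times> B) z \<partial>?R)" by (subst nn_integral_indicator) simp_all
    also have "\<dots> = (\<integral>\<^sup>+w. indicator (A \<times> B) (case w of (x, u) \<Rightarrow> (Y x, f (Y x, u))) \<partial>(M \<Otimes>\<^sub>M unit_interval))"
      by (rule nn_integral_distr[OF Rm]) measurable
    also have "\<dots> = (\<integral>\<^sup>+x. \<integral>\<^sup>+u. indicator (A \<times> B) (Y x, f (Y x, u)) \<partial>unit_interval \<partial>M)"
      by (subst U.nn_integral_fst[symmetric]) (simp_all add: measurable_compose[OF Rm])
    also have "\<dots> = (\<integral>\<^sup>+x. indicator A (Y x) * emeasure unit_interval {u \<in> {0..1}. f (Y x, u) \<in> B} \<partial>M)"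
    proof (rule nn_integral_cong)
      fix x assume x: "x \<in> space M"
      have Yx: "Y x \<in> space S" using measurable_space[OF Y x] .
      have fx: "(\<lambda>u. f (Y x, u)) \<in> borel_measurable unit_interval"
        by (rule measurable_compose[OF measurable_Pair1'[OF Yx] fm])
      have B': "{u \<in> {0..1}. f (Y x, u) \<in> B} \<in> sets unit_interval"
        using measurable_sets[OF fx \<open>B \<in> sets borel\<close>] by (simp add: vimage_def Int_def conj_commute)
      have "(\<integral>\<^sup>+u. indicator (A \<times> B) (Y x, f (Y x, u)) \<partial>unit_interval) = (\<integral>\<^sup>+u. indicator A (Y x) * indicator {u \<in> {0..1}. f (Y x, u) \<in> B} u \<partial>unit_interval)"
        by (rule nn_integral_cong) (auto split: split_indicator)
      then show "(\<integral>\<^sup>+u. indicator (A \<times> B) (Y x, f (Y x, u)) \<partial>unit_interval) = indicator A (Y x) * emeasure unit_interval {u \<in> {0..1}. f (Y x, u) \<in> B}"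
        using B' by (simp add: nn_integral_cmult)
    qed
    finally show ?thesis .
  qed
  have finL: "emeasure ?L (space ?L) \<noteq> \<infinity>"
    using prob_space.emeasure_space_1[OF M.prob_space_distr[of "\<lambda>x. (Y x, R x)" "S \<Otimes>\<^sub>M borel"]] by simp
  \<comment> \<open>Half lines in the second factor determine the law. Those starting below 0 have
    full measure because \<open>R\<close> takes values in [0,1].\<close>
  have half: "emeasure ?L (A \<times> {s<..}) = emeasure ?R (A \<times> {s<..})" if A[measurable]: "A \<in> sets S" for A s
  proof (cases "s < 0")
    case True
    have "R x > s" for x using R01[of x] True by linarith
    then have "emeasure ?L (A \<times> {s<..}) = emeasure M {x \<in> space M. Y x \<in> A}" by (subst L) simp_all
    also have "\<dots> = (\<integral>\<^sup>+x. indicator {x \<in> space M. Y x \<in> A} x \<partial>M)" by (subst nn_integral_indicator) simp_all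
    also have "\<dots> = (\<integral>\<^sup>+x. indicator A (Y x) * 1 \<partial>M)" by (rule nn_integral_cong) (auto split: split_indicator)
    also have "\<dots> = emeasure ?R (A \<times> {s<..})" unfolding Rr[OF A, of "{s<..}", simplified] using f_law[of s] True by simp
    finally show ?thesis .
  next
    case False
    define Q where "Q = {q :: rat. 0 \<le> q \<and> q \<le> 1 \<and> s < real_of_rat q}"
    have Req: "s < R x \<longleftrightarrow> (\<exists>q\<in>Q. real_of_rat q < R x)" for x
    proof
      assume "s < R x"
      then obtain q where q: "s < real_of_rat q" "real_of_rat q < R x" using of_rat_dense by blast
      have "0 \<le> real_of_rat q" "real_of_rat q \<le> 1" using q False R01[of x] by linarith+
      then show "\<exists>q\<in>Q. real_of_rat q < R x" using q by (auto simp: Q_def)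
    qed (auto simp: Q_def)
    have RR: "emeasure ?R (A \<times> {s<..}) = (\<integral>\<^sup>+x. indicator A (Y x) * min 1 (SUP q\<in>Q. F q (Y x)) \<partial>M)"
      unfolding Rr[OF A, of "{s<..}", simplified] using f_law[of s] False by (simp add: Q_def)
    show ?thesis
    proof (cases "Q = {}")
      case True
      have "{x \<in> space M. Y x \<in> A \<and> R x \<in> {s<..}} = {}" using Req True by auto
      then have "emeasure ?L (A \<times> {s<..}) = 0" by (subst L) (simp_all only: A emeasure_empty, simp)
      moreover have "emeasure ?R (A \<times> {s<..}) = 0" unfolding RR True by (simp add: bot_ennreal)
      ultimately show ?thesis by simp
    next
      case ne: False
      define e where "e = from_nat_into Q"
      \<comment> \<open>A decreasing sequence in \<open>Q\<close> that gets below every element of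
        \<open>Q\<close>: by monotonicity of \<open>F\<close> the supremum over \<open>Q\<close>
        becomes an increasing limit, so monotone convergence applies.\<close>
      define m where "m n = Min (e ` {..n})" for n :: nat
      have eQ: "e n \<in> Q" for n unfolding e_def by (rule from_nat_into[OF ne])
      have mQ: "m n \<in> Q" for n
      proof -
        have "m n \<in> e ` {..n}" unfolding m_def by (rule Min_in) auto
        then show ?thesis using eQ by auto
      qed
      have m_dec: "m (Suc n) \<le> m n" for n unfolding m_def by (rule Min_antimono) auto
      have m_le: "\<exists>n. m n \<le> q" if "q \<in> Q" for q
      proof -
        obtain n where "e n = q" using from_nat_into_surj[OF countableI_type \<open>q \<in> Q\<close>] unfolding e_def by blast
        then have "m n \<le> q" unfolding m_def by (intro Min_le) auto
        then show ?thesis by blast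
      qed
      have "emeasure ?R (A \<times> {s<..}) = (\<integral>\<^sup>+x. (SUP n. F (m n) (Y x) * indicator A (Y x)) \<partial>M)"
        unfolding RR
      proof (rule nn_integral_cong_AE, rule AE_mp[OF AEM], intro AE_I2 impI)
        fix x assume h: "(\<forall>q. F q (Y x) \<le> 1) \<and> (\<forall>p q. p \<le> q \<longrightarrow> F q (Y x) \<le> F p (Y x))"
        have "(SUP q\<in>Q. F q (Y x)) = (SUP n. F (m n) (Y x))"
        proof (rule antisym)
          show "(SUP n. F (m n) (Y x)) \<le> (SUP q\<in>Q. F q (Y x))" by (rule SUP_mono) (rule bexI[OF order_refl mQ])
          show "(SUP q\<in>Q. F q (Y x)) \<le> (SUP n. F (m n) (Y x))" 
          proof (rule SUP_mono)
            fix q assume "q \<in> Q"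
            then obtain n where "m n \<le> q" using m_le by blast
            then show "\<exists>n\<in>UNIV. F q (Y x) \<le> F (m n) (Y x)" using h by blast
          qed
        qed
        moreover have "(SUP n. F (m n) (Y x)) \<le> 1" by (rule SUP_least) (use h in blast)
        ultimately have "min 1 (SUP q\<in>Q. F q (Y x)) = (SUP n. F (m n) (Y x))" by (simp add: min_absorb2)
        then show "indicator A (Y x) * min 1 (SUP q\<in>Q. F q (Y x)) = (SUP n. F (m n) (Y x) * indicator A (Y x))"
          by (cases "Y x \<in> A") simp_all
      qed
      also have "\<dots> = (SUP n. \<integral>\<^sup>+x. F (m n) (Y x) * indicator A (Y x) \<partial>M)"
      proof (rule nn_integral_monotone_convergence_SUP_AE)
        show "AE x in M. F (m i) (Y x) * indicator A (Y x) \<le> F (m (Suc i)) (Y x) * indicator A (Y x)" for i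
          by (rule AE_mp[OF AEM], intro AE_I2 impI) (use m_dec[of i] in \<open>auto split: split_indicator\<close>)
      qed measurable
      also have "\<dots> = (SUP n. emeasure M {x \<in> space M. Y x \<in> A \<and> real_of_rat (m n) < R x})"
        by (simp only: FA'[OF A])
      also have "\<dots> = emeasure M (\<Union>n. {x \<in> space M. Y x \<in> A \<and> real_of_rat (m n) < R x})"
      proof (rule SUP_emeasure_incseq)
        show "range (\<lambda>n. {x \<in> space M. Y x \<in> A \<and> real_of_rat (m n) < R x}) \<subseteq> sets M" by auto
        show "incseq (\<lambda>n. {x \<in> space M. Y x \<in> A \<and> real_of_rat (m n) < R x})"
        proof (rule incseq_SucI)
          fix n
          have "real_of_rat (m (Suc n)) \<le> real_of_rat (m n)" using m_dec[of n] by (simp add: of_rat_less_eq)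
          then show "{x \<in> space M. Y x \<in> A \<and> real_of_rat (m n) < R x} \<subseteq> {x \<in> space M. Y x \<in> A \<and> real_of_rat (m (Suc n)) < R x}" by auto
        qed
      qed
      also have "(\<Union>n. {x \<in> space M. Y x \<in> A \<and> real_of_rat (m n) < R x}) = {x \<in> space M. Y x \<in> A \<and> R x \<in> {s<..}}"
      proof -
        have "(\<exists>n. real_of_rat (m n) < R x) \<longleftrightarrow> s < R x" for x
        proof
          assume "s < R x"
          then obtain q where "q \<in> Q" "real_of_rat q < R x" using Req by blast
          moreover then obtain n where "m n \<le> q" using m_le by blast
          ultimately show "\<exists>n. real_of_rat (m n) < R x" by (intro exI[of _ n]) (meson of_rat_less_eq order_le_less_trans)
        qed (use Req mQ in blast)
        then show ?thesis by auto
      qed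
      finally show ?thesis by (subst L) simp_all
    qed
  qed
  have "?L = ?R"
  proof (rule measure_eq_rectangles[OF _ _ finL])
    fix A and B :: "real set" assume A: "A \<in> sets S" and B: "B \<in> sets borel"
    define \<mu>1 where "\<mu>1 = distr (density ?L (indicator (A \<times> space borel))) borel snd"
    define \<mu>2 where "\<mu>2 = distr (density ?R (indicator (A \<times> space borel))) borel snd"
    have g1: "emeasure \<mu>1 B' = emeasure ?L (A \<times> B')" and g2: "emeasure \<mu>2 B' = emeasure ?R (A \<times> B')" if "B' \<in> sets borel" for B'
      unfolding \<mu>1_def \<mu>2_def by (rule emeasure_slice[OF _ A that], simp)+
    have "\<mu>1 = \<mu>2"
    proof (rule measure_eqI_lessThan)
      show "emeasure \<mu>1 {x<..} < \<infinity>" for x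
      proof -
        have "emeasure \<mu>1 {x<..} \<le> emeasure ?L (space ?L)" by (subst g1) (simp_all only: emeasure_space, simp)
        then show ?thesis using finL by (simp add: order_le_less_trans less_top)
      qed
      show "emeasure \<mu>1 {x<..} = emeasure \<mu>2 {x<..}" for x
        using half[OF A, of x] g1[of "{x<..}"] g2[of "{x<..}"] by simp
    qed (simp_all add: \<mu>1_def \<mu>2_def)
    then show "emeasure ?L (A \<times> B) = emeasure ?R (A \<times> B)" using g1[OF B] g2[OF B] by simp
  qed simp_all
  with fm show ?thesis by blast
qed


lemma conditional_quantile_integral:
  fixes g :: "'b \<times> real \<Rightarrow> real"
  assumes M: "prob_space M" and Y[measurable]: "Y \<in> measurable M S" and R[measurable]: "R \<in> borel_measurable M"
    and f[measurable]: "f \<in> borel_measurable (S \<Otimes>\<^sub>M unit_interval)"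
    and eq: "distr M (S \<Otimes>\<^sub>M borel) (\<lambda>x. (Y x, R x)) =
      distr (M \<Otimes>\<^sub>M unit_interval) (S \<Otimes>\<^sub>M borel) (\<lambda>(x, u). (Y x, f (Y x, u)))"
    and g[measurable]: "g \<in> borel_measurable (S \<Otimes>\<^sub>M borel)" and b: "\<And>z. \<bar>g z\<bar> \<le> K"
  shows "(\<integral>x. g (Y x, R x) \<partial>M) = (\<integral>x. \<integral>u. g (Y x, f (Y x, u)) \<partial>unit_interval \<partial>M)"
proof -
  interpret M: prob_space M by fact
  interpret U: prob_space unit_interval by (rule prob_space_unit_interval)
  interpret MU: pair_prob_space M unit_interval ..
  have m: "(\<lambda>(x, u). (Y x, f (Y x, u))) \<in> measurable (M \<Otimes>\<^sub>M unit_interval) (S \<Otimes>\<^sub>M borel)" by measurable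
  have "(\<integral>x. g (Y x, R x) \<partial>M) = (\<integral>z. g z \<partial>distr M (S \<Otimes>\<^sub>M borel) (\<lambda>x. (Y x, R x)))"
    by (subst integral_distr) simp_all
  also have "\<dots> = (\<integral>w. g (case w of (x, u) \<Rightarrow> (Y x, f (Y x, u))) \<partial>(M \<Otimes>\<^sub>M unit_interval))"
    unfolding eq by (rule integral_distr[OF m g])
  also have "\<dots> = (\<integral>w. (case w of (x, u) \<Rightarrow> g (Y x, f (Y x, u))) \<partial>(M \<Otimes>\<^sub>M unit_interval))"
    by (simp add: split_beta)
  also have "\<dots> = (\<integral>x. \<integral>u. g (Y x, f (Y x, u)) \<partial>unit_interval \<partial>M)"
  proof (rule MU.integral_fst[symmetric])
    have "(\<lambda>w. g (case w of (x, u) \<Rightarrow> (Y x, f (Y x, u)))) \<in> borel_measurable (M \<Otimes>\<^sub>M unit_interval)"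
      by (rule measurable_compose[OF m g])
    then show "integrable (M \<Otimes>\<^sub>M unit_interval) (\<lambda>(x, u). g (Y x, f (Y x, u)))"
      by (intro MU.integrable_const_bound[where B=K] AE_I2) (use b in \<open>simp_all add: split_beta\<close>)
  qed
  finally show ?thesis .
qed

subsection \<open>Exchangeable arrays\<close>

text \<open>Even numbers are the active vertices, odd numbers the auxiliary ones, so there is always
  room among the latter to absorb active vertices injectively.\<close>

definition vact :: "nat \<Rightarrow> nat" where "vact a = 2 * a"
definition vaux :: "nat \<Rightarrow> nat" where "vaux j = 2 * j + 1"

definition mixed :: "nat set \<Rightarrow> nat set \<Rightarrow> nat set" where "mixed A C = vact ` A \<union> vaux ` C"

lemma inj_vact: "inj vact" and inj_vaux: "inj vaux" and vact_neq_vaux: "vact a \<noteq> vaux j"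
  by (auto simp: inj_def vact_def vaux_def) presburger

lemma finite_mixed: "finite A \<Longrightarrow> finite C \<Longrightarrow> finite (mixed A C)"
  by (simp add: mixed_def)

text \<open>Bits are indexed by finite vertex sets through \<open>set_encode\<close>; this is the
  relabelling of such an array by \<pi>.\<close>

definition move :: "(nat \<Rightarrow> nat) \<Rightarrow> (nat \<Rightarrow> bool) \<Rightarrow> nat \<Rightarrow> bool" where
  "move \<pi> b i = b (set_encode (\<pi> ` set_decode i))"

lemma move_set_encode: "finite e \<Longrightarrow> move \<pi> b (set_encode e) = b (set_encode (\<pi> ` e))"
  by (simp add: move_def)

lemma move_measurable [measurable]: "move \<pi> \<in> measurable bit_space bit_space"
  unfolding move_def by (rule measurable_bit_spaceI) measurable

definition profile :: "nat set \<Rightarrow> (nat \<Rightarrow> bool) \<Rightarrow> nat \<Rightarrow> bool" where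
  "profile A b i = b (set_encode (mixed A (set_decode i)))"

lemma profile_measurable [measurable]: "profile A \<in> measurable bit_space bit_space"
  unfolding profile_def by (rule measurable_bit_spaceI) measurable

definition rho :: "nat set \<Rightarrow> (nat \<Rightarrow> bool) \<Rightarrow> real" where "rho A b = cantor (profile A b)"

lemma rho_measurable [measurable]: "rho A \<in> borel_measurable bit_space"
  unfolding rho_def by measurable

text \<open>The random variable \<open>rho A\<close> records all edges whose non-auxiliary part is \<open>A\<close>.  Given the
  variables of the proper subsets of \<open>A\<close> it is independent of all \<open>rho B\<close> with \<open>A\<close> not
  contained in \<open>B\<close>: an injection absorbing the remaining vertices into the auxiliary ones shows
  that knowing more of the \<open>rho B\<close> does not improve the best approximation in mean square.\<close>

locale exchangeable_bits =
  fixes P :: "(nat \<Rightarrow> bool) measure"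
  assumes prob_P: "prob_space P" and sets_P [measurable_cong]: "sets P = sets bit_space"
    and invariant: "\<And>\<pi>. inj \<pi> \<Longrightarrow> distr P bit_space (move \<pi>) = P"
begin

lemma move_P [measurable]: "move \<pi> \<in> measurable P bit_space"
  using move_measurable measurable_cong_sets[OF sets_P refl] by blast

lemma integral_move:
  fixes g :: "_ \<Rightarrow> real"
  assumes "inj \<pi>" "g \<in> borel_measurable bit_space"
  shows "(\<integral>b. g (move \<pi> b) \<partial>P) = (\<integral>b. g b \<partial>P)"
proof -
  have "(\<integral>b. g b \<partial>P) = (\<integral>b. g b \<partial>distr P bit_space (move \<pi>))" by (simp add: invariant[OF assms(1)])
  also have "\<dots> = (\<integral>b. g (move \<pi> b) \<partial>P)" by (rule integral_distr[OF move_P assms(2)])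
  finally show ?thesis by simp
qed

end

lemma quadratic_bound_zero:
  fixes c D :: real
  assumes "0 \<le> D" and "\<And>e. 2 * e * c \<le> e\<^sup>2 * D"
  shows "c = 0"
proof -
  \<comment> \<open>The minimiser c / D of the quadratic, with 1 added because D may vanish.\<close>
  define e where "e = c / (D + 1)"
  have c: "c = e * (D + 1)" using assms(1) by (simp add: e_def)
  have "2 * e * (e * (D + 1)) \<le> e\<^sup>2 * D" using assms(2)[of e] unfolding c .
  then have "e\<^sup>2 * (D + 2) \<le> 0" by (simp add: power2_eq_square algebra_simps)
  moreover have "0 < e\<^sup>2 * (D + 2)" if "e \<noteq> 0" using that assms(1) by (intro mult_pos_pos) auto
  ultimately have "e = 0" by fastforce
  then show ?thesis by (simp add: c)
qed

text \<open>\<open>H\<close> plays the role of a projection of \<open>f\<close>. The competitor H +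
  \<epsilon> G has the same error as some \<open>u\<close> with f - H orthogonal to H - u, so by
  Pythagoras its error is at least that of \<open>H\<close>. Hence \<epsilon> = 0 minimises a
  quadratic in \<epsilon>, whose linear coefficient must vanish.\<close>

lemma (in prob_space) projection_orthogonal:
  fixes f H G :: "'a \<Rightarrow> real"
  assumes [measurable]: "f \<in> borel_measurable M" "H \<in> borel_measurable M" "G \<in> borel_measurable M"
    and b: "\<And>x. \<bar>f x\<bar> \<le> 1" "\<And>x. \<bar>H x\<bar> \<le> 1" "\<And>x. \<bar>G x\<bar> \<le> 1"
    and ex: "\<And>\<epsilon>. \<exists>u K. u \<in> borel_measurable M \<and> (\<forall>x. \<bar>u x\<bar> \<le> K) \<and>
       (\<integral>x. (f x - (H x + \<epsilon> * G x))\<^sup>2 \<partial>M) = (\<integral>x. (f x - u x)\<^sup>2 \<partial>M) \<and> (\<integral>x. (f x - H x) * (H x - u x) \<partial>M) = 0"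
  shows "(\<integral>x. f x * G x \<partial>M) = (\<integral>x. H x * G x \<partial>M)"
proof -
  have bi: "integrable M h" if "h \<in> borel_measurable M" "\<And>x. \<bar>h x\<bar> \<le> K" for h :: "'a \<Rightarrow> real" and K
    by (rule integrable_const_bound[where B=K]) (use that in auto)
  have bm: "\<bar>a * c\<bar> \<le> A * C" if "\<bar>a\<bar> \<le> A" "\<bar>c\<bar> \<le> C" for a c A C :: real
    unfolding abs_mult by (rule mult_mono) (use that in auto)
  have bd: "\<bar>f x - H x\<bar> \<le> 2" for x using b(1)[of x] b(2)[of x] by linarith
  let ?c = "\<integral>x. (f x - H x) * G x \<partial>M" and ?D = "\<integral>x. (G x)\<^sup>2 \<partial>M"
  have i1: "integrable M (\<lambda>x. (f x - H x)\<^sup>2)" 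
    unfolding power2_eq_square by (rule bi) (simp, rule bm[OF bd bd])
  have i2: "integrable M (\<lambda>x. (f x - H x) * G x)" by (rule bi) (simp, rule bm[OF bd b(3)])
  have i3: "integrable M (\<lambda>x. (G x)\<^sup>2)" unfolding power2_eq_square by (rule bi) (simp, rule bm[OF b(3) b(3)])
  have D0: "0 \<le> ?D" by simp
  have key: "2 * \<epsilon> * ?c \<le> \<epsilon>\<^sup>2 * ?D" for \<epsilon>
  proof -
    obtain u K where [measurable]: "u \<in> borel_measurable M" and uK: "\<And>x. \<bar>u x\<bar> \<le> K"
      and e1: "(\<integral>x. (f x - (H x + \<epsilon> * G x))\<^sup>2 \<partial>M) = (\<integral>x. (f x - u x)\<^sup>2 \<partial>M)"
      and e2: "(\<integral>x. (f x - H x) * (H x - u x) \<partial>M) = 0" using ex by blast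
    have bu: "\<bar>H x - u x\<bar> \<le> 1 + K" for x using b(2)[of x] uK[of x] by linarith
    have i4: "integrable M (\<lambda>x. (f x - H x) * (H x - u x))" by (rule bi) (simp, rule bm[OF bd bu])
    have i5: "integrable M (\<lambda>x. (H x - u x)\<^sup>2)" unfolding power2_eq_square by (rule bi) (simp, rule bm[OF bu bu])
    have "(\<integral>x. (f x - u x)\<^sup>2 \<partial>M) = (\<integral>x. (f x - H x)\<^sup>2 + 2 * ((f x - H x) * (H x - u x)) + (H x - u x)\<^sup>2 \<partial>M)"
      by (rule Bochner_Integration.integral_cong[OF refl]) (simp add: power2_eq_square algebra_simps)
    also have "\<dots> = (\<integral>x. (f x - H x)\<^sup>2 \<partial>M) + 2 * 0 + (\<integral>x. (H x - u x)\<^sup>2 \<partial>M)"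
      using i1 i4 i5 e2 by simp
    finally have g1: "(\<integral>x. (f x - H x)\<^sup>2 \<partial>M) \<le> (\<integral>x. (f x - u x)\<^sup>2 \<partial>M)" by simp
    have "(\<integral>x. (f x - (H x + \<epsilon> * G x))\<^sup>2 \<partial>M) = (\<integral>x. (f x - H x)\<^sup>2 - (2 * \<epsilon>) * ((f x - H x) * G x) + \<epsilon>\<^sup>2 * (G x)\<^sup>2 \<partial>M)"
      by (rule Bochner_Integration.integral_cong[OF refl]) (simp add: power2_eq_square algebra_simps)
    also have "\<dots> = (\<integral>x. (f x - H x)\<^sup>2 \<partial>M) - (2 * \<epsilon>) * ?c + \<epsilon>\<^sup>2 * ?D"
      using i1 i2 i3 by simp
    finally show ?thesis using e1 g1 by simp
  qed
  have "?c = 0" by (rule quadratic_bound_zero[OF D0 key])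
  moreover have "?c = (\<integral>x. f x * G x \<partial>M) - (\<integral>x. H x * G x \<partial>M)"
  proof -
    have "integrable M (\<lambda>x. f x * G x)" "integrable M (\<lambda>x. H x * G x)"
      by (rule bi, simp, rule bm[OF b(1) b(3)], rule bi, simp, rule bm[OF b(2) b(3)])
    then show ?thesis by (simp add: left_diff_distrib)
  qed
  ultimately show ?thesis by simp
qed

text \<open>Unlike \<open>rprop\<close>, this contains the empty set, which indexes the randomness
  common to the whole array.\<close>

definition psub :: "nat \<Rightarrow> nat set set" where "psub j = {B. B \<subset> {1..j}}"

definition lower :: "nat set \<Rightarrow> (nat set \<Rightarrow> real) \<Rightarrow> nat set \<Rightarrow> real" where
  "lower A v = (\<lambda>B\<in>psub (card A). v (enum A ` B))"

lemma enum_image_psub: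
  assumes "finite A" "B \<in> psub (card A)" shows "enum A ` B \<subset> A"
proof -
  have "B \<subset> {1..card A}" using assms(2) by (simp add: psub_def)
  then have "enum A ` B \<subset> enum A ` {1..card A}"
    using enum_bij[OF assms(1)] by (intro image_strict_mono) (simp_all add: bij_betw_def)
  then show ?thesis using enum_bij[OF assms(1)] by (simp add: bij_betw_def)
qed

lemma lower_measurable:
  assumes "finite A" "\<And>B. B \<subset> A \<Longrightarrow> B \<in> \<D>"
  shows "lower A \<in> measurable (PiM \<D> (\<lambda>_. borel)) (PiM (psub (card A)) (\<lambda>_. borel))"
  unfolding lower_def
proof (rule measurable_PiM_reindex, rule Pi_I)
  fix B assume "B \<in> psub (card A)"
  from assms(2)[OF enum_image_psub[OF assms(1) this]] show "enum A ` B \<in> \<D>" .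
qed

definition lowrho :: "nat set \<Rightarrow> (nat \<Rightarrow> bool) \<Rightarrow> nat set \<Rightarrow> real" where
  "lowrho A b = lower A (\<lambda>B. rho B b)"

lemma lowrho_measurable [measurable]: "lowrho A \<in> measurable bit_space (PiM (psub (card A)) (\<lambda>_. borel))"
  unfolding lowrho_def lower_def by (rule measurable_restrict) simp

lemma profile_move:
  assumes "finite B" "\<And>C. finite C \<Longrightarrow> \<pi> ` mixed B C = mixed B' (\<kappa> C)"
  shows "profile B (move \<pi> b) i = b (set_encode (mixed B' (\<kappa> (set_decode i))))"
  using assms by (simp add: profile_def move_set_encode finite_mixed)

context exchangeable_bits
begin

text \<open>Hence the conditional law of \<open>rho A\<close> given the lower variables depends on \<open>A\<close> only through its size.\<close>

lemma transfer_canonical: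
  assumes A: "finite A"
  obtains \<pi> where "inj \<pi>" "\<And>b. rho {1..card A} (move \<pi> b) = rho A b" "\<And>b. lowrho {1..card A} (move \<pi> b) = lowrho A b"
proof -
  let ?j = "card A"
  \<comment> \<open>Outside [card A] the map is shifted beyond the maximum of A, which keeps it
    injective.\<close>
  define g where "g a = (if a \<in> {1..?j} then enum A a else a + Suc (Max (insert 0 A)))" for a
  have bij: "bij_betw (enum A) {1..?j} A" by (rule enum_bij[OF A])
  have eA: "enum A a \<le> Max (insert 0 A)" if "a \<in> {1..?j}" for a
    using bij_betwE[OF bij] that A by (intro Max_ge) auto
  have g1: "g a = enum A a" if "a \<in> {1..?j}" for a using that by (simp only: g_def if_True)
  have g2: "g a = a + Suc (Max (insert 0 A))" if "a \<notin> {1..?j}" for a using that by (simp only: g_def if_False)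
  have "inj g"
  proof (rule injI)
    fix a b assume eq: "g a = g b"
    show "a = b"
    proof (cases "a \<in> {1..?j}"; cases "b \<in> {1..?j}")
      assume *: "a \<in> {1..?j}" "b \<in> {1..?j}"
      then show ?thesis using eq g1 bij_betw_imp_inj_on[OF bij] by (metis inj_onD)
    next
      assume *: "a \<in> {1..?j}" "b \<notin> {1..?j}"
      then show ?thesis using eq eA[OF *(1)] g1[OF *(1)] g2[OF *(2)] by linarith
    next
      assume *: "a \<notin> {1..?j}" "b \<in> {1..?j}"
      then show ?thesis using eq eA[OF *(2)] g2[OF *(1)] g1[OF *(2)] by linarith
    next
      assume *: "a \<notin> {1..?j}" "b \<notin> {1..?j}"
      then show ?thesis using eq g2[OF *(1)] g2[OF *(2)] by linarith
    qed
  qed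
  define \<pi> where "\<pi> v = (if even v then vact (g (v div 2)) else v)" for v
  have \<pi>act: "\<pi> (vact a) = vact (g a)" and \<pi>aux: "\<pi> (vaux c) = vaux c" for a c by (simp_all add: \<pi>_def vact_def vaux_def)
  have "inj \<pi>"
  proof (rule injI)
    fix v w assume eq: "\<pi> v = \<pi> w"
    have "even (\<pi> v) \<longleftrightarrow> even v" for v by (simp add: \<pi>_def vact_def)
    then have par: "even v \<longleftrightarrow> even w" using eq by metis
    show "v = w"
    proof (cases "even v")
      case True
      then have "g (v div 2) = g (w div 2)" using eq par by (simp add: \<pi>_def vact_def)
      then show ?thesis using True par injD[OF \<open>inj g\<close>] by (metis dvd_mult_div_cancel)
    next
      case False then show ?thesis using eq par by (simp add: \<pi>_def)
    qed
  qed
  have \<pi>mixed: "\<pi> ` mixed B C = mixed (enum A ` B) C" if "B \<subseteq> {1..?j}" for B C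
  proof -
    have "g ` B = enum A ` B" by (rule image_cong[OF refl g1]) (use that in blast)
    then show ?thesis unfolding mixed_def image_Un by (metis (no_types, lifting) \<pi>act \<pi>aux image_cong image_image)
  qed
  have rho: "rho B (move \<pi> b) = rho (enum A ` B) b" if "B \<subseteq> {1..?j}" for B b
  proof -
    have "finite B" using that finite_subset by blast
    then have "profile B (move \<pi> b) = profile (enum A ` B) b"
      using profile_move[where \<kappa> = "\<lambda>C. C", OF _ \<pi>mixed[OF that], of b] by (intro ext) (simp only: profile_def)
    then show ?thesis by (simp add: rho_def)
  qed
  show thesis
  proof (rule that[OF \<open>inj \<pi>\<close>])
    show "rho {1..?j} (move \<pi> b) = rho A b" for b using rho[of "{1..?j}"] bij by (simp add: bij_betw_def)
    show "lowrho {1..?j} (move \<pi> b) = lowrho A b" for b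
    proof -
      have "lowrho {1..?j} (move \<pi> b) = (\<lambda>B\<in>psub ?j. rho (enum {1..?j} ` B) (move \<pi> b))"
        by (simp add: lowrho_def lower_def)
      also have "\<dots> = (\<lambda>B\<in>psub ?j. rho (enum A ` B) b)"
      proof (rule restrict_ext)
        fix B assume "B \<in> psub ?j"
        then have B: "B \<subseteq> {1..?j}" by (auto simp: psub_def)
        have "enum {1..?j} ` B = (\<lambda>i. i) ` B" by (rule image_cong[OF refl enum_atLeastAtMost]) (use B in blast)
        then show "rho (enum {1..?j} ` B) (move \<pi> b) = rho (enum A ` B) b" using rho[OF B] by simp
      qed
      finally show ?thesis by (simp add: lowrho_def lower_def)
    qed
  qed
qed

end

definition fam :: "nat set set \<Rightarrow> (nat set \<Rightarrow> real) \<Rightarrow> nat set \<Rightarrow> real" where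
  "fam \<D> v = (\<lambda>B\<in>\<D>. v B)"

lemma lower_fam:
  assumes "finite A" "\<And>B. B \<subset> A \<Longrightarrow> B \<in> \<D>" shows "lower A (fam \<D> v) = lower A v"
  unfolding lower_def
proof (rule restrict_ext)
  fix B assume "B \<in> psub (card A)"
  from assms(2)[OF enum_image_psub[OF assms(1) this]] show "fam \<D> v (enum A ` B) = v (enum A ` B)" by (simp add: fam_def)
qed

lemma fam_rho_measurable [measurable]: "(\<lambda>b. fam \<D> (\<lambda>B. rho B b)) \<in> measurable bit_space (PiM \<D> (\<lambda>_. borel))"
  unfolding fam_def by (rule measurable_restrict) simp

text \<open>The absorbing injection. It fixes the active vertices of \<open>A\<close> and the
  auxiliary vertices with index below m. The other auxiliary and active vertices go to auxiliary
  indices m + even and m + odd respectively, so that they do not collide.\<close>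

definition ghost :: "nat set \<Rightarrow> nat \<Rightarrow> nat \<Rightarrow> nat" where
  "ghost A m v = (if even v then (if v div 2 \<in> A then v else vaux (m + 2 * (v div 2) + 1))
     else (if v div 2 < m then v else vaux (m + 2 * (v div 2))))"

lemma ghost_vact: "ghost A m (vact a) = (if a \<in> A then vact a else vaux (m + 2 * a + 1))"
  and ghost_vaux: "ghost A m (vaux j) = (if j < m then vaux j else vaux (m + 2 * j))"
  by (simp_all add: ghost_def vact_def vaux_def)

lemma inj_ghost: "inj (ghost A m)"
proof (rule injI)
  fix v w assume eq: "ghost A m v = ghost A m w"
  have cases: "(\<exists>a. v = vact a) \<or> (\<exists>j. v = vaux j)" for v
    unfolding vact_def vaux_def by presburger
  have vv: "vaux i = vaux j \<longleftrightarrow> i = j" "vact i = vact j \<longleftrightarrow> i = j" "vact i \<noteq> vaux j" "vaux j \<noteq> vact i" for i j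
    by (auto simp: vaux_def vact_def) presburger+
  have par: "m + 2 * a + 1 \<noteq> m + 2 * j" "2 * j \<noteq> Suc (2 * a)" for a j :: nat by presburger+
  show "v = w"
    using cases[of v] cases[of w] eq par
    by (elim disjE exE) (auto simp: ghost_vact ghost_vaux vv split: if_splits)
qed

definition ghost_aux :: "nat set \<Rightarrow> nat \<Rightarrow> nat set \<Rightarrow> nat set \<Rightarrow> nat set" where
  "ghost_aux A m B C = (\<lambda>a. m + 2 * a + 1) ` (B - A) \<union> (\<lambda>j. if j < m then j else m + 2 * j) ` C"

lemma ghost_mixed: "ghost A m ` mixed B C = mixed (B \<inter> A) (ghost_aux A m B C)"
proof -
  have "ghost A m ` vact ` B = vact ` (B \<inter> A) \<union> vaux ` (\<lambda>a. m + 2 * a + 1) ` (B - A)"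
    unfolding image_image ghost_vact by auto
  moreover have "ghost A m ` vaux ` C = vaux ` (\<lambda>j. if j < m then j else m + 2 * j) ` C"
    unfolding image_image ghost_vaux by (rule image_cong[OF refl]) simp
  ultimately show ?thesis unfolding mixed_def ghost_aux_def image_Un by (simp only: Un_assoc)
qed

context exchangeable_bits
begin

text \<open>By \<open>cond\<close>, \<open>h\<close> is a version of the conditional expectation of
  a cylinder event of \<open>profile A\<close> given the lower variables. The conclusion says that
  it remains one when all \<open>rho B\<close> with B in \<D> are known.\<close>

lemma conditional_independence:
  fixes h :: "(nat set \<Rightarrow> real) \<Rightarrow> real"
  assumes A: "finite A" and \<D>: "\<And>B. B \<in> \<D> \<Longrightarrow> finite B \<and> \<not> A \<subseteq> B" "\<And>B. B \<subset> A \<Longrightarrow> B \<in> \<D>"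
    and J: "finite J" and h[measurable]: "h \<in> borel_measurable (PiM (psub (card A)) (\<lambda>_. borel))"
    and hb: "\<And>y. \<bar>h y\<bar> \<le> 1"
    and cond: "\<And>\<phi> K. \<phi> \<in> borel_measurable (PiM (psub (card A)) (\<lambda>_. borel)) \<Longrightarrow> (\<And>y. \<bar>\<phi> y\<bar> \<le> K) \<Longrightarrow>
      (\<integral>b. of_bool (\<forall>i\<in>J. profile A b i) * \<phi> (lowrho A b) \<partial>P) = (\<integral>b. h (lowrho A b) * \<phi> (lowrho A b) \<partial>P)"
    and T[measurable]: "T \<in> sets (PiM \<D> (\<lambda>_. borel))"
  shows "(\<integral>b. of_bool (\<forall>i\<in>J. profile A b i) * indicator T (fam \<D> (\<lambda>B. rho B b)) \<partial>P)
    = (\<integral>b. h (lowrho A b) * indicator T (fam \<D> (\<lambda>B. rho B b)) \<partial>P)"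
proof -
  interpret P: prob_space P by (rule prob_P)
  define V where "V b = fam \<D> (\<lambda>B. rho B b)" for b
  have Vm[measurable]: "V \<in> measurable bit_space (PiM \<D> (\<lambda>_. borel))" unfolding V_def by (rule fam_rho_measurable)
  define f where "f b = (of_bool (\<forall>i\<in>J. profile A b i) :: real)" for b
  have fm[measurable]: "f \<in> borel_measurable bit_space"
  proof -
    have "(\<lambda>b. \<forall>i\<in>J. profile A b i) \<in> measurable bit_space (count_space UNIV)"
      by (rule measurable_compose[OF profile_measurable]) (use cylinder_sets[OF J] in \<open>simp add: pred_def\<close>)
    then show ?thesis unfolding f_def of_bool_def by measurable
  qed
  have lm[measurable]: "lower A \<in> measurable (PiM \<D> (\<lambda>_. borel)) (PiM (psub (card A)) (\<lambda>_. borel))"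
    by (rule lower_measurable[OF A \<D>(2)])
  have lowV: "lowrho A b = lower A (V b)" for b unfolding lowrho_def V_def by (rule lower_fam[OF A \<D>(2), symmetric])
  \<comment> \<open>A cylinder event involves finitely many auxiliary vertices; fixing these makes
    the event invariant under \<open>ghost A m\<close>.\<close>
  obtain m where m: "\<And>i. i \<in> J \<Longrightarrow> set_decode i \<subseteq> {..<m}"
  proof -
    have "finite (\<Union>i\<in>J. set_decode i)" using J by simp
    then obtain m where "(\<Union>i\<in>J. set_decode i) \<subseteq> {..<m}" by (metis finite_nat_iff_bounded)
    then show thesis by (intro that[of m]) blast
  qed
  let ?\<pi> = "ghost A m"
  define idx where "idx B = {i \<in> {1..card A}. enum A i \<in> B}" for B
  have idx: "idx B \<in> psub (card A)" "enum A ` idx B = B \<inter> A" if "B \<in> \<D>" for B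
  proof -
    have bij: "enum A ` {1..card A} = A" by (rule enum_eq_imp_image[OF A refl])
    have "enum A ` idx B = B \<inter> enum A ` {1..card A}" unfolding idx_def by blast
    then show im: "enum A ` idx B = B \<inter> A" unfolding bij .
    have "idx B \<noteq> {1..card A}" using im bij \<D>(1)[OF that] by auto
    then show "idx B \<in> psub (card A)" by (auto simp: psub_def idx_def)
  qed
  \<comment> \<open>After the move the profile of B is read off from that of B \<inter> A. This is a
    proper subset of A, as A is not contained in B, so all \<open>rho B\<close> become functions of
    the lower variables of A.\<close>
  define \<kappa> where "\<kappa> y = (\<lambda>B\<in>\<D>. cantor (\<lambda>i. bits (y (idx B)) (set_encode (ghost_aux A m B (set_decode i)))))" for y :: "nat set \<Rightarrow> real"
  have \<kappa>m[measurable]: "\<kappa> \<in> measurable (PiM (psub (card A)) (\<lambda>_. borel)) (PiM \<D> (\<lambda>_. borel))"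
    unfolding \<kappa>_def
  proof (rule measurable_restrict)
    fix B assume "B \<in> \<D>"
    then have [measurable]: "(\<lambda>y. y (idx B)) \<in> borel_measurable (PiM (psub (card A)) (\<lambda>_. borel))"
      by (intro measurable_component_singleton idx)
    have "(\<lambda>y. (\<lambda>i. bits (y (idx B)) (set_encode (ghost_aux A m B (set_decode i))))) \<in> measurable (PiM (psub (card A)) (\<lambda>_. borel)) bit_space"
    proof (rule measurable_bit_spaceI)
      fix i
      have "(\<lambda>y. bits (y (idx B))) \<in> measurable (PiM (psub (card A)) (\<lambda>_. borel)) bit_space" by measurable
      from measurable_compose[OF this measurable_bit]
      show "(\<lambda>y. bits (y (idx B)) (set_encode (ghost_aux A m B (set_decode i)))) \<in> measurable (PiM (psub (card A)) (\<lambda>_. borel)) (count_space UNIV)" .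
    qed
    from measurable_compose[OF this cantor_measurable]
    show "(\<lambda>y. cantor (\<lambda>i. bits (y (idx B)) (set_encode (ghost_aux A m B (set_decode i))))) \<in> borel_measurable (PiM (psub (card A)) (\<lambda>_. borel))" .
  qed
  have Vmove: "V (move ?\<pi> b) = \<kappa> (lowrho A b)" for b
    unfolding V_def fam_def \<kappa>_def
  proof (rule restrict_ext)
    fix B assume B: "B \<in> \<D>"
    have "profile B (move ?\<pi> b) i = bits (lowrho A b (idx B)) (set_encode (ghost_aux A m B (set_decode i)))" for i
    proof -
      have fg: "finite (ghost_aux A m B (set_decode i))" using \<D>(1)[OF B] by (simp add: ghost_aux_def)
      have "profile B (move ?\<pi> b) i = b (set_encode (mixed (B \<inter> A) (ghost_aux A m B (set_decode i))))"
        by (rule profile_move[OF _ ghost_mixed]) (use \<D>(1)[OF B] in simp)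
      also have "\<dots> = profile (B \<inter> A) b (set_encode (ghost_aux A m B (set_decode i)))"
        using fg by (simp add: profile_def)
      also have "\<dots> = bits (rho (B \<inter> A) b) (set_encode (ghost_aux A m B (set_decode i)))" by (simp add: rho_def)
      also have "rho (B \<inter> A) b = lowrho A b (idx B)" using idx[OF B] by (simp add: lowrho_def lower_def)
      finally show ?thesis .
    qed
    then show "rho B (move ?\<pi> b) = cantor (\<lambda>i. bits (lowrho A b (idx B)) (set_encode (ghost_aux A m B (set_decode i))))"
      unfolding rho_def by (intro arg_cong[of _ _ cantor] ext)
  qed
  have fmove: "f (move ?\<pi> b) = f b" for b
  proof -
    have "profile A (move ?\<pi> b) i = profile A b i" if "i \<in> J" for i
    proof -
      have "ghost_aux A m A (set_decode i) = set_decode i"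
        using m[OF that] by (auto simp: ghost_aux_def image_iff subset_iff)
      then show ?thesis using profile_move[OF A ghost_mixed, of A m b i] by (simp add: profile_def)
    qed
    then show ?thesis unfolding f_def by simp
  qed
  have "(\<integral>b. f b * indicator T (V b) \<partial>P) = (\<integral>b. h (lowrho A b) * indicator T (V b) \<partial>P)"
  proof (rule P.projection_orthogonal)
    show "\<bar>f b\<bar> \<le> 1" for b by (simp add: f_def)
    show "\<bar>h (lowrho A b)\<bar> \<le> 1" for b by (rule hb)
    show "\<bar>indicator T (V b) :: real\<bar> \<le> 1" for b by (simp add: indicator_def)
    fix \<epsilon> :: real
    \<comment> \<open>The perturbed predictor as a function of all known variables. Moving it gives
      a function of the lower variables with the same error, which is the competitor that the
      orthogonality lemma asks for.\<close>
    define w where "w v = h (lower A v) + \<epsilon> * indicator T v" for v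
    have wm[measurable]: "w \<in> borel_measurable (PiM \<D> (\<lambda>_. borel))" unfolding w_def by measurable
    have wb: "\<bar>w v\<bar> \<le> 1 + \<bar>\<epsilon>\<bar>" for v
      unfolding w_def using hb[of "lower A v"] by (cases "v \<in> T") (auto simp: abs_le_iff)
    define \<phi> where "\<phi> y = h y - w (\<kappa> y)" for y
    have \<phi>m[measurable]: "\<phi> \<in> borel_measurable (PiM (psub (card A)) (\<lambda>_. borel))" unfolding \<phi>_def by measurable
    have \<phi>b: "\<bar>\<phi> y\<bar> \<le> 2 + \<bar>\<epsilon>\<bar>" for y unfolding \<phi>_def using hb[of y] wb[of "\<kappa> y"] by linarith
    show "\<exists>u K. u \<in> borel_measurable P \<and> (\<forall>x. \<bar>u x\<bar> \<le> K) \<and>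
       (\<integral>x. (f x - (h (lowrho A x) + \<epsilon> * indicator T (V x)))\<^sup>2 \<partial>P) = (\<integral>x. (f x - u x)\<^sup>2 \<partial>P) \<and>
       (\<integral>x. (f x - h (lowrho A x)) * (h (lowrho A x) - u x) \<partial>P) = 0"
    proof (intro exI conjI allI)
      show "(\<lambda>b. w (V (move ?\<pi> b))) \<in> borel_measurable P" by measurable
      show "\<bar>w (V (move ?\<pi> b))\<bar> \<le> 1 + \<bar>\<epsilon>\<bar>" for b by (rule wb)
      have "(\<integral>x. (f x - (h (lowrho A x) + \<epsilon> * indicator T (V x)))\<^sup>2 \<partial>P) = (\<integral>x. (f x - w (V x))\<^sup>2 \<partial>P)"
        unfolding w_def lowV by (rule refl)
      also have "\<dots> = (\<integral>x. (f (move ?\<pi> x) - w (V (move ?\<pi> x)))\<^sup>2 \<partial>P)"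
        by (rule integral_move[OF inj_ghost, symmetric]) measurable
      finally show "(\<integral>x. (f x - (h (lowrho A x) + \<epsilon> * indicator T (V x)))\<^sup>2 \<partial>P) = (\<integral>x. (f x - w (V (move ?\<pi> x)))\<^sup>2 \<partial>P)"
        unfolding fmove .
      have b1: "\<bar>f b * \<phi> (lowrho A b)\<bar> \<le> 1 * (2 + \<bar>\<epsilon>\<bar>)" "\<bar>h (lowrho A b) * \<phi> (lowrho A b)\<bar> \<le> 1 * (2 + \<bar>\<epsilon>\<bar>)" for b
        unfolding abs_mult by (rule mult_mono, simp add: f_def, rule \<phi>b, simp, simp, rule mult_mono, rule hb, rule \<phi>b, simp, simp)
      have "(\<integral>x. (f x - h (lowrho A x)) * (h (lowrho A x) - w (V (move ?\<pi> x))) \<partial>P) = 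
        (\<integral>x. f x * \<phi> (lowrho A x) - h (lowrho A x) * \<phi> (lowrho A x) \<partial>P)"
        unfolding Vmove \<phi>_def by (rule Bochner_Integration.integral_cong[OF refl]) (simp add: algebra_simps)
      also have "\<dots> = (\<integral>x. f x * \<phi> (lowrho A x) \<partial>P) - (\<integral>x. h (lowrho A x) * \<phi> (lowrho A x) \<partial>P)"
        by (rule Bochner_Integration.integral_diff; rule P.integrable_const_bound[where B="1 * (2 + \<bar>\<epsilon>\<bar>)"])
           (use b1 in \<open>simp_all only: real_norm_def AE_I2, measurable\<close>)
      also have "\<dots> = 0" using cond[OF \<phi>m \<phi>b] unfolding f_def by simp
      finally show "(\<integral>x. (f x - h (lowrho A x)) * (h (lowrho A x) - w (V (move ?\<pi> x))) \<partial>P) = 0" .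
    qed
  qed measurable
  then show ?thesis unfolding f_def V_def .
qed

text \<open>The quantile function is built for {1..j} and carried to every set of size j by
  exchangeability. Passing it through \<open>bits\<close> and \<open>cantor\<close> puts its values
  in the Cantor set and keeps the law, since \<open>rho\<close> takes its values there.\<close>

lemma exists_coding:
  "\<exists>F. F \<in> borel_measurable (PiM (psub j) (\<lambda>_. borel) \<Otimes>\<^sub>M unit_interval) \<and> (\<forall>w. cantor (bits (F w)) = F w) \<and>
    (\<forall>A (g :: _ \<Rightarrow> real) K. finite A \<and> card A = j \<and> g \<in> borel_measurable (PiM (psub j) (\<lambda>_. borel) \<Otimes>\<^sub>M borel) \<and> (\<forall>z. \<bar>g z\<bar> \<le> K) \<longrightarrow>
      (\<integral>b. g (lowrho A b, rho A b) \<partial>P) = (\<integral>b. \<integral>u. g (lowrho A b, F (lowrho A b, u)) \<partial>unit_interval \<partial>P))"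
proof -
  interpret P: prob_space P by (rule prob_P)
  interpret U: prob_space unit_interval by (rule prob_space_unit_interval)
  let ?S = "PiM (psub j) (\<lambda>_. borel) :: (nat set \<Rightarrow> real) measure"
  have Y: "lowrho {1..j} \<in> measurable P ?S" using lowrho_measurable[of "{1..j}"] measurable_cong_sets[OF sets_P refl] by auto
  have R: "rho {1..j} \<in> borel_measurable P" by measurable
  have R01: "0 \<le> rho {1..j} b \<and> rho {1..j} b \<le> 1" for b using cantor_bounds by (simp add: rho_def)
  from conditional_quantile[OF prob_P Y R R01] obtain f where f[measurable]: "f \<in> borel_measurable (?S \<Otimes>\<^sub>M unit_interval)"
    and eq: "distr P (?S \<Otimes>\<^sub>M borel) (\<lambda>x. (lowrho {1..j} x, rho {1..j} x)) =
      distr (P \<Otimes>\<^sub>M unit_interval) (?S \<Otimes>\<^sub>M borel) (\<lambda>(x, u). (lowrho {1..j} x, f (lowrho {1..j} x, u)))" by blast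
  define F where "F w = cantor (bits (f w))" for w
  have Fm[measurable]: "F \<in> borel_measurable (?S \<Otimes>\<^sub>M unit_interval)" unfolding F_def by measurable
  have main: "(\<integral>b. g (lowrho A b, rho A b) \<partial>P) = (\<integral>b. \<integral>u. g (lowrho A b, F (lowrho A b, u)) \<partial>unit_interval \<partial>P)"
    if A: "finite A" "card A = j" and g[measurable]: "g \<in> borel_measurable (?S \<Otimes>\<^sub>M borel)" and b: "\<And>z. \<bar>g z\<bar> \<le> K" for A g and K :: real
  proof -
    from transfer_canonical[OF A(1), unfolded A(2)] obtain \<pi> where \<pi>: "inj \<pi>" 
      "\<And>b. rho {1..j} (move \<pi> b) = rho A b" "\<And>b. lowrho {1..j} (move \<pi> b) = lowrho A b" by blast
    have Yb[measurable]: "lowrho {1..j} \<in> measurable bit_space ?S" using lowrho_measurable[of "{1..j}"] by simp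
    have g': "(\<lambda>(y, r). g (y, cantor (bits r))) \<in> borel_measurable (?S \<Otimes>\<^sub>M borel)" by measurable
    have "(\<integral>b. g (lowrho A b, rho A b) \<partial>P) = (\<integral>b. g (lowrho {1..j} (move \<pi> b), rho {1..j} (move \<pi> b)) \<partial>P)"
      by (simp only: \<pi>(2,3))
    also have "\<dots> = (\<integral>b. g (lowrho {1..j} b, rho {1..j} b) \<partial>P)" by (rule integral_move[OF \<pi>(1)]) measurable
    also have "\<dots> = (\<integral>b. (\<lambda>(y, r). g (y, cantor (bits r))) (lowrho {1..j} b, rho {1..j} b) \<partial>P)" by (simp add: rho_def)
    also have "\<dots> = (\<integral>b. \<integral>u. (\<lambda>(y, r). g (y, cantor (bits r))) (lowrho {1..j} b, f (lowrho {1..j} b, u)) \<partial>unit_interval \<partial>P)"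
      by (rule conditional_quantile_integral[OF prob_P Y R f eq g', of K]) (use b in \<open>simp add: split_beta\<close>)
    also have "\<dots> = (\<integral>b. \<integral>u. g (lowrho {1..j} b, F (lowrho {1..j} b, u)) \<partial>unit_interval \<partial>P)" by (simp add: F_def)
    also have "\<dots> = (\<integral>b. \<integral>u. g (lowrho {1..j} (move \<pi> b), F (lowrho {1..j} (move \<pi> b), u)) \<partial>unit_interval \<partial>P)"
      by (rule integral_move[OF \<pi>(1), symmetric]) measurable
    finally show ?thesis by (simp only: \<pi>(3))
  qed
  show ?thesis
  proof (rule exI[of _ F], intro conjI allI impI)
    show "cantor (bits (F w)) = F w" for w by (simp add: F_def)
    show "(\<integral>b. g (lowrho A b, rho A b) \<partial>P) = (\<integral>b. \<integral>u. g (lowrho A b, F (lowrho A b, u)) \<partial>unit_interval \<partial>P)"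
      if "finite A \<and> card A = j \<and> g \<in> borel_measurable (?S \<Otimes>\<^sub>M borel) \<and> (\<forall>z. \<bar>g z\<bar> \<le> K)" for A g and K :: real
      by (rule main[of A g K]) (use that in blast)+
  qed (rule Fm)
qed

end


text \<open>The coded array: each variable is computed from those of its proper subsets and one
  fresh uniform variable. The guard makes the recursion well-founded, and \<open>undefined\<close>
  is the value of \<open>restrict\<close> outside its domain, so that the first argument is
  \<open>lower A (zhat F x)\<close>.\<close>

function zhat :: "(nat \<Rightarrow> (nat set \<Rightarrow> real) \<times> real \<Rightarrow> real) \<Rightarrow> (nat set \<Rightarrow> real) \<Rightarrow> nat set \<Rightarrow> real" where
  "zhat F x A = F (card A) (\<lambda>B. if B \<subset> {1..card A} then zhat F x (enum A ` B) else undefined, x A)"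
  by pat_completeness auto
termination
proof (relation "Wellfounded.measure (\<lambda>(F, x, A). card A)")
  fix A B assume "B \<subset> {1..card (A :: nat set)}"
  then have "card B < card {1..card A}" by (intro psubset_card_mono) simp_all
  moreover have "card (enum A ` B) \<le> card B" using \<open>B \<subset> {1..card A}\<close> by (intro card_image_le) (meson finite_atLeastAtMost finite_subset psubset_imp_subset)
  ultimately show "((F, x, enum A ` B), (F, x, A)) \<in> Wellfounded.measure (\<lambda>(F, x, A). card A)" for F x by simp
qed simp

declare zhat.simps [simp del]

lemma zhat_eq: "zhat F x A = F (card A) (lower A (zhat F x), x A)"
  unfolding zhat.simps[of F x A] lower_def psub_def restrict_def by simp

lemma zhat_measurable:
  assumes F: "\<And>j. F j \<in> borel_measurable (PiM (psub j) (\<lambda>_. borel) \<Otimes>\<^sub>M unit_interval)"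
    and A: "finite A" "Pow A \<subseteq> \<D>"
  shows "(\<lambda>x. zhat F x A) \<in> borel_measurable (cube \<D>)"
  using A
proof (induction "card A" arbitrary: A rule: less_induct)
  case less
  have "(\<lambda>x. lower A (zhat F x)) \<in> measurable (cube \<D>) (PiM (psub (card A)) (\<lambda>_. borel))"
    unfolding lower_def
  proof (rule measurable_restrict)
    fix B assume "B \<in> psub (card A)"
    then have *: "enum A ` B \<subset> A" by (rule enum_image_psub[OF less.prems(1)])
    show "(\<lambda>x. zhat F x (enum A ` B)) \<in> borel_measurable (cube \<D>)"
      by (rule less.hyps[OF psubset_card_mono[OF less.prems(1) *]]) (rule finite_subset[OF psubset_imp_subset[OF *] less.prems(1)], rule order_trans[OF Pow_mono[OF psubset_imp_subset[OF *]] less.prems(2)])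
  qed
  moreover have "(\<lambda>x. x A) \<in> measurable (cube \<D>) unit_interval"
    unfolding cube_def by (rule measurable_component_singleton) (use less.prems in auto)
  ultimately have "(\<lambda>x. (lower A (zhat F x), x A)) \<in> measurable (cube \<D>) (PiM (psub (card A)) (\<lambda>_. borel) \<Otimes>\<^sub>M unit_interval)"
    by (rule measurable_Pair)
  from measurable_compose[OF this F] show ?case unfolding zhat_eq[of F _ A] .
qed

lemma zhat_cong:
  assumes "finite A" "\<And>B. B \<subseteq> A \<Longrightarrow> x B = y B" shows "zhat F x A = zhat F y A"
  using assms
proof (induction "card A" arbitrary: A rule: less_induct)
  case less
  have "lower A (zhat F x) = lower A (zhat F y)"
    unfolding lower_def
  proof (rule restrict_ext)
    fix B assume "B \<in> psub (card A)"
    then have *: "enum A ` B \<subset> A" by (rule enum_image_psub[OF less.prems(1)])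
    show "zhat F x (enum A ` B) = zhat F y (enum A ` B)"
      by (rule less.hyps[OF psubset_card_mono[OF less.prems(1) *]]) (rule finite_subset[OF psubset_imp_subset[OF *] less.prems(1)], rule less.prems(2)[OF order_trans[OF _ psubset_imp_subset[OF *]]])
  qed
  then show ?case unfolding zhat_eq[of F _ A] using less.prems(2)[of A] by simp
qed

text \<open>The coding sees only the order type of a set, because enumerations compose.\<close>

lemma zhat_enum:
  assumes A: "finite A" "B \<subseteq> {1..card A}"
  shows "zhat F (\<lambda>C. x (enum A ` C)) B = zhat F x (enum A ` B)"
  using A(2)
proof (induction "card B" arbitrary: B rule: less_induct)
  case less
  have B: "finite B" using less.prems finite_subset by blast
  have inj: "inj_on (enum A) B" using enum_bij[OF A(1)] less.prems by (auto simp: bij_betw_def intro: inj_on_subset)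
  have c: "card (enum A ` B) = card B" by (rule card_image[OF inj])
  have "lower B (zhat F (\<lambda>C. x (enum A ` C))) = lower (enum A ` B) (zhat F x)"
    unfolding lower_def c
  proof (rule restrict_ext)
    fix C assume C: "C \<in> psub (card B)"
    then have *: "enum B ` C \<subset> B" by (rule enum_image_psub[OF B])
    have "zhat F (\<lambda>C. x (enum A ` C)) (enum B ` C) = zhat F x (enum A ` enum B ` C)"
      by (rule less.hyps[OF psubset_card_mono[OF B *]]) (use * less.prems in auto)
    also have "enum A ` enum B ` C = enum (enum A ` B) ` C"
      unfolding image_image by (rule image_cong[OF refl enum_enum_image[OF A(1) less.prems, symmetric]]) (use C in \<open>auto simp: psub_def\<close>)
    finally show "zhat F (\<lambda>C. x (enum A ` C)) (enum B ` C) = zhat F x (enum (enum A ` B) ` C)" .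
  qed
  then show ?case unfolding zhat_eq[of F _ B] zhat_eq[of F _ "enum A ` B"] c by simp
qed

context exchangeable_bits
begin

text \<open>Induction on a downward closed family, removing a member of largest size. What remains
  is downward closed and contains no superset of it, so the conditional law of its variable given
  the rest is the one given its own proper subsets, which \<open>F\<close> reproduces.\<close>

theorem Aldous_Hoover:
  "\<exists>F. (\<forall>j. F j \<in> borel_measurable (PiM (psub j) (\<lambda>_. borel) \<Otimes>\<^sub>M unit_interval)) \<and>
    (\<forall>\<D>. finite \<D> \<and> (\<forall>A\<in>\<D>. finite A \<and> Pow A \<subseteq> \<D>) \<longrightarrow>
      distr P (PiM \<D> (\<lambda>_. borel)) (\<lambda>b. fam \<D> (\<lambda>B. rho B b)) = distr (cube \<D>) (PiM \<D> (\<lambda>_. borel)) (\<lambda>x. fam \<D> (zhat F x)))"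
proof -
  interpret P: prob_space P by (rule prob_P)
  interpret U: prob_space unit_interval by (rule prob_space_unit_interval)
  interpret PU: product_prob_space "\<lambda>_. unit_interval" UNIV ..
  define Q where "Q j F \<longleftrightarrow> F \<in> borel_measurable (PiM (psub j) (\<lambda>_. borel) \<Otimes>\<^sub>M unit_interval) \<and> (\<forall>w. cantor (bits (F w)) = F w) \<and>
    (\<forall>A (g :: _ \<Rightarrow> real) K. finite A \<and> card A = j \<and> g \<in> borel_measurable (PiM (psub j) (\<lambda>_. borel) \<Otimes>\<^sub>M borel) \<and> (\<forall>z. \<bar>g z\<bar> \<le> K) \<longrightarrow>
      (\<integral>b. g (lowrho A b, rho A b) \<partial>P) = (\<integral>b. \<integral>u. g (lowrho A b, F (lowrho A b, u)) \<partial>unit_interval \<partial>P))" for j F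
  have "\<forall>j. \<exists>F. Q j F" unfolding Q_def by (rule allI) (rule exists_coding)
  then obtain F where F: "\<And>j. Q j (F j)" by metis
  have Fm[measurable]: "F j \<in> borel_measurable (PiM (psub j) (\<lambda>_. borel) \<Otimes>\<^sub>M unit_interval)" for j
    using F[of j, unfolded Q_def, THEN conjunct1] .
  have Fc: "cantor (bits (F j w)) = F j w" for j w
    using F[of j, unfolded Q_def, THEN conjunct2, THEN conjunct1, rule_format] .
  have Fi: "(\<integral>b. g (lowrho A b, rho A b) \<partial>P) = (\<integral>b. \<integral>u. g (lowrho A b, F (card A) (lowrho A b, u)) \<partial>unit_interval \<partial>P)"
    if "finite A" "g \<in> borel_measurable (PiM (psub (card A)) (\<lambda>_. borel) \<Otimes>\<^sub>M borel)" "\<And>z. \<bar>g z\<bar> \<le> (K::real)" for A g K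
    using F[of "card A", unfolded Q_def, THEN conjunct2, THEN conjunct2, rule_format, of A g K] that by simp
  have law: "distr P (PiM \<D> (\<lambda>_. borel)) (\<lambda>b. fam \<D> (\<lambda>B. rho B b)) = distr (cube \<D>) (PiM \<D> (\<lambda>_. borel)) (\<lambda>x. fam \<D> (zhat F x))"
    if "finite \<D>" "\<And>A. A \<in> \<D> \<Longrightarrow> finite A \<and> Pow A \<subseteq> \<D>" for \<D>
    using that
  proof (induction "card \<D>" arbitrary: \<D> rule: less_induct)
    case less
    show ?case
    proof (cases "\<D> = {}")
      case True
      have "fam {} v = (\<lambda>_. undefined)" for v by (simp add: fam_def restrict_def)
      moreover have c: "(\<lambda>_. undefined) \<in> space (PiM {} (\<lambda>_. borel) :: (nat set \<Rightarrow> real) measure)" by (simp add: space_PiM)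
      ultimately show ?thesis unfolding True
        by (simp only: P.distr_const[OF c] prob_space.distr_const[OF prob_space_cube c])
    next
      case False
      have fc: "finite (card ` \<D>)" "card ` \<D> \<noteq> {}" using less.prems(1) False by simp_all
      obtain A where A: "A \<in> \<D>" and Am: "card A = Max (card ` \<D>)" using Max_in[OF fc] by auto
      have max: "card B \<le> card A" if "B \<in> \<D>" for B unfolding Am by (rule Max_ge[OF fc(1) imageI[OF that]])
      define \<D>' where "\<D>' = \<D> - {A}"
      have fA: "finite A" using less.prems(2)[OF A] by blast
      have ins: "\<D> = insert A \<D>'" and nin: "A \<notin> \<D>'" and fD': "finite \<D>'" using A less.prems(1) by (auto simp: \<D>'_def)
      have notsub: "finite B \<and> \<not> A \<subseteq> B" if "B \<in> \<D>'" for B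
      proof -
        have B: "B \<in> \<D>" "B \<noteq> A" using that by (auto simp: \<D>'_def)
        then show ?thesis using max[OF B(1)] less.prems(2)[OF B(1)] card_seteq[of B A] by blast
      qed
      have sub: "B \<in> \<D>'" if "B \<subset> A" for B using that less.prems(2)[OF A] by (auto simp: \<D>'_def)
      have down: "finite B \<and> Pow B \<subseteq> \<D>'" if "B \<in> \<D>'" for B
      proof -
        have "Pow B \<subseteq> \<D>" using less.prems(2)[of B] that by (auto simp: \<D>'_def)
        moreover have "A \<notin> Pow B" using notsub[OF that] by blast
        ultimately show ?thesis using notsub[OF that] by (auto simp: \<D>'_def)
      qed
      let ?N = "PiM \<D>' (\<lambda>_. borel) :: (nat set \<Rightarrow> real) measure"
      let ?V = "\<lambda>b. fam \<D>' (\<lambda>B. rho B b)" and ?Z = "\<lambda>x. fam \<D>' (zhat F x)"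
      have IH: "distr P ?N ?V = distr (cube \<D>') ?N ?Z"
        by (rule less.hyps) (use ins nin fD' less.prems(1) down in auto)
      have Vm[measurable]: "?V \<in> measurable P ?N" by measurable
      have Zm: "?Z \<in> measurable (cube \<E>) ?N" if "\<D>' \<subseteq> \<E>" for \<E>
        unfolding fam_def
      proof (rule measurable_restrict)
        fix B assume "B \<in> \<D>'"
        note * = down[OF this]
        show "(\<lambda>x. zhat F x B) \<in> borel_measurable (cube \<E>)"
          by (rule zhat_measurable[OF Fm conjunct1[OF *] order_trans[OF conjunct2[OF *] that]])
      qed
      note Zm'[measurable] = Zm[OF subset_refl]
      have \<D>\<D>': "\<D>' \<subseteq> \<D>" by (auto simp: \<D>'_def)
      have lm[measurable]: "lower A \<in> measurable ?N (PiM (psub (card A)) (\<lambda>_. borel))" by (rule lower_measurable[OF fA sub])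
      define E where "E x = bits (zhat F x A)" for x
      have Em: "E \<in> measurable (cube \<D>) bit_space" unfolding E_def
        by (rule measurable_compose[OF zhat_measurable[OF Fm fA conjunct2[OF less.prems(2)[OF A]]] bits_measurable])
      let ?L = "distr P (?N \<Otimes>\<^sub>M bit_space) (\<lambda>b. (?V b, profile A b))"
      let ?R = "distr (cube \<D>) (?N \<Otimes>\<^sub>M bit_space) (\<lambda>x. (?Z x, E x))"
      have Lm: "(\<lambda>b. (?V b, profile A b)) \<in> measurable P (?N \<Otimes>\<^sub>M bit_space)" by measurable
      have Rm: "(\<lambda>x. (?Z x, E x)) \<in> measurable (cube \<D>) (?N \<Otimes>\<^sub>M bit_space)"
        by (rule measurable_Pair[OF Zm[OF \<D>\<D>'] Em])
      interpret L: prob_space ?L by (rule P.prob_space_distr[OF Lm])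
      interpret R: prob_space ?R by (rule prob_space.prob_space_distr[OF prob_space_cube Rm])
      have LR: "?L = ?R"
      proof (rule measure_eq_rectangle_cylinders)
        fix T J assume T[measurable]: "T \<in> sets ?N" and J: "finite (J :: nat set)"
        define k :: "(nat \<Rightarrow> bool) \<Rightarrow> real" where "k c = of_bool (\<forall>i\<in>J. c i)" for c
        have km[measurable]: "k \<in> borel_measurable bit_space"
          unfolding k_def of_bool_def using cylinder_sets[OF J] by (intro measurable_If) (auto simp: pred_def)
        have kb: "0 \<le> k c \<and> k c \<le> 1" for c by (simp add: k_def)
        define h where "h y = (\<integral>u. k (bits (F (card A) (y, u))) \<partial>unit_interval)" for y
        have hm[measurable]: "h \<in> borel_measurable (PiM (psub (card A)) (\<lambda>_. borel))" unfolding h_def by measurable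
        \<comment> \<open>Here y ranges over all functions, also outside the product space; where
          the integrand is not measurable the integral is 0 by convention.\<close>
        have h01: "0 \<le> h y \<and> h y \<le> 1" for y
        proof (cases "(\<lambda>u. k (bits (F (card A) (y, u)))) \<in> borel_measurable unit_interval")
          case True then show ?thesis unfolding h_def by (rule U.integral_unit) (rule kb)
        next
          case False
          then have "\<not> integrable unit_interval (\<lambda>u. k (bits (F (card A) (y, u))))" by auto
          then show ?thesis unfolding h_def by (simp add: not_integrable_integral_eq)
        qed
        have TJ: "T \<times> {b. \<forall>i\<in>J. b i} \<in> sets (?N \<Otimes>\<^sub>M bit_space)" using T cylinder_sets[OF J] by (rule pair_measureI)
        have ind: "indicator (T \<times> {b. \<forall>i\<in>J. b i}) (v, c) = (k c * indicator T v :: real)" for v c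
          by (auto simp: k_def indicator_def)
        have "measure ?L (T \<times> {b. \<forall>i\<in>J. b i}) = (\<integral>z. indicator (T \<times> {b. \<forall>i\<in>J. b i}) z \<partial>?L)"
          using TJ by simp
        also have "\<dots> = (\<integral>b. k (profile A b) * indicator T (?V b) \<partial>P)"
          unfolding ind[symmetric] by (rule integral_distr[OF Lm]) (use TJ in simp)
        \<comment> \<open>Conditional independence replaces the event of A by its conditional
          probability. Only variables of \<D>' are left, and the induction hypothesis applies to
          them.\<close>
        also have "\<dots> = (\<integral>b. h (lowrho A b) * indicator T (?V b) \<partial>P)"
          unfolding k_def
        proof (rule conditional_independence[OF fA notsub sub J hm])
          show "\<bar>h y\<bar> \<le> 1" for y using h01[of y] by simp
          fix \<phi> :: "(nat set \<Rightarrow> real) \<Rightarrow> real" and K assume \<phi>[measurable]: "\<phi> \<in> borel_measurable (PiM (psub (card A)) (\<lambda>_. borel))"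
            and b: "\<And>y. \<bar>\<phi> y\<bar> \<le> K"
          have "(\<integral>b. (\<lambda>(y, r). k (bits r) * \<phi> y) (lowrho A b, rho A b) \<partial>P) =
             (\<integral>b. \<integral>u. (\<lambda>(y, r). k (bits r) * \<phi> y) (lowrho A b, F (card A) (lowrho A b, u)) \<partial>unit_interval \<partial>P)"
          proof (rule Fi[OF fA])
            show "(\<lambda>(y, r). k (bits r) * \<phi> y) \<in> borel_measurable (PiM (psub (card A)) (\<lambda>_. borel) \<Otimes>\<^sub>M borel)" by measurable
            show "\<bar>(\<lambda>(y, r). k (bits r) * \<phi> y) z\<bar> \<le> 1 * K" for z
              unfolding split_beta abs_mult by (rule mult_mono) (use kb b in auto)
          qed
          then show "(\<integral>b. of_bool (\<forall>i\<in>J. profile A b i) * \<phi> (lowrho A b) \<partial>P) = (\<integral>b. h (lowrho A b) * \<phi> (lowrho A b) \<partial>P)"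
            by (simp add: h_def k_def rho_def)
        qed (assumption | rule T)+
        also have "\<dots> = (\<integral>b. h (lower A (?V b)) * indicator T (?V b) \<partial>P)"
          by (simp only: lower_fam[OF fA sub] lowrho_def)
        also have "\<dots> = (\<integral>v. h (lower A v) * indicator T v \<partial>distr P ?N ?V)"
          by (rule integral_distr[symmetric, OF Vm]) measurable
        also have "\<dots> = (\<integral>x. h (lower A (?Z x)) * indicator T (?Z x) \<partial>cube \<D>')"
          unfolding IH by (rule integral_distr[OF Zm']) measurable
        also have "\<dots> = (\<integral>x. \<integral>u. k (E (x(A := u))) * indicator T (?Z (x(A := u))) \<partial>unit_interval \<partial>cube \<D>')"
        proof (rule Bochner_Integration.integral_cong[OF refl])
          fix x assume x: "x \<in> space (cube \<D>')"
          have z: "zhat F (x(A := u)) B = zhat F x B" if "B \<in> \<D>'" for B u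
            by (rule zhat_cong) (use notsub[OF that] in auto)
          have Z: "?Z (x(A := u)) = ?Z x" for u unfolding fam_def by (rule restrict_ext[OF z])
          have "lower A (zhat F (x(A := u))) = lower A (?Z x)" for u
            using lower_fam[OF fA sub, of "zhat F (x(A := u))"] unfolding Z by simp
          then have "E (x(A := u)) = bits (F (card A) (lower A (?Z x), u))" for u
            unfolding E_def zhat_eq[of F _ A] by simp
          then show "h (lower A (?Z x)) * indicator T (?Z x) = (\<integral>u. k (E (x(A := u))) * indicator T (?Z (x(A := u))) \<partial>unit_interval)"
            unfolding Z h_def by simp
        qed
        also have "\<dots> = (\<integral>x. k (E x) * indicator T (?Z x) \<partial>cube \<D>)"
          unfolding ins cube_def
        proof (rule PU.product_integral_insert[OF fD' nin, symmetric])
          show "integrable (PiM (insert A \<D>') (\<lambda>_. unit_interval)) (\<lambda>x. k (E x) * indicator T (?Z x))"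
            unfolding ins[symmetric] cube_def[symmetric]
          proof (rule prob_space.integrable_unit[OF prob_space_cube])
            show "(\<lambda>x. k (E x) * indicator T (?Z x)) \<in> borel_measurable (cube \<D>)"
              by (intro borel_measurable_times measurable_compose[OF Em km] measurable_compose[OF Zm[OF \<D>\<D>'] borel_measurable_indicator[OF T]])
          qed (auto simp: kb indicator_def)
        qed
        also have "\<dots> = (\<integral>z. indicator (T \<times> {b. \<forall>i\<in>J. b i}) z \<partial>?R)"
          unfolding ind[symmetric] by (rule integral_distr[symmetric, OF Rm]) (use TJ in simp)
        also have "\<dots> = measure ?R (T \<times> {b. \<forall>i\<in>J. b i})" using TJ by simp
        finally show "emeasure ?L (T \<times> {b. \<forall>i\<in>J. b i}) = emeasure ?R (T \<times> {b. \<forall>i\<in>J. b i})"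
          by (simp add: L.emeasure_eq_measure R.emeasure_eq_measure)
      qed (simp_all add: L.emeasure_space_1)
      \<comment> \<open>Restores the variable of A from its bits. Nothing is lost, because
        \<open>F\<close> takes values in the Cantor set.\<close>
      define G where "G = (\<lambda>(v :: nat set \<Rightarrow> real, c). v(A := cantor c))"
      have Gm: "G \<in> measurable (?N \<Otimes>\<^sub>M bit_space) (PiM \<D> (\<lambda>_. borel))"
        unfolding G_def ins split_beta
        by (rule measurable_fun_upd[of _ \<D>' A]) (simp, rule measurable_fst, rule measurable_compose[OF measurable_snd cantor_measurable])
      have g1: "fam \<D> (\<lambda>B. rho B b) = G (?V b, profile A b)" for b
        unfolding G_def ins fam_def using nin by (auto simp: fun_eq_iff rho_def)
      have g2: "fam \<D> (zhat F x) = G (?Z x, E x)" for x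
      proof -
        have "cantor (E x) = zhat F x A" unfolding E_def zhat_eq[of F x A] by (rule Fc)
        then show ?thesis unfolding G_def ins fam_def using nin by (auto simp: fun_eq_iff)
      qed
      have "distr P (PiM \<D> (\<lambda>_. borel)) (\<lambda>b. fam \<D> (\<lambda>B. rho B b)) = distr ?L (PiM \<D> (\<lambda>_. borel)) G"
        unfolding g1 by (subst distr_distr[OF Gm Lm]) (simp add: comp_def)
      also have "\<dots> = distr (cube \<D>) (PiM \<D> (\<lambda>_. borel)) (\<lambda>x. fam \<D> (zhat F x))"
        unfolding g2 LR by (subst distr_distr[OF Gm Rm]) (simp add: comp_def)
      finally show ?thesis .
    qed
  qed
  show ?thesis by (rule exI[of _ F], intro conjI allI impI, rule Fm, rule law) blast+
qed

end

subsection \<open>Compactness\<close>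

lemma measurable_PiM_uniform:
  assumes "finite I" "finite V" "V \<noteq> {}" "\<And>x. f x \<in> space N"
  shows "f \<in> measurable (PiM I (\<lambda>_. uniform_count_measure V)) N"
  unfolding PiM_uniform[OF assms(1-3)]
  using assms(4) by (simp add: measurable_def space_uniform_count_measure sets_uniform_count_measure)

text \<open>The random sample of G as a bit sequence. The map \<phi> places all natural numbers at
  once, so that one measure carries the samples of every finite size.\<close>

definition gbits :: "nat \<Rightarrow> hgraph \<Rightarrow> (nat \<Rightarrow> nat) \<Rightarrow> nat \<Rightarrow> bool" where
  "gbits k G \<phi> i \<longleftrightarrow> card (set_decode i) = k \<and> \<phi> ` set_decode i \<in> edges G"

definition gdens :: "nat \<Rightarrow> hgraph \<Rightarrow> nat set \<Rightarrow> real" where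
  "gdens k G J = (\<integral>\<phi>. of_bool (\<forall>i\<in>J. gbits k G \<phi> i) \<partial>PiM UNIV (\<lambda>_. uniform_count_measure (verts G)))"

lemma gbits_measurable:
  assumes "finite (verts G)" "verts G \<noteq> {}"
  shows "gbits k G \<in> measurable (PiM UNIV (\<lambda>_. uniform_count_measure (verts G))) bit_space"
proof (rule measurable_bit_spaceI)
  fix i
  have "(\<lambda>\<phi>. gbits k G (restrict \<phi> (set_decode i)) i) \<in> measurable (PiM UNIV (\<lambda>_. uniform_count_measure (verts G))) (count_space UNIV)"
    by (rule measurable_compose[OF measurable_restrict_PiM[OF subset_UNIV] measurable_PiM_uniform[OF finite_set_decode assms]]) simp
  moreover have "gbits k G (restrict \<phi> (set_decode i)) i = gbits k G \<phi> i" for \<phi>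
    unfolding gbits_def by (simp only: image_restrict_eq)
  ultimately show "(\<lambda>\<phi>. gbits k G \<phi> i) \<in> measurable (PiM UNIV (\<lambda>_. uniform_count_measure (verts G))) (count_space UNIV)"
    by (simp only:)
qed

lemma cylinder_ind_measurable:
  assumes "finite J" shows "(\<lambda>b. of_bool (\<forall>i\<in>J. b i) :: real) \<in> borel_measurable bit_space"
  unfolding of_bool_def using cylinder_sets[OF assms] by (intro measurable_If) (auto simp: pred_def)

lemma prod_digit_cantor:
  assumes "finite J" shows "(\<Prod>i\<in>J. digit i (cantor b)) = of_bool (\<forall>i\<in>J. b i)"
  unfolding digit_cantor using assms by (cases "\<forall>i\<in>J. b i") (auto intro!: prod.neutral prod_zero)

lemma gdens_t_graph:
  assumes H: "kgraph k H" and G: "finite (verts G)" "verts G \<noteq> {}"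
  shows "gdens k G (set_encode ` edges H) = t_graph H G"
proof -
  have "(\<forall>i\<in>set_encode ` edges H. gbits k G \<phi> i) \<longleftrightarrow> (\<forall>e\<in>edges H. \<phi> ` e \<in> edges G)" for \<phi>
  proof -
    have "gbits k G \<phi> (set_encode e) \<longleftrightarrow> \<phi> ` e \<in> edges G" if "e \<in> edges H" for e
      using kgraph_edgeD(3,4)[OF H that] by (simp add: gbits_def)
    then show ?thesis by simp
  qed
  then show ?thesis unfolding gdens_def t_graph_integral_superset[OF H G subset_UNIV] hom_ind_eq[OF kgraph_finite_edges[OF H]]
    by (simp only:)
qed

lemma gdens_move:
  assumes \<pi>: "inj \<pi>" and J: "finite J" and G: "finite (verts G)" "verts G \<noteq> {}"
  shows "gdens k G ((\<lambda>i. set_encode (\<pi> ` set_decode i)) ` J) = gdens k G J"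
proof -
  let ?P = "PiM UNIV (\<lambda>_. uniform_count_measure (verts G)) :: (nat \<Rightarrow> nat) measure"
  have m: "(\<lambda>\<phi>. of_bool (\<forall>i\<in>J. gbits k G \<phi> i) :: real) \<in> borel_measurable ?P"
    by (rule measurable_compose[OF gbits_measurable[OF G] cylinder_ind_measurable[OF J]])
  have "gdens k G J = (\<integral>\<phi>. of_bool (\<forall>i\<in>J. gbits k G (\<lambda>j\<in>UNIV. \<phi> (\<pi> j)) i) \<partial>?P)"
    unfolding gdens_def
    by (rule integral_PiM_reindex[symmetric, OF prob_space_uniform_count_measure[OF G] _ _ m]) (use \<pi> in auto)
  also have "\<dots> = (\<integral>\<phi>. of_bool (\<forall>i\<in>(\<lambda>i. set_encode (\<pi> ` set_decode i)) ` J. gbits k G \<phi> i) \<partial>?P)"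
  proof -
    have "gbits k G (\<lambda>j\<in>UNIV. \<phi> (\<pi> j)) i \<longleftrightarrow> gbits k G \<phi> (set_encode (\<pi> ` set_decode i))" for \<phi> i
      using card_image[OF inj_on_subset[OF \<pi>, of "set_decode i"]] by (simp add: gbits_def image_image)
    then show ?thesis by simp
  qed
  finally show ?thesis by (simp add: gdens_def)
qed

text \<open>As Cantor numbers the sampled arrays lie in [0,1] and form a tight sequence. Indicators
  of cylinders are products of digits, which are continuous, so their probabilities pass to the weak
  limit.\<close>

lemma exchangeable_limit:
  assumes G: "\<And>n. finite (verts (G n)) \<and> verts (G n) \<noteq> {}"
  obtains s P where "strict_mono (s :: nat \<Rightarrow> nat)" "exchangeable_bits P"
    "\<And>J. finite J \<Longrightarrow> (\<lambda>n. gdens k (G (s n)) J) \<longlonglongrightarrow> measure P {b. \<forall>i\<in>J. b i}"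
proof -
  let ?Q = "\<lambda>n. PiM UNIV (\<lambda>_. uniform_count_measure (verts (G n))) :: (nat \<Rightarrow> nat) measure"
  have pQ: "prob_space (?Q n)" for n by (intro prob_space_PiM prob_space_uniform_count_measure) (use G[of n] in auto)
  have gm: "gbits k (G n) \<in> measurable (?Q n) bit_space" for n by (rule gbits_measurable) (use G[of n] in auto)
  define \<mu> where "\<mu> n = distr (?Q n) borel (\<lambda>\<phi>. cantor (gbits k (G n) \<phi>))" for n
  have cm: "(\<lambda>\<phi>. cantor (gbits k (G n) \<phi>)) \<in> borel_measurable (?Q n)" for n
    by (rule measurable_compose[OF gm cantor_measurable])
  have rd: "real_distribution (\<mu> n)" for n unfolding \<mu>_def by (rule prob_space.real_distribution_distr[OF pQ cm])
  have "tight \<mu>" unfolding tight_def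
  proof (intro conjI allI impI)
    fix \<epsilon> :: real assume \<epsilon>: "\<epsilon> > 0"
    have "measure (\<mu> n) {-1<..1} = 1" for n
    proof -
      have "(\<lambda>\<phi>. cantor (gbits k (G n) \<phi>)) -` {-1<..1} \<inter> space (?Q n) = space (?Q n)"
        using cantor_bounds(2) less_le_trans[OF _ cantor_bounds(1), of "-1"] by auto
      then have "measure (\<mu> n) {-1<..1} = measure (?Q n) (space (?Q n))"
        unfolding \<mu>_def by (subst measure_distr[OF cm]) simp_all
      then show ?thesis using prob_space.prob_space[OF pQ] by simp
    qed
    then show "\<exists>a b. a < b \<and> (\<forall>n. 1 - \<epsilon> < measure (\<mu> n) {a<..b})" using \<epsilon> by (intro exI[of _ "-1"] exI[of _ 1]) simp
  qed (rule rd)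
  from tight_imp_convergent_subsubsequence[OF this strict_mono_id] obtain s M where s: "strict_mono s"
    and M: "real_distribution M" and weak: "weak_conv_m (\<mu> \<circ> id \<circ> s) M" by blast
  have weak': "weak_conv_m (\<lambda>n. \<mu> (s n)) M" using weak by (simp add: comp_def)
  interpret M: real_distribution M by fact
  have lim: "(\<lambda>n. \<integral>z. f z \<partial>\<mu> (s n)) \<longlonglongrightarrow> (\<integral>z. f z \<partial>M)" if "continuous_on UNIV f" "\<And>z. \<bar>f z\<bar> \<le> 1" for f :: "real \<Rightarrow> real"
    by (rule weak_conv_imp_integral_bdd_continuous_conv[OF rd M weak', where B=1])
       (use that in \<open>simp_all add: continuous_on_eq_continuous_at\<close>)
  have int\<mu>: "(\<integral>z. f z \<partial>\<mu> n) = (\<integral>\<phi>. f (cantor (gbits k (G n) \<phi>)) \<partial>?Q n)" if "continuous_on UNIV f" for n and f :: "real \<Rightarrow> real"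
    unfolding \<mu>_def by (rule integral_distr[OF cm borel_measurable_continuous_onI[OF that]])
  have cd: "continuous_on UNIV (\<lambda>z. \<Prod>i\<in>J. digit i z)" for J by (intro continuous_on_prod continuous_digit)
  have pu: "\<bar>\<Prod>i\<in>J. digit i z\<bar> \<le> 1" for J z using prod_unit[of J "\<lambda>i. digit i z"] digit_unit by auto
  \<comment> \<open>The limit law might charge points whose digits are not 0 or 1. The continuous
    function d (1 - d) of a digit d vanishes before the limit, hence almost surely in the
    limit.\<close>
  have AE01: "AE z in M. digit i z \<in> {0, 1}" for i
  proof -
    have c: "continuous_on UNIV (\<lambda>z. digit i z * (1 - digit i z))" by (intro continuous_intros continuous_digit)
    have bd: "0 \<le> digit i z * (1 - digit i z) \<and> digit i z * (1 - digit i z) \<le> 1" for z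
      using digit_unit[of i z] by (intro mult_unit) auto
    then have b: "\<bar>digit i z * (1 - digit i z)\<bar> \<le> 1" for z by (simp add: abs_of_nonneg)
    have "(\<integral>z. digit i z * (1 - digit i z) \<partial>\<mu> n) = 0" for n
    proof -
      have z: "of_bool p * (1 - of_bool p) = (0::real)" for p by (cases p) simp_all
      show ?thesis unfolding int\<mu>[OF c] digit_cantor z by simp
    qed
    then have "(\<integral>z. digit i z * (1 - digit i z) \<partial>M) = 0" using lim[OF c b] by (simp add: LIMSEQ_const_iff)
    moreover have "integrable M (\<lambda>z. digit i z * (1 - digit i z))"
      by (rule M.integrable_unit[OF _ bd]) (use borel_measurable_continuous_onI[OF c] in simp)
    ultimately have "AE z in M. digit i z * (1 - digit i z) = 0"
      by (subst (asm) integral_nonneg_eq_0_iff_AE) (use bd in auto)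
    then show ?thesis by (rule AE_mp) (auto intro!: AE_I2)
  qed
  define P where "P = distr M bit_space bits"
  have bm: "bits \<in> measurable M bit_space" by measurable
  have pP: "prob_space P" unfolding P_def by (rule M.prob_space_distr[OF bm])
  have meas: "measure P {b. \<forall>i\<in>J. b i} = (\<integral>z. (\<Prod>i\<in>J. digit i z) \<partial>M)" if J: "finite J" for J
  proof -
    have "measure P {b. \<forall>i\<in>J. b i} = (\<integral>b. of_bool (\<forall>i\<in>J. b i) \<partial>P)"
    proof -
      have "(\<integral>b. of_bool (\<forall>i\<in>J. b i) \<partial>P) = (\<integral>b. indicator {b. \<forall>i\<in>J. b i} b \<partial>P :: real)"
        by (simp add: indicator_def of_bool_def)
      then show ?thesis using cylinder_sets[OF J] by (simp add: P_def)
    qed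
    also have "\<dots> = (\<integral>z. of_bool (\<forall>i\<in>J. bits z i) \<partial>M)"
      unfolding P_def by (rule integral_distr[OF bm cylinder_ind_measurable[OF J]])
    also have "\<dots> = (\<integral>z. (\<Prod>i\<in>J. digit i z) \<partial>M)"
    proof (rule integral_cong_AE)
      show "(\<lambda>z. of_bool (\<forall>i\<in>J. bits z i) :: real) \<in> borel_measurable M"
        by (rule measurable_compose[OF bm cylinder_ind_measurable[OF J]])
      show "(\<lambda>z. \<Prod>i\<in>J. digit i z) \<in> borel_measurable M" using borel_measurable_continuous_onI[OF cd] by simp
      have "AE z in M. \<forall>i. digit i z \<in> {0, 1}" unfolding AE_all_countable by (intro allI AE01)
      then show "AE z in M. of_bool (\<forall>i\<in>J. bits z i) = (\<Prod>i\<in>J. digit i z)"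
      proof (rule AE_mp, intro AE_I2 impI)
        fix z assume "\<forall>i. digit i z \<in> {0, 1}"
        then have d: "digit i z = of_bool (bits z i)" for i by (auto simp: bits_def dest: spec[of _ i])
        show "of_bool (\<forall>i\<in>J. bits z i) = (\<Prod>i\<in>J. digit i z)"
          unfolding d using J by (cases "\<forall>i\<in>J. bits z i") (auto intro!: prod.neutral[symmetric] prod_zero[symmetric])
      qed
    qed
    finally show ?thesis .
  qed
  have conv: "(\<lambda>n. gdens k (G (s n)) J) \<longlonglongrightarrow> measure P {b. \<forall>i\<in>J. b i}" if J: "finite J" for J
  proof -
    have "(\<integral>z. (\<Prod>i\<in>J. digit i z) \<partial>\<mu> n) = gdens k (G n) J" for n
      unfolding int\<mu>[OF cd] prod_digit_cantor[OF J] gdens_def by (rule refl)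
    then show ?thesis using lim[OF cd pu, of J] unfolding meas[OF J] by simp
  qed
  have "exchangeable_bits P"
  proof (rule exchangeable_bits.intro)
    show "prob_space P" by (rule pP)
    show sP: "sets P = sets bit_space" by (simp add: P_def)
    fix \<pi> :: "nat \<Rightarrow> nat" assume \<pi>: "inj \<pi>"
    have mm: "move \<pi> \<in> measurable P bit_space" using move_measurable measurable_cong_sets[OF sP refl] by blast
    interpret D: prob_space "distr P bit_space (move \<pi>)" by (rule prob_space.prob_space_distr[OF pP mm])
    interpret PP: prob_space P by (rule pP)
    show "distr P bit_space (move \<pi>) = P"
    proof (rule measure_eq_cylinders)
      fix J :: "nat set" assume J: "finite J"
      let ?J = "(\<lambda>i. set_encode (\<pi> ` set_decode i)) ` J"
      have "measure (distr P bit_space (move \<pi>)) {b. \<forall>i\<in>J. b i} = measure P (move \<pi> -` {b. \<forall>i\<in>J. b i} \<inter> space P)"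
        by (rule measure_distr[OF mm cylinder_sets[OF J]])
      also have "move \<pi> -` {b. \<forall>i\<in>J. b i} \<inter> space P = {b. \<forall>i\<in>?J. b i}"
        using sets_eq_imp_space_eq[OF sP] by (auto simp: move_def)
      also have "measure P {b. \<forall>i\<in>?J. b i} = measure P {b. \<forall>i\<in>J. b i}"
      proof (rule LIMSEQ_unique)
        show "(\<lambda>n. gdens k (G (s n)) ?J) \<longlonglongrightarrow> measure P {b. \<forall>i\<in>?J. b i}" using J by (intro conv) simp
        show "(\<lambda>n. gdens k (G (s n)) ?J) \<longlonglongrightarrow> measure P {b. \<forall>i\<in>J. b i}"
          using conv[OF J] gdens_move[OF \<pi> J, of "G (s n)" k for n] G by simp
      qed
      finally show "emeasure (distr P bit_space (move \<pi>)) {b. \<forall>i\<in>J. b i} = emeasure P {b. \<forall>i\<in>J. b i}"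
        by (simp add: D.emeasure_eq_measure PP.emeasure_eq_measure)
    qed (use sP D.emeasure_space_1 in simp_all)
  qed
  from that[OF s this conv] show thesis .
qed

section \<open>Densities of the limit array and the kernel behind them\<close>

definition pdens :: "(nat \<Rightarrow> bool) measure \<Rightarrow> hgraph \<Rightarrow> real" where
  "pdens P H = measure P {b. \<forall>e\<in>edges H. b (set_encode e)}"

text \<open>The conditional probability of the edge A given the variables of its proper subsets. Bit
  0 stands for the edge without auxiliary vertices, since 0 codes the empty set.\<close>

definition edge_kernel :: "(nat \<Rightarrow> (nat set \<Rightarrow> real) \<times> real \<Rightarrow> real) \<Rightarrow> nat set \<Rightarrow> (nat set \<Rightarrow> real) \<Rightarrow> real" where
  "edge_kernel F A x = (\<integral>u. of_bool (bits (F (card A) (lower A (zhat F x), u)) 0) \<partial>unit_interval)"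

lemma first_bit_measurable: "(\<lambda>r. of_bool (bits r 0) :: real) \<in> borel_measurable borel"
  unfolding bits_def of_bool_def by measurable

lemma edge_kernel_measurable:
  assumes F: "\<And>j. F j \<in> borel_measurable (PiM (psub j) (\<lambda>_. borel) \<Otimes>\<^sub>M unit_interval)"
    and A: "finite A" "\<And>B. B \<subset> A \<Longrightarrow> B \<in> \<D>"
  shows "edge_kernel F A \<in> borel_measurable (cube \<D>)"
    and "x \<in> space (cube \<D>) \<Longrightarrow> 0 \<le> edge_kernel F A x \<and> edge_kernel F A x \<le> 1"
proof -
  interpret U: prob_space unit_interval by (rule prob_space_unit_interval)
  have l: "(\<lambda>x. lower A (zhat F x)) \<in> measurable (cube \<D>) (PiM (psub (card A)) (\<lambda>_. borel))"
    unfolding lower_def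
  proof (rule measurable_restrict)
    fix B assume "B \<in> psub (card A)"
    then have *: "enum A ` B \<subset> A" by (rule enum_image_psub[OF A(1)])
    have "Pow (enum A ` B) \<subseteq> \<D>"
    proof
      fix C assume "C \<in> Pow (enum A ` B)"
      then have "C \<subset> A" using * by blast
      then show "C \<in> \<D>" by (rule A(2))
    qed
    then show "(\<lambda>x. zhat F x (enum A ` B)) \<in> borel_measurable (cube \<D>)"
      by (rule zhat_measurable[OF F finite_subset[OF psubset_imp_subset[OF *] A(1)]])
  qed
  have "(\<lambda>(x, u). (lower A (zhat F x), u)) \<in> measurable (cube \<D> \<Otimes>\<^sub>M unit_interval) (PiM (psub (card A)) (\<lambda>_. borel) \<Otimes>\<^sub>M unit_interval)"
    unfolding split_beta by (rule measurable_Pair[OF measurable_compose[OF measurable_fst l] measurable_snd])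
  from measurable_compose[OF measurable_compose[OF this F] first_bit_measurable]
  have m: "(\<lambda>(x, u). of_bool (bits (F (card A) (lower A (zhat F x), u)) 0) :: real) \<in> borel_measurable (cube \<D> \<Otimes>\<^sub>M unit_interval)"
    by (simp add: split_beta)
  show "edge_kernel F A \<in> borel_measurable (cube \<D>)"
    unfolding edge_kernel_def by (rule U.borel_measurable_lebesgue_integral[OF m])
  show "0 \<le> edge_kernel F A x \<and> edge_kernel F A x \<le> 1" if "x \<in> space (cube \<D>)"
    unfolding edge_kernel_def
  proof (rule U.integral_unit)
    show "(\<lambda>u. of_bool (bits (F (card A) (lower A (zhat F x), u)) 0) :: real) \<in> borel_measurable unit_interval"
      using measurable_compose[OF measurable_Pair1'[OF that] m] by simp
  qed simp
qed

lemma edge_kernel_cong: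
  assumes "finite A" "\<And>B. B \<subset> A \<Longrightarrow> x B = y B" shows "edge_kernel F A x = edge_kernel F A y"
proof -
  have "lower A (zhat F x) = lower A (zhat F y)"
    unfolding lower_def
  proof (rule restrict_ext)
    fix B assume "B \<in> psub (card A)"
    then have *: "enum A ` B \<subset> A" by (rule enum_image_psub[OF assms(1)])
    show "zhat F x (enum A ` B) = zhat F y (enum A ` B)"
      by (rule zhat_cong[OF finite_subset[OF psubset_imp_subset[OF *] assms(1)]], rule assms(2)) (use * in blast)
  qed
  then show ?thesis by (simp add: edge_kernel_def)
qed

lemma edge_kernel_enum:
  assumes A: "finite A" "card A = k"
  shows "edge_kernel F {1..k} (\<lambda>C. x (enum A ` C)) = edge_kernel F A x"
proof -
  have "lower {1..k} (zhat F (\<lambda>C. x (enum A ` C))) = lower A (zhat F x)"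
    unfolding lower_def card_atLeastAtMost A(2) diff_Suc_1
  proof (rule restrict_ext)
    fix B assume "B \<in> psub k"
    then have B: "B \<subseteq> {1..k}" by (auto simp: psub_def)
    have "enum {1..k} ` B = (\<lambda>i. i) ` B" by (rule image_cong[OF refl enum_atLeastAtMost]) (use B in blast)
    then show "zhat F (\<lambda>C. x (enum A ` C)) (enum {1..k} ` B) = zhat F x (enum A ` B)"
      using zhat_enum[OF A(1), of B F x] B A(2) by simp
  qed
  then show ?thesis unfolding edge_kernel_def by (simp add: A)
qed

lemma prod_of_bool: "finite K \<Longrightarrow> (\<Prod>i\<in>K. of_bool (p i)) = (of_bool (\<forall>i\<in>K. p i) :: real)"
  by (cases "\<forall>i\<in>K. p i") (auto intro!: prod.neutral prod_zero)

text \<open>The coordinate of an edge enters only its own variable, so the edges are independent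
  given the coordinates of the smaller sets. The empty set is still among these.\<close>

lemma (in exchangeable_bits) pdens_integral:
  assumes F: "\<And>j. F j \<in> borel_measurable (PiM (psub j) (\<lambda>_. borel) \<Otimes>\<^sub>M unit_interval)"
    and law: "\<And>\<D>. finite \<D> \<and> (\<forall>A\<in>\<D>. finite A \<and> Pow A \<subseteq> \<D>) \<Longrightarrow>
      distr P (PiM \<D> (\<lambda>_. borel)) (\<lambda>b. fam \<D> (\<lambda>B. rho B b)) = distr (cube \<D>) (PiM \<D> (\<lambda>_. borel)) (\<lambda>x. fam \<D> (zhat F x))"
    and H: "kgraph k H" and k: "0 < k"
  shows "pdens P H = (\<integral>x. (\<Prod>A\<in>edges H. edge_kernel F A x) \<partial>cube (insert {} (binom_le (verts H) (k - 1))))"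
proof -
  interpret P: prob_space P by (rule prob_P)
  interpret U: prob_space unit_interval by (rule prob_space_unit_interval)
  interpret PU: product_prob_space "\<lambda>_. unit_interval" UNIV ..
  let ?V = "verts H" and ?E = "edges H" and ?J0 = "insert {} (binom_le (verts H) (k - 1))"
  let ?D = "Pow ?V"
  have fV: "finite ?V" using H by (simp add: kgraph_def)
  have fE: "finite ?E" by (rule kgraph_finite_edges[OF H])
  have sE: "A \<in> ?D" "finite A" "card A = k" if "A \<in> ?E" for A using kgraph_edgeD[OF H that] by auto
  have J0: "?J0 = {B. B \<subseteq> ?V \<and> card B < k}" using k by (auto simp: binom_le_def)
  have subJ0: "B \<in> ?J0" if "A \<in> ?E" "B \<subset> A" for A B
  proof -
    have "card B < card A" using psubset_card_mono[OF sE(2)[OF that(1)] that(2)] .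
    then show ?thesis unfolding J0 using sE[OF that(1)] that(2) by auto
  qed
  have fm: "(\<lambda>v. \<Prod>A\<in>?E. of_bool (bits (v A) 0) :: real) \<in> borel_measurable (PiM ?D (\<lambda>_. borel))"
    by (intro borel_measurable_prod measurable_compose[OF measurable_component_singleton[of _ ?D "\<lambda>_. borel"] first_bit_measurable] sE)
  have zm: "(\<lambda>x. fam ?D (zhat F x)) \<in> measurable (cube ?D) (PiM ?D (\<lambda>_. borel))"
    unfolding fam_def
  proof (rule measurable_restrict)
    fix B assume B: "B \<in> ?D"
    show "(\<lambda>x. zhat F x B) \<in> borel_measurable (cube ?D)"
      by (rule zhat_measurable[OF F finite_subset[OF _ fV]]) (use B in auto)
  qed
  have rm: "(\<lambda>b. fam ?D (\<lambda>B. rho B b)) \<in> measurable P (PiM ?D (\<lambda>_. borel))" by measurable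
  have enc0: "finite (set_encode ` ?E)" using fE by simp
  have cyl: "{b. \<forall>e\<in>?E. b (set_encode e)} = {b. \<forall>i\<in>set_encode ` ?E. b i}" by auto
  have "pdens P H = (\<integral>b. of_bool (\<forall>e\<in>?E. b (set_encode e)) \<partial>P)"
  proof -
    have "(\<integral>b. of_bool (\<forall>e\<in>?E. b (set_encode e)) \<partial>P) = (\<integral>b. indicator {b. \<forall>e\<in>?E. b (set_encode e)} b \<partial>P :: real)"
      by (simp add: indicator_def of_bool_def)
    then show ?thesis unfolding pdens_def using cylinder_sets[OF enc0] unfolding cyl by (simp add: sets_P)
  qed
  \<comment> \<open>By exchangeability the vertices of H may be taken to be active.\<close>
  also have "\<dots> = (\<integral>b. of_bool (\<forall>e\<in>?E. move vact b (set_encode e)) \<partial>P)"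
  proof (rule integral_move[OF inj_vact, symmetric])
    show "(\<lambda>b. of_bool (\<forall>e\<in>?E. b (set_encode e)) :: real) \<in> borel_measurable bit_space"
      using cylinder_ind_measurable[OF enc0] by simp
  qed
  also have "\<dots> = (\<integral>b. (\<Prod>A\<in>?E. of_bool (bits (fam ?D (\<lambda>B. rho B b) A) 0)) \<partial>P)"
  proof -
    have "move vact b (set_encode A) = bits (fam ?D (\<lambda>B. rho B b) A) 0" if "A \<in> ?E" for A b
      using sE[OF that] by (simp add: move_set_encode fam_def rho_def profile_def mixed_def)
    then show ?thesis unfolding prod_of_bool[OF fE] by simp
  qed
  also have "\<dots> = (\<integral>v. (\<Prod>A\<in>?E. of_bool (bits (v A) 0)) \<partial>distr P (PiM ?D (\<lambda>_. borel)) (\<lambda>b. fam ?D (\<lambda>B. rho B b)))"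
    by (rule integral_distr[OF rm fm, symmetric])
  also have "\<dots> = (\<integral>v. (\<Prod>A\<in>?E. of_bool (bits (v A) 0)) \<partial>distr (cube ?D) (PiM ?D (\<lambda>_. borel)) (\<lambda>x. fam ?D (zhat F x)))"
    by (subst law) (use fV finite_subset in auto)
  also have "\<dots> = (\<integral>x. (\<Prod>A\<in>?E. of_bool (bits (fam ?D (zhat F x) A) 0)) \<partial>cube ?D)"
    by (rule integral_distr[OF zm fm])
  also have "\<dots> = (\<integral>x. (\<Prod>A\<in>?E. of_bool (bits (zhat F (restrict x (?J0 \<union> {A})) A) 0)) \<partial>cube ?D)"
  proof (rule Bochner_Integration.integral_cong[OF refl], rule prod.cong[OF refl])
    fix x A assume A: "A \<in> ?E"
    have "zhat F x A = zhat F (restrict x (?J0 \<union> {A})) A"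
    proof (rule zhat_cong[OF sE(2)[OF A]])
      fix B assume "B \<subseteq> A"
      then have "B \<in> ?J0 \<union> {A}" using subJ0[OF A, of B] by blast
      then show "x B = restrict x (?J0 \<union> {A}) B" by (simp only: restrict_apply if_True)
    qed
    then show "of_bool (bits (fam ?D (zhat F x) A) 0) = (of_bool (bits (zhat F (restrict x (?J0 \<union> {A})) A) 0) :: real)"
      using sE(1)[OF A] by (simp add: fam_def)
  qed
  also have "\<dots> = (\<integral>x. (\<Prod>A\<in>?E. \<integral>y. of_bool (bits (zhat F (merge ?J0 {A} (x, y)) A) 0) \<partial>PiM {A} (\<lambda>_. unit_interval)) \<partial>PiM ?J0 (\<lambda>_. unit_interval))"
    unfolding cube_def
  proof (rule integral_prod_fibres[OF prob_space_unit_interval fE])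
    show "finite ?D" using fV by simp
    show "?J0 \<subseteq> ?D" unfolding J0 by auto
    show "{A} \<subseteq> ?D \<and> ?J0 \<inter> {A} = {}" if "A \<in> ?E" for A unfolding J0 using sE[OF that] by auto
    show "disjoint_family_on (\<lambda>A. {A}) ?E" by (auto simp: disjoint_family_on_def)
    show "(\<lambda>x. of_bool (bits (zhat F x A) 0) :: real) \<in> borel_measurable (PiM (?J0 \<union> {A}) (\<lambda>_. unit_interval))" if A: "A \<in> ?E" for A
    proof -
      have "Pow A \<subseteq> ?J0 \<union> {A}" using subJ0[OF A] by blast
      from measurable_compose[OF zhat_measurable[OF F sE(2)[OF A] this] first_bit_measurable]
      show ?thesis unfolding cube_def .
    qed
  qed simp
  also have "\<dots> = (\<integral>x. (\<Prod>A\<in>?E. edge_kernel F A x) \<partial>PiM ?J0 (\<lambda>_. unit_interval))"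
  proof (rule Bochner_Integration.integral_cong[OF refl], rule prod.cong[OF refl])
    fix x A assume x: "x \<in> space (PiM ?J0 (\<lambda>_. unit_interval))" and A: "A \<in> ?E"
    have nA: "A \<notin> ?J0" unfolding J0 using sE[OF A] by simp
    have "zhat F (merge ?J0 {A} (x, y)) A = F (card A) (lower A (zhat F x), y A)" for y
    proof -
      have "lower A (zhat F (merge ?J0 {A} (x, y))) = lower A (zhat F x)"
        unfolding lower_def
      proof (rule restrict_ext)
        fix B assume "B \<in> psub (card A)"
        then have *: "enum A ` B \<subset> A" by (rule enum_image_psub[OF sE(2)[OF A]])
        show "zhat F (merge ?J0 {A} (x, y)) (enum A ` B) = zhat F x (enum A ` B)"
        proof (rule zhat_cong[OF finite_subset[OF psubset_imp_subset[OF *] sE(2)[OF A]]])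
          fix C assume "C \<subseteq> enum A ` B"
          then have "C \<in> ?J0" using subJ0[OF A, of C] * by blast
          then show "merge ?J0 {A} (x, y) C = x C" by (simp add: merge_def)
        qed
      qed
      moreover have "merge ?J0 {A} (x, y) A = y A" unfolding merge_def using nA by simp
      ultimately show ?thesis unfolding zhat_eq[of F _ A] by simp
    qed
    then have "(\<integral>y. of_bool (bits (zhat F (merge ?J0 {A} (x, y)) A) 0) \<partial>PiM {A} (\<lambda>_. unit_interval)) =
      (\<integral>y. (\<lambda>u. of_bool (bits (F (card A) (lower A (zhat F x), u)) 0)) (y A) \<partial>PiM {A} (\<lambda>_. unit_interval) :: real)" by simp
    also have "\<dots> = edge_kernel F A x"
      unfolding edge_kernel_def
    proof (rule PU.product_integral_singleton)
      have l: "lower A (zhat F x) \<in> space (PiM (psub (card A)) (\<lambda>_. borel))" by (simp add: lower_def space_PiM)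
      show "(\<lambda>u. of_bool (bits (F (card A) (lower A (zhat F x), u)) 0) :: real) \<in> borel_measurable unit_interval"
        by (rule measurable_compose[OF measurable_compose[OF measurable_Pair1'[OF l] F] first_bit_measurable])
    qed
    finally show "(\<integral>y. of_bool (bits (zhat F (merge ?J0 {A} (x, y)) A) 0) \<partial>PiM {A} (\<lambda>_. unit_interval)) = edge_kernel F A x" .
  qed
  finally show ?thesis unfolding cube_def .
qed

text \<open>Lets a property that holds almost surely for each graph hold almost surely for all
  graphs at once.\<close>

lemma countable_kgraphs: "countable {H. kgraph k H}"
proof -
  let ?S = "{A :: nat set. finite A \<and> A \<subseteq> UNIV}"
  have "countable ?S" by (rule countable_Collect_finite_subset) simp
  then have "countable {E. finite E \<and> E \<subseteq> ?S}" by (rule countable_Collect_finite_subset)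
  with \<open>countable ?S\<close> have "countable (?S \<times> {E. finite E \<and> E \<subseteq> ?S})" by (rule countable_SIGMA)
  moreover have "{H. kgraph k H} \<subseteq> ?S \<times> {E. finite E \<and> E \<subseteq> ?S}"
  proof
    fix H assume "H \<in> {H. kgraph k H}"
    then have H: "kgraph k H" by simp
    then have "finite (verts H)" "finite (edges H)" "\<forall>e\<in>edges H. finite e"
      using kgraph_finite_edges[OF H] kgraph_edgeD(3)[OF H] by (auto simp: kgraph_def)
    then show "H \<in> ?S \<times> {E. finite E \<and> E \<subseteq> ?S}" by (cases H) (auto simp: verts_def edges_def)
  qed
  ultimately show ?thesis by (rule countable_subset[rotated])
qed

text \<open>The copy is increasing, so that its density agrees even for a kernel that is not yet
  symmetric.\<close>

lemma exists_disjoint_copy: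
  assumes "kgraph k H" obtains f where "strict_mono f" "verts H \<inter> f ` verts H = {}"
proof -
  have "finite (verts H)" using assms by (simp add: kgraph_def)
  then obtain N where N: "\<And>v. v \<in> verts H \<Longrightarrow> v < N" by (metis finite_nat_set_iff_bounded)
  show thesis
  proof (rule that[of "\<lambda>v. v + N"])
    show "strict_mono (\<lambda>v. v + N)" by (simp add: strict_mono_def)
    show "verts H \<inter> (\<lambda>v. v + N) ` verts H = {}" using N by fastforce
  qed
qed

text \<open>Freezing the coordinate of the empty set at c gives a kernel \<open>W c\<close>. For
  uniform c its density of \<open>H\<close> has mean \<open>pdens P H\<close>, and two disjoint
  copies of \<open>H\<close> show that the second moment is the square of the mean. So the density
  is almost surely constant, and one c serves all graphs.\<close>

lemma kernel_of_exchangeable: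
  assumes P: "exchangeable_bits P" and k: "0 < k"
    and mult: "\<And>H H'. kgraph k H \<Longrightarrow> kgraph k H' \<Longrightarrow> verts H \<inter> verts H' = {} \<Longrightarrow> pdens P (disj_union H H') = pdens P H * pdens P H'"
    and rel: "\<And>H f. kgraph k H \<Longrightarrow> inj f \<Longrightarrow> pdens P (relabel f H) = pdens P H"
  shows "\<exists>W. unit_kernel k W \<and> (\<forall>H. kgraph k H \<longrightarrow> t_hom k H W = pdens P H)"
proof -
  interpret exchangeable_bits P by fact
  interpret U: prob_space unit_interval by (rule prob_space_unit_interval)
  interpret PU: product_prob_space "\<lambda>_. unit_interval" UNIV ..
  from Aldous_Hoover obtain F where "(\<forall>j. F j \<in> borel_measurable (PiM (psub j) (\<lambda>_. borel) \<Otimes>\<^sub>M unit_interval)) \<and>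
    (\<forall>\<D>. finite \<D> \<and> (\<forall>A\<in>\<D>. finite A \<and> Pow A \<subseteq> \<D>) \<longrightarrow>
      distr P (PiM \<D> (\<lambda>_. borel)) (\<lambda>b. fam \<D> (\<lambda>B. rho B b)) = distr (cube \<D>) (PiM \<D> (\<lambda>_. borel)) (\<lambda>x. fam \<D> (zhat F x)))" ..
  note F = this[THEN conjunct1, rule_format] and law = this[THEN conjunct2, rule_format]
  define W where "W c x = edge_kernel F {1..k} (x({} := c))" for c :: real and x :: "nat set \<Rightarrow> real"
  have psub_rprop: "B \<in> insert {} (rprop {1..k})" if "B \<subset> {1..k}" for B using that by (auto simp: rprop_def)
  have uW: "unit_kernel k (W c)" if c: "c \<in> {0..1}" for c
  proof -
    have m: "(\<lambda>x. x({} := c)) \<in> measurable (cube (rprop {1..k})) (cube (insert {} (rprop {1..k})))"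
      unfolding cube_def by (rule measurable_fun_upd[of _ "rprop {1..k}"]) (use c in \<open>simp_all\<close>)
    note e = edge_kernel_measurable[OF F finite_atLeastAtMost psub_rprop]
    show ?thesis unfolding unit_kernel_def
    proof (intro conjI ballI)
      show "W c \<in> borel_measurable (cube (rprop {1..k}))" unfolding W_def by (rule measurable_compose[OF m e(1)])
      fix x assume "x \<in> space (cube (rprop {1..k}))"
      from e(2)[OF _ measurable_space[OF m this]] show "0 \<le> W c x" "W c x \<le> 1" unfolding W_def by auto
    qed
  qed
  let ?C = "PiM {{}} (\<lambda>_. unit_interval) :: (nat set \<Rightarrow> real) measure"
  have pC: "prob_space ?C" by (rule prob_space_PiM) (rule prob_space_unit_interval)
  have cC: "x {} \<in> {0..1}" if "x \<in> space ?C" for x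
    using PiE_mem[OF that[unfolded space_PiM space_unit_interval] singletonI] .
  define \<theta> where "\<theta> H x = t_hom k H (W (x {}))" for H and x :: "nat set \<Rightarrow> real"
  have \<theta>: "\<theta> H \<in> borel_measurable ?C" "(\<integral>x. \<theta> H x \<partial>?C) = pdens P H" if H: "kgraph k H" for H
  proof -
    let ?I = "binom_le (verts H) (k - 1)"
    let ?g = "\<lambda>x. \<Prod>A\<in>edges H. edge_kernel F A x"
    have fI: "finite ?I" using H by (simp add: kgraph_def)
    have dis: "{{}} \<inter> ?I = {}" by (auto simp: binom_le_def)
    have sub: "B \<in> insert {} ?I" if "A \<in> edges H" "B \<subset> A" for A B
    proof -
      have "B = {} \<or> B \<in> rprop A" using that(2) by (auto simp: rprop_def)
      then show ?thesis using kgraph_edgeD(6)[OF H that(1)] by blast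
    qed
    note e = edge_kernel_measurable[OF F kgraph_edgeD(3)[OF H] sub]
    have gm: "?g \<in> borel_measurable (cube ({{}} \<union> ?I))" unfolding insert_is_Un[of "{}" ?I, symmetric]
      by (rule borel_measurable_prod) (rule e(1))
    have gb: "0 \<le> ?g x \<and> ?g x \<le> 1" if "x \<in> space (cube ({{}} \<union> ?I))" for x
      using that unfolding insert_is_Un[of "{}" ?I, symmetric] by (intro prod_unit e(2))
    have eq: "(\<integral>y. ?g (merge {{}} ?I (x, y)) \<partial>PiM ?I (\<lambda>_. unit_interval)) = \<theta> H x" for x
      unfolding \<theta>_def t_hom_pull cube_def
    proof (rule Bochner_Integration.integral_cong[OF refl], rule prod.cong[OF refl])
      fix y A assume A: "A \<in> edges H"
      note eA = kgraph_edgeD[OF H A]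
      have "edge_kernel F A (merge {{}} ?I (x, y)) = edge_kernel F {1..k} (\<lambda>C. merge {{}} ?I (x, y) (enum A ` C))"
        by (rule edge_kernel_enum[OF eA(3,4), symmetric])
      also have "\<dots> = W (x {}) (pull k (enum A) y)" unfolding W_def
      proof (rule edge_kernel_cong)
        fix B assume B: "B \<subset> {1..k}"
        show "merge {{}} ?I (x, y) (enum A ` B) = ((pull k (enum A) y)({} := x {})) B"
        proof (cases "B = {}")
          case True then show ?thesis by (simp add: merge_def)
        next
          case False
          then have r: "B \<in> rprop {1..k}" using B by (auto simp: rprop_def)
          have "enum A ` B \<in> ?I" using image_rprop[OF eA(5) r] eA(6) by blast
          then show ?thesis using False r by (simp add: merge_def pull_def)
        qed
      qed simp
      finally show "edge_kernel F A (merge {{}} ?I (x, y)) = W (x {}) (pull k (enum A) y)" .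
    qed
    show "\<theta> H \<in> borel_measurable ?C"
      using integral_merge_measurable[OF prob_space_unit_interval gm[unfolded cube_def]] unfolding eq .
    have "pdens P H = (\<integral>x. ?g x \<partial>cube ({{}} \<union> ?I))"
      using pdens_integral[OF F law H k] unfolding insert_is_Un[of "{}" ?I, symmetric] .
    also have "\<dots> = (\<integral>x. (\<integral>y. ?g (merge {{}} ?I (x, y)) \<partial>PiM ?I (\<lambda>_. unit_interval)) \<partial>?C)"
      unfolding cube_def
      by (rule PU.product_integral_fold[OF dis _ fI prob_space.integrable_unit[OF prob_space_cube gm gb, unfolded cube_def]]) simp
    finally show "(\<integral>x. \<theta> H x \<partial>?C) = pdens P H" unfolding eq ..
  qed
  have \<theta>b: "0 \<le> \<theta> H x \<and> \<theta> H x \<le> 1" if "kgraph k H" "x \<in> space ?C" for H x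
    unfolding \<theta>_def by (rule t_hom_unit[OF uW[OF cC[OF that(2)]] that(1)])
  have AE: "AE x in ?C. \<theta> H x = pdens P H" if H: "kgraph k H" for H
  proof -
    obtain f where f: "strict_mono f" "verts H \<inter> f ` verts H = {}" by (rule exists_disjoint_copy[OF H])
    have fi: "inj f" by (rule strict_mono_imp_inj_on[OF f(1)])
    let ?H = "relabel f H"
    have H': "kgraph k ?H" by (rule kgraph_relabel[OF H inj_on_subset[OF fi subset_UNIV]])
    have d: "verts H \<inter> verts ?H = {}" using f(2) by simp
    have "\<theta> (disj_union H ?H) x = (\<theta> H x)\<^sup>2" if "x \<in> space ?C" for x
      unfolding \<theta>_def power2_eq_square t_hom_disj_union[OF uW[OF cC[OF that]] H H' d k] t_hom_relabel_mono[OF uW[OF cC[OF that]] H f(1)] by (rule refl)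
    then have sq: "(\<integral>x. (\<theta> H x)\<^sup>2 \<partial>?C) = (\<integral>x. \<theta> (disj_union H ?H) x \<partial>?C)"
      by (intro Bochner_Integration.integral_cong[OF refl]) simp
    also have "\<dots> = (pdens P H)\<^sup>2"
      unfolding \<theta>(2)[OF kgraph_disj_union[OF H H']] mult[OF H H' d] rel[OF H fi] by (simp add: power2_eq_square)
    finally have s2: "(\<integral>x. (\<theta> H x)\<^sup>2 \<partial>?C) = (pdens P H)\<^sup>2" .
    have [measurable]: "\<theta> H \<in> borel_measurable ?C" by (rule \<theta>(1)[OF H])
    have i1: "integrable ?C (\<theta> H)" by (rule prob_space.integrable_unit[OF pC \<theta>(1)[OF H] \<theta>b[OF H]])
    have i2: "integrable ?C (\<lambda>x. (\<theta> H x)\<^sup>2)"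
      by (rule prob_space.integrable_unit[OF pC]) (use \<theta>b[OF H] in \<open>auto intro!: power_le_one\<close>)
    have i3: "integrable ?C (\<lambda>x. (pdens P H)\<^sup>2)" using prob_space.finite_measure[OF pC] by (simp add: finite_measure.integrable_const)
    have i4: "integrable ?C (\<lambda>x. (\<theta> H x - pdens P H)\<^sup>2)"
      unfolding power2_diff by (intro Bochner_Integration.integrable_add Bochner_Integration.integrable_diff i2 i3 integrable_mult_left integrable_mult_right i1)
    have "(\<integral>x. (\<theta> H x - pdens P H)\<^sup>2 \<partial>?C) = (\<integral>x. (\<theta> H x)\<^sup>2 + (pdens P H)\<^sup>2 - (2 * pdens P H) * \<theta> H x \<partial>?C)"
      unfolding power2_diff by (simp add: ac_simps)
    also have "\<dots> = (\<integral>x. (\<theta> H x)\<^sup>2 \<partial>?C) + (\<integral>x. (pdens P H)\<^sup>2 \<partial>?C) - (2 * pdens P H) * (\<integral>x. \<theta> H x \<partial>?C)"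
      using i1 i2 i3 by simp
    also have "\<dots> = 0" unfolding s2 \<theta>(2)[OF H] by (simp add: prob_space.prob_space[OF pC] power2_eq_square)
    finally have "AE x in ?C. (\<theta> H x - pdens P H)\<^sup>2 = 0"
      by (subst (asm) integral_nonneg_eq_0_iff_AE[OF i4]) auto
    then show ?thesis by (rule AE_mp) (intro AE_I2 impI, simp)
  qed
  have "AE x in ?C. \<forall>H\<in>{H. kgraph k H}. \<theta> H x = pdens P H"
    unfolding AE_ball_countable[OF countable_kgraphs] using AE by blast
  then have "\<exists>x\<in>space ?C. \<forall>H\<in>{H. kgraph k H}. \<theta> H x = pdens P H"
  proof (rule contrapos_pp)
    assume "\<not> (\<exists>x\<in>space ?C. \<forall>H\<in>{H. kgraph k H}. \<theta> H x = pdens P H)"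
    then have "AE x in ?C. \<not> (\<forall>H\<in>{H. kgraph k H}. \<theta> H x = pdens P H)" by (intro AE_I2) blast
    then show "\<not> (AE x in ?C. \<forall>H\<in>{H. kgraph k H}. \<theta> H x = pdens P H)" using prob_space.AE_contr[OF pC] by blast
  qed
  then obtain x where x: "x \<in> space ?C" "\<forall>H\<in>{H. kgraph k H}. \<theta> H x = pdens P H" ..
  then show ?thesis using uW[OF cC[OF x(1)]] unfolding \<theta>_def by blast
qed

section \<open>Two independent uniform variables from one\<close>

definition cutval :: "(nat \<Rightarrow> bool) \<Rightarrow> real" where
  "cutval b = Sup (insert 0 {real_of_rat (from_nat n) | n. 0 \<le> (from_nat n :: rat) \<and> (from_nat n :: rat) \<le> 1 \<and> b n})"

lemma less_cutval: "a < cutval b \<longleftrightarrow> a < 0 \<or> (\<exists>n. 0 \<le> (from_nat n :: rat) \<and> (from_nat n :: rat) \<le> 1 \<and> a < real_of_rat (from_nat n) \<and> b n)"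
proof -
  have "bdd_above (insert 0 {real_of_rat (from_nat n) | n. 0 \<le> (from_nat n :: rat) \<and> (from_nat n :: rat) \<le> 1 \<and> b n})"
    by (rule bdd_aboveI[of _ 1]) auto
  then show ?thesis unfolding cutval_def by (subst less_cSup_iff) auto
qed

lemma cutval_unit: "cutval b \<in> {0..1}"
proof -
  have "\<not> 1 < cutval b" unfolding less_cutval by auto
  moreover have "\<not> cutval b < 0" using less_cutval[of "cutval b" b] by blast
  ultimately show ?thesis by simp
qed

lemma cutval_measurable: "cutval \<in> measurable bit_space unit_interval"
proof -
  have "cutval \<in> borel_measurable bit_space"
  proof (subst borel_measurable_iff_greater, intro allI)
    fix a
    show "{b \<in> space bit_space. a < cutval b} \<in> sets bit_space" unfolding less_cutval by measurable
  qed
  then have "cutval \<in> measurable bit_space (restrict_space borel {0..1})"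
    by (intro measurable_restrict_space2) (use cutval_unit in auto)
  then show ?thesis using measurable_cong_sets[OF refl sets_unit_interval] by blast
qed

text \<open>A number in [0,1] is recovered from its lower cut of rationals: a measurable coding into
  bits that avoids ambiguous binary expansions.\<close>

lemma cutval_inverse:
  assumes "p \<in> {0..1}" shows "cutval (\<lambda>n. real_of_rat (from_nat n) < p) = p"
proof (rule antisym)
  show "cutval (\<lambda>n. real_of_rat (from_nat n) < p) \<le> p"
    using less_cutval[of p] assms by (force simp: not_less[symmetric])
  show "p \<le> cutval (\<lambda>n. real_of_rat (from_nat n) < p)"
  proof (rule ccontr)
    assume "\<not> p \<le> cutval (\<lambda>n. real_of_rat (from_nat n) < p)"
    then have "cutval (\<lambda>n. real_of_rat (from_nat n) < p) < p" by simp
    then obtain q where q: "cutval (\<lambda>n. real_of_rat (from_nat n) < p) < real_of_rat q" "real_of_rat q < p" using of_rat_dense by blast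
    have "0 \<le> real_of_rat q" "real_of_rat q \<le> 1" using q cutval_unit[of "\<lambda>n. real_of_rat (from_nat n) < p"] assms
      unfolding atLeastAtMost_iff by linarith+
    then have "0 \<le> (from_nat (to_nat q) :: rat) \<and> (from_nat (to_nat q) :: rat) \<le> 1" by simp
    then have "cutval (\<lambda>n. real_of_rat (from_nat n) < p) < cutval (\<lambda>n. real_of_rat (from_nat n) < p)"
      unfolding less_cutval[of "cutval (\<lambda>n. real_of_rat (from_nat n) < p)"] using q by (intro disjI2 exI[of _ "to_nat q"]) simp
    then show False by simp
  qed
qed

text \<open>A uniform point of the unit square is stored in one Cantor number. The quantile
  transform of this number over a trivial first variable maps a uniform variable to its law, and
  decoding yields the two components.\<close>

lemma unit_interval_split:
  "\<exists>s c. s \<in> measurable unit_interval unit_interval \<and> c \<in> measurable unit_interval unit_interval \<and>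
    distr unit_interval (unit_interval \<Otimes>\<^sub>M unit_interval) (\<lambda>u. (s u, c u)) = unit_interval \<Otimes>\<^sub>M unit_interval"
proof -
  interpret U: prob_space unit_interval by (rule prob_space_unit_interval)
  interpret UU: pair_prob_space unit_interval unit_interval ..
  let ?M = "unit_interval \<Otimes>\<^sub>M unit_interval" and ?S = "count_space {()}"
  \<comment> \<open>Even bits hold the cut of the first component, odd bits that of the
    second.\<close>
  define e where "e w n = (if even n then real_of_rat (from_nat (n div 2)) < fst w else real_of_rat (from_nat (n div 2)) < snd w)" for w :: "real \<times> real" and n :: nat
  have em: "e \<in> measurable ?M bit_space"
  proof (rule measurable_bit_spaceI)
    fix n
    have [measurable]: "fst \<in> borel_measurable ?M" "snd \<in> borel_measurable ?M"
      by (rule measurable_compose[OF measurable_fst borel_measurable_unit_interval_id], rule measurable_compose[OF measurable_snd borel_measurable_unit_interval_id])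
    show "(\<lambda>w. e w n) \<in> measurable ?M (count_space UNIV)" unfolding e_def by (cases "even n") simp_all
  qed
  have Rm: "(\<lambda>w. cantor (e w)) \<in> borel_measurable ?M" by (rule measurable_compose[OF em cantor_measurable])
  have Ym: "(\<lambda>w. ()) \<in> measurable ?M ?S" by simp
  from conditional_quantile[OF UU.prob_space_axioms Ym Rm] cantor_bounds
  obtain f where f: "f \<in> borel_measurable (?S \<Otimes>\<^sub>M unit_interval)"
    and eq: "distr ?M (?S \<Otimes>\<^sub>M borel) (\<lambda>w. ((), cantor (e w))) = distr (?M \<Otimes>\<^sub>M unit_interval) (?S \<Otimes>\<^sub>M borel) (\<lambda>(w, u). ((), f ((), u)))"
    by blast
  define s where "s u = cutval (\<lambda>n. bits (f ((), u)) (2 * n))" for u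
  define c where "c u = cutval (\<lambda>n. bits (f ((), u)) (2 * n + 1))" for u
  define D where "D z = (cutval (\<lambda>n. bits (snd z) (2 * n)), cutval (\<lambda>n. bits (snd z) (2 * n + 1)))" for z :: "unit \<times> real"
  have bm: "(\<lambda>z. (\<lambda>n. bits (snd z) (h n))) \<in> measurable (?S \<Otimes>\<^sub>M borel) bit_space" for h
  proof (rule measurable_bit_spaceI)
    fix n show "(\<lambda>z. bits (snd z) (h n)) \<in> measurable (?S \<Otimes>\<^sub>M borel) (count_space UNIV)"
      using measurable_compose[OF measurable_compose[OF measurable_snd bits_measurable] measurable_bit] .
  qed
  have Dm: "D \<in> measurable (?S \<Otimes>\<^sub>M borel) ?M" unfolding D_def
    by (rule measurable_Pair[OF measurable_compose[OF bm cutval_measurable] measurable_compose[OF bm cutval_measurable]])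
  have fu: "(\<lambda>u. f ((), u)) \<in> borel_measurable unit_interval"
    by (rule measurable_compose[OF measurable_Pair1' f]) simp
  have fm: "(\<lambda>u. ((), f ((), u))) \<in> measurable unit_interval (?S \<Otimes>\<^sub>M borel)"
    by (rule measurable_Pair[OF _ fu]) simp
  have sc: "(s u, c u) = D ((), f ((), u))" for u by (simp add: D_def s_def c_def)
  have scm: "(\<lambda>u. (s u, c u)) \<in> measurable unit_interval ?M" unfolding sc by (rule measurable_compose[OF fm Dm])
  have De: "D ((), cantor (e w)) = w" if "w \<in> space ?M" for w
  proof -
    have "fst w \<in> {0..1}" "snd w \<in> {0..1}" using that by (auto simp: space_pair_measure)
    then show ?thesis using cutval_inverse[of "fst w"] cutval_inverse[of "snd w"] by (simp add: D_def e_def)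
  qed
  have eqm: "(\<lambda>w. ((), cantor (e w))) \<in> measurable ?M (?S \<Otimes>\<^sub>M borel)" by (rule measurable_Pair[OF Ym Rm])
  have "distr unit_interval ?M (\<lambda>u. (s u, c u)) = distr (distr unit_interval (?S \<Otimes>\<^sub>M borel) (\<lambda>u. ((), f ((), u)))) ?M D"
    unfolding sc by (subst distr_distr[OF Dm fm]) (simp add: comp_def)
  also have "distr unit_interval (?S \<Otimes>\<^sub>M borel) (\<lambda>u. ((), f ((), u))) = distr (?M \<Otimes>\<^sub>M unit_interval) (?S \<Otimes>\<^sub>M borel) (\<lambda>(w, u). ((), f ((), u)))"
  proof -
    interpret MU: pair_prob_space ?M unit_interval ..
    have "distr (?M \<Otimes>\<^sub>M unit_interval) unit_interval snd = unit_interval"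
    proof (rule measure_eqI)
      fix A assume "A \<in> sets (distr (?M \<Otimes>\<^sub>M unit_interval) unit_interval snd)"
      then have A: "A \<in> sets unit_interval" by simp
      have "snd -` A \<inter> space (?M \<Otimes>\<^sub>M unit_interval) = space ?M \<times> A"
        using sets.sets_into_space[OF A] by (auto simp: space_pair_measure)
      then show "emeasure (distr (?M \<Otimes>\<^sub>M unit_interval) unit_interval snd) A = emeasure unit_interval A"
        using A U.emeasure_pair_measure_Times[OF sets.top A, of ?M] UU.emeasure_space_1 by (subst emeasure_distr) simp_all
    qed simp
    then have "distr unit_interval (?S \<Otimes>\<^sub>M borel) (\<lambda>u. ((), f ((), u))) = distr (distr (?M \<Otimes>\<^sub>M unit_interval) unit_interval snd) (?S \<Otimes>\<^sub>M borel) (\<lambda>u. ((), f ((), u)))"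
      by simp
    also have "\<dots> = distr (?M \<Otimes>\<^sub>M unit_interval) (?S \<Otimes>\<^sub>M borel) ((\<lambda>u. ((), f ((), u))) \<circ> snd)"
      by (rule distr_distr[OF fm measurable_snd])
    finally show ?thesis by (simp add: comp_def case_prod_unfold)
  qed
  also have "\<dots> = distr ?M (?S \<Otimes>\<^sub>M borel) (\<lambda>w. ((), cantor (e w)))" by (rule eq[symmetric])
  also have "distr \<dots> ?M D = distr ?M ?M (\<lambda>w. D ((), cantor (e w)))" by (subst distr_distr[OF Dm eqm]) (simp add: comp_def)
  also have "\<dots> = distr ?M ?M (\<lambda>w. w)" by (rule distr_cong[OF refl refl De])
  also have "\<dots> = ?M" by (rule distr_id)
  finally have "distr unit_interval ?M (\<lambda>u. (s u, c u)) = ?M" .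
  moreover have "s \<in> measurable unit_interval unit_interval" "c \<in> measurable unit_interval unit_interval"
    using measurable_compose[OF scm measurable_fst] measurable_compose[OF scm measurable_snd] by simp_all
  ultimately show ?thesis by blast
qed

text \<open>Applying s and c to every coordinate maps the cube over I to the cube over two copies of
  I, so functions of the s-part and of the c-part are independent.\<close>

lemma cube_split_integral:
  assumes s: "s \<in> measurable unit_interval unit_interval" and c: "c \<in> measurable unit_interval unit_interval"
    and law: "distr unit_interval (unit_interval \<Otimes>\<^sub>M unit_interval) (\<lambda>u. (s u, c u)) = unit_interval \<Otimes>\<^sub>M unit_interval"
    and I: "finite I" and a: "a \<in> borel_measurable (cube I)" "\<And>x. x \<in> space (cube I) \<Longrightarrow> 0 \<le> a x \<and> a x \<le> (1::real)"
    and g: "g \<in> borel_measurable (cube I)" "\<And>x. x \<in> space (cube I) \<Longrightarrow> 0 \<le> g x \<and> g x \<le> (1::real)"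
  shows "(\<integral>x. a (\<lambda>B\<in>I. s (x B)) * g (\<lambda>B\<in>I. c (x B)) \<partial>cube I) = (\<integral>x. a x \<partial>cube I) * (\<integral>x. g x \<partial>cube I)"
proof -
  interpret U: prob_space unit_interval by (rule prob_space_unit_interval)
  interpret PU: product_prob_space "\<lambda>_ :: nat set. unit_interval" UNIV ..
  interpret PU': product_prob_space "\<lambda>_ :: nat set \<times> bool. unit_interval" UNIV ..
  let ?K = "I \<times> (UNIV :: bool set)"
  let ?T = "\<lambda>x. \<lambda>(B, b)\<in>?K. if b then s (x B) else c (x B)"
  let ?P = "PiM I (\<lambda>_. unit_interval)" and ?P2 = "PiM ?K (\<lambda>_. unit_interval)"
  have fK: "finite ?K" using I by simp
  have Tm: "?T \<in> measurable ?P ?P2"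
  proof (rule measurable_restrict)
    fix z assume "z \<in> ?K"
    then have B: "fst z \<in> I" by auto
    have "(\<lambda>x. s (x (fst z))) \<in> measurable ?P unit_interval" "(\<lambda>x. c (x (fst z))) \<in> measurable ?P unit_interval"
      using measurable_compose[OF measurable_component_singleton[OF B, of "\<lambda>_. unit_interval"] s]
        measurable_compose[OF measurable_component_singleton[OF B, of "\<lambda>_. unit_interval"] c] .
    then show "(\<lambda>x. case z of (B, b) \<Rightarrow> if b then s (x B) else c (x B)) \<in> measurable ?P unit_interval"
      by (cases z; cases "snd z") simp_all
  qed
  have law2: "distr ?P ?P2 ?T = ?P2"
  proof (rule PU'.PiM_eqI[OF fK])
    fix A assume A: "\<And>z. z \<in> ?K \<Longrightarrow> A z \<in> sets unit_interval"
    let ?A = "\<lambda>B. {u \<in> {0..1}. s u \<in> A (B, True) \<and> c u \<in> A (B, False)}"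
    have scm: "(\<lambda>u. (s u, c u)) \<in> measurable unit_interval (unit_interval \<Otimes>\<^sub>M unit_interval)" by (rule measurable_Pair[OF s c])
    have pre: "(\<lambda>u. (s u, c u)) -` (A (B, True) \<times> A (B, False)) \<inter> space unit_interval = ?A B" for B by auto
    have AB: "A (B, True) \<times> A (B, False) \<in> sets (unit_interval \<Otimes>\<^sub>M unit_interval)" if "B \<in> I" for B
      by (rule pair_measureI) (use A that in auto)
    have sA: "?A B \<in> sets unit_interval" if "B \<in> I" for B
      using measurable_sets[OF scm AB[OF that]] unfolding pre .
    have eA: "emeasure unit_interval (?A B) = emeasure unit_interval (A (B, True)) * emeasure unit_interval (A (B, False))" if "B \<in> I" for B
    proof -
      have "emeasure unit_interval (?A B) = emeasure (distr unit_interval (unit_interval \<Otimes>\<^sub>M unit_interval) (\<lambda>u. (s u, c u))) (A (B, True) \<times> A (B, False))"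
        unfolding emeasure_distr[OF scm AB[OF that]] pre by (rule refl)
      also have "\<dots> = emeasure unit_interval (A (B, True)) * emeasure unit_interval (A (B, False))"
        unfolding law by (rule U.emeasure_pair_measure_Times) (use A that in auto)
      finally show ?thesis .
    qed
    have "?T -` (Pi\<^sub>E ?K A) \<inter> space ?P = (\<Pi>\<^sub>E B\<in>I. ?A B)"
    proof (rule set_eqI)
      fix x
      have "(\<forall>z\<in>?K. ?T x z \<in> A z) \<longleftrightarrow> (\<forall>B\<in>I. s (x B) \<in> A (B, True) \<and> c (x B) \<in> A (B, False))"
        by (auto simp: all_bool_eq split: if_splits)
      then show "x \<in> ?T -` (Pi\<^sub>E ?K A) \<inter> space ?P \<longleftrightarrow> x \<in> (\<Pi>\<^sub>E B\<in>I. ?A B)"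
        unfolding vimage_def Int_iff mem_Collect_eq PiE_iff space_PiM space_unit_interval by auto
    qed
    then have "emeasure (distr ?P ?P2 ?T) (Pi\<^sub>E ?K A) = emeasure ?P (\<Pi>\<^sub>E B\<in>I. ?A B)"
      by (subst emeasure_distr[OF Tm]) (use A fK in \<open>auto intro!: sets_PiM_I_finite\<close>)
    also have "\<dots> = (\<Prod>B\<in>I. emeasure unit_interval (?A B))" by (rule PU.emeasure_PiM[OF I sA])
    also have "\<dots> = (\<Prod>B\<in>I. \<Prod>b\<in>UNIV. emeasure unit_interval (A (B, b)))"
    proof (rule prod.cong[OF refl])
      fix B assume B: "B \<in> I"
      show "emeasure unit_interval (?A B) = (\<Prod>b\<in>UNIV. emeasure unit_interval (A (B, b)))"
        unfolding eA[OF B] UNIV_bool by (simp add: mult.commute)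
    qed
    also have "\<dots> = (\<Prod>z\<in>?K. emeasure unit_interval (A z))"
      by (subst prod.cartesian_product) (simp add: split_beta)
    finally show "emeasure (distr ?P ?P2 ?T) (Pi\<^sub>E ?K A) = (\<Prod>z\<in>?K. emeasure unit_interval (A z))" .
  qed simp
  let ?J = "\<lambda>b. I \<times> {b :: bool}"
  let ?h = "\<lambda>b y. if b then a (\<lambda>B\<in>I. y (B, True)) else g (\<lambda>B\<in>I. y (B, False))"
  have rei: "(\<lambda>y. \<lambda>B\<in>I. y (B, b)) \<in> measurable (PiM (?J b) (\<lambda>_. unit_interval)) (cube I)" for b
    unfolding cube_def by (rule measurable_PiM_reindex) auto
  have hm: "?h b \<in> borel_measurable (PiM (?J b) (\<lambda>_. unit_interval))" for b
    using measurable_compose[OF rei[of b] a(1)] measurable_compose[OF rei[of b] g(1)] by (cases b) simp_all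
  have hb: "0 \<le> ?h b y \<and> ?h b y \<le> 1" if "y \<in> space (PiM (?J b) (\<lambda>_. unit_interval))" for b y
    using a(2)[OF measurable_space[OF rei that]] g(2)[OF measurable_space[OF rei that]] by (cases b) simp_all
  let ?H = "\<lambda>y. \<Prod>b\<in>UNIV. ?h b (restrict y (?J b))"
  have Hm: "?H \<in> borel_measurable ?P2"
    by (intro borel_measurable_prod measurable_compose[OF measurable_restrict_PiM hm]) auto
  have "(\<integral>x. a (\<lambda>B\<in>I. s (x B)) * g (\<lambda>B\<in>I. c (x B)) \<partial>?P) = (\<integral>x. ?H (?T x) \<partial>?P)"
  proof (rule Bochner_Integration.integral_cong[OF refl])
    fix x
    have "(\<lambda>B\<in>I. restrict (?T x) (?J True) (B, True)) = (\<lambda>B\<in>I. s (x B))" "(\<lambda>B\<in>I. restrict (?T x) (?J False) (B, False)) = (\<lambda>B\<in>I. c (x B))"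
      by (auto simp: fun_eq_iff)
    then show "a (\<lambda>B\<in>I. s (x B)) * g (\<lambda>B\<in>I. c (x B)) = ?H (?T x)" unfolding UNIV_bool by simp
  qed
  also have "\<dots> = (\<integral>y. ?H y \<partial>?P2)" by (rule integral_distr[OF Tm Hm, unfolded law2, symmetric])
  also have "\<dots> = (\<Prod>b\<in>UNIV. \<integral>y. ?h b y \<partial>PiM (?J b) (\<lambda>_. unit_interval))"
    by (rule integral_prod_disjoint[OF prob_space_unit_interval _ fK _ _ hm hb]) (auto simp: disjoint_family_on_def)
  also have "\<dots> = (\<integral>y. a (\<lambda>B\<in>I. y (B, True)) \<partial>PiM (?J True) (\<lambda>_. unit_interval)) * (\<integral>y. g (\<lambda>B\<in>I. y (B, False)) \<partial>PiM (?J False) (\<lambda>_. unit_interval))"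
    unfolding UNIV_bool by simp
  also have "(\<integral>y. a (\<lambda>B\<in>I. y (B, True)) \<partial>PiM (?J True) (\<lambda>_. unit_interval)) = (\<integral>x. a x \<partial>?P)"
    by (rule integral_PiM_reindex[OF prob_space_unit_interval]) (use a(1) in \<open>auto simp: inj_on_def cube_def\<close>)
  also have "(\<integral>y. g (\<lambda>B\<in>I. y (B, False)) \<partial>PiM (?J False) (\<lambda>_. unit_interval)) = (\<integral>x. g x \<partial>?P)"
    by (rule integral_PiM_reindex[OF prob_space_unit_interval]) (use g(1) in \<open>auto simp: inj_on_def cube_def\<close>)
  finally show ?thesis unfolding cube_def .
qed


section \<open>Symmetrising a kernel by sorting the vertices\<close>

lemma sorting_permutation_exists:
  fixes val :: "nat \<Rightarrow> real"
  assumes V: "finite V" and inj: "inj_on val V"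
  shows "\<exists>\<rho>. \<rho> permutes V \<and> (\<forall>v\<in>V. \<forall>w\<in>V. v < w \<longrightarrow> val (\<rho> v) < val (\<rho> w))"
proof -
  let ?X = "val ` V"
  have cX: "card ?X = card V" by (rule card_image[OF inj])
  have bX: "bij_betw (enum ?X) {1..card V} ?X" using enum_bij[of ?X] V cX by simp
  have bV: "bij_betw (enum V) {1..card V} V" by (rule enum_bij[OF V])
  have bi: "bij_betw (inv_into {1..card V} (enum V)) V {1..card V}" by (rule bij_betw_inv_into[OF bV])
  have bval: "bij_betw (inv_into V val) ?X V" by (rule bij_betw_inv_into) (use inj in \<open>simp add: bij_betw_def\<close>)
  define \<rho> where "\<rho> v = (if v \<in> V then inv_into V val (enum ?X (inv_into {1..card V} (enum V) v)) else v)" for v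
  have "bij_betw (\<lambda>v. inv_into V val (enum ?X (inv_into {1..card V} (enum V) v))) V V"
    using bij_betw_trans[OF bij_betw_trans[OF bi bX] bval] by (simp add: comp_def)
  then have "bij_betw \<rho> V V" by (rule bij_betw_cong[THEN iffD1, rotated]) (simp add: \<rho>_def)
  then have "\<rho> permutes V" by (rule bij_imp_permutes) (simp add: \<rho>_def)
  moreover have "val (\<rho> v) < val (\<rho> w)" if "v \<in> V" "w \<in> V" "v < w" for v w
  proof -
    let ?i = "inv_into {1..card V} (enum V)"
    have iv: "?i v \<in> {1..card V}" "?i w \<in> {1..card V}" using bij_betwE[OF bi] that by auto
    have ev: "enum V (?i v) = v" "enum V (?i w) = w" using bij_betw_inv_into_right[OF bV] that by auto
    have "?i v < ?i w"
    proof (rule ccontr)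
      assume "\<not> ?i v < ?i w"
      then consider "?i v = ?i w" | "?i w < ?i v" by linarith
      then show False
      proof cases
        case 1 then show False using ev that(3) by simp
      next
        case 2 then have "enum V (?i w) < enum V (?i v)" using iv by (intro enum_mono[OF V]) auto
        then show False using ev that(3) by simp
      qed
    qed
    then have "enum ?X (?i v) < enum ?X (?i w)" using iv V cX by (intro enum_mono) auto
    moreover have "val (\<rho> v) = enum ?X (?i v)" "val (\<rho> w) = enum ?X (?i w)"
      using that iv bij_betwE[OF bX] by (simp_all add: \<rho>_def f_inv_into_f)
    ultimately show ?thesis by simp
  qed
  ultimately show ?thesis by blast
qed

lemma sorting_unique:
  fixes val :: "'a \<Rightarrow> real" and \<beta> \<beta>' :: "nat \<Rightarrow> 'a"
  assumes inc: "\<And>i j. 1 \<le> i \<Longrightarrow> i < j \<Longrightarrow> j \<le> k \<Longrightarrow> val (\<beta> i) < val (\<beta> j)"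
    and inc': "\<And>i j. 1 \<le> i \<Longrightarrow> i < j \<Longrightarrow> j \<le> k \<Longrightarrow> val (\<beta>' i) < val (\<beta>' j)"
    and im: "\<beta> ` {1..k} = \<beta>' ` {1..k}" and i: "i \<in> {1..k}"
  shows "\<beta> i = \<beta>' i"
proof -
  let ?X = "(\<lambda>i. val (\<beta> i)) ` {1..k}"
  have inj: "inj_on (\<lambda>i. val (\<beta> i)) {1..k}"
  proof (rule linorder_inj_onI)
    fix i j assume "i < j" "i \<in> {1..k}" "j \<in> {1..k}"
    then show "val (\<beta> i) \<noteq> val (\<beta> j)" using inc[of i j] by simp
  qed auto
  have X': "(\<lambda>i. val (\<beta>' i)) ` {1..k} = ?X" using im by (metis image_image)
  have c: "card ?X = k" using card_image[OF inj] by simp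
  have e: "enum ?X i = val (\<beta> i)" if "i \<in> {1..k}" for i
    by (rule enum_unique) (use c inc that in simp_all)
  have e': "enum ?X i = val (\<beta>' i)" if "i \<in> {1..k}" for i
    by (rule enum_unique) (use c inc' X' that in simp_all)
  obtain j where j: "j \<in> {1..k}" "\<beta>' i = \<beta> j" using im i by (metis imageE imageI)
  have "val (\<beta> i) = val (\<beta> j)" using e[OF i] e'[OF i] j(2) by simp
  then have "i = j" by (rule inj_onD[OF inj _ i j(1)])
  then show ?thesis using j(2) by simp
qed

definition sorted_by :: "(real \<Rightarrow> real) \<Rightarrow> nat \<Rightarrow> (nat \<Rightarrow> nat) \<Rightarrow> (nat set \<Rightarrow> real) \<Rightarrow> bool" where
  "sorted_by s k \<beta> x \<longleftrightarrow> (\<forall>i\<in>{1..k}. \<forall>j\<in>{1..k}. i < j \<longrightarrow> s (x {\<beta> i}) < s (x {\<beta> j}))"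

text \<open>Sorting the vertices by \<open>s\<close> and evaluating a non-symmetric kernel on the independent
  coordinates \<open>c\<close> makes it symmetric without changing the densities.\<close>

definition symm :: "(real \<Rightarrow> real) \<Rightarrow> (real \<Rightarrow> real) \<Rightarrow> nat \<Rightarrow> ((nat set \<Rightarrow> real) \<Rightarrow> real) \<Rightarrow> (nat set \<Rightarrow> real) \<Rightarrow> real" where
  "symm s c k W x = (\<Sum>\<sigma> | \<sigma> permutes {1..k}. of_bool (sorted_by s k \<sigma> x) * W (pull k \<sigma> (\<lambda>B. c (x B))))"

lemma singleton_rprop:
  assumes "2 \<le> k" "i \<in> {1..k}" shows "{i} \<in> rprop {1..k}"
proof -
  have "{i} \<noteq> {1..k}"
  proof
    assume "{i} = {1..k}"
    then have "card {i} = card {1..k}" by (rule arg_cong)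
    then show False using assms(1) by simp
  qed
  then show ?thesis using assms(2) by (auto simp: rprop_def)
qed

lemma sorted_by_unique:
  assumes "\<sigma> permutes {1..k}" "\<sigma>' permutes {1..k}" "sorted_by s k \<sigma> x" "sorted_by s k \<sigma>' x"
  shows "\<sigma> = \<sigma>'"
proof
  fix i
  show "\<sigma> i = \<sigma>' i"
  proof (cases "i \<in> {1..k}")
    case True
    show ?thesis
    proof (rule sorting_unique[where val = "\<lambda>v. s (x {v})" and k = k and \<beta> = \<sigma> and \<beta>' = \<sigma>'])
      show "s (x {\<sigma> i}) < s (x {\<sigma> j})" if "1 \<le> i" "i < j" "j \<le> k" for i j
        using assms(3) that unfolding sorted_by_def by simp
      show "s (x {\<sigma>' i}) < s (x {\<sigma>' j})" if "1 \<le> i" "i < j" "j \<le> k" for i j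
        using assms(4) that unfolding sorted_by_def by simp
      show "\<sigma> ` {1..k} = \<sigma>' ` {1..k}" unfolding permutes_image[OF assms(1)] permutes_image[OF assms(2)] ..
    qed (rule True)
  next
    case False
    then show ?thesis using assms(1,2) by (simp add: permutes_def)
  qed
qed

text \<open>At most one permutation sorts the vertices strictly, so at most one term of the sum is
  non-zero.\<close>

lemma symm_eq:
  assumes "\<sigma> permutes {1..k}" "sorted_by s k \<sigma> x"
  shows "symm s c k W x = W (pull k \<sigma> (\<lambda>B. c (x B)))"
proof -
  have "symm s c k W x = (\<Sum>\<tau> | \<tau> permutes {1..k}. if \<tau> = \<sigma> then W (pull k \<sigma> (\<lambda>B. c (x B))) else 0)"
    unfolding symm_def
  proof (rule sum.cong[OF refl])
    fix \<tau> assume "\<tau> \<in> {\<tau>. \<tau> permutes {1..k}}"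
    then have \<tau>: "\<tau> permutes {1..k}" by simp
    show "of_bool (sorted_by s k \<tau> x) * W (pull k \<tau> (\<lambda>B. c (x B))) = (if \<tau> = \<sigma> then W (pull k \<sigma> (\<lambda>B. c (x B))) else 0)"
    proof (cases "\<tau> = \<sigma>")
      case True then show ?thesis using assms(2) by simp
    next
      case False
      then have "\<not> sorted_by s k \<tau> x" using sorted_by_unique[OF \<tau> assms(1) _ assms(2)] by blast
      then show ?thesis using False by simp
    qed
  qed
  then show ?thesis using assms(1) finite_permutations[of "{1..k}"] by simp
qed

lemma symm_zero: "(\<And>\<sigma>. \<sigma> permutes {1..k} \<Longrightarrow> \<not> sorted_by s k \<sigma> x) \<Longrightarrow> symm s c k W x = 0"
  unfolding symm_def by (rule sum.neutral) simp

lemma map_cube_measurable: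
  assumes "c \<in> measurable unit_interval unit_interval"
  shows "(\<lambda>x. \<lambda>B\<in>I. c (x B)) \<in> measurable (cube I) (cube I)"
  unfolding cube_def
  by (rule measurable_restrict) (rule measurable_compose[OF measurable_component_singleton[of _ I "\<lambda>_. unit_interval"] assms])

lemma pull_map_restrict:
  assumes "\<And>B. B \<in> rprop {1..k} \<Longrightarrow> \<beta> ` B \<in> I"
  shows "pull k \<beta> (\<lambda>B. c (x B)) = pull k \<beta> (\<lambda>B\<in>I. c (x B))"
  by (rule pull_cong) (use assms in simp)

lemma sorted_by_measurable:
  assumes s: "s \<in> measurable unit_interval unit_interval" and "\<And>i. i \<in> {1..k} \<Longrightarrow> {\<beta> i} \<in> I"
  shows "(\<lambda>x. of_bool (sorted_by s k \<beta> x) :: real) \<in> borel_measurable (cube I)"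
proof -
  have sm: "(\<lambda>x. s (x {\<beta> i})) \<in> borel_measurable (cube I)" if "i \<in> {1..k}" for i
    unfolding cube_def
    by (rule measurable_compose[OF measurable_compose[OF measurable_component_singleton[of _ I "\<lambda>_. unit_interval"] s] borel_measurable_unit_interval_id])
       (rule assms(2)[OF that])
  have "{x \<in> space (cube I). sorted_by s k \<beta> x} \<in> sets (cube I)"
    unfolding sorted_by_def
  proof (intro sets.sets_Collect_finite_All finite_atLeastAtMost)
    fix i j assume "i \<in> {1..k}" "j \<in> {1..k}"
    then have [measurable]: "(\<lambda>x. s (x {\<beta> i})) \<in> borel_measurable (cube I)" "(\<lambda>x. s (x {\<beta> j})) \<in> borel_measurable (cube I)" by (auto intro: sm)
    show "{x \<in> space (cube I). i < j \<longrightarrow> s (x {\<beta> i}) < s (x {\<beta> j})} \<in> sets (cube I)" by (cases "i < j") simp_all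
  qed
  then show ?thesis unfolding of_bool_def by (intro measurable_If) (simp_all add: pred_def)
qed

lemma permutes_image_rprop: "\<sigma> permutes {1..k} \<Longrightarrow> B \<in> rprop {1..k} \<Longrightarrow> \<sigma> ` B \<in> rprop {1..k}"
  by (rule image_rprop[OF permutes_imp_bij])

lemma hypergraphon_symm:
  assumes W: "unit_kernel k W" and k: "2 \<le> k"
    and s: "s \<in> measurable unit_interval unit_interval" and c: "c \<in> measurable unit_interval unit_interval"
  shows "hypergraphon k (symm s c k W)"
  unfolding hypergraphon_def
proof (intro conjI ballI allI impI)
  let ?I = "rprop {1..k}"
  have pe: "(\<lambda>x. W (pull k \<sigma> (\<lambda>B. c (x B)))) \<in> borel_measurable (cube ?I)"
    "x \<in> space (cube ?I) \<Longrightarrow> 0 \<le> W (pull k \<sigma> (\<lambda>B. c (x B))) \<and> W (pull k \<sigma> (\<lambda>B. c (x B))) \<le> 1" if \<sigma>: "\<sigma> permutes {1..k}" for \<sigma> x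
  proof -
    note u = unit_kernel_pull[OF W permutes_imp_bij[OF \<sigma>] subset_refl]
    have r: "W (pull k \<sigma> (\<lambda>B. c (x B))) = W (pull k \<sigma> (\<lambda>B\<in>?I. c (x B)))" for x
      by (rule arg_cong[of _ _ W], rule pull_map_restrict, rule permutes_image_rprop[OF \<sigma>])
    show "(\<lambda>x. W (pull k \<sigma> (\<lambda>B. c (x B)))) \<in> borel_measurable (cube ?I)"
      by (subst r) (rule measurable_compose[OF map_cube_measurable[OF c] u(1)])
    show "0 \<le> W (pull k \<sigma> (\<lambda>B. c (x B))) \<and> W (pull k \<sigma> (\<lambda>B. c (x B))) \<le> 1" if "x \<in> space (cube ?I)"
      using u(2)[OF measurable_space[OF map_cube_measurable[OF c] that]] r[of x] by simp
  qed
  show "symm s c k W \<in> borel_measurable (cube ?I)"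
    unfolding symm_def
  proof (intro borel_measurable_sum borel_measurable_times)
    fix \<sigma> assume "\<sigma> \<in> {\<sigma>. \<sigma> permutes {1..k}}"
    then have \<sigma>: "\<sigma> permutes {1..k}" by simp
    show "(\<lambda>x. of_bool (sorted_by s k \<sigma> x) :: real) \<in> borel_measurable (cube ?I)"
      by (rule sorted_by_measurable[OF s]) (use singleton_rprop[OF k] permutes_in_image[OF \<sigma>] in blast)
    show "(\<lambda>x. W (pull k \<sigma> (\<lambda>B. c (x B)))) \<in> borel_measurable (cube ?I)" by (rule pe(1)[OF \<sigma>])
  qed
  fix x assume x: "x \<in> space (cube ?I)"
  have "0 \<le> symm s c k W x \<and> symm s c k W x \<le> 1"
  proof (cases "\<exists>\<sigma>. \<sigma> permutes {1..k} \<and> sorted_by s k \<sigma> x")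
    case True
    then obtain \<sigma> where "\<sigma> permutes {1..k}" "sorted_by s k \<sigma> x" by blast
    then show ?thesis using symm_eq pe(2) x by metis
  next
    case False
    then show ?thesis using symm_zero[of k s x c W] by auto
  qed
  then show "0 \<le> symm s c k W x" "symm s c k W x \<le> 1" by auto
next
  fix \<tau> x assume \<tau>x: "\<tau> permutes {1..k} \<and> x \<in> space (cube (rprop {1..k}))"
  then have \<tau>: "\<tau> permutes {1..k}" by simp
  let ?x = "\<lambda>B\<in>rprop {1..k}. x (\<tau> ` B)"
  let ?T = "\<lambda>\<sigma>. of_bool (sorted_by s k \<sigma> x) * W (pull k \<sigma> (\<lambda>B. c (x B)))"
  have "symm s c k W ?x = (\<Sum>\<sigma> | \<sigma> permutes {1..k}. ?T (\<tau> \<circ> \<sigma>))"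
    unfolding symm_def
  proof (rule sum.cong[OF refl])
    fix \<sigma> assume "\<sigma> \<in> {\<sigma>. \<sigma> permutes {1..k}}"
    then have \<sigma>: "\<sigma> permutes {1..k}" by simp
    have "?x {\<sigma> i} = x {(\<tau> \<circ> \<sigma>) i}" if "i \<in> {1..k}" for i
      using singleton_rprop[OF k, of "\<sigma> i"] permutes_in_image[OF \<sigma>, of i] that by simp
    then have "sorted_by s k \<sigma> ?x \<longleftrightarrow> sorted_by s k (\<tau> \<circ> \<sigma>) x" unfolding sorted_by_def by (simp only: cong: ball_cong)
    moreover have "pull k \<sigma> (\<lambda>B. c (?x B)) = pull k (\<tau> \<circ> \<sigma>) (\<lambda>B. c (x B))"
      by (rule pull_cong) (use permutes_image_rprop[OF \<sigma>] in \<open>simp add: image_comp\<close>)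
    ultimately show "of_bool (sorted_by s k \<sigma> ?x) * W (pull k \<sigma> (\<lambda>B. c (?x B))) = ?T (\<tau> \<circ> \<sigma>)" by simp
  qed
  \<comment> \<open>Permuting the coordinates by \<tau> only reindexes the sum over
    permutations.\<close>
  also have "\<dots> = symm s c k W x" unfolding symm_def by (rule setum_permutations_compose_left[OF \<tau>, symmetric])
  finally show "symm s c k W ?x = symm s c k W x" .
qed

text \<open>Sorts the whole vertex set, where \<open>sorted_by\<close> sorts one edge; the global
  order induces that of every edge.\<close>

definition vsorted :: "(real \<Rightarrow> real) \<Rightarrow> nat set \<Rightarrow> (nat \<Rightarrow> nat) \<Rightarrow> (nat set \<Rightarrow> real) \<Rightarrow> bool" where
  "vsorted s V \<rho> x \<longleftrightarrow> (\<forall>v\<in>V. \<forall>w\<in>V. v < w \<longrightarrow> s (x {\<rho> v}) < s (x {\<rho> w}))"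

lemma vsorted_unique:
  assumes V: "finite V" and \<rho>: "\<rho> permutes V" "\<rho>' permutes V" and inc: "vsorted s V \<rho> x" "vsorted s V \<rho>' x"
  shows "\<rho> = \<rho>'"
proof
  fix v
  have bV: "bij_betw (enum V) {1..card V} V" by (rule enum_bij[OF V])
  have im: "(\<rho> \<circ> enum V) ` {1..card V} = V" if "\<rho> permutes V" for \<rho>
    using bij_betw_imp_surj_on[OF bij_betw_trans[OF bV permutes_imp_bij[OF that]]] .
  have mono: "s (x {(\<rho> \<circ> enum V) i}) < s (x {(\<rho> \<circ> enum V) j})" if "vsorted s V \<rho> x" "1 \<le> i" "i < j" "j \<le> card V" for \<rho> i j
  proof -
    have "enum V i \<in> V" "enum V j \<in> V" using bij_betwE[OF bV] that by auto
    moreover have "enum V i < enum V j" by (rule enum_mono[OF V that(2-4)])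
    ultimately show ?thesis using that(1) unfolding vsorted_def by simp
  qed
  show "\<rho> v = \<rho>' v"
  proof (cases "v \<in> V")
    case True
    then obtain i where i: "i \<in> {1..card V}" "v = enum V i" using bij_betw_imp_surj_on[OF bV] by blast
    have "(\<rho> \<circ> enum V) i = (\<rho>' \<circ> enum V) i"
      by (rule sorting_unique[where val = "\<lambda>v. s (x {v})" and k = "card V" and \<beta> = "\<rho> \<circ> enum V" and \<beta>' = "\<rho>' \<circ> enum V"])
        (use mono[OF inc(1)] mono[OF inc(2)] im[OF \<rho>(1)] im[OF \<rho>(2)] i(1) in \<open>simp_all only:\<close>)
    then show ?thesis using i(2) by simp
  next
    case False
    then show ?thesis using \<rho> by (simp add: permutes_def)
  qed
qed

text \<open>Ties are negligible: with one coordinate fixed, the uniform law of the other gives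
  measure 0 to a point.\<close>

lemma AE_split_distinct:
  assumes s: "s \<in> measurable unit_interval unit_interval" and law: "distr unit_interval unit_interval s = unit_interval"
    and B: "B \<in> I" "B' \<in> I" "B \<noteq> B'"
  shows "AE x in cube I. s (x B) \<noteq> s (x B')"
proof -
  interpret U: prob_space unit_interval by (rule prob_space_unit_interval)
  interpret PU: product_prob_space "\<lambda>_ :: nat set. unit_interval" UNIV ..
  let ?P = "PiM {B', B} (\<lambda>_. unit_interval)"
  have sr: "s \<in> borel_measurable unit_interval" using measurable_compose[OF s borel_measurable_unit_interval_id] .
  have [measurable]: "(\<lambda>x. s (x B)) \<in> borel_measurable ?P" "(\<lambda>x. s (x B')) \<in> borel_measurable ?P"
    by (rule measurable_compose[OF measurable_component_singleton[of _ "{B', B}" "\<lambda>_. unit_interval"] sr], simp)+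
  let ?f = "\<lambda>x. of_bool (s (x B) = s (x B')) :: real"
  have fm: "?f \<in> borel_measurable ?P" unfolding of_bool_def by measurable
  have int: "integrable ?P ?f" by (rule prob_space.integrable_unit[OF prob_space_cube[unfolded cube_def] fm]) simp
  have "(\<integral>x. ?f x \<partial>?P) = (\<integral>x. \<integral>y. ?f (x(B' := y)) \<partial>unit_interval \<partial>PiM {B} (\<lambda>_. unit_interval))"
  proof (rule PU.product_integral_insert[OF _ _ int])
    show "finite {B}" "B' \<notin> {B}" using B(3) by auto
  qed
  also have "\<dots> = (\<integral>x. 0 \<partial>PiM {B} (\<lambda>_. unit_interval))"
  proof (rule Bochner_Integration.integral_cong[OF refl])
    fix x assume "x \<in> space (PiM {B} (\<lambda>_. unit_interval))"
    let ?t = "s (x B)"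
    have sing: "{?t} \<inter> {0..1} \<in> sets unit_interval" unfolding sets_unit_interval by (subst sets_restrict_space_iff) simp_all
    have "(\<integral>y. ?f (x(B' := y)) \<partial>unit_interval) = (\<integral>y. indicator ({?t} \<inter> {0..1}) (s y) \<partial>unit_interval)"
    proof (rule Bochner_Integration.integral_cong[OF refl])
      fix y assume "y \<in> space unit_interval"
      then have "s y \<in> {0..1}" using measurable_space[OF s] by simp
      then show "?f (x(B' := y)) = indicator ({?t} \<inter> {0..1}) (s y)" using B(3) by (cases "s (x B) = s y") (simp_all add: indicator_def)
    qed
    also have "\<dots> = (\<integral>y. indicator ({?t} \<inter> {0..1}) y \<partial>distr unit_interval unit_interval s)"
      by (rule integral_distr[symmetric, OF s]) (use sing in simp)
    also have "\<dots> = measure unit_interval ({?t} \<inter> {0..1})" unfolding law using sing by simp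
    also have "\<dots> = 0" unfolding unit_interval_def
      by (subst measure_restrict_space) (auto simp: measure_lborel_singleton Int_insert_left)
    finally show "(\<integral>y. ?f (x(B' := y)) \<partial>unit_interval) = 0" .
  qed
  finally have "(\<integral>x. ?f x \<partial>?P) = 0" by simp
  then have "AE x in ?P. ?f x = 0" by (subst (asm) integral_nonneg_eq_0_iff_AE[OF int]) auto
  then have "AE x in ?P. s (x B) \<noteq> s (x B')" by (rule AE_mp) (auto intro!: AE_I2)
  then have "AE x in cube I. s ((\<lambda>j\<in>{B', B}. x j) B) \<noteq> s ((\<lambda>j\<in>{B', B}. x j) B')"
    unfolding cube_def by (intro AE_PiM_reindex[OF prob_space_unit_interval, of "\<lambda>j. j" "{B', B}" I "\<lambda>x. s (x B) \<noteq> s (x B')"]) (use B in auto)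
  then show ?thesis by simp
qed

text \<open>The integral is split according to the permutation \<rho> of V that sorts the vertices
  by their s-values. On this event every edge is evaluated in the order given by \<rho>, which
  yields the density in W of a relabelled H on the c-values. Independence of s and c gives p * t for
  each \<rho>. The factor q depends on V alone, so it can be found from another graph on V.\<close>

lemma t_hom_symm_aux:
  assumes W: "unit_kernel k W" and k: "2 \<le> k"
    and s: "s \<in> measurable unit_interval unit_interval" and c: "c \<in> measurable unit_interval unit_interval"
    and law: "distr unit_interval (unit_interval \<Otimes>\<^sub>M unit_interval) (\<lambda>u. (s u, c u)) = unit_interval \<Otimes>\<^sub>M unit_interval"
    and V: "finite V"
  shows "\<exists>q. \<forall>H t. kgraph k H \<and> verts H = V \<and> (\<forall>f. inj_on f V \<longrightarrow> t_hom k (relabel f H) W = t) \<longrightarrow> t_hom k H (symm s c k W) = q * t"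
proof -
  let ?I = "binom_le V (k - 1)" and ?W = "symm s c k W"
  let ?Perm = "{\<rho>. \<rho> permutes V}"
  have hyp: "hypergraphon k ?W" by (rule hypergraphon_symm[OF W k s c])
  note uW = hypergraphon_unit_kernel[OF hyp]
  have fI: "finite ?I" using V by simp
  have fP: "finite ?Perm" using V by (rule finite_permutations)
  have sing: "{v} \<in> ?I" if "v \<in> V" for v using that k by (simp add: binom_le_def)
  have law_s: "distr unit_interval unit_interval s = unit_interval"
  proof -
    interpret U: prob_space unit_interval by (rule prob_space_unit_interval)
    have scm: "(\<lambda>u. (s u, c u)) \<in> measurable unit_interval (unit_interval \<Otimes>\<^sub>M unit_interval)" by (rule measurable_Pair[OF s c])
    have "distr unit_interval unit_interval s = distr (distr unit_interval (unit_interval \<Otimes>\<^sub>M unit_interval) (\<lambda>u. (s u, c u))) unit_interval fst"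
      by (subst distr_distr[OF measurable_fst scm]) (simp add: comp_def)
    also have "\<dots> = distr (unit_interval \<Otimes>\<^sub>M unit_interval) unit_interval fst" unfolding law ..
    also have "\<dots> = unit_interval"
    proof (rule measure_eqI)
      fix A assume "A \<in> sets (distr (unit_interval \<Otimes>\<^sub>M unit_interval) unit_interval fst)"
      then have A: "A \<in> sets unit_interval" by simp
      have "fst -` A \<inter> space (unit_interval \<Otimes>\<^sub>M unit_interval) = A \<times> space unit_interval"
        using sets.sets_into_space[OF A] by (auto simp: space_pair_measure)
      then show "emeasure (distr (unit_interval \<Otimes>\<^sub>M unit_interval) unit_interval fst) A = emeasure unit_interval A"
        using A U.emeasure_pair_measure_Times[OF A sets.top] U.emeasure_space_1 by (subst emeasure_distr) simp_all
    qed simp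
    finally show ?thesis .
  qed
  have AE1: "AE x in cube ?I. (\<Sum>\<rho>\<in>?Perm. of_bool (vsorted s V \<rho> x)) = (1::real)"
  proof -
    have "AE x in cube ?I. \<forall>z\<in>V \<times> V. fst z \<noteq> snd z \<longrightarrow> s (x {fst z}) \<noteq> s (x {snd z})"
    proof (rule AE_ball_countable[THEN iffD2], use V in \<open>simp add: countable_finite\<close>, intro ballI)
      fix z assume z: "z \<in> V \<times> V"
      show "AE x in cube ?I. fst z \<noteq> snd z \<longrightarrow> s (x {fst z}) \<noteq> s (x {snd z})"
      proof (cases "fst z = snd z")
        case False
        have "AE x in cube ?I. s (x {fst z}) \<noteq> s (x {snd z})"
          by (rule AE_split_distinct[OF s law_s]) (use sing z False in auto)
        then show ?thesis by (rule AE_mp) (intro AE_I2, simp)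
      qed simp
    qed
    then show ?thesis
    proof (rule AE_mp, intro AE_I2 impI)
      fix x assume d: "\<forall>z\<in>V \<times> V. fst z \<noteq> snd z \<longrightarrow> s (x {fst z}) \<noteq> s (x {snd z})"
      have "inj_on (\<lambda>v. s (x {v})) V"
      proof (rule inj_onI, rule ccontr)
        fix v w assume "v \<in> V" "w \<in> V" "s (x {v}) = s (x {w})" "v \<noteq> w"
        then show False using d[rule_format, of "(v, w)"] by simp
      qed
      from sorting_permutation_exists[OF V this] obtain \<rho> where \<rho>: "\<rho> permutes V" "vsorted s V \<rho> x"
        unfolding vsorted_def by blast
      have "(\<Sum>\<tau>\<in>?Perm. of_bool (vsorted s V \<tau> x)) = (\<Sum>\<tau>\<in>?Perm. if \<tau> = \<rho> then 1 else 0 :: real)"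
      proof (rule sum.cong[OF refl])
        fix \<tau> assume "\<tau> \<in> ?Perm"
        then have \<tau>: "\<tau> permutes V" by simp
        show "of_bool (vsorted s V \<tau> x) = (if \<tau> = \<rho> then 1 else 0 :: real)"
        proof (cases "\<tau> = \<rho>")
          case True then show ?thesis using \<rho>(2) by simp
        next
          case False
          then have "\<not> vsorted s V \<tau> x" using vsorted_unique[OF V \<tau> \<rho>(1) _ \<rho>(2)] by blast
          then show ?thesis using False by simp
        qed
      qed
      then show "(\<Sum>\<tau>\<in>?Perm. of_bool (vsorted s V \<tau> x)) = (1::real)" using \<rho>(1) fP by simp
    qed
  qed
  have vsm: "(\<lambda>x. of_bool (vsorted (\<lambda>u. u) V (\<lambda>v. v) x) :: real) \<in> borel_measurable (cube ?I)"
  proof -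
    have "{x \<in> space (cube ?I). vsorted (\<lambda>u. u) V (\<lambda>v. v) x} \<in> sets (cube ?I)"
      unfolding vsorted_def
    proof (intro sets.sets_Collect_finite_All V)
      fix v w assume vw: "v \<in> V" "w \<in> V"
      have [measurable]: "(\<lambda>x. x {v}) \<in> borel_measurable (cube ?I)" "(\<lambda>x. x {w}) \<in> borel_measurable (cube ?I)"
        by (rule borel_measurable_cube_component[OF sing[OF vw(1)]], rule borel_measurable_cube_component[OF sing[OF vw(2)]])
      show "{x \<in> space (cube ?I). v < w \<longrightarrow> x {v} < x {w}} \<in> sets (cube ?I)" by measurable
    qed
    then show ?thesis unfolding of_bool_def by (intro measurable_If) (simp_all add: pred_def)
  qed
  define p where "p = (\<integral>x. of_bool (vsorted (\<lambda>u. u) V (\<lambda>v. v) x) \<partial>cube ?I :: real)"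
  have main: "t_hom k H ?W = (real (card ?Perm) * p) * t"
    if H: "kgraph k H" "verts H = V" and t: "\<And>f. inj_on f V \<Longrightarrow> t_hom k (relabel f H) W = t" for H t
  proof -
    let ?G = "\<lambda>x. \<Prod>A\<in>edges H. ?W (pull k (enum A) x)"
    have Gm: "?G \<in> borel_measurable (cube ?I)" and Gb: "\<And>x. x \<in> space (cube ?I) \<Longrightarrow> 0 \<le> ?G x \<and> ?G x \<le> 1"
      using t_hom_integrand[OF uW H(1)] unfolding H(2) by blast+
    have trm: "(\<lambda>x. of_bool (vsorted s V \<rho> x) * ?G x) \<in> borel_measurable (cube ?I) \<and>
       (\<integral>x. of_bool (vsorted s V \<rho> x) * ?G x \<partial>cube ?I) = p * t" if \<rho>: "\<rho> permutes V" for \<rho>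
    proof -
      \<comment> \<open>The vertex sorted into place v is \<rho> v; relabelling H by the inverse
        makes the sorted order the natural one.\<close>
      let ?r = "inv \<rho>"
      have r: "?r permutes V" by (rule permutes_inv[OF \<rho>])
      let ?H = "relabel ?r H"
      have rinj: "inj_on ?r V" using permutes_inj[OF r] by (rule inj_on_subset) simp
      have H': "kgraph k ?H" by (rule kgraph_relabel[OF H(1)]) (use rinj H(2) in simp)
      have VH': "verts ?H = V" using permutes_image[OF r] H(2) by simp
      let ?a = "\<lambda>x. of_bool (vsorted (\<lambda>u. u) V (\<lambda>v. v) x) :: real"
      let ?g = "\<lambda>x. \<Prod>A\<in>edges ?H. W (pull k (enum A) x)"
      have gm: "?g \<in> borel_measurable (cube ?I)" and gb: "\<And>x. x \<in> space (cube ?I) \<Longrightarrow> 0 \<le> ?g x \<and> ?g x \<le> 1"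
        using t_hom_integrand[OF W H'] unfolding VH' by blast+
      let ?\<Psi> = "\<lambda>x. ?a (\<lambda>B\<in>?I. s (x B)) * ?g (\<lambda>B\<in>?I. c (x B))"
      have \<Psi>m: "?\<Psi> \<in> borel_measurable (cube ?I)"
        by (intro borel_measurable_times measurable_compose[OF map_cube_measurable[OF s] vsm] measurable_compose[OF map_cube_measurable[OF c] gm])
      have "(\<integral>x. ?\<Psi> x \<partial>cube ?I) = p * (\<integral>x. ?g x \<partial>cube ?I)"
        unfolding p_def by (rule cube_split_integral[OF s c law fI vsm _ gm gb]) simp
      also have "(\<integral>x. ?g x \<partial>cube ?I) = t" using t[OF rinj] unfolding t_hom_pull VH' .
      finally have int\<Psi>: "(\<integral>x. ?\<Psi> x \<partial>cube ?I) = p * t" .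
      have \<rho>I: "\<rho> ` B \<in> ?I" if "B \<in> ?I" for B
      proof -
        have "card (\<rho> ` B) = card B" by (rule card_image[OF inj_on_subset[OF permutes_inj[OF \<rho>] subset_UNIV]])
        then show ?thesis using that permutes_image[OF \<rho>] by (auto simp: binom_le_def)
      qed
      have inj\<rho>: "inj_on ((`) \<rho>) ?I" by (rule inj_on_subset[OF inj_on_image_Pow[of \<rho> UNIV]]) (use permutes_inj[OF \<rho>] in auto)
      have eq: "?\<Psi> (\<lambda>B\<in>?I. x (\<rho> ` B)) = of_bool (vsorted s V \<rho> x) * ?G x" for x
      proof (cases "vsorted s V \<rho> x")
        case False
        have "(\<lambda>B\<in>?I. s ((\<lambda>B\<in>?I. x (\<rho> ` B)) B)) {v} = s (x {\<rho> v})" if "v \<in> V" for v using sing[OF that] by simp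
        then have "\<not> vsorted (\<lambda>u. u) V (\<lambda>v. v) (\<lambda>B\<in>?I. s ((\<lambda>B\<in>?I. x (\<rho> ` B)) B))"
          using False unfolding vsorted_def by (simp only: cong: ball_cong) simp
        then show ?thesis using False by simp
      next
        case True
        have "(\<lambda>B\<in>?I. s ((\<lambda>B\<in>?I. x (\<rho> ` B)) B)) {v} = s (x {\<rho> v})" if "v \<in> V" for v using sing[OF that] by simp
        then have a: "vsorted (\<lambda>u. u) V (\<lambda>v. v) (\<lambda>B\<in>?I. s ((\<lambda>B\<in>?I. x (\<rho> ` B)) B))"
          using True unfolding vsorted_def by (simp only: cong: ball_cong)
        have inj_r: "inj_on ((`) ?r) (edges H)" by (rule inj_on_image_edges[OF H(1)]) (use rinj H(2) in simp)
        have "?g (\<lambda>B\<in>?I. c ((\<lambda>B\<in>?I. x (\<rho> ` B)) B)) = (\<Prod>A\<in>edges H. W (pull k (enum (?r ` A)) (\<lambda>B\<in>?I. c ((\<lambda>B\<in>?I. x (\<rho> ` B)) B))))"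
          unfolding relabel_simps prod.reindex[OF inj_r] comp_def by (rule refl)
        also have "\<dots> = ?G x"
        proof (rule prod.cong[OF refl])
          fix A assume A: "A \<in> edges H"
          note eA = kgraph_edgeD[OF H(1) A]
          let ?A = "?r ` A"
          have A': "?A \<in> edges ?H" using A by simp
          note eA' = kgraph_edgeD[OF H' A', unfolded VH']
          let ?\<beta> = "\<rho> \<circ> enum ?A"
          have "\<rho> ` ?A = A" unfolding image_image using permutes_inverses(1)[OF \<rho>] by simp
          then have b\<beta>: "bij_betw ?\<beta> {1..k} A"
            using bij_betw_trans[OF eA'(5) bij_betw_subset[OF permutes_bij[OF \<rho>] subset_UNIV refl, of ?A]] by simp
          \<comment> \<open>The local sorting permutation of the edge A: it leads from the
            increasing enumeration of A to the one in the sorted order.\<close>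
          define \<sigma> where "\<sigma> i = (if i \<in> {1..k} then inv_into {1..k} (enum A) (?\<beta> i) else i)" for i
          have "bij_betw (\<lambda>i. inv_into {1..k} (enum A) (?\<beta> i)) {1..k} {1..k}"
            using bij_betw_trans[OF b\<beta> bij_betw_inv_into[OF eA(5)]] by (simp add: comp_def)
          then have "bij_betw \<sigma> {1..k} {1..k}" by (rule bij_betw_cong[THEN iffD1, rotated]) (simp add: \<sigma>_def)
          then have \<sigma>: "\<sigma> permutes {1..k}" by (rule bij_imp_permutes) (simp only: \<sigma>_def if_False)
          have e\<sigma>: "enum A (\<sigma> i) = ?\<beta> i" if "i \<in> {1..k}" for i
            using bij_betw_inv_into_right[OF eA(5)] bij_betwE[OF b\<beta>] that by (simp only: \<sigma>_def if_True)
          have img: "enum A ` \<sigma> ` B = ?\<beta> ` B" if "B \<in> rprop {1..k}" for B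
            unfolding image_image by (rule image_cong[OF refl e\<sigma>]) (use that in \<open>auto simp: rprop_def\<close>)
          have "sorted_by s k \<sigma> (pull k (enum A) x)"
            unfolding sorted_by_def
          proof (intro ballI impI)
            fix i j assume ij: "i \<in> {1..k}" "j \<in> {1..k}" "i < j"
            have pl: "pull k (enum A) x {\<sigma> i} = x {?\<beta> i}" if "i \<in> {1..k}" for i
              using singleton_rprop[OF k, of "\<sigma> i"] permutes_in_image[OF \<sigma>, of i] that e\<sigma>[OF that] by (simp add: pull_def)
            have "enum ?A i \<in> V" "enum ?A j \<in> V" using bij_betwE[OF eA'(5)] ij eA'(2) by blast+
            moreover have "enum ?A i < enum ?A j" by (rule enum_mono) (use ij eA' in auto)
            ultimately show "s (pull k (enum A) x {\<sigma> i}) < s (pull k (enum A) x {\<sigma> j})"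
              using True unfolding pl[OF ij(1)] pl[OF ij(2)] vsorted_def by simp
          qed
          then have "?W (pull k (enum A) x) = W (pull k \<sigma> (\<lambda>B. c (pull k (enum A) x B)))" by (rule symm_eq[OF \<sigma>])
          also have "pull k \<sigma> (\<lambda>B. c (pull k (enum A) x B)) = pull k (enum ?A) (\<lambda>B\<in>?I. c ((\<lambda>B\<in>?I. x (\<rho> ` B)) B))"
          proof (rule pull_cong)
            fix B assume B: "B \<in> rprop {1..k}"
            have "enum ?A ` B \<in> ?I" using image_rprop[OF eA'(5) B] eA'(6) by blast
            moreover have "pull k (enum A) x (\<sigma> ` B) = x (\<rho> ` enum ?A ` B)"
              using permutes_image_rprop[OF \<sigma> B] img[OF B] by (simp add: pull_def image_comp)
            ultimately show "c (pull k (enum A) x (\<sigma> ` B)) = (\<lambda>B\<in>?I. c ((\<lambda>B\<in>?I. x (\<rho> ` B)) B)) (enum ?A ` B)" by simp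
          qed
          finally show "W (pull k (enum ?A) (\<lambda>B\<in>?I. c ((\<lambda>B\<in>?I. x (\<rho> ` B)) B))) = ?W (pull k (enum A) x)" by simp
        qed
        finally show ?thesis using True a by simp
      qed
      have "(\<integral>x. ?\<Psi> (\<lambda>B\<in>?I. x (\<rho> ` B)) \<partial>cube ?I) = (\<integral>x. ?\<Psi> x \<partial>cube ?I)"
        unfolding cube_def
        by (rule integral_PiM_reindex[OF prob_space_unit_interval inj\<rho> _ \<Psi>m[unfolded cube_def]]) (use \<rho>I in blast)
      then have "(\<integral>x. of_bool (vsorted s V \<rho> x) * ?G x \<partial>cube ?I) = p * t" unfolding eq int\<Psi> .
      moreover have "(\<lambda>x. ?\<Psi> (\<lambda>B\<in>?I. x (\<rho> ` B))) \<in> borel_measurable (cube ?I)"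
        by (rule measurable_compose[OF measurable_PiM_reindex[of "(`) \<rho>" ?I ?I unit_interval, folded cube_def] \<Psi>m]) (use \<rho>I in blast)
      ultimately show ?thesis unfolding eq by blast
    qed
    have int: "integrable (cube ?I) (\<lambda>x. of_bool (vsorted s V \<rho> x) * ?G x)" if "\<rho> \<in> ?Perm" for \<rho>
      by (rule prob_space.integrable_unit[OF prob_space_cube]) (use trm[of \<rho>] that in blast, rule mult_unit, simp, rule Gb)
    have "t_hom k H ?W = (\<integral>x. ?G x \<partial>cube ?I)" unfolding t_hom_pull H(2) ..
    also have "\<dots> = (\<integral>x. (\<Sum>\<rho>\<in>?Perm. of_bool (vsorted s V \<rho> x) * ?G x) \<partial>cube ?I)"
    proof (rule integral_cong_AE[OF Gm])
      show "(\<lambda>x. \<Sum>\<rho>\<in>?Perm. of_bool (vsorted s V \<rho> x) * ?G x) \<in> borel_measurable (cube ?I)"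
        by (rule borel_measurable_sum) (use trm in blast)
      show "AE x in cube ?I. ?G x = (\<Sum>\<rho>\<in>?Perm. of_bool (vsorted s V \<rho> x) * ?G x)"
        by (rule AE_mp[OF AE1], intro AE_I2 impI) (simp add: sum_distrib_right[symmetric])
    qed
    also have "\<dots> = (\<Sum>\<rho>\<in>?Perm. (\<integral>x. of_bool (vsorted s V \<rho> x) * ?G x \<partial>cube ?I))"
      by (rule Bochner_Integration.integral_sum[OF int])
    also have "\<dots> = (\<Sum>\<rho>\<in>?Perm. p * t)" by (rule sum.cong[OF refl]) (use trm in blast)
    finally show ?thesis by simp
  qed
  show ?thesis
    by (rule exI[of _ "real (card ?Perm) * p"]) (use main in blast)
qed

text \<open>The edgeless graph on the vertices of \<open>H\<close> has density 1 in every kernel,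
  which identifies the factor q as 1.\<close>

lemma t_hom_symm:
  assumes W: "unit_kernel k W" and k: "2 \<le> k"
    and s: "s \<in> measurable unit_interval unit_interval" and c: "c \<in> measurable unit_interval unit_interval"
    and law: "distr unit_interval (unit_interval \<Otimes>\<^sub>M unit_interval) (\<lambda>u. (s u, c u)) = unit_interval \<Otimes>\<^sub>M unit_interval"
    and H: "kgraph k H" and t: "\<And>f. inj_on f (verts H) \<Longrightarrow> t_hom k (relabel f H) W = t"
  shows "t_hom k H (symm s c k W) = t"
proof -
  have "finite (verts H)" using H by (simp add: kgraph_def)
  from t_hom_symm_aux[OF W k s c law this] obtain q where
    q: "\<And>H' t. kgraph k H' \<and> verts H' = verts H \<and> (\<forall>f. inj_on f (verts H) \<longrightarrow> t_hom k (relabel f H') W = t) \<Longrightarrow> t_hom k H' (symm s c k W) = q * t"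
    by blast
  have one: "t_hom k H' W' = 1" if "edges H' = {}" for H' and W' :: "(nat set \<Rightarrow> real) \<Rightarrow> real"
    unfolding t_hom_pull that by (simp add: prob_space.prob_space[OF prob_space_cube])
  have "t_hom k (verts H, {}) (symm s c k W) = q * 1"
    by (rule q) (use H in \<open>auto simp: kgraph_def intro!: one\<close>)
  then have "q = 1" using one[of "(verts H, {})" "symm s c k W"] by simp
  then show ?thesis using q[of H t] H t by simp
qed

text \<open>The densities of the limit array inherit multiplicativity and invariance under
  relabelling from those of the graphs, which is what the passage to a kernel and its symmetrisation
  require.\<close>

theorem hypergraphon_compactness:
  assumes k: "0 < k" and G: "\<And>n. kgraph k (G n) \<and> verts (G n) \<noteq> {}"
  shows "\<exists>r W. strict_mono (r :: nat \<Rightarrow> nat) \<and> hypergraphon k W \<and> converges_to k (\<lambda>n. G (r n)) W"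
proof -
  have G': "finite (verts (G n)) \<and> verts (G n) \<noteq> {}" for n using G[of n] by (simp add: kgraph_def)
  show ?thesis
  proof (rule exchangeable_limit[where G = G and k = k, OF G'])
  fix r :: "nat \<Rightarrow> nat" and P assume r: "strict_mono r" and P: "exchangeable_bits P"
    and lim: "\<And>J. finite J \<Longrightarrow> (\<lambda>n. gdens k (G (r n)) J) \<longlonglongrightarrow> measure P {b. \<forall>i\<in>J. b i}"
  have conv: "(\<lambda>n. t_graph H (G (r n))) \<longlonglongrightarrow> pdens P H" if H: "kgraph k H" for H
  proof -
    have "gdens k (G n) (set_encode ` edges H) = t_graph H (G n)" for n
      using G'[of n] by (intro gdens_t_graph[OF H]) auto
    moreover have "{b. \<forall>i\<in>set_encode ` edges H. b i} = {b. \<forall>e\<in>edges H. b (set_encode e)}" by auto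
    ultimately show ?thesis using lim[of "set_encode ` edges H"] kgraph_finite_edges[OF H] unfolding pdens_def by simp
  qed
  have rel: "pdens P (relabel f H) = pdens P H" if H: "kgraph k H" and f: "inj_on f (verts H)" for H f
  proof (rule LIMSEQ_unique[OF conv[OF kgraph_relabel[OF H f]]])
    have "t_graph (relabel f H) (G n) = t_graph H (G n)" for n using t_graph_relabel[OF H f] G'[of n] by blast
    then show "(\<lambda>n. t_graph (relabel f H) (G (r n))) \<longlonglongrightarrow> pdens P H" using conv[OF H] by simp
  qed
  have mult: "pdens P (disj_union H H') = pdens P H * pdens P H'" if H: "kgraph k H" "kgraph k H'" "verts H \<inter> verts H' = {}" for H H'
  proof (rule LIMSEQ_unique[OF conv[OF kgraph_disj_union[OF H(1,2)]]])
    have "t_graph (disj_union H H') (G n) = t_graph H (G n) * t_graph H' (G n)" for n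
      using t_graph_disj_union[OF H k] G'[of n] by blast
    then show "(\<lambda>n. t_graph (disj_union H H') (G (r n))) \<longlonglongrightarrow> pdens P H * pdens P H'"
      using tendsto_mult[OF conv[OF H(1)] conv[OF H(2)]] by simp
  qed
  have "pdens P (relabel f H) = pdens P H" if "kgraph k H" "inj f" for H f
    by (rule rel[OF that(1) inj_on_subset[OF that(2) subset_UNIV]])
  from kernel_of_exchangeable[OF P k mult this] obtain W where W: "unit_kernel k W"
    and tW: "\<And>H. kgraph k H \<Longrightarrow> t_hom k H W = pdens P H" by blast
  have "\<exists>W'. hypergraphon k W' \<and> (\<forall>H. kgraph k H \<longrightarrow> t_hom k H W' = pdens P H)"
  proof (cases "k = 1")
    case True
    \<comment> \<open>For k = 1 a kernel has no coordinates to sort by, and it is symmetric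
      already.\<close>
    have e: "rprop {1..k} = {}" unfolding True by (auto simp: rprop_def)
    have "hypergraphon k W" unfolding hypergraphon_def
    proof (intro conjI allI impI)
      show "W \<in> borel_measurable (cube (rprop {1..k}))" "\<forall>x\<in>space (cube (rprop {1..k})). 0 \<le> W x \<and> W x \<le> 1"
        using W unfolding unit_kernel_def by blast+
      fix \<sigma> :: "nat \<Rightarrow> nat" and x assume "\<sigma> permutes {1..k} \<and> x \<in> space (cube (rprop {1..k}))"
      then have "x \<in> extensional {}" unfolding e space_cube by (simp add: PiE_iff)
      then have "x = (\<lambda>B\<in>rprop {1..k}. x (\<sigma> ` B))" unfolding e by (simp add: fun_eq_iff extensional_def)
      then show "W (\<lambda>B\<in>rprop {1..k}. x (\<sigma> ` B)) = W x" by simp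
    qed
    then show ?thesis using tW by blast
  next
    case False
    then have k2: "2 \<le> k" using k by simp
    obtain s c where sc: "s \<in> measurable unit_interval unit_interval" "c \<in> measurable unit_interval unit_interval"
      "distr unit_interval (unit_interval \<Otimes>\<^sub>M unit_interval) (\<lambda>u. (s u, c u)) = unit_interval \<Otimes>\<^sub>M unit_interval"
      using unit_interval_split by blast
    have "t_hom k H (symm s c k W) = pdens P H" if H: "kgraph k H" for H
      by (rule t_hom_symm[OF W k2 sc H]) (simp add: tW[OF kgraph_relabel[OF H]] rel[OF H])
    then show ?thesis using hypergraphon_symm[OF W k2 sc(1,2)] by blast
  qed
  then obtain W' where "hypergraphon k W'" "\<And>H. kgraph k H \<Longrightarrow> t_hom k H W' = pdens P H" by blast
  then show ?thesis using r conv unfolding converges_to_def by (intro exI[of _ r] exI[of _ W']) auto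
  qed
qed

subsection \<open>Sampling from a hypergraphon\<close>

text \<open>One point of the cube over \<open>binom_le {1..n} k\<close> determines the whole random
  graph; the coordinate of a k-set is the coin tossed for that edge.\<close>

definition sgraph :: "nat \<Rightarrow> nat \<Rightarrow> ((nat set \<Rightarrow> real) \<Rightarrow> real) \<Rightarrow> (nat set \<Rightarrow> real) \<Rightarrow> hgraph" where
  "sgraph k n W x = ({1..n}, {A. A \<subseteq> {1..n} \<and> card A = k \<and> x A < W (pull k (enum A) x)})"

definition eind :: "nat \<Rightarrow> ((nat set \<Rightarrow> real) \<Rightarrow> real) \<Rightarrow> nat set \<Rightarrow> (nat set \<Rightarrow> real) \<Rightarrow> real" where
  "eind k W A x = of_bool (x A < W (pull k (enum A) x))"

lemma kgraph_sgraph: "kgraph k (sgraph k n W x)"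
  by (auto simp: kgraph_def sgraph_def)

lemma eind_unit: "0 \<le> eind k W A x \<and> eind k W A x \<le> 1"
  by (simp add: eind_def)

lemma eind_measurable:
  assumes W: "unit_kernel k W" and A: "finite A" "card A = k" and J: "rprop A \<subseteq> J" "A \<in> J"
  shows "eind k W A \<in> borel_measurable (cube J)"
proof -
  have bA: "bij_betw (enum A) {1..k} A" using enum_bij[OF A(1)] A(2) by simp
  have [measurable]: "(\<lambda>x. x A) \<in> borel_measurable (cube J)" "(\<lambda>x. W (pull k (enum A) x)) \<in> borel_measurable (cube J)"
    by (rule borel_measurable_cube_component[OF J(2)], rule unit_kernel_pull(1)[OF W bA J(1)])
  show ?thesis unfolding eind_def of_bool_def by measurable
qed

lemma eind_cong:
  assumes A: "finite A" "card A = k" and eq: "\<And>B. B \<in> rprop A \<Longrightarrow> x B = y B" "x A = y A"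
  shows "eind k W A x = eind k W A y"
proof -
  have bA: "bij_betw (enum A) {1..k} A" using enum_bij[OF A(1)] A(2) by simp
  have "pull k (enum A) x = pull k (enum A) y"
    by (rule pull_cong, rule eq(1), rule image_rprop[OF bA])
  then show ?thesis using eq(2) by (simp add: eind_def)
qed

lemma integral_of_bool_less:
  assumes "0 \<le> w \<and> w \<le> (1::real)" shows "(\<integral>u. of_bool (u < w) \<partial>unit_interval) = w"
proof -
  interpret U: prob_space unit_interval by (rule prob_space_unit_interval)
  let ?B = "{u \<in> {0..1}. ennreal u < ennreal w}"
  have B: "?B \<in> sets unit_interval"
  proof -
    have [measurable]: "(\<lambda>u. u) \<in> borel_measurable unit_interval" by (rule borel_measurable_unit_interval_id)
    have "{u \<in> space unit_interval. ennreal u < ennreal w} \<in> sets unit_interval" by measurable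
    then show ?thesis by simp
  qed
  have "(\<integral>u. of_bool (u < w) \<partial>unit_interval) = (\<integral>u. indicator ?B u \<partial>unit_interval :: real)"
    by (rule Bochner_Integration.integral_cong[OF refl]) (use assms in \<open>auto simp: indicator_def ennreal_less_iff\<close>)
  also have "\<dots> = measure unit_interval (?B \<inter> space unit_interval)" by (rule Bochner_Integration.integral_indicator)
  also have "?B \<inter> space unit_interval = ?B" by auto
  also have "measure unit_interval ?B = w"
    using emeasure_unit_interval_less[of "ennreal w"] assms by (simp add: measure_def min_absorb2 ennreal_le_1)
  finally show ?thesis .
qed

lemma eind_inner:
  assumes W: "unit_kernel k W" and A: "finite A" "card A = k" and x: "x \<in> space (cube J)" and J: "rprop A \<subseteq> J" "A \<notin> J"
  shows "(\<integral>u. eind k W A (x(A := u)) \<partial>unit_interval) = W (pull k (enum A) x)"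
proof -
  have bA: "bij_betw (enum A) {1..k} A" using enum_bij[OF A(1)] A(2) by simp
  have "pull k (enum A) (x(A := u)) = pull k (enum A) x" for u
  proof (rule pull_cong)
    fix B assume "B \<in> rprop {1..k}"
    then have "enum A ` B \<noteq> A" using image_rprop[OF bA] by (auto simp: rprop_def)
    then show "(x(A := u)) (enum A ` B) = x (enum A ` B)" by simp
  qed
  then have "(\<integral>u. eind k W A (x(A := u)) \<partial>unit_interval) = (\<integral>u. of_bool (u < W (pull k (enum A) x)) \<partial>unit_interval)"
    unfolding eind_def by simp
  also have "\<dots> = W (pull k (enum A) x)"
    by (rule integral_of_bool_less[OF unit_kernel_pull(2)[OF W bA J(1) x]])
  finally show ?thesis .
qed

text \<open>Integrating the coin of each edge first leaves the product of the kernel values. The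
  coordinates outside the vertices of \<open>F\<close> then integrate out.\<close>

lemma sample_expectation:
  assumes W: "unit_kernel k W" and F: "kgraph k F" "verts F \<subseteq> {1..n}" and k: "0 < k"
  shows "(\<integral>x. (\<Prod>A\<in>edges F. eind k W A x) \<partial>cube (binom_le {1..n} k)) = t_hom k F W"
proof -
  interpret U: prob_space unit_interval by (rule prob_space_unit_interval)
  interpret PU: product_prob_space "\<lambda>_ :: nat set. unit_interval" UNIV ..
  let ?I = "binom_le {1..n} k" and ?J0 = "binom_le {1..n} (k - 1)" and ?E = "edges F"
  note e = kgraph_edgeD[OF F(1)]
  have rJ: "rprop A \<subseteq> ?J0" if "A \<in> ?E" for A
    by (rule rprop_subset_binom_le[OF _ order_trans[OF e(2)[OF that] F(2)] e(4)[OF that]]) simp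
  have nJ: "A \<notin> ?J0" if "A \<in> ?E" for A using e(4)[OF that] k by (auto simp: binom_le_def)
  have AI: "A \<in> ?I" if "A \<in> ?E" for A using e(2,3,4)[OF that] F(2) k by (auto simp: binom_le_def)
  have JI: "?J0 \<subseteq> ?I" by (auto simp: binom_le_def)
  have "(\<integral>x. (\<Prod>A\<in>?E. eind k W A x) \<partial>cube ?I) = (\<integral>x. (\<Prod>A\<in>?E. eind k W A (restrict x (?J0 \<union> {A}))) \<partial>cube ?I)"
  proof (rule Bochner_Integration.integral_cong[OF refl], rule prod.cong[OF refl])
    fix x A assume A: "A \<in> ?E"
    show "eind k W A x = eind k W A (restrict x (?J0 \<union> {A}))"
      by (rule eind_cong[OF e(3,4)[OF A]]) (use rJ[OF A] in \<open>auto simp: subset_iff\<close>)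
  qed
  also have "\<dots> = (\<integral>x. (\<Prod>A\<in>?E. \<integral>y. eind k W A (merge ?J0 {A} (x, y)) \<partial>PiM {A} (\<lambda>_. unit_interval)) \<partial>PiM ?J0 (\<lambda>_. unit_interval))"
    unfolding cube_def
  proof (rule integral_prod_fibres[OF prob_space_unit_interval kgraph_finite_edges[OF F(1)]])
    show "finite ?I" by simp
    show "{A} \<subseteq> ?I \<and> ?J0 \<inter> {A} = {}" if "A \<in> ?E" for A using AI[OF that] nJ[OF that] by blast
    show "disjoint_family_on (\<lambda>A. {A}) ?E" by (auto simp: disjoint_family_on_def)
    show "eind k W A \<in> borel_measurable (PiM (?J0 \<union> {A}) (\<lambda>_. unit_interval))" if "A \<in> ?E" for A
      unfolding cube_def[symmetric] by (rule eind_measurable[OF W e(3,4)[OF that]]) (use rJ[OF that] in auto)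
  qed (rule JI, rule eind_unit)
  also have "\<dots> = (\<integral>x. (\<Prod>A\<in>?E. W (pull k (enum A) x)) \<partial>PiM ?J0 (\<lambda>_. unit_interval))"
  proof (rule Bochner_Integration.integral_cong[OF refl], rule prod.cong[OF refl])
    fix x A assume x: "x \<in> space (PiM ?J0 (\<lambda>_. unit_interval))" and A: "A \<in> ?E"
    have m: "(\<lambda>u. eind k W A (x(A := u))) \<in> borel_measurable unit_interval"
      using measurable_compose[OF measurable_component_update[OF x nJ[OF A]] eind_measurable[OF W e(3,4)[OF A], of "insert A ?J0", unfolded cube_def]]
        rJ[OF A] by blast
    have "eind k W A (merge ?J0 {A} (x, y)) = eind k W A (x(A := y A))" for y
      by (rule eind_cong[OF e(3,4)[OF A]]) (use rJ[OF A] nJ[OF A] in \<open>auto simp: merge_def subset_iff\<close>)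
    then have "(\<integral>y. eind k W A (merge ?J0 {A} (x, y)) \<partial>PiM {A} (\<lambda>_. unit_interval)) = (\<integral>y. (\<lambda>u. eind k W A (x(A := u))) (y A) \<partial>PiM {A} (\<lambda>_. unit_interval))" by simp
    also have "\<dots> = (\<integral>u. eind k W A (x(A := u)) \<partial>unit_interval)" by (rule PU.product_integral_singleton[OF m])
    also have "\<dots> = W (pull k (enum A) x)" by (rule eind_inner[OF W e(3,4)[OF A] x[folded cube_def] rJ[OF A] nJ[OF A]])
    finally show "(\<integral>y. eind k W A (merge ?J0 {A} (x, y)) \<partial>PiM {A} (\<lambda>_. unit_interval)) = W (pull k (enum A) x)" .
  qed
  also have "\<dots> = (\<integral>x. (\<Prod>A\<in>?E. W (pull k (enum A) (restrict x (binom_le (verts F) (k - 1))))) \<partial>PiM ?J0 (\<lambda>_. unit_interval))"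
  proof (rule Bochner_Integration.integral_cong[OF refl], rule prod.cong[OF refl])
    fix x A assume A: "A \<in> ?E"
    have "pull k (enum A) x = pull k (enum A) (restrict x (binom_le (verts F) (k - 1)))"
    proof (rule pull_cong)
      fix B assume "B \<in> rprop {1..k}"
      then have "enum A ` B \<in> binom_le (verts F) (k - 1)" using image_rprop[OF e(5)[OF A]] e(6)[OF A] by blast
      then show "x (enum A ` B) = restrict x (binom_le (verts F) (k - 1)) (enum A ` B)" by simp
    qed
    then show "W (pull k (enum A) x) = W (pull k (enum A) (restrict x (binom_le (verts F) (k - 1))))" by (rule arg_cong)
  qed
  also have "\<dots> = t_hom k F W" unfolding t_hom_pull cube_def
    by (rule integral_PiM_restrict[OF prob_space_unit_interval _ t_hom_integrand(1)[OF W F(1), unfolded cube_def]])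
       (use F(2) in \<open>auto simp: binom_le_def\<close>)
  finally show ?thesis .
qed

lemma hom_ind_sgraph:
  assumes F: "kgraph k F" and \<phi>: "inj_on \<phi> (verts F)" "\<phi> ` verts F \<subseteq> {1..n}"
  shows "hom_ind F (sgraph k n W x) \<phi> = (\<Prod>A\<in>edges (relabel \<phi> F). eind k W A x)"
proof -
  have "of_bool (\<phi> ` e \<in> edges (sgraph k n W x)) = eind k W (\<phi> ` e) x" if e: "e \<in> edges F" for e
  proof -
    note * = kgraph_edgeD[OF F e]
    have "card (\<phi> ` e) = k" using card_image[OF inj_on_subset[OF \<phi>(1) *(2)]] *(4) by simp
    moreover have "\<phi> ` e \<subseteq> {1..n}" using \<phi>(2) *(2) by blast
    ultimately show ?thesis by (simp add: sgraph_def eind_def)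
  qed
  then show ?thesis unfolding hom_ind_def relabel_simps prod.reindex[OF inj_on_image_edges[OF F \<phi>(1)]] comp_def
    by (intro prod.cong[OF refl])
qed

text \<open>Since \<phi> is arbitrary, the image of an edge may fail to be a k-subset of {1..n}; the
  corresponding factor is then constantly 0.\<close>

lemma hom_ind_sgraph_measurable:
  assumes W: "unit_kernel k W" and F: "kgraph k F" and k: "0 < k"
  shows "(\<lambda>x. hom_ind F (sgraph k n W x) \<phi>) \<in> borel_measurable (cube (binom_le {1..n} k))"
  unfolding hom_ind_def
proof (rule borel_measurable_prod)
  fix e assume "e \<in> edges F"
  show "(\<lambda>x. of_bool (\<phi> ` e \<in> edges (sgraph k n W x)) :: real) \<in> borel_measurable (cube (binom_le {1..n} k))"
  proof (cases "\<phi> ` e \<subseteq> {1..n} \<and> card (\<phi> ` e) = k")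
    case True
    have fin: "finite (\<phi> ` e)" using True k by (metis card.infinite less_numeral_extra(3))
    have "eind k W (\<phi> ` e) \<in> borel_measurable (cube (binom_le {1..n} k))"
    proof (rule eind_measurable[OF W fin])
      show "rprop (\<phi> ` e) \<subseteq> binom_le {1..n} k"
        using rprop_subset_binom_le[of "{1..n}" "\<phi> ` e" k] True by (auto simp: binom_le_def)
      show "\<phi> ` e \<in> binom_le {1..n} k" using True k by (auto simp: binom_le_def)
    qed (use True in simp)
    moreover have "(\<lambda>x. of_bool (\<phi> ` e \<in> edges (sgraph k n W x)) :: real) = eind k W (\<phi> ` e)"
      using True by (intro ext) (simp add: sgraph_def eind_def)
    ultimately show ?thesis by simp
  next
    case False
    then have "\<phi> ` e \<notin> edges (sgraph k n W x)" for x by (auto simp: sgraph_def)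
    then show ?thesis by simp
  qed
qed

lemma sample_hom_inj:
  assumes W: "hypergraphon k W" and F: "kgraph k F" and k: "0 < k" and \<phi>: "inj_on \<phi> (verts F)" "\<phi> ` verts F \<subseteq> {1..n}"
  shows "(\<integral>x. hom_ind F (sgraph k n W x) \<phi> \<partial>cube (binom_le {1..n} k)) = t_hom k F W"
  unfolding hom_ind_sgraph[OF F \<phi>]
  using sample_expectation[OF hypergraphon_unit_kernel[OF W] kgraph_relabel[OF F \<phi>(1)] _ k] \<phi>(2)
    hypergraphon_t_hom_relabel[OF W F \<phi>(1)] by simp

text \<open>Each injective placement of a member F spans a copy with probability t(F,W) = 0, and
  there are countably many members with finitely many placements each.\<close>

lemma AE_sample_Ffree:
  assumes W: "hypergraphon k W" and Fam: "\<forall>F\<in>Fam. kgraph k F" and free: "W_free k Fam W" and k: "0 < k"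
  shows "AE x in cube (binom_le {1..n} k). Ffree Fam (sgraph k n W x)"
proof -
  note uW = hypergraphon_unit_kernel[OF W]
  have cF: "countable Fam" by (rule countable_subset[OF _ countable_kgraphs[of k]]) (use Fam in blast)
  have "AE x in cube (binom_le {1..n} k). \<forall>F\<in>Fam. \<forall>\<phi>\<in>verts F \<rightarrow>\<^sub>E {1..n}. inj_on \<phi> (verts F) \<longrightarrow> hom_ind F (sgraph k n W x) \<phi> = 0"
    unfolding AE_ball_countable[OF cF]
  proof
    fix F assume F: "F \<in> Fam"
    then have kF: "kgraph k F" using Fam by blast
    have "finite (verts F \<rightarrow>\<^sub>E {1..n})" using kF by (intro finite_PiE) (auto simp: kgraph_def)
    then have "countable (verts F \<rightarrow>\<^sub>E {1..n})" by (rule countable_finite)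
    then show "AE x in cube (binom_le {1..n} k). \<forall>\<phi>\<in>verts F \<rightarrow>\<^sub>E {1..n}. inj_on \<phi> (verts F) \<longrightarrow> hom_ind F (sgraph k n W x) \<phi> = 0"
    proof (rule AE_ball_countable[THEN iffD2], intro ballI)
      fix \<phi> assume \<phi>: "\<phi> \<in> verts F \<rightarrow>\<^sub>E {1..n}"
      show "AE x in cube (binom_le {1..n} k). inj_on \<phi> (verts F) \<longrightarrow> hom_ind F (sgraph k n W x) \<phi> = 0"
      proof (cases "inj_on \<phi> (verts F)")
        case True
        have im: "\<phi> ` verts F \<subseteq> {1..n}" using \<phi> by auto
        have "(\<integral>x. hom_ind F (sgraph k n W x) \<phi> \<partial>cube (binom_le {1..n} k)) = 0"
          using sample_hom_inj[OF W kF k True im] free F by (simp add: W_free_def)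
        moreover have "integrable (cube (binom_le {1..n} k)) (\<lambda>x. hom_ind F (sgraph k n W x) \<phi>)"
          by (rule prob_space.integrable_unit[OF prob_space_cube hom_ind_sgraph_measurable[OF uW kF k] hom_ind_unit])
        ultimately have "AE x in cube (binom_le {1..n} k). hom_ind F (sgraph k n W x) \<phi> = 0"
          by (subst (asm) integral_nonneg_eq_0_iff_AE) (use hom_ind_unit in auto)
        then show ?thesis by (rule AE_mp) (intro AE_I2, simp)
      qed simp
    qed
  qed
  then show ?thesis
  proof (rule AE_mp, intro AE_I2 impI)
    fix x assume h: "\<forall>F\<in>Fam. \<forall>\<phi>\<in>verts F \<rightarrow>\<^sub>E {1..n}. inj_on \<phi> (verts F) \<longrightarrow> hom_ind F (sgraph k n W x) \<phi> = 0"
    show "Ffree Fam (sgraph k n W x)" unfolding Ffree_def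
    proof (intro ballI notI)
      fix F assume F: "F \<in> Fam" and "contains_copy (sgraph k n W x) F"
      then have kF: "kgraph k F" using Fam by blast
      from \<open>contains_copy (sgraph k n W x) F\<close> obtain f where f: "inj_on f (verts F)" "f ` verts F \<subseteq> {1..n}"
        "\<forall>e\<in>edges F. f ` e \<in> edges (sgraph k n W x)" unfolding contains_copy_def by (auto simp: sgraph_def)
      let ?f = "restrict f (verts F)"
      have "?f \<in> verts F \<rightarrow>\<^sub>E {1..n}" unfolding restrict_PiE_iff using f(2) by blast
      moreover have "inj_on ?f (verts F)" using f(1) by (simp add: inj_on_def)
      ultimately have "hom_ind F (sgraph k n W x) ?f = 0" using h F by blast
      moreover have "hom_ind F (sgraph k n W x) ?f = hom_ind F (sgraph k n W x) f" by (rule hom_ind_cong[OF kF]) simp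
      ultimately show False using f(3) by (simp add: hom_ind_eq[OF kgraph_finite_edges[OF kF]])
    qed
  qed
qed

text \<open>For an injective map the expected indicator is exactly \<open>t_hom k F W\<close>; the
  bias comes from the non-injective maps alone.\<close>

lemma sample_t_graph_mean:
  assumes W: "hypergraphon k W" and F: "kgraph k F" and k: "0 < k" and n: "0 < n"
  shows "integrable (cube (binom_le {1..n} k)) (\<lambda>x. t_graph F (sgraph k n W x))"
    and "\<bar>(\<integral>x. t_graph F (sgraph k n W x) \<partial>cube (binom_le {1..n} k)) - t_hom k F W\<bar> \<le> (real (card (verts F)))\<^sup>2 / n"
proof -
  let ?C = "cube (binom_le {1..n} k)" and ?U = "PiM (verts F) (\<lambda>_. uniform_count_measure {1..n})"
  let ?X = "verts F \<rightarrow>\<^sub>E {1..n}" and ?h = "\<lambda>x \<phi>. hom_ind F (sgraph k n W x) \<phi>" and ?t = "t_hom k F W"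
  note uW = hypergraphon_unit_kernel[OF W]
  have vF: "finite (verts F)" using F by (simp add: kgraph_def)
  have fX: "finite ?X" using vF by (simp add: finite_PiE)
  have V: "finite {1..n}" "{1..n} \<noteq> {}" using n by auto
  have pU: "prob_space ?U" by (intro prob_space_PiM prob_space_uniform_count_measure V)
  have vs: "verts (sgraph k n W x) = {1..n}" for x by (simp add: sgraph_def)
  have tg: "t_graph F (sgraph k n W x) = (\<Sum>\<phi>\<in>?X. ?h x \<phi>) / card ?X" for x
    unfolding t_graph_integral[OF F, of "sgraph k n W x", unfolded vs, OF V] PiM_uniform[OF vF V] integral_uniform_count_measure[OF fX] ..
  have hint: "integrable ?C (\<lambda>x. ?h x \<phi>)" for \<phi>
    by (rule prob_space.integrable_unit[OF prob_space_cube hom_ind_sgraph_measurable[OF uW F k] hom_ind_unit])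
  show "integrable ?C (\<lambda>x. t_graph F (sgraph k n W x))"
    unfolding tg by (intro integrable_divide Bochner_Integration.integrable_sum hint)
  define a where "a \<phi> = (\<integral>x. ?h x \<phi> \<partial>?C)" for \<phi>
  have a01: "0 \<le> a \<phi> \<and> a \<phi> \<le> 1" for \<phi> unfolding a_def
    by (rule prob_space.integral_unit[OF prob_space_cube hom_ind_sgraph_measurable[OF uW F k] hom_ind_unit])
  have t01: "0 \<le> ?t \<and> ?t \<le> 1" by (rule t_hom_unit[OF uW F])
  note m = borel_measurable_PiM_uniform[OF vF V]
  have ia: "integrable ?U a" by (rule prob_space.integrable_unit[OF pU m a01])
  have "(\<integral>x. t_graph F (sgraph k n W x) \<partial>?C) = (\<Sum>\<phi>\<in>?X. a \<phi>) / card ?X"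
    unfolding tg a_def using hint by simp
  also have "\<dots> = (\<integral>\<phi>. a \<phi> \<partial>?U)" unfolding PiM_uniform[OF vF V] integral_uniform_count_measure[OF fX] ..
  finally have "(\<integral>x. t_graph F (sgraph k n W x) \<partial>?C) - ?t = (\<integral>\<phi>. a \<phi> - ?t \<partial>?U)"
    using ia prob_space.prob_space[OF pU] prob_space.finite_measure[OF pU]
    by (simp add: Bochner_Integration.integral_diff finite_measure.integrable_const)
  then have "\<bar>(\<integral>x. t_graph F (sgraph k n W x) \<partial>?C) - ?t\<bar> \<le> (\<integral>\<phi>. \<bar>a \<phi> - ?t\<bar> \<partial>?U)"
    using integral_abs_bound[of ?U "\<lambda>\<phi>. a \<phi> - ?t"] by simp
  also have "\<dots> \<le> (\<integral>\<phi>. of_bool (\<not> inj_on \<phi> (verts F)) \<partial>?U)"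
  proof (rule integral_mono)
    show "integrable ?U (\<lambda>\<phi>. \<bar>a \<phi> - ?t\<bar>)"
      by (rule prob_space.integrable_unit[OF pU m]) (smt (verit) a01 t01)
    show "integrable ?U (\<lambda>\<phi>. of_bool (\<not> inj_on \<phi> (verts F)) :: real)" by (rule prob_space.integrable_unit[OF pU m]) simp
    fix \<phi> assume "\<phi> \<in> space ?U"
    then have im: "\<phi> ` verts F \<subseteq> {1..n}" by (auto simp: space_PiM space_uniform_count_measure)
    show "\<bar>a \<phi> - ?t\<bar> \<le> of_bool (\<not> inj_on \<phi> (verts F))"
    proof (cases "inj_on \<phi> (verts F)")
      case True then show ?thesis using sample_hom_inj[OF W F k True im] by (simp add: a_def)
    next
      case False
      have "\<bar>a \<phi> - ?t\<bar> \<le> 1" using a01[of \<phi>] t01 by linarith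
      then show ?thesis using False by simp
    qed
  qed
  also have "\<dots> \<le> (real (card (verts F)))\<^sup>2 / card {1..n}" by (rule noninj_uniform[OF vF V])
  finally show "\<bar>(\<integral>x. t_graph F (sgraph k n W x) \<partial>?C) - ?t\<bar> \<le> (real (card (verts F)))\<^sup>2 / n" by simp
qed

text \<open>The second moment for Chebyshev's inequality is the mean density of two disjoint copies
  of F. The constant 6 consists of 4 from the doubled number of vertices and 2 from the cross
  term.\<close>

lemma sample_t_graph_deviation:
  assumes W: "hypergraphon k W" and F: "kgraph k F" and k: "0 < k" and n: "0 < n" and \<epsilon>: "0 < \<epsilon>"
  shows "{x \<in> space (cube (binom_le {1..n} k)). \<epsilon> \<le> \<bar>t_graph F (sgraph k n W x) - t_hom k F W\<bar>} \<in> sets (cube (binom_le {1..n} k)) \<and>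
    measure (cube (binom_le {1..n} k)) {x \<in> space (cube (binom_le {1..n} k)). \<epsilon> \<le> \<bar>t_graph F (sgraph k n W x) - t_hom k F W\<bar>} \<le> 6 * (real (card (verts F)))\<^sup>2 / (n * \<epsilon>\<^sup>2)"
proof -
  let ?C = "cube (binom_le {1..n} k)" and ?T = "\<lambda>x. t_graph F (sgraph k n W x)" and ?t = "t_hom k F W" and ?v = "real (card (verts F))"
  note uW = hypergraphon_unit_kernel[OF W]
  obtain f where f: "strict_mono f" "verts F \<inter> f ` verts F = {}" by (rule exists_disjoint_copy[OF F])
  have fi: "inj_on f (verts F)" by (rule inj_on_subset[OF strict_mono_imp_inj_on[OF f(1)] subset_UNIV])
  let ?F = "relabel f F" and ?FF = "disj_union F (relabel f F)"
  have F': "kgraph k ?F" by (rule kgraph_relabel[OF F fi])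
  have d: "verts F \<inter> verts ?F = {}" using f(2) by simp
  have FF: "kgraph k ?FF" by (rule kgraph_disj_union[OF F F'])
  have gr: "finite (verts (sgraph k n W x))" "verts (sgraph k n W x) \<noteq> {}" for x using n by (auto simp: sgraph_def)
  have sq: "t_graph ?FF (sgraph k n W x) = (?T x)\<^sup>2" for x
    unfolding t_graph_disj_union[OF F F' d k gr] t_graph_relabel[OF F fi gr] by (simp add: power2_eq_square)
  have tsq: "t_hom k ?FF W = ?t\<^sup>2"
    unfolding t_hom_disj_union[OF uW F F' d k] hypergraphon_t_hom_relabel[OF W F fi] by (simp add: power2_eq_square)
  have cv: "card (verts ?FF) = 2 * card (verts F)"
    using card_Un_disjoint[of "verts F" "f ` verts F"] card_image[OF fi] f(2) F by (simp add: kgraph_def)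
  note m1 = sample_t_graph_mean[OF W F k n]
  note m2 = sample_t_graph_mean[OF W FF k n, unfolded sq tsq cv]
  have t01: "0 \<le> ?t \<and> ?t \<le> 1" by (rule t_hom_unit[OF uW F])
  have ic: "integrable ?C (\<lambda>x. c)" for c :: real using prob_space.finite_measure[OF prob_space_cube] by (rule finite_measure.integrable_const)
  have i: "integrable ?C (\<lambda>x. (?T x - ?t)\<^sup>2)"
    unfolding power2_diff by (intro Bochner_Integration.integrable_add Bochner_Integration.integrable_diff m2(1) ic integrable_mult_left integrable_mult_right m1(1))
  have "(\<integral>x. (?T x - ?t)\<^sup>2 \<partial>?C) = (\<integral>x. (?T x)\<^sup>2 - (2 * ?t) * ?T x + ?t\<^sup>2 \<partial>?C)"
    by (rule Bochner_Integration.integral_cong[OF refl]) (simp add: power2_eq_square algebra_simps)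
  also have "\<dots> = (\<integral>x. (?T x)\<^sup>2 \<partial>?C) - (2 * ?t) * (\<integral>x. ?T x \<partial>?C) + ?t\<^sup>2"
    using m1(1) m2(1) ic by (simp add: prob_space.prob_space[OF prob_space_cube])
  also have "\<dots> = ((\<integral>x. (?T x)\<^sup>2 \<partial>?C) - ?t\<^sup>2) - (2 * ?t) * ((\<integral>x. ?T x \<partial>?C) - ?t)"
    by (simp add: power2_eq_square algebra_simps)
  also have "\<dots> \<le> (2 * ?v)\<^sup>2 / n + 2 * (?v\<^sup>2 / n)"
  proof -
    have "\<bar>(2 * ?t) * ((\<integral>x. ?T x \<partial>?C) - ?t)\<bar> \<le> 2 * (?v\<^sup>2 / n)"
      unfolding abs_mult by (rule mult_mono) (use t01 m1(2) in auto)
    moreover have "\<bar>(\<integral>x. (?T x)\<^sup>2 \<partial>?C) - ?t\<^sup>2\<bar> \<le> (2 * ?v)\<^sup>2 / n" using m2(2) by simp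
    ultimately show ?thesis by linarith
  qed
  also have "\<dots> = 6 * ?v\<^sup>2 / n" by (simp add: power2_eq_square field_simps)
  finally have E: "(\<integral>x. (?T x - ?t)\<^sup>2 \<partial>?C) \<le> 6 * ?v\<^sup>2 / n" .
  have [measurable]: "?T \<in> borel_measurable ?C" using m1(1) by simp
  have S: "{x \<in> space ?C. \<epsilon> \<le> \<bar>?T x - ?t\<bar>} \<in> sets ?C" by measurable
  have eqS: "{x \<in> space ?C. \<epsilon> \<le> \<bar>?T x - ?t\<bar>} = {x \<in> space ?C. \<epsilon>\<^sup>2 \<le> (?T x - ?t)\<^sup>2}"
  proof -
    have "\<epsilon> \<le> \<bar>z\<bar> \<longleftrightarrow> \<epsilon>\<^sup>2 \<le> z\<^sup>2" for z :: real using \<epsilon> abs_le_square_iff[of \<epsilon> z] by simp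
    then show ?thesis by simp
  qed
  have "measure ?C {x \<in> space ?C. \<epsilon>\<^sup>2 \<le> (?T x - ?t)\<^sup>2} \<le> (\<integral>x. (?T x - ?t)\<^sup>2 \<partial>?C) / \<epsilon>\<^sup>2"
    by (rule integral_Markov_inequality_measure[OF i, where A = "{}"]) (use \<epsilon> in auto)
  also have "\<dots> \<le> (6 * ?v\<^sup>2 / n) / \<epsilon>\<^sup>2" by (rule divide_right_mono[OF E]) simp
  finally show ?thesis using S unfolding eqS by simp
qed

section \<open>Degrees in the sampled graph\<close>

lemma eind_fibre:
  assumes W: "hypergraphon k W" and lk: "l < k"
    and L: "finite L" "card L = l" and B: "finite B" "card B = k - l" "L \<inter> B = {}"
    and x: "x \<in> space (cube (rall L))"
  shows "(\<integral>y. eind k W (L \<union> B) (merge (rall L) (rall (L \<union> B) - rall L) (x, y)) \<partial>cube (rall (L \<union> B) - rall L))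
     = deg_W k l W (\<lambda>S\<in>rall {1..l}. x (enum L ` S))"
    and "eind k W (L \<union> B) \<in> borel_measurable (cube (rall L \<union> (rall (L \<union> B) - rall L)))"
    and "(\<lambda>y. eind k W (L \<union> B) (merge (rall L) (rall (L \<union> B) - rall L) (x, y))) \<in> borel_measurable (cube (rall (L \<union> B) - rall L))"
proof -
  interpret U: prob_space unit_interval by (rule prob_space_unit_interval)
  interpret PU: product_prob_space "\<lambda>_ :: nat set. unit_interval" UNIV ..
  define K where "K = L \<union> B"
  let ?R = "rprop K - rall L"
  note uW = hypergraphon_unit_kernel[OF W]
  have K: "finite K" "card K = k" using L B lk unfolding K_def by (simp_all add: card_Un_disjoint)
  have Bne: "B \<noteq> {}" using B(2) lk by auto
  have KnL: "K \<notin> rall L" using Bne B(3) unfolding K_def rall_def by blast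
  have Lr: "rall L \<subseteq> rprop K" using Bne B(3) unfolding K_def rall_def rprop_def by blast
  \<comment> \<open>The integrated coordinates are those of \<open>deg_W_fibre\<close> together with
    the coin of the k-set itself.\<close>
  have ins: "rall K - rall L = insert K ?R" using KnL Bne unfolding K_def rall_def rprop_def by blast
  have KR: "K \<notin> ?R" unfolding rprop_def by blast
  have U1: "rall L \<union> ?R = rprop K" using Lr by blast
  have U2: "rall L \<union> insert K ?R = insert K (rprop K)" using Lr by blast
  have m: "eind k W K \<in> borel_measurable (cube (rall L \<union> insert K ?R))"
    unfolding U2 by (rule eind_measurable[OF uW K]) auto
  show "eind k W (L \<union> B) \<in> borel_measurable (cube (rall L \<union> (rall (L \<union> B) - rall L)))"
    unfolding K_def[symmetric] ins by (rule m)
  have mm: "(\<lambda>y. eind k W K (merge (rall L) (insert K ?R) (x, y))) \<in> borel_measurable (cube (insert K ?R))"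
    by (rule measurable_compose[OF measurable_compose[OF measurable_Pair1'[OF x] measurable_merge[of "rall L" "insert K ?R" "\<lambda>_. unit_interval", folded cube_def]] m])
  show "(\<lambda>y. eind k W (L \<union> B) (merge (rall L) (rall (L \<union> B) - rall L) (x, y))) \<in> borel_measurable (cube (rall (L \<union> B) - rall L))"
    unfolding K_def[symmetric] ins by (rule mm)
  have int: "integrable (PiM (insert K ?R) (\<lambda>_. unit_interval)) (\<lambda>y. eind k W K (merge (rall L) (insert K ?R) (x, y)))"
    unfolding cube_def[symmetric] by (rule prob_space.integrable_unit[OF prob_space_cube mm eind_unit])
  have "(\<integral>y. eind k W K (merge (rall L) (insert K ?R) (x, y)) \<partial>cube (insert K ?R))
      = (\<integral>y. (\<integral>u. eind k W K (merge (rall L) (insert K ?R) (x, y(K := u))) \<partial>unit_interval) \<partial>cube ?R)"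
    unfolding cube_def by (rule PU.product_integral_insert[OF _ KR int]) (use K in simp)
  also have "\<dots> = (\<integral>y. W (pull k (enum K) (merge (rall L) ?R (x, y))) \<partial>cube ?R)"
  proof (rule Bochner_Integration.integral_cong[OF refl])
    fix y assume y: "y \<in> space (cube ?R)"
    have sp: "merge (rall L) ?R (x, y) \<in> space (cube (rprop K))"
      using merge_space_PiM[OF x[unfolded cube_def] y[unfolded cube_def]] unfolding U1 cube_def .
    have "eind k W K (merge (rall L) (insert K ?R) (x, y(K := u))) = eind k W K ((merge (rall L) ?R (x, y))(K := u))" for u
    proof (rule eind_cong[OF K])
      fix S assume "S \<in> rprop K"
      then show "merge (rall L) (insert K ?R) (x, y(K := u)) S = ((merge (rall L) ?R (x, y))(K := u)) S"
        using KR unfolding merge_def rprop_def by auto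
    qed (use KnL in \<open>simp add: merge_def\<close>)
    then show "(\<integral>u. eind k W K (merge (rall L) (insert K ?R) (x, y(K := u))) \<partial>unit_interval) = W (pull k (enum K) (merge (rall L) ?R (x, y)))"
      using eind_inner[OF uW K sp order_refl] by (simp add: rprop_def)
  qed
  also have "\<dots> = deg_W k l W (\<lambda>S\<in>rall {1..l}. x (enum L ` S))"
    unfolding K_def by (rule deg_W_fibre[OF W lk L B x])
  finally show "(\<integral>y. eind k W (L \<union> B) (merge (rall L) (rall (L \<union> B) - rall L) (x, y)) \<partial>cube (rall (L \<union> B) - rall L))
     = deg_W k l W (\<lambda>S\<in>rall {1..l}. x (enum L ` S))"
    unfolding K_def[symmetric] ins .
qed

lemma delta_W_unit:
  assumes "unit_kernel k W" "l < k" shows "0 \<le> delta_W k l W \<and> delta_W k l W \<le> 1"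
proof
  show "0 \<le> delta_W k l W" by (rule delta_W_ge[OF assms]) (use deg_W_unit[OF assms] in \<open>auto intro!: AE_I2\<close>)
  have "AE x in cube (rall {1..l}). delta_W k l W \<le> 1"
    using AE_delta_W_le[OF assms]
  proof (rule AE_mp, intro AE_I2 impI)
    fix x assume "x \<in> space (cube (rall {1..l}))" "delta_W k l W \<le> deg_W k l W x"
    then show "delta_W k l W \<le> 1" using deg_W_unit[OF assms] order_trans by blast
  qed
  then show "delta_W k l W \<le> 1" by (simp add: prob_space.AE_const[OF prob_space_cube])
qed

text \<open>Over disjoint blocks the edges through \<open>L\<close> are conditionally independent
  given the coordinates inside \<open>L\<close>, each with a conditional probability that is almost
  surely at least \<open>delta_W k l W\<close>.\<close>

lemma sample_blocks_moment:
  assumes W: "hypergraphon k W" and lk: "l < k" and L: "L \<subseteq> {1..n}" "card L = l"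
    and B: "\<And>i. i < m \<Longrightarrow> B i \<subseteq> {1..n} - L \<and> card (B i) = k - l" "disjoint_family_on B {..<m}"
    and c: "0 \<le> c" "c \<le> (1 :: real)"
  shows "(\<integral>x. (\<Prod>i<m. 1 - c * eind k W (L \<union> B i) x) \<partial>cube (binom_le {1..n} k)) \<le> (1 - c * delta_W k l W) ^ m"
proof -
  let ?I = "binom_le {1..n} k" and ?J = "\<lambda>i. rall (L \<union> B i) - rall L"
  let ?g = "\<lambda>i x. 1 - c * eind k W (L \<union> B i) x" and ?d = "delta_W k l W"
  let ?f = "\<lambda>x. deg_W k l W (\<lambda>S\<in>rall {1..l}. x (enum L ` S))"
  note uW = hypergraphon_unit_kernel[OF W]
  have fL: "finite L" using L(1) finite_subset by blast
  have fB: "finite (B i)" if "i < m" for i using B(1)[OF that] by (meson finite_Diff finite_atLeastAtMost finite_subset)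
  have LB: "L \<inter> B i = {}" if "i < m" for i using B(1)[OF that] by blast
  have K: "finite (L \<union> B i)" "card (L \<union> B i) = k" if "i < m" for i
    using fL fB[OF that] LB[OF that] B(1)[OF that] L lk by (simp_all add: card_Un_disjoint)
  have KI: "rall (L \<union> B i) \<subseteq> ?I" if "i < m" for i
  proof
    fix S assume S: "S \<in> rall (L \<union> B i)"
    then have "card S \<le> k" using card_mono[OF K(1)[OF that], of S] K(2)[OF that] by (auto simp: rall_def)
    then show "S \<in> ?I" using S L(1) B(1)[OF that] unfolding rall_def binom_le_def by blast
  qed
  have LI: "rall L \<subseteq> ?I"
  proof
    fix S assume S: "S \<in> rall L"
    then have "card S \<le> k" using card_mono[OF fL, of S] L lk by (auto simp: rall_def)
    then show "S \<in> ?I" using S L(1) unfolding rall_def binom_le_def by blast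
  qed
  have gu: "0 \<le> ?g i x \<and> ?g i x \<le> 1" for i x
    using eind_unit[of k W "L \<union> B i" x] c by (simp add: mult_le_one)
  note fib = eind_fibre[OF W lk fL L(2) fB _ LB]
  have "(\<integral>x. (\<Prod>i<m. ?g i x) \<partial>cube ?I) = (\<integral>x. (\<Prod>i<m. ?g i (restrict x (rall L \<union> ?J i))) \<partial>cube ?I)"
  proof (rule Bochner_Integration.integral_cong[OF refl], rule prod.cong[OF refl])
    fix x i assume "i \<in> {..<m}"
    then have i: "i < m" by simp
    have ne: "L \<union> B i \<noteq> {}" using K(2)[OF i] lk by auto
    have "eind k W (L \<union> B i) x = eind k W (L \<union> B i) (restrict x (rall L \<union> ?J i))"
      by (rule eind_cong[OF K[OF i]]) (use ne in \<open>auto simp: rall_def rprop_def\<close>)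
    then show "?g i x = ?g i (restrict x (rall L \<union> ?J i))" by simp
  qed
  also have "\<dots> = (\<integral>x. (\<Prod>i<m. \<integral>y. ?g i (merge (rall L) (?J i) (x, y)) \<partial>PiM (?J i) (\<lambda>_. unit_interval)) \<partial>PiM (rall L) (\<lambda>_. unit_interval))"
    unfolding cube_def
  proof (rule integral_prod_fibres[OF prob_space_unit_interval])
    show "finite ?I" by simp
    show "?J i \<subseteq> ?I \<and> rall L \<inter> ?J i = {}" if "i \<in> {..<m}" for i using KI[of i] that by blast
    show "disjoint_family_on ?J {..<m}" unfolding disjoint_family_on_def
    proof (intro ballI impI)
      fix i j assume ij: "i \<in> {..<m}" "j \<in> {..<m}" "i \<noteq> j"
      then have "B i \<inter> B j = {}" using B(2) unfolding disjoint_family_on_def by blast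
      then show "?J i \<inter> ?J j = {}" unfolding rall_def by blast
    qed
    show "?g i \<in> borel_measurable (PiM (rall L \<union> ?J i) (\<lambda>_. unit_interval))" if "i \<in> {..<m}" for i
    proof -
      have i: "i < m" using that by simp
      obtain z where z: "z \<in> space (cube (rall L))" using prob_space.not_empty[OF prob_space_cube[of "rall L"]] by blast
      have "eind k W (L \<union> B i) \<in> borel_measurable (cube (rall L \<union> ?J i))"
        by (rule fib(2)[OF i _ i z]) (use B(1)[OF i] in blast)
      then show ?thesis unfolding cube_def by simp
    qed
  qed (simp, rule LI, rule gu)
  also have "\<dots> = (\<integral>x. (1 - c * ?f x) ^ m \<partial>cube (rall L))"
    unfolding cube_def[symmetric]
  proof (rule Bochner_Integration.integral_cong[OF refl])
    fix x assume x: "x \<in> space (cube (rall L))"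
    have "(\<integral>y. ?g i (merge (rall L) (?J i) (x, y)) \<partial>cube (?J i)) = 1 - c * ?f x" if "i \<in> {..<m}" for i
    proof -
      have i: "i < m" using that by simp
      have cb: "card (B i) = k - l" using B(1)[OF i] by blast
      have int: "integrable (cube (?J i)) (\<lambda>y. eind k W (L \<union> B i) (merge (rall L) (?J i) (x, y)))"
        by (rule prob_space.integrable_unit[OF prob_space_cube fib(3)[OF i cb i x] eind_unit])
      have ic: "integrable (cube (?J i)) (\<lambda>y. 1 :: real)"
        using prob_space.finite_measure[OF prob_space_cube] by (rule finite_measure.integrable_const)
      have "(\<integral>y. ?g i (merge (rall L) (?J i) (x, y)) \<partial>cube (?J i))
         = (\<integral>y. 1 \<partial>cube (?J i)) - (\<integral>y. c * eind k W (L \<union> B i) (merge (rall L) (?J i) (x, y)) \<partial>cube (?J i))"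
        by (rule Bochner_Integration.integral_diff[OF ic integrable_mult_right[OF int]])
      also have "\<dots> = 1 - c * ?f x"
        using fib(1)[OF i cb i x] by (simp add: prob_space.prob_space[OF prob_space_cube])
      finally show ?thesis .
    qed
    then have "(\<Prod>i<m. \<integral>y. ?g i (merge (rall L) (?J i) (x, y)) \<partial>cube (?J i)) = (\<Prod>i<m. 1 - c * ?f x)"
      by (rule prod.cong[OF refl])
    then show "(\<Prod>i<m. \<integral>y. ?g i (merge (rall L) (?J i) (x, y)) \<partial>cube (?J i)) = (1 - c * ?f x) ^ m" by simp
  qed
  also have "\<dots> \<le> (\<integral>x. (1 - c * ?d) ^ m \<partial>cube (rall L))"
  proof -
    have b: "bij_betw (enum L) {1..l} L" using enum_bij[OF fL] L(2) by simp
    have inj: "inj_on ((`) (enum L)) (rall {1..l})"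
      by (rule inj_on_subset[OF inj_on_image_Pow[OF bij_betw_imp_inj_on[OF b]]]) (auto simp: rall_def)
    have mp: "(`) (enum L) \<in> rall {1..l} \<rightarrow> rall L"
    proof
      fix S assume "S \<in> rall {1..l}"
      then show "enum L ` S \<in> rall L" using image_mono[of S "{1..l}" "enum L"] bij_betw_imp_surj_on[OF b] unfolding rall_def by simp
    qed
    have re: "(\<lambda>x. \<lambda>S\<in>rall {1..l}. x (enum L ` S)) \<in> measurable (cube (rall L)) (cube (rall {1..l}))"
      unfolding cube_def by (rule measurable_PiM_reindex[OF mp])
    have fm[measurable]: "?f \<in> borel_measurable (cube (rall L))" by (rule measurable_compose[OF re deg_W_measurable[OF uW lk]])
    have fu: "0 \<le> ?f x \<and> ?f x \<le> 1" if "x \<in> space (cube (rall L))" for x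
      by (rule deg_W_unit[OF uW lk measurable_space[OF re that]])
    have ae: "AE x in cube (rall L). ?d \<le> ?f x"
      using AE_PiM_reindex[OF prob_space_unit_interval inj mp AE_delta_W_le[OF uW lk, unfolded cube_def]] unfolding cube_def .
    have cf: "0 \<le> 1 - c * ?f x \<and> 1 - c * ?f x \<le> 1" if "x \<in> space (cube (rall L))" for x
      using fu[OF that] c by (simp add: mult_le_one)
    show ?thesis
    proof (rule integral_mono_AE)
      show "integrable (cube (rall L)) (\<lambda>x. (1 - c * ?f x) ^ m)"
      proof (rule prob_space.integrable_unit[OF prob_space_cube])
        show "(\<lambda>x. (1 - c * ?f x) ^ m) \<in> borel_measurable (cube (rall L))" by measurable
        show "0 \<le> (1 - c * ?f x) ^ m \<and> (1 - c * ?f x) ^ m \<le> 1" if "x \<in> space (cube (rall L))" for x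
          using cf[OF that] by (simp add: power_le_one)
      qed
      show "integrable (cube (rall L)) (\<lambda>x. (1 - c * ?d) ^ m)"
        using prob_space.finite_measure[OF prob_space_cube] by (rule finite_measure.integrable_const)
      show "AE x in cube (rall L). (1 - c * ?f x) ^ m \<le> (1 - c * ?d) ^ m"
        using ae
      proof (rule AE_mp, intro AE_I2 impI)
        fix x assume x: "x \<in> space (cube (rall L))" and "?d \<le> ?f x"
        then have "c * ?d \<le> c * ?f x" using c by (intro mult_left_mono)
        then show "(1 - c * ?f x) ^ m \<le> (1 - c * ?d) ^ m" using cf[OF x] by (intro power_mono) linarith+
      qed
    qed
  qed
  also have "\<dots> = (1 - c * ?d) ^ m" by (simp add: prob_space.prob_space[OF prob_space_cube])
  finally show ?thesis .
qed

lemma exists_permutes_image: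
  assumes U: "finite U" and A: "A \<subseteq> U" "B \<subseteq> U" "card A = card B"
  shows "\<exists>\<tau>. \<tau> permutes U \<and> \<tau> ` A = B"
proof -
  have fin: "finite A" "finite B" using A U finite_subset by blast+
  obtain g where g: "bij_betw g A B" using finite_same_card_bij[OF fin A(3)] by blast
  have "card (U - A) = card (U - B)" using U A fin by (simp add: card_Diff_subset)
  then obtain h where h: "bij_betw h (U - A) (U - B)" using finite_same_card_bij[of "U - A" "U - B"] U by blast
  define \<tau> where "\<tau> x = (if x \<in> A then g x else if x \<in> U then h x else x)" for x
  have 1: "bij_betw \<tau> A B" by (rule bij_betw_cong[THEN iffD1, OF _ g]) (simp add: \<tau>_def)
  have 2: "bij_betw \<tau> (U - A) (U - B)" by (rule bij_betw_cong[THEN iffD1, OF _ h]) (simp add: \<tau>_def)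
  have "bij_betw \<tau> (A \<union> (U - A)) (B \<union> (U - B))" by (rule bij_betw_combine[OF 1 2]) blast
  moreover have "A \<union> (U - A) = U" "B \<union> (U - B) = U" using A by auto
  ultimately have "bij_betw \<tau> U U" by simp
  then have "\<tau> permutes U" by (rule bij_imp_permutes) (use A in \<open>auto simp: \<tau>_def\<close>)
  then show ?thesis using bij_betw_imp_surj_on[OF 1] by blast
qed

text \<open>A uniformly random permutation sends A to a uniformly random r-subset. The left-hand sum
  is the same for every r-subset in place of A, so it may be summed over all of them and the order
  of summation exchanged.\<close>

lemma sum_permutes_image:
  fixes f :: "'a set \<Rightarrow> real"
  assumes U: "finite U" and A: "A \<subseteq> U" "card A = r"
  shows "real (card U choose r) * (\<Sum>\<sigma> | \<sigma> permutes U. f (\<sigma> ` A)) = fact (card U) * (\<Sum>B | B \<subseteq> U \<and> card B = r. f B)"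
proof -
  let ?P = "{\<sigma>. \<sigma> permutes U}" and ?B = "{B. B \<subseteq> U \<and> card B = r}"
  have "(\<Sum>\<sigma>\<in>?P. f (\<sigma> ` A)) = (\<Sum>\<sigma>\<in>?P. f (\<sigma> ` B))" if B: "B \<in> ?B" for B
  proof -
    obtain \<tau> where \<tau>: "\<tau> permutes U" "\<tau> ` A = B" using exists_permutes_image[OF U A(1), of B] A(2) B by auto
    have "(\<Sum>\<sigma>\<in>?P. f (\<sigma> ` B)) = (\<Sum>\<sigma>\<in>?P. f ((\<sigma> \<circ> \<tau>) ` A))" unfolding image_comp[symmetric] \<tau>(2) ..
    also have "\<dots> = (\<Sum>\<sigma>\<in>?P. f (\<sigma> ` A))" by (rule sum_permutations_compose_right[OF \<tau>(1), symmetric])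
    finally show ?thesis by simp
  qed
  then have "(\<Sum>B\<in>?B. \<Sum>\<sigma>\<in>?P. f (\<sigma> ` A)) = (\<Sum>B\<in>?B. \<Sum>\<sigma>\<in>?P. f (\<sigma> ` B))" by (rule sum.cong[OF refl])
  also have "\<dots> = (\<Sum>\<sigma>\<in>?P. \<Sum>B\<in>?B. f (\<sigma> ` B))" by (rule sum.swap)
  also have "\<dots> = (\<Sum>\<sigma>\<in>?P. \<Sum>B\<in>?B. f B)"
  proof (rule sum.cong[OF refl])
    fix \<sigma> assume "\<sigma> \<in> ?P"
    then have \<sigma>: "\<sigma> permutes U" by simp
    have i: "inj \<sigma>" by (rule permutes_inj[OF \<sigma>])
    have ii: "inj (inv \<sigma>)" by (rule permutes_inj[OF permutes_inv[OF \<sigma>]])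
    show "(\<Sum>B\<in>?B. f (\<sigma> ` B)) = (\<Sum>B\<in>?B. f B)"
    proof (rule sum.reindex_bij_witness[where i = "\<lambda>B. inv \<sigma> ` B" and j = "\<lambda>B. \<sigma> ` B"])
      fix B assume B: "B \<in> ?B"
      show "inv \<sigma> ` \<sigma> ` B = B" "\<sigma> ` inv \<sigma> ` B = B"
        unfolding image_image by (simp_all add: permutes_inverses[OF \<sigma>])
      have "\<sigma> ` B \<subseteq> U" using image_mono[of B U \<sigma>] permutes_image[OF \<sigma>] B by simp
      then show "\<sigma> ` B \<in> ?B" using B card_image[OF inj_on_subset[OF i subset_UNIV], of B] by simp
      have "inv \<sigma> ` B \<subseteq> U" using image_mono[of B U "inv \<sigma>"] permutes_image[OF permutes_inv[OF \<sigma>]] B by simp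
      then show "inv \<sigma> ` B \<in> ?B" using B card_image[OF inj_on_subset[OF ii subset_UNIV], of B] by simp
    qed simp
  qed
  finally show ?thesis using n_subsets[OF U, of r] card_permutations[OF refl U] by simp
qed

lemma sample_deg:
  assumes L: "L \<subseteq> {1..n}" "card L = l" and lk: "l < k"
  shows "real (deg (sgraph k n W x) L) = (\<Sum>B | B \<subseteq> {1..n} - L \<and> card B = k - l. eind k W (L \<union> B) x)"
proof -
  let ?S = "{A. A \<subseteq> {1..n} \<and> card A = k \<and> L \<subseteq> A}"
  have fL: "finite L" using L(1) finite_subset by blast
  have fS: "finite ?S" by (rule finite_subset[of _ "Pow {1..n}"]) auto
  have "{e \<in> edges (sgraph k n W x). L \<subseteq> e} = {A \<in> ?S. x A < W (pull k (enum A) x)}" by (auto simp: sgraph_def)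
  then have "real (deg (sgraph k n W x) L) = (\<Sum>A\<in>?S. eind k W A x)"
    unfolding deg_def eind_def of_bool_def by (simp only: real_of_card sum.inter_filter[OF fS])
  also have "\<dots> = (\<Sum>B | B \<subseteq> {1..n} - L \<and> card B = k - l. eind k W (L \<union> B) x)"
  proof (rule sum.reindex_bij_witness[where i = "\<lambda>B. L \<union> B" and j = "\<lambda>A. A - L"])
    fix A assume A: "A \<in> ?S"
    show "L \<union> (A - L) = A" using A by blast
    then show "eind k W (L \<union> (A - L)) x = eind k W A x" by simp
    show "A - L \<in> {B. B \<subseteq> {1..n} - L \<and> card B = k - l}" using A card_Diff_subset[OF fL, of A] L(2) by auto
  next
    fix B assume B: "B \<in> {B. B \<subseteq> {1..n} - L \<and> card B = k - l}"
    then have "finite B" by (intro finite_subset[of B "{1..n} - L"]) auto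
    moreover have "L \<inter> B = {}" using B by blast
    ultimately have "card (L \<union> B) = k" using fL B L(2) lk by (simp add: card_Un_disjoint)
    then show "L \<union> B \<in> ?S" using B L(1) by blast
    show "L \<union> B - L = B" using B by blast
  qed
  finally show ?thesis .
qed

text \<open>The product of 1 - x + x^2/2 and 1 + x + x^2/2 is 1 + x^4/4, and the second factor is a
  lower bound for exp x.\<close>

lemma exp_minus_le: "0 \<le> (x :: real) \<Longrightarrow> exp (- x) \<le> 1 - x + x\<^sup>2 / 2"
proof -
  assume x: "0 \<le> x"
  have "1 \<le> (1 - x + x\<^sup>2 / 2) * (1 + x + x\<^sup>2 / 2)"
  proof -
    have "(1 - x + x\<^sup>2 / 2) * (1 + x + x\<^sup>2 / 2) = 1 + (x\<^sup>2)\<^sup>2 / 4" by (simp add: power2_eq_square field_simps)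
    then show ?thesis by simp
  qed
  also have "\<dots> \<le> (1 - x + x\<^sup>2 / 2) * exp x"
  proof (rule mult_left_mono[OF exp_lower_Taylor_quadratic[OF x]])
    have "0 \<le> (1 - x)\<^sup>2 + 1" by simp
    then show "0 \<le> 1 - x + x\<^sup>2 / 2" by (simp add: power2_eq_square field_simps)
  qed
  finally show ?thesis by (simp add: exp_minus divide_simps)
qed

text \<open>Hoeffding's averaging trick: the degree is an average, over the permutations of the remaining
  vertices, of sums over disjoint blocks, and these summands are conditionally independent.\<close>

lemma sample_deg_concentration:
  assumes W: "hypergraphon k W" and lk: "l < k" and L: "L \<subseteq> {1..n}" "card L = l" and n: "k \<le> n" and \<epsilon>: "0 < \<epsilon>"
  defines "C \<equiv> cube (binom_le {1..n} k)"
  shows "{x \<in> space C. real (deg (sgraph k n W x) L) < (delta_W k l W - \<epsilon>) * real ((n - l) choose (k - l))} \<in> sets C \<and>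
    measure C {x \<in> space C. real (deg (sgraph k n W x) L) < (delta_W k l W - \<epsilon>) * real ((n - l) choose (k - l))}
      \<le> exp (- (real ((n - l) div (k - l)) * \<epsilon>\<^sup>2 / 2))"
proof -
  define U where "U = {1..n} - L"
  define r where "r = k - l"
  define m where "m = (n - l) div r"
  define N where "N = real ((n - l) choose r)"
  define D where "D x = real (deg (sgraph k n W x) L)" for x
  \<comment> \<open>For e in {0,1}, exp (- \<epsilon> e) equals the affine expression 1 - c e. The
    deviation \<epsilon> itself serves as the exponential parameter.\<close>
  define c where "c = 1 - exp (- \<epsilon>)"
  let ?d = "delta_W k l W" and ?P = "{\<sigma>. \<sigma> permutes U}"
  note uW = hypergraphon_unit_kernel[OF W]
  note d01 = delta_W_unit[OF uW lk]
  have fL: "finite L" using L(1) finite_subset by blast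
  have fU: "finite U" and cU: "card U = n - l" using L fL by (simp_all add: U_def card_Diff_subset)
  have N0: "0 < N" using n lk by (simp add: N_def r_def)
  have fP: "finite ?P" by (rule finite_permutations[OF fU])
  have cP: "card ?P = fact (n - l)" by (rule card_permutations[OF cU fU])
  have Pne: "?P \<noteq> {}" using permutes_id by blast
  have c01: "0 \<le> c" "c \<le> 1" and ce: "\<epsilon> - \<epsilon>\<^sup>2 / 2 \<le> c" using \<epsilon> exp_minus_le[of \<epsilon>] by (simp_all add: c_def)
  have Dm[measurable]: "D \<in> borel_measurable C"
  proof -
    have "eind k W (L \<union> B) \<in> borel_measurable C" if B: "B \<in> {B. B \<subseteq> {1..n} - L \<and> card B = k - l}" for B
    proof -
      have fB: "finite B" using B by (intro finite_subset[of B "{1..n} - L"]) auto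
      have "L \<inter> B = {}" using B by blast
      then have ck: "card (L \<union> B) = k" using fL fB B L(2) lk by (simp add: card_Un_disjoint)
      have sub: "L \<union> B \<subseteq> {1..n}" using L(1) B by blast
      have fK: "finite (L \<union> B)" using fL fB by simp
      have "rprop (L \<union> B) \<subseteq> binom_le {1..n} k"
        using rprop_subset_binom_le[OF _ sub ck] unfolding binom_le_def by fastforce
      moreover have "L \<union> B \<in> binom_le {1..n} k" using sub ck lk by (auto simp: binom_le_def)
      ultimately show ?thesis unfolding C_def using eind_measurable[OF uW fK ck] by blast
    qed
    then show ?thesis unfolding D_def sample_deg[OF L lk] by (rule borel_measurable_sum)
  qed
  define B where "B i = enum U ` blk 0 r i" for i
  have mr: "m * r \<le> n - l" by (simp add: m_def)
  have bU: "bij_betw (enum U) {1..n - l} U" using enum_bij[OF fU] cU by simp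
  have bs: "blk 0 r i \<subseteq> {1..n - l}" if "i < m" for i
  proof -
    have "Suc i * r \<le> m * r" using that by (intro mult_right_mono) auto
    then have "Suc i * r \<le> n - l" using mr by linarith
    then show ?thesis unfolding blk_def by auto
  qed
  have B1: "B i \<subseteq> U \<and> card (B i) = r" if "i < m" for i
    using image_mono[OF bs[OF that], of "enum U"] bij_betw_imp_surj_on[OF bU]
      card_image[OF inj_on_subset[OF bij_betw_imp_inj_on[OF bU] bs[OF that]]] blk_simps(2)[of 0 r i] by (simp add: B_def)
  have B2: "disjoint_family_on B {..<m}" unfolding disjoint_family_on_def
  proof (intro ballI impI)
    fix i j assume ij: "i \<in> {..<m}" "j \<in> {..<m}" "i \<noteq> j"
    have "blk 0 r i \<inter> blk 0 r j = {}" using blk_disjoint[of 0 r UNIV] ij(3) unfolding disjoint_family_on_def by blast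
    moreover have "enum U ` (blk 0 r i \<inter> blk 0 r j) = B i \<inter> B j" unfolding B_def
      by (rule inj_on_image_Int[OF bij_betw_imp_inj_on[OF bU] bs bs]) (use ij in auto)
    ultimately show "B i \<inter> B j = {}" by simp
  qed
  \<comment> \<open>Counts the edges through L over the disjoint blocks moved by \<sigma>; its
    average over \<sigma> is the degree times m / N.\<close>
  define S where "S \<sigma> x = (\<Sum>i<m. eind k W (L \<union> \<sigma> ` B i) x)" for \<sigma> x
  have avg: "(\<Sum>\<sigma>\<in>?P. S \<sigma> x) = fact (n - l) * (real m * D x / N)" for x
  proof -
    have "(\<Sum>\<sigma>\<in>?P. S \<sigma> x) = (\<Sum>i<m. \<Sum>\<sigma>\<in>?P. eind k W (L \<union> \<sigma> ` B i) x)" unfolding S_def by (rule sum.swap)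
    also have "\<dots> = (\<Sum>i<m. fact (n - l) * (D x / N))"
    proof (rule sum.cong[OF refl])
      fix i assume "i \<in> {..<m}"
      then have Bi: "B i \<subseteq> U" "card (B i) = r" using B1 by auto
      have "N * (\<Sum>\<sigma>\<in>?P. eind k W (L \<union> \<sigma> ` B i) x) = fact (n - l) * D x"
        using sum_permutes_image[OF fU Bi, of "\<lambda>B. eind k W (L \<union> B) x", unfolded cU]
        unfolding D_def sample_deg[OF L lk] N_def U_def r_def .
      then show "(\<Sum>\<sigma>\<in>?P. eind k W (L \<union> \<sigma> ` B i) x) = fact (n - l) * (D x / N)" using N0 by (simp add: field_simps)
    qed
    finally show ?thesis by simp
  qed
  have es: "exp (- \<epsilon> * S \<sigma> x) = (\<Prod>i<m. 1 - c * eind k W (L \<union> \<sigma> ` B i) x)" for \<sigma> x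
  proof -
    have "exp (- \<epsilon> * S \<sigma> x) = (\<Prod>i<m. exp (- \<epsilon> * eind k W (L \<union> \<sigma> ` B i) x))"
      unfolding S_def sum_distrib_left by (rule exp_sum) simp
    also have "\<dots> = (\<Prod>i<m. 1 - c * eind k W (L \<union> \<sigma> ` B i) x)"
      by (rule prod.cong[OF refl]) (simp add: eind_def c_def)
    finally show ?thesis .
  qed
  let ?w = "1 / fact (n - l) :: real"
  \<comment> \<open>Convexity bounds the exponential of an average by the average of exponentials,
    and the expectation of each of these is a block moment.\<close>
  have jensen: "exp (- (\<epsilon> * (real m / N) * D x)) \<le> (\<Sum>\<sigma>\<in>?P. ?w * exp (- \<epsilon> * S \<sigma> x))" for x
  proof -
    have "exp (\<Sum>\<sigma>\<in>?P. ?w *\<^sub>R (- \<epsilon> * S \<sigma> x)) \<le> (\<Sum>\<sigma>\<in>?P. ?w * exp (- \<epsilon> * S \<sigma> x))"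
      by (rule convex_on_sum[OF fP Pne exp_convex]) (simp_all add: cP)
    moreover have "(\<Sum>\<sigma>\<in>?P. ?w *\<^sub>R (- \<epsilon> * S \<sigma> x)) = ?w * (- \<epsilon>) * (\<Sum>\<sigma>\<in>?P. S \<sigma> x)"
      unfolding sum_distrib_left by (rule sum.cong[OF refl]) simp
    moreover have "?w * (- \<epsilon>) * (\<Sum>\<sigma>\<in>?P. S \<sigma> x) = - (\<epsilon> * (real m / N) * D x)" unfolding avg by simp
    ultimately show ?thesis by simp
  qed
  have pC: "prob_space C" unfolding C_def by (rule prob_space_cube)
  have em: "integrable C (\<lambda>x. exp (- \<epsilon> * S \<sigma> x)) \<and> (\<integral>x. exp (- \<epsilon> * S \<sigma> x) \<partial>C) \<le> (1 - c * ?d) ^ m" if "\<sigma> \<in> ?P" for \<sigma>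
  proof
    have \<sigma>: "\<sigma> permutes U" using that by simp
    have sB: "\<sigma> ` B i \<subseteq> {1..n} - L \<and> card (\<sigma> ` B i) = k - l" if "i < m" for i
      using image_mono[of "B i" U \<sigma>] permutes_image[OF \<sigma>] B1[OF that] card_image[OF inj_on_subset[OF permutes_inj[OF \<sigma>] subset_UNIV], of "B i"]
      by (simp add: U_def r_def)
    have dB: "disjoint_family_on (\<lambda>i. \<sigma> ` B i) {..<m}"
      using B2 image_Int[OF permutes_inj[OF \<sigma>], symmetric] by (simp add: disjoint_family_on_def)
    show "(\<integral>x. exp (- \<epsilon> * S \<sigma> x) \<partial>C) \<le> (1 - c * ?d) ^ m"
      unfolding es C_def by (rule sample_blocks_moment[OF W lk L sB dB c01])
    have Sm: "(\<lambda>x. S \<sigma> x) \<in> borel_measurable C" unfolding S_def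
    proof (rule borel_measurable_sum)
      fix i assume "i \<in> {..<m}"
      then have i: "i < m" by simp
      have fB: "finite (\<sigma> ` B i)" using sB[OF i] by (intro finite_subset[of "\<sigma> ` B i" "{1..n} - L"]) auto
      have "L \<inter> \<sigma> ` B i = {}" using sB[OF i] by blast
      then have ck: "card (L \<union> \<sigma> ` B i) = k" using fL fB sB[OF i] L(2) lk by (simp add: card_Un_disjoint)
      have sub: "L \<union> \<sigma> ` B i \<subseteq> {1..n}" using L(1) sB[OF i] by blast
      have fK: "finite (L \<union> \<sigma> ` B i)" using fL fB by simp
      have "rprop (L \<union> \<sigma> ` B i) \<subseteq> binom_le {1..n} k"
        using rprop_subset_binom_le[OF _ sub ck] unfolding binom_le_def by fastforce
      moreover have "L \<union> \<sigma> ` B i \<in> binom_le {1..n} k" using sub ck lk by (auto simp: binom_le_def)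
      ultimately show "eind k W (L \<union> \<sigma> ` B i) \<in> borel_measurable C" unfolding C_def using eind_measurable[OF uW fK ck] by blast
    qed
    have S0: "0 \<le> S \<sigma> x" for x unfolding S_def by (rule sum_nonneg) (use eind_unit in blast)
    show "integrable C (\<lambda>x. exp (- \<epsilon> * S \<sigma> x))"
    proof (rule prob_space.integrable_unit[OF pC])
      show "(\<lambda>x. exp (- \<epsilon> * S \<sigma> x)) \<in> borel_measurable C" using Sm by measurable
      show "0 \<le> exp (- \<epsilon> * S \<sigma> x) \<and> exp (- \<epsilon> * S \<sigma> x) \<le> 1" for x using S0[of x] \<epsilon> by simp
    qed
  qed
  have D0: "0 \<le> D x" for x by (simp add: D_def)
  have iD: "integrable C (\<lambda>x. exp (- (\<epsilon> * (real m / N) * D x)))"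
  proof (rule prob_space.integrable_unit[OF pC])
    show "(\<lambda>x. exp (- (\<epsilon> * (real m / N) * D x))) \<in> borel_measurable C" by measurable
    show "0 \<le> exp (- (\<epsilon> * (real m / N) * D x)) \<and> exp (- (\<epsilon> * (real m / N) * D x)) \<le> 1" for x using D0[of x] \<epsilon> N0 by simp
  qed
  have "(\<integral>x. exp (- (\<epsilon> * (real m / N) * D x)) \<partial>C) \<le> (\<integral>x. (\<Sum>\<sigma>\<in>?P. ?w * exp (- \<epsilon> * S \<sigma> x)) \<partial>C)"
    by (rule integral_mono[OF iD _ jensen]) (intro Bochner_Integration.integrable_sum integrable_mult_right conjunct1[OF em])
  also have "\<dots> = (\<Sum>\<sigma>\<in>?P. \<integral>x. ?w * exp (- \<epsilon> * S \<sigma> x) \<partial>C)"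
    by (rule Bochner_Integration.integral_sum) (intro integrable_mult_right conjunct1[OF em])
  also have "\<dots> \<le> (\<Sum>\<sigma>\<in>?P. ?w * (1 - c * ?d) ^ m)"
  proof (rule sum_mono)
    fix \<sigma> assume "\<sigma> \<in> ?P"
    then show "(\<integral>x. ?w * exp (- \<epsilon> * S \<sigma> x) \<partial>C) \<le> ?w * (1 - c * ?d) ^ m"
      unfolding integral_mult_right_zero by (intro mult_left_mono conjunct2[OF em]) auto
  qed
  also have "\<dots> = (1 - c * ?d) ^ m" by (simp add: cP)
  also have "\<dots> \<le> exp (- (c * ?d)) ^ m"
    using exp_ge_add_one_self[of "- (c * ?d)"] c01 d01 by (intro power_mono) (simp_all add: mult_le_one)
  also have "\<dots> = exp (- (real m * (c * ?d)))" by (simp add: exp_of_nat_mult[symmetric])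
  finally have E: "(\<integral>x. exp (- (\<epsilon> * (real m / N) * D x)) \<partial>C) \<le> exp (- (real m * (c * ?d)))" .
  let ?a = "(?d - \<epsilon>) * N"
  let ?b = "exp (- (\<epsilon> * (real m / N) * ?a))"
  have Bs: "{x \<in> space C. D x < ?a} \<in> sets C" by measurable
  interpret C: prob_space C by (rule pC)
  have Bs2: "{x \<in> space C. ?b \<le> exp (- (\<epsilon> * (real m / N) * D x))} \<in> sets C" by measurable
  have "measure C {x \<in> space C. D x < ?a} \<le> measure C {x \<in> space C. ?b \<le> exp (- (\<epsilon> * (real m / N) * D x))}"
  proof (rule C.finite_measure_mono[OF _ Bs2], rule subsetI)
    fix x assume x: "x \<in> {x \<in> space C. D x < ?a}"
    then have "\<epsilon> * (real m / N) * D x \<le> \<epsilon> * (real m / N) * ?a" using \<epsilon> N0 by (intro mult_left_mono) auto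
    then show "x \<in> {x \<in> space C. ?b \<le> exp (- (\<epsilon> * (real m / N) * D x))}" using x by simp
  qed
  also have "\<dots> \<le> (\<integral>x. exp (- (\<epsilon> * (real m / N) * D x)) \<partial>C) / ?b"
    by (rule integral_Markov_inequality_measure[OF iD, where A = "{}"]) auto
  also have "\<dots> \<le> exp (- (real m * (c * ?d))) / ?b" by (rule divide_right_mono[OF E]) simp
  also have "\<dots> = exp (real m * (\<epsilon> * (?d - \<epsilon>) - c * ?d))"
  proof -
    have "\<epsilon> * (real m / N) * ?a = real m * (\<epsilon> * (?d - \<epsilon>))" using N0 by simp
    then show ?thesis by (simp add: exp_diff[symmetric] algebra_simps)
  qed
  \<comment> \<open>With c \<ge> \<epsilon> - \<epsilon>^2/2 and delta \<le> 1 the bracket is at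
    most - \<epsilon>^2 + \<epsilon>^2/2.\<close>
  also have "\<dots> \<le> exp (real m * (- (\<epsilon>\<^sup>2 / 2)))"
  proof -
    have "(\<epsilon> - \<epsilon>\<^sup>2 / 2) * ?d \<le> c * ?d" using d01 ce by (intro mult_right_mono) auto
    moreover have "\<epsilon>\<^sup>2 / 2 * ?d \<le> \<epsilon>\<^sup>2 / 2 * 1" using d01 by (intro mult_left_mono) auto
    ultimately have "\<epsilon> * (?d - \<epsilon>) - c * ?d \<le> - (\<epsilon>\<^sup>2 / 2)" by (simp add: algebra_simps power2_eq_square)
    then have "real m * (\<epsilon> * (?d - \<epsilon>) - c * ?d) \<le> real m * (- (\<epsilon>\<^sup>2 / 2))" by (rule mult_left_mono) simp
    then show ?thesis by simp
  qed
  finally have "measure C {x \<in> space C. D x < ?a} \<le> exp (- (real m * \<epsilon>\<^sup>2 / 2))" by simp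
  then show ?thesis using Bs unfolding D_def N_def m_def r_def by blast
qed

subsection \<open>The codegree density\<close>

lemma pow_exp_decay:
  fixes a :: real
  assumes "0 < a" shows "(\<lambda>n. real n ^ l * exp (- (a * real n))) \<longlonglongrightarrow> 0"
proof -
  have "filterlim (\<lambda>n. a * real n) at_top sequentially"
    by (rule filterlim_tendsto_pos_mult_at_top[OF tendsto_const assms filterlim_real_sequentially])
  from filterlim_compose[OF tendsto_power_div_exp_0[of l] this]
  have "(\<lambda>n. (1 / a ^ l) * ((a * real n) ^ l / exp (a * real n))) \<longlonglongrightarrow> (1 / a ^ l) * 0"
    by (rule tendsto_mult_left)
  moreover have "(1 / a ^ l) * ((a * real n) ^ l / exp (a * real n)) = real n ^ l * exp (- (a * real n))" for n
    using assms by (simp add: power_mult_distrib exp_minus field_simps)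
  ultimately show ?thesis by simp
qed

text \<open>The number of blocks is at least n/r - l/r - 1, so the exponent is linear in n up to a
  constant, which \<open>?K\<close> absorbs.\<close>

lemma union_bound_tendsto:
  assumes r: "0 < r" and \<epsilon>: "0 < (\<epsilon> :: real)"
  shows "(\<lambda>n. real n ^ l * exp (- (real ((n - l) div r) * \<epsilon>\<^sup>2 / 2))) \<longlonglongrightarrow> 0"
proof -
  let ?a = "\<epsilon>\<^sup>2 / (2 * real r)" and ?K = "exp ((real l / real r + 1) * \<epsilon>\<^sup>2 / 2)"
  have a: "0 < ?a" using r \<epsilon> by simp
  have lim: "(\<lambda>n. ?K * (real n ^ l * exp (- (?a * real n)))) \<longlonglongrightarrow> 0"
    using tendsto_mult_left[OF pow_exp_decay[OF a, of l], of ?K] by simp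
  show ?thesis
  proof (rule tendsto_sandwich[OF always_eventually always_eventually tendsto_const lim], goal_cases)
    case 2
    show ?case
    proof
      fix n
      have "n - l < Suc ((n - l) div r) * r" using div_mult_mod_eq[of "n - l" r] mod_less_divisor[OF r, of "n - l"]
        unfolding mult_Suc by linarith
      then have "real (n - l) \<le> (real ((n - l) div r) + 1) * real r"
        by (metis of_nat_Suc of_nat_mult of_nat_le_iff less_imp_le add.commute)
      then have "real n - real l \<le> (real ((n - l) div r) + 1) * real r" by linarith
      then have "(real n - real l) / real r \<le> real ((n - l) div r) + 1" using r by (simp add: pos_divide_le_eq)
      then have "real n / real r - real l / real r - 1 \<le> real ((n - l) div r)" by (simp add: diff_divide_distrib)
      then have "(real n / real r - real l / real r - 1) * (\<epsilon>\<^sup>2 / 2) \<le> real ((n - l) div r) * (\<epsilon>\<^sup>2 / 2)" by (rule mult_right_mono) simp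
      moreover have "(real n / real r - real l / real r - 1) * (\<epsilon>\<^sup>2 / 2) = ?a * real n - (real l / real r + 1) * \<epsilon>\<^sup>2 / 2"
        using r by (simp add: field_simps)
      ultimately have "- (real ((n - l) div r) * \<epsilon>\<^sup>2 / 2) \<le> (real l / real r + 1) * \<epsilon>\<^sup>2 / 2 + - (?a * real n)"
        by linarith
      then have "exp (- (real ((n - l) div r) * \<epsilon>\<^sup>2 / 2)) \<le> ?K * exp (- (?a * real n))" unfolding exp_add[symmetric] by simp
      then have "real n ^ l * exp (- (real ((n - l) div r) * \<epsilon>\<^sup>2 / 2)) \<le> real n ^ l * (?K * exp (- (?a * real n)))"
        by (rule mult_left_mono) simp
      then show "real n ^ l * exp (- (real ((n - l) div r) * \<epsilon>\<^sup>2 / 2)) \<le> ?K * (real n ^ l * exp (- (?a * real n)))"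
        by (simp only: mult.left_commute)
    qed
  qed simp
qed

text \<open>Union bound over the l-sets and the finite family \<open>X\<close> of test graphs,
  together with the null event that a member of \<open>Fam\<close> occurs. Once the total p n is
  below 1, some sample avoids every failure.\<close>

lemma sample_exists:
  assumes W: "hypergraphon k W" and lk: "l < k" and Fam: "\<forall>F\<in>Fam. kgraph k F" and free: "W_free k Fam W"
    and X: "finite X" "\<And>F. F \<in> X \<Longrightarrow> kgraph k F" and \<epsilon>: "0 < \<epsilon>"
  shows "\<forall>\<^sub>F n in sequentially. \<exists>G. kgraph k G \<and> card (verts G) = n \<and> Ffree Fam G \<and>
    (\<forall>L. L \<subseteq> verts G \<and> card L = l \<longrightarrow> (delta_W k l W - \<epsilon>) * real ((n - l) choose (k - l)) \<le> real (deg G L)) \<and>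
    (\<forall>F\<in>X. \<bar>t_graph F G - t_hom k F W\<bar> < \<epsilon>)"
proof -
  define p where "p n = real n ^ l * exp (- (real ((n - l) div (k - l)) * \<epsilon>\<^sup>2 / 2)) + (\<Sum>F\<in>X. 6 * (real (card (verts F)))\<^sup>2 / (n * \<epsilon>\<^sup>2))" for n
  have "p \<longlonglongrightarrow> 0 + (\<Sum>F\<in>X. 0)"
    unfolding p_def
  proof (intro tendsto_add tendsto_sum union_bound_tendsto)
    fix F assume "F \<in> X"
    have "(\<lambda>n. (6 * (real (card (verts F)))\<^sup>2 / \<epsilon>\<^sup>2) * (1 / real n)) \<longlonglongrightarrow> (6 * (real (card (verts F)))\<^sup>2 / \<epsilon>\<^sup>2) * 0"
      by (rule tendsto_mult_left[OF lim_1_over_n])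
    then show "(\<lambda>n. 6 * (real (card (verts F)))\<^sup>2 / (real n * \<epsilon>\<^sup>2)) \<longlonglongrightarrow> 0" by (simp add: mult.commute)
  qed (use lk \<epsilon> in auto)
  then have "p \<longlonglongrightarrow> 0" by simp
  then have "\<forall>\<^sub>F n in sequentially. p n < 1" by (rule order_tendstoD) simp
  then show ?thesis using eventually_ge_at_top[of k]
  proof eventually_elim
    fix n assume p1: "p n < 1" and n: "k \<le> n"
    define C where "C = cube (binom_le {1..n} k)"
    let ?\<L> = "{L. L \<subseteq> {1..n} \<and> card L = l}"
    let ?c = "(delta_W k l W - \<epsilon>) * real ((n - l) choose (k - l))"
    define A1 where "A1 L = {x \<in> space C. real (deg (sgraph k n W x) L) < ?c}" for L
    define A2 where "A2 F = {x \<in> space C. \<epsilon> \<le> \<bar>t_graph F (sgraph k n W x) - t_hom k F W\<bar>}" for F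
    interpret C: prob_space C unfolding C_def by (rule prob_space_cube)
    have k0: "0 < k" and n0: "0 < n" using lk n by auto
    have A1: "A1 L \<in> sets C \<and> measure C (A1 L) \<le> exp (- (real ((n - l) div (k - l)) * \<epsilon>\<^sup>2 / 2))" if "L \<in> ?\<L>" for L
      unfolding A1_def C_def by (rule sample_deg_concentration[OF W lk _ _ n \<epsilon>]) (use that in auto)
    have A2: "A2 F \<in> sets C \<and> measure C (A2 F) \<le> 6 * (real (card (verts F)))\<^sup>2 / (n * \<epsilon>\<^sup>2)" if "F \<in> X" for F
      unfolding A2_def C_def by (rule sample_t_graph_deviation[OF W X(2)[OF that] k0 n0 \<epsilon>])
    have fL: "finite ?\<L>" by (rule finite_subset[of _ "Pow {1..n}"]) auto
    have cL: "card ?\<L> \<le> n ^ l" using n_subsets[of "{1..n}" l] binomial_le_pow[of l n] lk n by simp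
    obtain N where N1: "{x \<in> space C. \<not> Ffree Fam (sgraph k n W x)} \<subseteq> N" and N0: "emeasure C N = 0" and N2: "N \<in> sets C"
      by (rule AE_E[OF AE_sample_Ffree[OF W Fam free k0, of n, folded C_def]])
    have N3: "measure C N = 0" using N0 by (simp add: measure_def)
    note N = N1 N2 N3
    have m1: "measure C (\<Union>L\<in>?\<L>. A1 L) \<le> real n ^ l * exp (- (real ((n - l) div (k - l)) * \<epsilon>\<^sup>2 / 2))"
    proof -
      have "measure C (\<Union>L\<in>?\<L>. A1 L) \<le> (\<Sum>L\<in>?\<L>. measure C (A1 L))"
        by (rule C.finite_measure_subadditive_finite[OF fL]) (use A1 in blast)
      also have "\<dots> \<le> (\<Sum>L\<in>?\<L>. exp (- (real ((n - l) div (k - l)) * \<epsilon>\<^sup>2 / 2)))" by (rule sum_mono) (use A1 in blast)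
      also have "\<dots> = real (card ?\<L>) * exp (- (real ((n - l) div (k - l)) * \<epsilon>\<^sup>2 / 2))" by (simp only: sum_constant)
      also have "\<dots> \<le> real (n ^ l) * exp (- (real ((n - l) div (k - l)) * \<epsilon>\<^sup>2 / 2))" by (rule mult_right_mono) (use cL of_nat_mono in blast, simp)
      finally show ?thesis by simp
    qed
    have m2: "measure C (\<Union>F\<in>X. A2 F) \<le> (\<Sum>F\<in>X. 6 * (real (card (verts F)))\<^sup>2 / (n * \<epsilon>\<^sup>2))"
    proof -
      have "measure C (\<Union>F\<in>X. A2 F) \<le> (\<Sum>F\<in>X. measure C (A2 F))"
        by (rule C.finite_measure_subadditive_finite[OF X(1)]) (use A2 in blast)
      also have "\<dots> \<le> (\<Sum>F\<in>X. 6 * (real (card (verts F)))\<^sup>2 / (n * \<epsilon>\<^sup>2))" by (rule sum_mono) (use A2 in blast)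
      finally show ?thesis .
    qed
    have s1: "(\<Union>L\<in>?\<L>. A1 L) \<in> sets C" by (rule sets.finite_UN[OF fL]) (use A1 in blast)
    have s2: "(\<Union>F\<in>X. A2 F) \<in> sets C" by (rule sets.finite_UN[OF X(1)]) (use A2 in blast)
    have "measure C (((\<Union>L\<in>?\<L>. A1 L) \<union> (\<Union>F\<in>X. A2 F)) \<union> N) \<le> p n"
      using measure_Un_le[OF sets.Un[OF s1 s2] N(2)] measure_Un_le[OF s1 s2] m1 m2 N(3)
      unfolding p_def by linarith
    then have "((\<Union>L\<in>?\<L>. A1 L) \<union> (\<Union>F\<in>X. A2 F)) \<union> N \<noteq> space C" using p1 C.prob_space by force
    moreover have "((\<Union>L\<in>?\<L>. A1 L) \<union> (\<Union>F\<in>X. A2 F)) \<union> N \<subseteq> space C"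
      by (rule sets.sets_into_space[OF sets.Un[OF sets.Un[OF s1 s2] N(2)]])
    ultimately obtain x where x: "x \<in> space C" "x \<notin> (\<Union>L\<in>?\<L>. A1 L)" "x \<notin> (\<Union>F\<in>X. A2 F)" "x \<notin> N" by blast
    let ?G = "sgraph k n W x"
    have vG: "verts ?G = {1..n}" by (simp add: sgraph_def)
    show "\<exists>G. kgraph k G \<and> card (verts G) = n \<and> Ffree Fam G \<and>
      (\<forall>L. L \<subseteq> verts G \<and> card L = l \<longrightarrow> ?c \<le> real (deg G L)) \<and> (\<forall>F\<in>X. \<bar>t_graph F G - t_hom k F W\<bar> < \<epsilon>)"
    proof (intro exI[of _ ?G] conjI allI impI ballI)
      show "kgraph k ?G" by (rule kgraph_sgraph)
      show "card (verts ?G) = n" unfolding vG by simp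
      show "Ffree Fam ?G" using x(1,4) N(1) by blast
      fix L assume "L \<subseteq> verts ?G \<and> card L = l"
      then have "x \<notin> A1 L" using x(2) unfolding vG by blast
      then show "?c \<le> real (deg ?G L)" using x(1) by (simp add: A1_def)
    next
      fix F assume "F \<in> X"
      then have "x \<notin> A2 F" using x(3) by blast
      then show "\<bar>t_graph F ?G - t_hom k F W\<bar> < \<epsilon>" using x(1) by (simp add: A2_def)
    qed
  qed
qed

lemma deg_le_choose:
  assumes G: "kgraph k G" and L: "L \<subseteq> verts G" "card L = l"
  shows "deg G L \<le> (card (verts G) - l) choose (k - l)"
proof -
  have fin: "finite (verts G)" using G by (simp add: kgraph_def)
  have fL: "finite L" using L(1) fin finite_subset by blast
  have "card {e \<in> edges G. L \<subseteq> e} \<le> card {B. B \<subseteq> verts G - L \<and> card B = k - l}"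
  proof (rule card_inj_on_le[of "\<lambda>e. e - L"])
    show "inj_on (\<lambda>e. e - L) {e \<in> edges G. L \<subseteq> e}" by (rule inj_onI) blast
    show "(\<lambda>e. e - L) ` {e \<in> edges G. L \<subseteq> e} \<subseteq> {B. B \<subseteq> verts G - L \<and> card B = k - l}"
    proof
      fix B assume "B \<in> (\<lambda>e. e - L) ` {e \<in> edges G. L \<subseteq> e}"
      then obtain e where e: "B = e - L" "e \<in> edges G" "L \<subseteq> e" by blast
      then have "e \<subseteq> verts G" "card e = k" using G by (auto simp: kgraph_def)
      then show "B \<in> {B. B \<subseteq> verts G - L \<and> card B = k - l}" using e card_Diff_subset[OF fL e(3)] L(2) by auto
    qed
    show "finite {B. B \<subseteq> verts G - L \<and> card B = k - l}" by (rule finite_subset[of _ "Pow (verts G)"]) (use fin in auto)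
  qed
  also have "\<dots> = card (verts G - L) choose (k - l)" by (rule n_subsets) (use fin in simp)
  also have "card (verts G - L) = card (verts G) - l" using card_Diff_subset[OF fL L(1)] L(2) by simp
  finally show ?thesis by (simp add: deg_def)
qed

context
  fixes k l :: nat and Fam :: "hgraph set"
  assumes lk: "l < k" and kFam: "\<forall>F\<in>Fam. kgraph k F" and neFam: "\<forall>F\<in>Fam. edges F \<noteq> {}"
begin

text \<open>\<open>coex\<close> is a maximum, so its set has to be finite and non-empty. The
  edgeless graph witnesses 0; it is free because every member of \<open>Fam\<close> has an
  edge.\<close>

lemma coex_set:
  assumes "l \<le> n"
  defines "M \<equiv> {m. \<exists>G. kgraph k G \<and> card (verts G) = n \<and> Ffree Fam G \<and> (\<forall>L. L \<subseteq> verts G \<and> card L = l \<longrightarrow> m \<le> deg G L)}"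
  shows "M \<subseteq> {..(n - l) choose (k - l)}" "0 \<in> M"
proof
  fix m assume "m \<in> M"
  then obtain G where G: "kgraph k G" "card (verts G) = n" "\<forall>L. L \<subseteq> verts G \<and> card L = l \<longrightarrow> m \<le> deg G L"
    unfolding M_def by blast
  obtain L where L: "L \<subseteq> verts G" "card L = l" using obtain_subset_with_card_n[of l "verts G"] assms(1) G(2) by metis
  then have "m \<le> deg G L" using G(3) by blast
  also have "\<dots> \<le> (n - l) choose (k - l)" using deg_le_choose[OF G(1) L] G(2) by simp
  finally show "m \<in> {..(n - l) choose (k - l)}" by simp
next
  let ?G = "({1..n}, {}) :: hgraph"
  have "kgraph k ?G" by (simp add: kgraph_def)
  moreover have "Ffree Fam ?G" using neFam unfolding Ffree_def contains_copy_def by auto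
  ultimately show "0 \<in> M" unfolding M_def mem_Collect_eq by (intro exI[of _ ?G] conjI) simp_all
qed

lemma coex_le: "l \<le> n \<Longrightarrow> coex k l n Fam \<le> (n - l) choose (k - l)"
  unfolding coex_def using coex_set[of n] finite_subset[OF coex_set(1)] by (subst Max_le_iff) auto

lemma le_coex:
  assumes "kgraph k G" "card (verts G) = n" "Ffree Fam G" "\<And>L. L \<subseteq> verts G \<Longrightarrow> card L = l \<Longrightarrow> m \<le> deg G L" "l \<le> n"
  shows "m \<le> coex k l n Fam"
  unfolding coex_def
proof (rule Max_ge[OF finite_subset[OF coex_set(1)[OF assms(5)] finite_atMost]], rule CollectI, rule exI[of _ G])
  show "kgraph k G \<and> card (verts G) = n \<and> Ffree Fam G \<and> (\<forall>L. L \<subseteq> verts G \<and> card L = l \<longrightarrow> m \<le> deg G L)"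
    using assms by blast
qed

lemma min_deg_ge:
  assumes "finite (verts G)" "l \<le> card (verts G)" "\<And>L. L \<subseteq> verts G \<Longrightarrow> card L = l \<Longrightarrow> m \<le> deg G L"
  shows "m \<le> min_deg l G"
proof -
  let ?D = "{deg G L |L. L \<subseteq> verts G \<and> card L = l}"
  have fin: "finite ?D" by (rule finite_subset[of _ "deg G ` Pow (verts G)"]) (use assms(1) in auto)
  obtain L where "L \<subseteq> verts G" "card L = l" using obtain_subset_with_card_n[OF assms(2)] by metis
  then have ne: "?D \<noteq> {}" by blast
  show ?thesis unfolding min_deg_def Min_ge_iff[OF fin ne] using assms(3) by blast
qed

lemma min_deg_le_coex:
  assumes "kgraph k G" "Ffree Fam G" "l \<le> card (verts G)"
  shows "min_deg l G \<le> coex k l (card (verts G)) Fam"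
  by (rule le_coex[OF assms(1) refl assms(2) _ assms(3)]) (use min_deg_le assms(1) in \<open>auto simp: kgraph_def\<close>)

lemma coex_attained:
  assumes "l \<le> n"
  shows "\<exists>G. kgraph k G \<and> card (verts G) = n \<and> Ffree Fam G \<and> min_deg l G = coex k l n Fam"
proof -
  have "coex k l n Fam \<in> {m. \<exists>G. kgraph k G \<and> card (verts G) = n \<and> Ffree Fam G \<and> (\<forall>L. L \<subseteq> verts G \<and> card L = l \<longrightarrow> m \<le> deg G L)}"
    unfolding coex_def by (rule Max_in[OF finite_subset[OF coex_set(1)[OF assms]]]) (use coex_set(2)[OF assms] in auto)
  then obtain G where G: "kgraph k G" "card (verts G) = n" "Ffree Fam G" "\<forall>L. L \<subseteq> verts G \<and> card L = l \<longrightarrow> coex k l n Fam \<le> deg G L"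
    by blast
  have "coex k l n Fam \<le> min_deg l G" by (rule min_deg_ge) (use G assms in \<open>auto simp: kgraph_def\<close>)
  moreover have "min_deg l G \<le> coex k l n Fam" using min_deg_le_coex[OF G(1,3)] assms G(2) by simp
  ultimately show ?thesis using G by (intro exI[of _ G]) auto
qed

definition coex_density :: "nat \<Rightarrow> real" where
  "coex_density n = real (coex k l n Fam) / real ((n - l) choose (k - l))"

lemma coex_density_unit: "k \<le> n \<Longrightarrow> 0 \<le> coex_density n \<and> coex_density n \<le> 1"
  unfolding coex_density_def using coex_le[of n] lk by (auto simp: divide_le_eq_1)

text \<open>Extremal graphs along the subsequence have a convergent further subsequence, whose limit
  is free and has minimum degree at least c.\<close>

lemma subseq_limit_le_delta:
  assumes s: "strict_mono s" and lim: "(\<lambda>n. coex_density (s n)) \<longlonglongrightarrow> c"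
  shows "\<exists>W. hypergraphon k W \<and> W_free k Fam W \<and> c \<le> delta_W k l W"
proof -
  \<comment> \<open>The shift guarantees at least k vertices, so the graphs are non-empty and the
    densities lie in [0,1].\<close>
  define s' where "s' n = s (n + k)" for n
  have sk: "k \<le> s' n" and sn: "n \<le> s' n" for n using strict_mono_imp_increasing[OF s, of "n + k"] by (simp_all add: s'_def)
  have lim': "(\<lambda>n. coex_density (s' n)) \<longlonglongrightarrow> c" unfolding s'_def by (rule LIMSEQ_ignore_initial_segment[OF lim])
  have "\<forall>n. \<exists>G. kgraph k G \<and> card (verts G) = s' n \<and> Ffree Fam G \<and> min_deg l G = coex k l (s' n) Fam"
    using coex_attained sk lk by (meson le_trans less_imp_le)
  then obtain G where G: "\<And>n. kgraph k (G n) \<and> card (verts (G n)) = s' n \<and> Ffree Fam (G n) \<and> min_deg l (G n) = coex k l (s' n) Fam"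
    by metis
  have ne: "verts (G n) \<noteq> {}" for n using G[of n] sk[of n] lk by force
  obtain r W where r: "strict_mono r" and W: "hypergraphon k W" and conv: "converges_to k (\<lambda>n. G (r n)) W"
    using hypergraphon_compactness[of k G] G ne lk by (metis gr_implies_not0 neq0_conv)
  have card: "filterlim (\<lambda>n. card (verts (G (r n)))) at_top sequentially"
  proof (rule filterlim_at_top_mono[OF filterlim_ident], rule always_eventually, rule allI)
    fix n show "n \<le> card (verts (G (r n)))" using G[of "r n"] sn[of "r n"] strict_mono_imp_increasing[OF r, of n] by linarith
  qed
  have deg: "(\<lambda>n. real (min_deg l (G (r n))) / real ((card (verts (G (r n))) - l) choose (k - l))) \<longlonglongrightarrow> c"
    using LIMSEQ_subseq_LIMSEQ[OF lim' r] G unfolding comp_def coex_density_def by simp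
  have c1: "c \<le> 1" by (rule LIMSEQ_le_const2[OF lim']) (use coex_density_unit[OF sk] in blast)
  have "c \<le> delta_W k l W" by (rule delta_W_limit_ge[OF W lk conv _ card deg c1]) (use G in blast)
  moreover have "W_free k Fam W" by (rule W_free_limit[OF kFam conv _ card]) (use G in blast)
  ultimately show ?thesis using W by blast
qed

text \<open>Samples exist for every large number of vertices, so this bound holds along the full
  sequence, in contrast to the one from compactness.\<close>

lemma delta_le_coex_density:
  assumes W: "hypergraphon k W" and free: "W_free k Fam W" and \<epsilon>: "0 < \<epsilon>"
  shows "\<forall>\<^sub>F n in sequentially. delta_W k l W - \<epsilon> \<le> coex_density n"
proof -
  have ev: "\<forall>\<^sub>F n in sequentially. \<exists>G. kgraph k G \<and> card (verts G) = n \<and> Ffree Fam G \<and>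
    (\<forall>L. L \<subseteq> verts G \<and> card L = l \<longrightarrow> (delta_W k l W - \<epsilon>) * real ((n - l) choose (k - l)) \<le> real (deg G L))"
    by (rule eventually_mono[OF sample_exists[OF W lk kFam free finite.emptyI _ \<epsilon>]], simp, blast)
  show ?thesis using ev eventually_ge_at_top[of k]
  proof eventually_elim
    case (elim n)
    then obtain G where G: "kgraph k G" "card (verts G) = n" "Ffree Fam G"
      "\<And>L. L \<subseteq> verts G \<Longrightarrow> card L = l \<Longrightarrow> (delta_W k l W - \<epsilon>) * real ((n - l) choose (k - l)) \<le> real (deg G L)" by blast
    have n: "k \<le> n" by (rule elim)
    let ?c = "(delta_W k l W - \<epsilon>) * real ((n - l) choose (k - l))"
    \<comment> \<open>Degrees are integers and therefore reach the ceiling of ?c; \<open>nat\<close>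
      takes care of a negative value.\<close>
    have "nat \<lceil>?c\<rceil> \<le> coex k l n Fam"
      by (rule le_coex[OF G(1-3)]) (use G(4) n lk in \<open>auto simp: nat_le_iff ceiling_le_iff\<close>)
    then have "?c \<le> real (coex k l n Fam)" by linarith
    moreover have "0 < (n - l) choose (k - l)" using n lk by simp
    ultimately show "delta_W k l W - \<epsilon> \<le> coex_density n" unfolding coex_density_def by (simp add: pos_le_divide_eq)
  qed
qed

lemma delta_le_subseq_limit:
  assumes W: "hypergraphon k W" and free: "W_free k Fam W" and s: "strict_mono s" and lim: "(\<lambda>n. coex_density (s n)) \<longlonglongrightarrow> c"
  shows "delta_W k l W \<le> c"
proof (rule field_le_epsilon)
  fix \<epsilon> :: real assume "0 < \<epsilon>"
  then have "\<forall>\<^sub>F n in sequentially. delta_W k l W - \<epsilon> \<le> coex_density (s n)"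
    by (rule eventually_compose_filterlim[OF delta_le_coex_density[OF W free] filterlim_subseq[OF s]])
  then have "delta_W k l W - \<epsilon> \<le> c" by (rule tendsto_lowerbound[OF lim]) simp
  then show "delta_W k l W \<le> c + \<epsilon>" by simp
qed

lemma exists_subseq_limit:
  fixes s :: "nat \<Rightarrow> nat"
  assumes s: "strict_mono s" shows "\<exists>(r :: nat \<Rightarrow> nat) c. strict_mono r \<and> (\<lambda>n. coex_density (s (r n))) \<longlonglongrightarrow> c"
proof -
  have "coex_density (s (n + k)) \<in> {0..1}" for n
  proof -
    have "k \<le> s (n + k)" using strict_mono_imp_increasing[OF s, of "n + k"] by linarith
    then show ?thesis using coex_density_unit by simp
  qed
  then obtain c r where r: "strict_mono r" and lim: "((\<lambda>n. coex_density (s (n + k))) \<circ> r) \<longlonglongrightarrow> c"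
    using compact_imp_seq_compact[OF compact_Icc[of 0 "1::real"]] unfolding seq_compact_def by metis
  have "strict_mono (\<lambda>n. r n + k)" using r by (simp add: strict_mono_def)
  then show ?thesis using lim unfolding comp_def by blast
qed

text \<open>Every subsequential limit is at most the minimum degree of some free hypergraphon, and
  this is in turn at most every other subsequential limit. So all of them agree, and boundedness
  gives convergence.\<close>

lemma coex_density_limit:
  "\<exists>W. hypergraphon k W \<and> W_free k Fam W \<and> coex_density \<longlonglongrightarrow> delta_W k l W"
proof -
  obtain r :: "nat \<Rightarrow> nat" and c where r: "strict_mono r" and rc: "(\<lambda>n. coex_density (r n)) \<longlonglongrightarrow> c"
    using exists_subseq_limit[OF strict_mono_id] unfolding id_def by blast
  obtain W where W: "hypergraphon k W" "W_free k Fam W" "c \<le> delta_W k l W" using subseq_limit_le_delta[OF r rc] by blast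
  have eq: "delta_W k l W = c" using delta_le_subseq_limit[OF W(1,2) r rc] W(3) by simp
  have "coex_density \<longlonglongrightarrow> c"
  proof (rule tendstoI, rule ccontr)
    fix e :: real assume e: "0 < e" and n: "\<not> (\<forall>\<^sub>F n in sequentially. dist (coex_density n) c < e)"
    obtain s :: "nat \<Rightarrow> nat" where s: "strict_mono s" "\<And>n. \<not> dist (coex_density (s n)) c < e" using not_eventually_sequentiallyD[OF n] by blast
    obtain t :: "nat \<Rightarrow> nat" and c' where t: "strict_mono t" and tc: "(\<lambda>n. coex_density (s (t n))) \<longlonglongrightarrow> c'" using exists_subseq_limit[OF s(1)] by blast
    have st: "strict_mono (\<lambda>n. s (t n))" using s(1) t by (simp add: strict_mono_def)
    obtain W' where W': "hypergraphon k W'" "W_free k Fam W'" "c' \<le> delta_W k l W'" using subseq_limit_le_delta[OF st tc] by blast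
    have "c' = c" using W'(3) delta_le_subseq_limit[OF W'(1,2) r rc] delta_le_subseq_limit[OF W(1,2) st tc] eq by linarith
    then have "\<forall>\<^sub>F n in sequentially. dist (coex_density (s (t n))) c < e" using tendstoD[OF tc e] by simp
    then show False using s(2) by (simp add: eventually_False)
  qed
  then show ?thesis using W eq by blast
qed

lemma coex_density_tendsto_gamma: "coex_density \<longlonglongrightarrow> gamma k l Fam"
proof -
  obtain c where c: "coex_density \<longlonglongrightarrow> c" using coex_density_limit by blast
  then have "lim coex_density = c" by (rule limI)
  then show ?thesis using c unfolding gamma_def coex_density_def[abs_def] by simp
qed

text \<open>Passage to the limit gives only a lower bound for the minimum degree; equality will come
  from the maximality of gamma among free hypergraphons.\<close>

lemma Wset_free_delta:
  assumes "W \<in> Wset k l Fam" shows "W_free k Fam W \<and> gamma k l Fam \<le> delta_W k l W"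
proof -
  obtain G where W: "hypergraphon k W" and G: "\<forall>n. kgraph k (G n) \<and> Ffree Fam (G n)" and conv: "converges_to k G W"
    and card: "filterlim (\<lambda>n. card (verts (G n))) at_top sequentially"
    and deg: "(\<lambda>n. real (min_deg l (G n)) / real ((card (verts (G n)) - l) choose (k - l))) \<longlonglongrightarrow> gamma k l Fam"
    using assms unfolding Wset_def by blast
  have "gamma k l Fam \<le> 1"
    by (rule LIMSEQ_le_const2[OF coex_density_tendsto_gamma]) (use coex_density_unit in blast)
  then have "gamma k l Fam \<le> delta_W k l W" by (rule delta_W_limit_ge[OF W lk conv _ card deg, rotated]) (use G in blast)
  moreover have "W_free k Fam W" by (rule W_free_limit[OF kFam conv _ card]) (use G in blast)
  ultimately show ?thesis by blast
qed

text \<open>A diagonal choice: the j-th graph is a sample that approximates the first j + 1 graphs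
  of an enumeration of all k-graphs, and the minimum degree from below, up to 1 / (j + 1).\<close>

lemma Wset_of_free_delta:
  assumes W: "hypergraphon k W" and free: "W_free k Fam W" and d: "delta_W k l W = gamma k l Fam"
  shows "W \<in> Wset k l Fam"
proof -
  have ne: "{H. kgraph k H} \<noteq> {}" by (auto intro!: exI[of _ "({}, {})"] simp: kgraph_def)
  define H where "H = from_nat_into {H. kgraph k H}"
  have H: "kgraph k (H j)" for j using from_nat_into[OF ne, of j] by (simp add: H_def)
  have Hs: "\<exists>j. F = H j" if "kgraph k F" for F
    using from_nat_into_surj[OF countable_kgraphs[of k], of F] that unfolding H_def by auto
  define \<epsilon> where "\<epsilon> j = 1 / real (Suc j)" for j
  let ?P = "\<lambda>j n G. kgraph k G \<and> card (verts G) = n \<and> Ffree Fam G \<and>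
    (\<forall>L. L \<subseteq> verts G \<and> card L = l \<longrightarrow> (delta_W k l W - \<epsilon> j) * real ((n - l) choose (k - l)) \<le> real (deg G L)) \<and>
    (\<forall>F\<in>H ` {..j}. \<bar>t_graph F G - t_hom k F W\<bar> < \<epsilon> j)"
  have "\<exists>n G. j + k \<le> n \<and> ?P j n G" for j
  proof -
    have "\<forall>\<^sub>F n in sequentially. \<exists>G. ?P j n G"
      by (rule sample_exists[OF W lk kFam free]) (use H in \<open>auto simp: \<epsilon>_def\<close>)
    then have "\<forall>\<^sub>F n in sequentially. j + k \<le> n \<and> (\<exists>G. ?P j n G)" using eventually_ge_at_top by (rule eventually_conj[rotated])
    then obtain n where "j + k \<le> n \<and> (\<exists>G. ?P j n G)" using eventually_happens'[OF sequentially_bot] by blast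
    then show ?thesis by blast
  qed
  then obtain n G where nG: "\<And>j. j + k \<le> n j \<and> ?P j (n j) (G j)" by metis
  have G: "kgraph k (G j) \<and> Ffree Fam (G j)" and cG: "card (verts (G j)) = n j" for j using nG[of j] by blast+
  have \<epsilon>0: "\<epsilon> \<longlonglongrightarrow> 0" unfolding \<epsilon>_def[abs_def] by (rule LIMSEQ_Suc[OF lim_1_over_n])
  have card: "filterlim (\<lambda>j. card (verts (G j))) at_top sequentially"
  proof (rule filterlim_at_top_mono[OF filterlim_ident], rule always_eventually, rule allI)
    fix j show "j \<le> card (verts (G j))" using nG[of j] unfolding cG by linarith
  qed
  have conv: "converges_to k G W" unfolding converges_to_def
  proof (intro allI impI)
    fix F assume "kgraph k F"
    then obtain i where i: "F = H i" using Hs by blast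
    have "(\<lambda>j. t_graph F (G j) - t_hom k F W) \<longlonglongrightarrow> 0"
    proof (rule Lim_null_comparison[OF _ \<epsilon>0])
      show "\<forall>\<^sub>F j in sequentially. norm (t_graph F (G j) - t_hom k F W) \<le> \<epsilon> j"
        using eventually_ge_at_top[of i]
      proof (rule eventually_mono)
        fix j assume "i \<le> j"
        then have "F \<in> H ` {..j}" using i by blast
        then have "\<bar>t_graph F (G j) - t_hom k F W\<bar> < \<epsilon> j" using nG[of j] by blast
        then show "norm (t_graph F (G j) - t_hom k F W) \<le> \<epsilon> j" by simp
      qed
    qed
    then show "(\<lambda>j. t_graph F (G j)) \<longlonglongrightarrow> t_hom k F W" by (rule LIM_zero_cancel)
  qed
  \<comment> \<open>The density is bounded from below by the sampled degrees and from above by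
    \<open>coex_density\<close>, which tends to gamma.\<close>
  have deg: "(\<lambda>j. real (min_deg l (G j)) / real ((card (verts (G j)) - l) choose (k - l))) \<longlonglongrightarrow> gamma k l Fam"
  proof (rule tendsto_sandwich[OF always_eventually always_eventually])
    show "(\<lambda>j. gamma k l Fam - \<epsilon> j) \<longlonglongrightarrow> gamma k l Fam" using tendsto_diff[OF tendsto_const \<epsilon>0] by simp
    show "(\<lambda>j. coex_density (card (verts (G j)))) \<longlonglongrightarrow> gamma k l Fam"
      by (rule filterlim_compose[OF coex_density_tendsto_gamma card])
    have ln: "l \<le> n j" "k \<le> n j" for j using nG[of j] lk by linarith+
    have pos: "0 < (n j - l) choose (k - l)" for j using ln[of j] lk by simp
    show "\<forall>j. real (min_deg l (G j)) / real ((card (verts (G j)) - l) choose (k - l)) \<le> coex_density (card (verts (G j)))"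
    proof
      fix j
      have "min_deg l (G j) \<le> coex k l (card (verts (G j))) Fam"
        by (rule min_deg_le_coex) (use G cG ln in auto)
      then show "real (min_deg l (G j)) / real ((card (verts (G j)) - l) choose (k - l)) \<le> coex_density (card (verts (G j)))"
        unfolding coex_density_def by (intro divide_right_mono) auto
    qed
    show "\<forall>j. gamma k l Fam - \<epsilon> j \<le> real (min_deg l (G j)) / real ((card (verts (G j)) - l) choose (k - l))"
    proof
      fix j
      let ?c = "(gamma k l Fam - \<epsilon> j) * real ((n j - l) choose (k - l))"
      have "nat \<lceil>?c\<rceil> \<le> min_deg l (G j)"
      proof (rule min_deg_ge)
        show "finite (verts (G j))" using G by (simp add: kgraph_def)
        show "l \<le> card (verts (G j))" unfolding cG by (rule ln)
        fix L assume "L \<subseteq> verts (G j)" "card L = l"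
        then have "?c \<le> real (deg (G j) L)" using nG[of j] unfolding d by blast
        then show "nat \<lceil>?c\<rceil> \<le> deg (G j) L" by (simp add: nat_le_iff ceiling_le_iff)
      qed
      then have "?c \<le> real (min_deg l (G j))" by linarith
      then show "gamma k l Fam - \<epsilon> j \<le> real (min_deg l (G j)) / real ((card (verts (G j)) - l) choose (k - l))"
        unfolding cG using pos[of j] by (simp add: pos_le_divide_eq)
    qed
  qed
  show ?thesis unfolding Wset_def using W G conv card deg by blast
qed

lemma delta_W_le_gamma: "hypergraphon k W \<Longrightarrow> W_free k Fam W \<Longrightarrow> delta_W k l W \<le> gamma k l Fam"
  using delta_le_subseq_limit[OF _ _ strict_mono_id] coex_density_tendsto_gamma by (simp add: id_def)

lemma gamma_attained: "\<exists>W. hypergraphon k W \<and> W_free k Fam W \<and> delta_W k l W = gamma k l Fam"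
  using coex_density_limit LIMSEQ_unique[OF coex_density_tendsto_gamma] by metis

end

theorem theorem5p1:
  fixes k l :: nat and Fam :: "hgraph set"
  assumes "l < k"
    and "\<forall>F\<in>Fam. kgraph k F"
    and "\<forall>F\<in>Fam. edges F \<noteq> {}"
  shows "(\<exists>W. hypergraphon k W \<and> W_free k Fam W \<and> delta_W k l W = gamma k l Fam) \<and>
         (\<forall>W. hypergraphon k W \<and> W_free k Fam W \<longrightarrow> delta_W k l W \<le> gamma k l Fam) \<and>
         (\<forall>W. hypergraphon k W \<longrightarrow>
              (W \<in> Wset k l Fam \<longleftrightarrow> W_free k Fam W \<and> delta_W k l W = gamma k l Fam))"
proof (intro conjI allI impI)
  show "\<exists>W. hypergraphon k W \<and> W_free k Fam W \<and> delta_W k l W = gamma k l Fam" by (rule gamma_attained[OF assms])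
  show "delta_W k l W \<le> gamma k l Fam" if "hypergraphon k W \<and> W_free k Fam W" for W
    using delta_W_le_gamma[OF assms] that by blast
  fix W assume W: "hypergraphon k W"
  show "W \<in> Wset k l Fam \<longleftrightarrow> W_free k Fam W \<and> delta_W k l W = gamma k l Fam"
  proof
    assume "W \<in> Wset k l Fam"
    from Wset_free_delta[OF assms this] show "W_free k Fam W \<and> delta_W k l W = gamma k l Fam"
      using delta_W_le_gamma[OF assms W] by (meson order_antisym)
  next
    assume "W_free k Fam W \<and> delta_W k l W = gamma k l Fam"
    then show "W \<in> Wset k l Fam" using Wset_of_free_delta[OF assms W] by blast
  qed
qed

end
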